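(* Let $\psi:\mathbb{R}^2\to[0,+\infty]$ be a symmetric Finsler metric controlled from below by the Euclidean norm, i.e. (i) $\psi(\lambda w)=\lambda^2\psi(w)$ for all $w\in\mathbb{R}^2$ and $\lambda\in\mathbb{R}$; (ii) $\psi$ is convex; (iii) $\psi(w)\ge|w|^2$ for all $w\in\mathbb{R}^2$; and suppose that ${\rm dom}\,\psi=\{w\in\mathbb{R}^2:\psi(w)<+\infty\}\ne\{0\}$. Then for any $\eta>0$ there exists a periodic Lipschitz function $\varphi=\varphi_\eta:\mathbb{R}^2\to\mathbb{R}$ such that the corresponding functionals $$F_\varepsilon(u)=\int_0^1\Bigl(|u'|^2+\Bigl(\frac{\delta}{\varepsilon}\Bigr)^2\Bigl|\nabla\varphi\Bigl(\frac u\varepsilon\Bigr)u'\Bigr|^2\Bigr)\,dt\ \text{ if }u\in H^1([0,1];\mathbb{R}^2),\qquad F_\varepsilon(u)=+\infty\ \text{otherwise in }L^2([0,1];\mathbb{R}^2),$$ $\Gamma$-converge as $\varepsilon\to0$, in the strong topology of $L^2([0,1];\mathbb{R}^2)$, to the functional equal to $$\int_0^1\psi_\eta(u')\,dt\quad\text{for }u\in H^1([0,1];\mathbb{R}^2)$$ and to $+\infty$ otherwise, for a function $\psi_\eta:\mathbb{R}^2\to[0,+\infty]$ satisfying $$|\psi_\eta(w)-\psi(w)|\le\eta|w|^2\quad\text{for all }w\text{ such that }\psi(w)<+\infty,$$ and $\psi_\eta(w)=+\infty$ for all $w$ such that $\psi(w)=+\infty$.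
   Context: Throughout, $\delta=\delta_\varepsilon>0$ is given with $\delta_\varepsilon\to0$ and $\delta_\varepsilon/\varepsilon\to+\infty$ as $\varepsilon\to0$. A function on $\mathbb{R}^2$ is called periodic if it is invariant under translations by two linearly independent vectors of $\mathbb{R}^2$. For $u\in H^1$ the quantity $\frac1\varepsilon\nabla\varphi(u/\varepsilon)u'$ is understood as the a.e. derivative $\frac{d}{dt}\bigl(\varphi(u(t)/\varepsilon)\bigr)$. In (i) the convention $0\cdot(+\infty)=0$ is used, so $\psi(0)=0$. *)

theory Defs
  imports "HOL-Analysis.Analysis"
begin

text \<open>
  Elements of \<open>L\<^sup>2([0,1])\<close> are represented by functions on the real line of which only the values
  on \<open>[0,1]\<close>, up to null sets, matter. All notions below are invariant under a.e. equality.
\<close>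

abbreviation leb01 :: "real measure" where
  "leb01 \<equiv> lebesgue_on {0..1}"

definition L2 :: "(real \<Rightarrow> 'a::euclidean_space) set" where
  "L2 = {u \<in> borel_measurable leb01. integrable leb01 (\<lambda>t. (norm (u t))\<^sup>2)}"

definition L2_tendsto :: "(nat \<Rightarrow> real \<Rightarrow> 'a::euclidean_space) \<Rightarrow> (real \<Rightarrow> 'a) \<Rightarrow> bool" where
  "L2_tendsto U u \<longleftrightarrow> (\<lambda>j. integral\<^sup>L leb01 (\<lambda>t. (norm (U j t - u t))\<^sup>2)) \<longlonglongrightarrow> 0"

text \<open>Test functions are taken in \<open>C\<^sup>1\<^sub>c((0,1))\<close>, as in Brezis' definition of Sobolev spaces on an interval.\<close>

definition test_functions :: "(real \<Rightarrow> real) set" where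
  "test_functions = {f. f C1_differentiable_on UNIV \<and>
     (\<exists>K. compact K \<and> K \<subseteq> {0<..<1} \<and> (\<forall>t. t \<notin> K \<longrightarrow> f t = 0))}"

definition is_weak_deriv :: "(real \<Rightarrow> 'a::euclidean_space) \<Rightarrow> (real \<Rightarrow> 'a) \<Rightarrow> bool" where
  "is_weak_deriv u g \<longleftrightarrow> (\<forall>f\<in>test_functions.
     integral\<^sup>L leb01 (\<lambda>t. deriv f t *\<^sub>R u t) = - integral\<^sup>L leb01 (\<lambda>t. f t *\<^sub>R g t))"

definition H1 :: "(real \<Rightarrow> 'a::euclidean_space) set" where
  "H1 = {u \<in> L2. \<exists>g\<in>L2. is_weak_deriv u g}"

text \<open>For \<open>u\<close> in \<open>H1\<close> the following two choices are unique up to a null set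
  and unique on \<open>[0,1]\<close>, respectively.\<close>

definition weak_deriv :: "(real \<Rightarrow> 'a::euclidean_space) \<Rightarrow> real \<Rightarrow> 'a" where
  "weak_deriv u = (SOME g. g \<in> L2 \<and> is_weak_deriv u g)"

definition cont_rep :: "(real \<Rightarrow> 'a::euclidean_space) \<Rightarrow> real \<Rightarrow> 'a" where
  "cont_rep u = (SOME v. continuous_on {0..1} v \<and> (AE t in leb01. v t = u t))"

text \<open>Sequential \<open>\<Gamma>\<close>-convergence as \<open>\<epsilon> \<rightarrow> 0\<^sup>+\<close> on a space \<open>X\<close> whose (metrizable) topology
  is given through its convergent sequences \<open>conv U u\<close>.\<close>

definition Gamma_converges ::
    "'x set \<Rightarrow> ((nat \<Rightarrow> 'x) \<Rightarrow> 'x \<Rightarrow> bool) \<Rightarrow> (real \<Rightarrow> 'x \<Rightarrow> ennreal) \<Rightarrow> ('x \<Rightarrow> ennreal) \<Rightarrow> bool" where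
  "Gamma_converges X conv F F0 \<longleftrightarrow>
     (\<forall>e::nat \<Rightarrow> real. (\<forall>j. 0 < e j) \<and> e \<longlonglongrightarrow> 0 \<longrightarrow>
       (\<forall>u\<in>X.
          (\<forall>U. (\<forall>j. U j \<in> X) \<and> conv U u \<longrightarrow> F0 u \<le> liminf (\<lambda>j. F (e j) (U j))) \<and>
          (\<exists>U. (\<forall>j. U j \<in> X) \<and> conv U u \<and> limsup (\<lambda>j. F (e j) (U j)) \<le> F0 u)))"

definition periodic :: "(real^2 \<Rightarrow> real) \<Rightarrow> bool" where
  "periodic \<phi> \<longleftrightarrow> (\<exists>a b. a \<noteq> b \<and> independent {a, b} \<and>
     (\<forall>x. \<phi> (x + a) = \<phi> x \<and> \<phi> (x + b) = \<phi> x))"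

text \<open>The term \<open>(1/\<epsilon>) \<nabla>\<phi>(u/\<epsilon>) u'\<close> is the a.e. derivative of \<open>t \<mapsto> \<phi>(u(t)/\<epsilon>)\<close>, where \<open>u\<close> is the
  continuous representative; hence \<open>(\<delta>/\<epsilon>)\<^sup>2 |\<nabla>\<phi>(u/\<epsilon>) u'|\<^sup>2\<close> equals \<open>(\<delta>/\<epsilon>)\<^sup>2 |\<epsilon> d/dt \<phi>(u/\<epsilon>)|\<^sup>2\<close>.\<close>

definition F_eps :: "(real \<Rightarrow> real) \<Rightarrow> (real^2 \<Rightarrow> real) \<Rightarrow> real \<Rightarrow> (real \<Rightarrow> real^2) \<Rightarrow> ennreal" where
  "F_eps \<delta> \<phi> \<epsilon> u =
     (if u \<in> H1 then
        \<integral>\<^sup>+ t. ennreal ((norm (weak_deriv u t))\<^sup>2 +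
           (\<delta> \<epsilon> / \<epsilon>)\<^sup>2 * \<bar>\<epsilon> * deriv (\<lambda>s. \<phi> (cont_rep u s /\<^sub>R \<epsilon>)) t\<bar>\<^sup>2) \<partial>leb01
      else \<infinity>)"

definition F_lim :: "(real^2 \<Rightarrow> ennreal) \<Rightarrow> (real \<Rightarrow> real^2) \<Rightarrow> ennreal" where
  "F_lim \<psi> u = (if u \<in> H1 then \<integral>\<^sup>+ t. \<psi> (weak_deriv u t) \<partial>leb01 else \<infinity>)"

end

theory Submission
  imports Defs
begin


text \<open>The penalty \<open>(\<delta>/\<epsilon>)\<^sup>2 |\<nabla>\<phi>(u/\<epsilon>)u'|\<^sup>2\<close> has an unbounded coefficient, so a curve of bounded energy must
  essentially follow the level sets of \<open>\<phi>(\<cdot>/\<epsilon>)\<close>. If \<open>\<phi>\<close> is the distance to a periodic network of curves,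
  then the cheapest way to travel in a direction \<open>w\<close> is to move along the network, and the cost of \<open>w\<close> is the
  square of the length of an optimal path in the network per unit of displacement. Prescribing the lengths of
  the curves prescribes the limit.

  All limit densities occurring here have the dual form \<open>dual_sq P w = (SUP p\<in>P. (p \<bullet> w)\<^sup>2)\<close>, and
  \<open>Gamma_convergence_of_network\<close> reduces the \<open>\<Gamma>\<close>-limit to two geometric facts about \<open>\<phi>\<close>. For the lower bound
  every \<open>p \<in> P\<close> needs correctors: functions \<open>h\<close> at bounded distance from \<open>x \<mapsto> p \<bullet> x\<close> whose small increments are
  at most \<open>(1 + \<theta>)|x - y| + C|\<phi> x - \<phi> y|\<close>. Then \<open>\<epsilon> h(u/\<epsilon>)\<close> converges to \<open>p \<bullet> u\<close> but varies at most as fast as the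
  energy permits, the second term being absorbed by the penalty; Cauchy-Schwarz on a grid and refinement of the
  grid give the lower bound. For the upper bound, every point has a node at bounded distance, and the
  nodes of points with difference \<open>w\<close> have to be joined inside \<open>{\<phi> = 0}\<close> by paths of length \<open>sqrt (dual_sq P w)\<close> up to an additive constant; a
  recovery sequence follows such paths between the values of \<open>u\<close> on a grid that is coarse compared with \<open>\<epsilon>\<close>.
  Sobolev functions enter through their primitives, obtained from bounded energies along dyadic grids.

  The basic curve is the graph of a periodic oscillation of small amplitude whose period has a prescribed
  length (\<open>exists_profile\<close>). Its arc length, extended off the curve to first order, is a function with slope at
  most \<open>1 + \<theta>\<close> nearby (\<open>corrected_arclength_lip\<close>); this is the source of all correctors.

  The set where \<open>\<psi>\<close> is finite is a nonzero linear subspace, hence a line or the plane. If it is a line, parallel copies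
  of one curve, with \<open>\<phi>\<close> oscillating between them, realize \<open>\<psi>\<close> exactly (\<open>line_network\<close>). If it is the plane,
  \<open>n = sqrt \<psi>\<close> is a norm. Finitely many lattice directions \<open>m\<close> are chosen, and along every lattice line in
  direction \<open>m\<close>, at a large integer spacing, runs a curve with length \<open>n m\<close> per step \<open>m\<close>. The oscillations vanish at the
  crossings, where staircases make the correctors constant, so that the correctors of different directions
  agree there (\<open>crossing\<close>, \<open>H_consistent\<close>). The resulting density is the square of the largest norm
  with value at most \<open>n m\<close> at the chosen \<open>m\<close>; it is above \<open>n\<^sup>2\<close>, and within \<open>\<eta>|w|\<^sup>2\<close> of it when the directions are
  sufficiently many (\<open>norm_network\<close>).\<close>

section \<open>Curves of finite energy\<close>

subsection \<open>Differentiation of primitives\<close>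

lemma cball_midpoint_real:
  fixes t y :: real
  shows "cball ((t + y) / 2) (\<bar>y - t\<bar> / 2) = {min t y..max t y}"
  by (auto simp: dist_real_def min_def max_def abs_if field_simps split: if_splits)

text \<open>Around a point where the derivative fails, arbitrarily short intervals have a fixed relative deviation
  between the integral and the value of \<open>g\<close> times the length. The Vitali covering theorem selects disjoint ones covering almost all
  such points, while by Henstock's lemma their total deviation, hence their total length, is arbitrarily small.\<close>

theorem integral_has_vector_derivative_ae:
  fixes g :: "real \<Rightarrow> 'a::euclidean_space"
  assumes g: "g integrable_on {a..b}"
  shows "negligible {t \<in> {a<..<b}. \<not> ((\<lambda>s. integral {a..s} g) has_vector_derivative g t) (at t)}"
proof -
  define F where "F s = integral {a..s} g" for s
  define E where "E n = {t \<in> {a<..<b}. \<forall>d>0. \<exists>y\<in>{a..b}. y \<noteq> t \<and> \<bar>y - t\<bar> < d \<and>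
      norm (F y - F t - (y - t) *\<^sub>R g t) > \<bar>y - t\<bar> / real (Suc n)}" for n
  have diff: "F y - F t = (if t \<le> y then integral {t..y} g else - integral {y..t} g)"
    if "t \<in> {a..b}" "y \<in> {a..b}" for t y
  proof (cases "t \<le> y")
    case True
    have "g integrable_on {a..y}" by (rule integrable_on_subinterval[OF g]) (use that in auto)
    then have "integral {a..t} g + integral {t..y} g = integral {a..y} g"
      using True that by (intro Henstock_Kurzweil_Integration.integral_combine) auto
    then show ?thesis using True by (simp add: F_def algebra_simps)
  next
    case False
    have "g integrable_on {a..t}" by (rule integrable_on_subinterval[OF g]) (use that in auto)
    then have "integral {a..y} g + integral {y..t} g = integral {a..t} g"
      using False that by (intro Henstock_Kurzweil_Integration.integral_combine) auto
    then show ?thesis using False by (simp add: F_def algebra_simps)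
  qed
  have dev: "norm (F y - F t - (y - t) *\<^sub>R g t) =
      norm (measure lborel {min t y..max t y} *\<^sub>R g t - integral {min t y..max t y} g)"
    if "t \<in> {a..b}" "y \<in> {a..b}" for t y
  proof (cases "t \<le> y")
    case True
    then show ?thesis using diff[OF that] by (simp add: norm_minus_commute)
  next
    case False
    have eq: "- integral {y..t} g - (y - t) *\<^sub>R g t = (t - y) *\<^sub>R g t - integral {y..t} g"
      by (simp add: algebra_simps)
    have "F y - F t = - integral {y..t} g" using diff[OF that] False by simp
    then have "norm (F y - F t - (y - t) *\<^sub>R g t) = norm ((t - y) *\<^sub>R g t - integral {y..t} g)"
      by (simp only: eq)
    then show ?thesis using False by (simp add: min_def max_def)
  qed
  have neg: "negligible (E n)" for n
    unfolding negligible_outer_le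
  proof (intro allI impI)
    fix e :: real assume "e > 0"
    then have e': "e / real (Suc n) > 0" by simp
    obtain \<gamma> where \<gamma>: "gauge \<gamma>" and hen: "\<And>p. \<lbrakk>p tagged_partial_division_of (cbox a b); \<gamma> fine p\<rbrakk> \<Longrightarrow>
             sum (\<lambda>(x,k). norm (measure lborel k *\<^sub>R g x - integral k g)) p < e / real (Suc n)"
      by (rule Henstock_lemma[of g a b, OF _ e']) (use g in auto)
    define I where "I = (\<lambda>(t, y). {min t y..max t (y::real)})"
    define K where "K = {(t, y). t \<in> E n \<and> y \<in> {a..b} \<and> y \<noteq> t \<and> I (t, y) \<subseteq> \<gamma> t \<and>
       norm (F y - F t - (y - t) *\<^sub>R g t) > \<bar>y - t\<bar> / real (Suc n)}"
    have cb: "cball ((\<lambda>(t,y). (t + y) / 2) i) ((\<lambda>(t,y). \<bar>y - t\<bar> / 2) i) = I i" for i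
      by (cases i) (simp add: I_def cball_midpoint_real)
    obtain C where C: "countable C" "C \<subseteq> K" "pairwise (\<lambda>i j. disjnt (I i) (I j)) C"
      and negC: "negligible (E n - (\<Union>i\<in>C. I i))"
    proof (rule Vitali_covering_theorem_cballs[of K "\<lambda>(t,y). \<bar>y - t\<bar> / 2" "E n" "\<lambda>(t,y). (t + y) / 2"])
      show "0 < (case i of (t, y) \<Rightarrow> \<bar>y - t\<bar> / 2)" if "i \<in> K" for i
        using that by (auto simp: K_def)
      fix t d :: real assume t: "t \<in> E n" and "0 < d"
      have "open (\<gamma> t)" "t \<in> \<gamma> t" using \<gamma> by (auto simp: gauge_def)
      then obtain r where r: "r > 0" "ball t r \<subseteq> \<gamma> t" by (meson openE)
      obtain y where y: "y \<in> {a..b}" "y \<noteq> t" "\<bar>y - t\<bar> < min r d"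
          "norm (F y - F t - (y - t) *\<^sub>R g t) > \<bar>y - t\<bar> / real (Suc n)"
      proof -
        have "0 < min r d" using r(1) \<open>0 < d\<close> by simp
        then show ?thesis using t that unfolding E_def by blast
      qed
      have "I (t, y) \<subseteq> ball t r" using y(3) by (auto simp: I_def dist_real_def)
      then have "(t, y) \<in> K" using y t r by (auto simp: K_def)
      moreover have "t \<in> I (t, y)" by (auto simp: I_def)
      ultimately show "\<exists>i. i \<in> K \<and> t \<in> cball (case i of (t, y) \<Rightarrow> (t + y) / 2) (case i of (t, y) \<Rightarrow> \<bar>y - t\<bar> / 2)
                 \<and> (case i of (t, y) \<Rightarrow> \<bar>y - t\<bar> / 2) < d"
        using y(3) \<open>0 < d\<close> by (intro exI[of _ "(t, y)"]) (auto simp: cball_midpoint_real I_def)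
    qed (auto simp: cb)
    have fstI: "fst i \<in> I i" for i by (cases i) (auto simp: I_def)
    have Im: "I i \<in> lmeasurable" for i by (cases i) (auto simp: I_def)
    have fin: "measure lebesgue (\<Union>i\<in>D. I i) \<le> e" if D: "D \<subseteq> C" "finite D" for D
    proof -
      have inj: "inj_on (\<lambda>i. (fst i, I i)) D"
      proof (rule inj_onI)
        fix i j assume ij: "i \<in> D" "j \<in> D" "(fst i, I i) = (fst j, I j)"
        have "\<not> disjnt (I i) (I j)"
          using ij fstI[of i] fstI[of j] by (auto simp: disjnt_iff)
        with ij C(3) D(1) show "i = j" by (meson pairwiseD subsetD)
      qed
      define p where "p = (\<lambda>i. (fst i, I i)) ` D"
      have "p tagged_partial_division_of (cbox a b)"
      proof (unfold tagged_partial_division_of_def, intro conjI allI impI)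
        show "finite p" using D by (simp add: p_def)
      next
        fix x k assume "(x, k) \<in> p"
        then obtain y where i: "(x, y) \<in> D" "k = I (x, y)" by (auto simp: p_def)
        have "(x, y) \<in> K" using i D C by auto
        then show "x \<in> k" "k \<subseteq> cbox a b" "\<exists>a b. k = cbox a b"
          using i by (auto simp: K_def I_def E_def)
      next
        fix x1 k1 x2 k2 assume 1: "(x1, k1) \<in> p \<and> (x2, k2) \<in> p \<and> (x1, k1) \<noteq> (x2, k2)"
        then obtain i j where ij: "i \<in> D" "j \<in> D" "i \<noteq> j" "k1 = I i" "k2 = I j"
          by (auto simp: p_def)
        then have "disjnt k1 k2" using C(3) D(1) by (meson pairwiseD subsetD)
        then show "interior k1 \<inter> interior k2 = {}"
          unfolding disjnt_def using interior_subset by fastforce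
      qed
      moreover have "\<gamma> fine p"
      proof (rule fineI)
        fix x k assume "(x, k) \<in> p"
        then obtain y where "(x, y) \<in> D" "k = I (x, y)" by (auto simp: p_def)
        then show "k \<subseteq> \<gamma> x" using D C(2) by (auto simp: K_def)
      qed
      ultimately have h: "sum (\<lambda>(x,k). norm (measure lborel k *\<^sub>R g x - integral k g)) p < e / real (Suc n)"
        by (rule hen)
      have "sum (\<lambda>(x,k). norm (measure lborel k *\<^sub>R g x - integral k g)) p
          = (\<Sum>i\<in>D. norm (measure lborel (I i) *\<^sub>R g (fst i) - integral (I i) g))"
        unfolding p_def by (simp add: sum.reindex[OF inj] case_prod_beta)
      moreover have "measure lebesgue (I i) / real (Suc n) \<le> norm (measure lborel (I i) *\<^sub>R g (fst i) - integral (I i) g)"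
        if "i \<in> D" for i
      proof -
        obtain t y where i: "i = (t, y)" by (cases i)
        have "(t, y) \<in> K" using that D C i by auto
        then have "t \<in> {a..b}" "y \<in> {a..b}" and gt: "norm (F y - F t - (y - t) *\<^sub>R g t) > \<bar>y - t\<bar> / real (Suc n)"
          by (auto simp: K_def E_def)
        from gt dev[OF this(1,2)] show ?thesis
          by (simp add: i I_def min_def max_def split: if_splits)
      qed
      then have "(\<Sum>i\<in>D. measure lebesgue (I i) / real (Suc n)) \<le> (\<Sum>i\<in>D. norm (measure lborel (I i) *\<^sub>R g (fst i) - integral (I i) g))"
        by (rule sum_mono)
      ultimately have "(\<Sum>i\<in>D. measure lebesgue (I i)) / real (Suc n) < e / real (Suc n)"
        using h by (simp add: sum_divide_distrib)
      then have "(\<Sum>i\<in>D. measure lebesgue (I i)) < e" by (simp add: divide_less_cancel)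
      moreover have "measure lebesgue (\<Union>i\<in>D. I i) \<le> (\<Sum>i\<in>D. measure lebesgue (I i))"
        by (rule measure_UNION_le) (use D Im in \<open>auto simp: fmeasurableD\<close>)
      ultimately show ?thesis by linarith
    qed
    have U: "(\<Union>i\<in>C. I i) \<in> lmeasurable" "measure lebesgue (\<Union>i\<in>C. I i) \<le> e"
      by (intro fmeasurable_UN_bound[of C I lebesgue e] measure_UN_bound[of C I lebesgue e] C(1) Im fin; assumption)+
    show "\<exists>T. E n \<subseteq> T \<and> T \<in> lmeasurable \<and> measure lebesgue T \<le> e"
    proof (intro exI conjI)
      show "E n \<subseteq> (\<Union>i\<in>C. I i) \<union> (E n - (\<Union>i\<in>C. I i))" by auto
      show "(\<Union>i\<in>C. I i) \<union> (E n - (\<Union>i\<in>C. I i)) \<in> lmeasurable"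
        using U negC by (intro fmeasurable.Un) (auto simp: negligible_imp_measurable)
      show "measure lebesgue ((\<Union>i\<in>C. I i) \<union> (E n - (\<Union>i\<in>C. I i))) \<le> e"
        using U negC by (subst measure_Un_null_set) (auto simp: fmeasurableD negligible_iff_null_sets)
    qed
  qed
  have "{t \<in> {a<..<b}. \<not> (F has_vector_derivative g t) (at t)} \<subseteq> (\<Union>n. E n)"
  proof safe
    fix t assume t: "t \<in> {a<..<b}" and nd: "\<not> (F has_vector_derivative g t) (at t)"
    show "t \<in> (\<Union>n. E n)"
    proof (rule ccontr)
      assume nt: "t \<notin> (\<Union>n. E n)"
      have "(F has_vector_derivative g t) (at t)"
        unfolding has_vector_derivative_def has_derivative_at_alt
      proof (intro conjI allI impI)
        show "bounded_linear (\<lambda>x. x *\<^sub>R g t)" by (rule bounded_linear_scaleR_left)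
        fix e :: real assume "e > 0"
        then obtain n where n: "1 / real (Suc n) < e" by (metis nat_approx_posE)
        obtain d where d: "d > 0" "\<And>y. y \<in> {a..b} \<Longrightarrow> y \<noteq> t \<Longrightarrow> \<bar>y - t\<bar> < d \<Longrightarrow>
             norm (F y - F t - (y - t) *\<^sub>R g t) \<le> \<bar>y - t\<bar> / real (Suc n)"
        proof -
          have "t \<notin> E n" using nt by blast
          then show ?thesis using t that unfolding E_def by (force simp: not_less)
        qed
        define d' where "d' = min d (min (t - a) (b - t))"
        have "d' > 0" using d t by (auto simp: d'_def)
        moreover have "norm (F y - F t - (y - t) *\<^sub>R g t) \<le> e * norm (y - t)" if "norm (y - t) < d'" for y
        proof (cases "y = t")
          case False
          have "y \<in> {a..b}" "\<bar>y - t\<bar> < d" using that t by (auto simp: d'_def abs_if split: if_splits)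
          then have "norm (F y - F t - (y - t) *\<^sub>R g t) \<le> \<bar>y - t\<bar> * (1 / real (Suc n))"
            using d(2)[of y] False by auto
          also have "\<dots> \<le> \<bar>y - t\<bar> * e" by (rule mult_left_mono) (use n in auto)
          finally show ?thesis by (simp add: mult.commute)
        qed simp
        ultimately show "\<exists>d>0. \<forall>y. norm (y - t) < d \<longrightarrow> norm (F y - F t - (y - t) *\<^sub>R g t) \<le> e * norm (y - t)"
          by blast
      qed
      with nd show False by blast
    qed
  qed
  moreover have "negligible (\<Union>n. E n)"
    by (rule negligible_countable_Union) (auto intro: neg)
  ultimately show ?thesis
    unfolding F_def[abs_def] by (rule negligible_subset[rotated])
qed

subsection \<open>Integrals over grid intervals\<close>

lemma finite_measure_leb01: "finite_measure leb01"
  by (rule finite_measure_lebesgue_on) auto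

lemma emeasure_leb01_Ico:
  assumes "0 \<le> a" "a \<le> b" "b \<le> 1"
  shows "emeasure leb01 {a..<b} = ennreal (b - a)"
proof -
  have "emeasure leb01 {a..<b} = emeasure lebesgue {a..<b}"
    using assms by (intro emeasure_restrict_space) auto
  then show ?thesis using assms by simp
qed

lemma emeasure_leb01: "emeasure leb01 {0..1} = 1"
  by (subst emeasure_restrict_space) auto

lemma AE_leb01_less1: "AE t in leb01. 0 < t \<and> t < 1"
proof (rule AE_I')
  have "{0, 1::real} \<in> null_sets lebesgue" by (rule null_sets_completionI) (auto intro: finite_imp_null_set_lborel)
  then show "{0, 1::real} \<in> null_sets leb01" by (subst null_sets_restrict_space) auto
qed auto

lemma sets_leb01_Ico [simp]: "0 \<le> a \<Longrightarrow> b \<le> 1 \<Longrightarrow> {a..<b::real} \<in> sets leb01"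
  by (auto simp: sets_restrict_space intro!: image_eqI[of _ _ "{a..<b}"])

lemma ident_leb01: "(\<lambda>t. t) \<in> borel_measurable leb01"
  using id_borel_measurable_lebesgue_on[of "{0..1::real}"] by (simp add: id_def)

lemma continuous_leb01:
  "continuous_on {0..1} f \<Longrightarrow> f \<in> borel_measurable leb01"
  by (rule continuous_imp_measurable_on_sets_lebesgue) auto

lemma floor_measurable_leb01: "(\<lambda>t. F (nat \<lfloor>real n * t\<rfloor>)) \<in> borel_measurable leb01"
proof -
  have "(\<lambda>t. nat \<lfloor>real n * t\<rfloor>) \<in> borel \<rightarrow>\<^sub>M count_space UNIV" by measurable
  then have "(\<lambda>t. F (nat \<lfloor>real n * t\<rfloor>)) \<in> borel \<rightarrow>\<^sub>M borel"
    by (rule measurable_compose) auto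
  from measurable_compose[OF ident_leb01 this] show ?thesis .
qed

lemma grid_bounds:
  assumes "k < n"
  shows "0 \<le> real k / real n" "real k / real n \<le> real (Suc k) / real n" "real (Suc k) / real n \<le> 1"
    "{real k / real n..<real (Suc k) / real n} \<in> sets leb01"
proof -
  show 1: "0 \<le> real k / real n" by simp
  show "real k / real n \<le> real (Suc k) / real n" by (rule divide_right_mono) auto
  have "real (Suc k) \<le> real n" using assms by (simp only: of_nat_le_iff Suc_le_eq)
  then show 2: "real (Suc k) / real n \<le> 1" using assms by (simp only: divide_le_eq_1) simp
  show "{real k / real n..<real (Suc k) / real n} \<in> sets leb01"
    by (rule sets_leb01_Ico[OF 1 2])
qed

lemma grid_indicator_sum:
  fixes F :: "nat \<Rightarrow> ennreal"
  assumes n: "0 < n" and t: "0 \<le> t" "t < 1"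
  shows "(\<Sum>k<n. F k * indicator {real k / real n..<real (Suc k) / real n} t) = F (nat \<lfloor>real n * t\<rfloor>)"
proof -
  have iff: "t \<in> {real k / real n..<real (Suc k) / real n} \<longleftrightarrow> k = nat \<lfloor>real n * t\<rfloor>" for k
  proof -
    have "t \<in> {real k / real n..<real (Suc k) / real n} \<longleftrightarrow> real k \<le> real n * t \<and> real n * t < real k + 1"
      using n by (simp add: field_simps)
    also have "\<dots> \<longleftrightarrow> \<lfloor>real n * t\<rfloor> = int k" by (simp add: floor_eq_iff)
    also have "\<dots> \<longleftrightarrow> k = nat \<lfloor>real n * t\<rfloor>"
      using n t by (auto simp: nat_eq_iff)
    finally show ?thesis .
  qed
  have lt: "nat \<lfloor>real n * t\<rfloor> < n"
  proof -
    have "real n * t < real n" using n t by simp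
    then have "\<lfloor>real n * t\<rfloor> < int n" by (simp add: floor_less_iff)
    then show ?thesis using n by (simp add: nat_less_iff)
  qed
  have "(\<Sum>k<n. F k * indicator {real k / real n..<real (Suc k) / real n} t)
      = (\<Sum>k<n. if k = nat \<lfloor>real n * t\<rfloor> then F k else 0)"
    by (rule sum.cong) (auto simp only: indicator_def iff mult_1_right mult_zero_right of_bool_def split: if_splits)
  then show ?thesis using lt by simp
qed

lemma nn_integral_step:
  assumes n: "0 < n"
  shows "(\<integral>\<^sup>+ t. F (nat \<lfloor>real n * t\<rfloor>) \<partial>leb01) = (\<Sum>k<n. F k) * ennreal (1 / real n)"
proof -
  have "(\<integral>\<^sup>+ t. F (nat \<lfloor>real n * t\<rfloor>) \<partial>leb01)
      = (\<integral>\<^sup>+ t. (\<Sum>k<n. F k * indicator {real k / real n..<real (Suc k) / real n} t) \<partial>leb01)"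
    by (rule nn_integral_cong_AE, use AE_leb01_less1 in eventually_elim)
      (rule grid_indicator_sum[OF n, symmetric], auto)
  also have "\<dots> = (\<Sum>k<n. \<integral>\<^sup>+ t. F k * indicator {real k / real n..<real (Suc k) / real n} t \<partial>leb01)"
    by (rule nn_integral_sum, rule borel_measurable_times_ennreal[OF borel_measurable_const
          borel_measurable_indicator[OF grid_bounds(4)]]) simp
  also have "\<dots> = (\<Sum>k<n. F k * ennreal (1 / real n))"
  proof (rule sum.cong[OF refl])
    fix k assume k: "k \<in> {..<n}"
    then have kn: "k < n" by simp
    note 1 = grid_bounds(4)[OF kn]
    have "emeasure leb01 {real k / real n..<real (Suc k) / real n} = ennreal (real (Suc k) / real n - real k / real n)"
      by (intro emeasure_leb01_Ico grid_bounds kn)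
    also have "real (Suc k) / real n - real k / real n = 1 / real n" by (simp add: add_divide_distrib)
    finally show "(\<integral>\<^sup>+ t. F k * indicator {real k / real n..<real (Suc k) / real n} t \<partial>leb01) = F k * ennreal (1 / real n)"
      using nn_integral_cmult_indicator[OF 1, of "F k"] by simp
  qed
  finally show ?thesis by (simp add: sum_distrib_right)
qed

lemma sum_grid_integral_le:
  fixes q :: "real \<Rightarrow> ennreal"
  assumes n: "0 < n" and q: "q \<in> borel_measurable leb01"
  shows "(\<Sum>k<n. \<integral>\<^sup>+ t. q t * indicator {real k / real n..<real (Suc k) / real n} t \<partial>leb01) \<le> integral\<^sup>N leb01 q"
proof -
  have "(\<Sum>k<n. \<integral>\<^sup>+ t. q t * indicator {real k / real n..<real (Suc k) / real n} t \<partial>leb01)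
      = (\<integral>\<^sup>+ t. (\<Sum>k<n. q t * indicator {real k / real n..<real (Suc k) / real n} t) \<partial>leb01)"
    by (rule nn_integral_sum[symmetric], rule borel_measurable_times_ennreal[OF q
          borel_measurable_indicator[OF grid_bounds(4)]]) simp
  also have "\<dots> = integral\<^sup>N leb01 q"
  proof (rule nn_integral_cong_AE, use AE_leb01_less1 in eventually_elim)
    fix t :: real assume "0 < t \<and> t < 1"
    then show "(\<Sum>k<n. q t * indicator {real k / real n..<real (Suc k) / real n} t) = q t"
      using grid_indicator_sum[OF n, of t "\<lambda>_. q t"] by simp
  qed
  finally show ?thesis by simp
qed

lemma nn_Cauchy_Schwarz_Ico:
  assumes ab: "0 \<le> a" "a \<le> b" "b \<le> 1" and q[measurable]: "q \<in> borel_measurable leb01"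
  shows "(\<integral>\<^sup>+ t. q t * indicator {a..<b} t \<partial>leb01)\<^sup>2 \<le> ennreal (b - a) * (\<integral>\<^sup>+ t. (q t)\<^sup>2 * indicator {a..<b} t \<partial>leb01)"
proof -
  have [measurable]: "{a..<b} \<in> sets leb01" using ab by auto
  have "(\<integral>\<^sup>+ t. (q t * indicator {a..<b} t) * indicator {a..<b} t \<partial>leb01)\<^sup>2
     \<le> (\<integral>\<^sup>+ t. (q t * indicator {a..<b} t)\<^sup>2 \<partial>leb01) * (\<integral>\<^sup>+ t. (indicator {a..<b} t)\<^sup>2 \<partial>leb01)"
    by (rule Cauchy_Schwarz_nn_integral) measurable
  also have "(\<integral>\<^sup>+ t. (q t * indicator {a..<b} t)\<^sup>2 \<partial>leb01) = (\<integral>\<^sup>+ t. (q t)\<^sup>2 * indicator {a..<b} t \<partial>leb01)"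
    by (rule nn_integral_cong) (auto simp: indicator_def power2_eq_square)
  also have "(\<integral>\<^sup>+ t. (indicator {a..<b} t)\<^sup>2 \<partial>leb01) = (\<integral>\<^sup>+ t. indicator {a..<b} t \<partial>leb01)"
    by (rule nn_integral_cong) (auto simp: indicator_def power2_eq_square)
  also have "\<dots> = ennreal (b - a)" using emeasure_leb01_Ico[OF ab] by simp
  also have "(\<integral>\<^sup>+ t. (q t * indicator {a..<b} t) * indicator {a..<b} t \<partial>leb01) = (\<integral>\<^sup>+ t. q t * indicator {a..<b} t \<partial>leb01)"
    by (rule nn_integral_cong) (auto simp: indicator_def)
  finally show ?thesis by (simp add: mult.commute)
qed

lemma L2D:
  assumes "g \<in> L2"
  shows "g \<in> borel_measurable leb01" "(\<integral>\<^sup>+ t. ennreal ((norm (g t))\<^sup>2) \<partial>leb01) < \<infinity>"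
proof -
  show 1: "g \<in> borel_measurable leb01" using assms by (simp add: L2_def)
  have "integrable leb01 (\<lambda>t. (norm (g t))\<^sup>2)" using assms by (simp add: L2_def)
  then show "(\<integral>\<^sup>+ t. ennreal ((norm (g t))\<^sup>2) \<partial>leb01) < \<infinity>"
    by (subst (asm) integrable_iff_bounded) simp
qed

lemma L2I:
  assumes "g \<in> borel_measurable leb01" "(\<integral>\<^sup>+ t. ennreal ((norm (g t))\<^sup>2) \<partial>leb01) < \<infinity>"
  shows "g \<in> L2"
  using assms by (simp add: L2_def integrable_iff_bounded)

lemma L2_integrable:
  assumes "g \<in> L2" shows "integrable leb01 g"
proof -
  interpret finite_measure leb01 by (rule finite_measure_leb01)
  have "integrable leb01 (\<lambda>t. 1 + (norm (g t))\<^sup>2)"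
    using assms by (auto simp: L2_def)
  then show ?thesis
  proof (rule Bochner_Integration.integrable_bound)
    show "AE t in leb01. norm (g t) \<le> norm (1 + (norm (g t))\<^sup>2)"
    proof (intro AE_I2)
      fix t
      have "0 \<le> (norm (g t) - 1)\<^sup>2" by simp
      then have "2 * norm (g t) \<le> 1 + (norm (g t))\<^sup>2" by (simp add: power2_diff)
      moreover have "0 \<le> norm (g t)" by simp
      moreover have "norm (1 + (norm (g t))\<^sup>2) = 1 + (norm (g t))\<^sup>2" by (simp add: abs_of_nonneg)
      ultimately show "norm (g t) \<le> norm (1 + (norm (g t))\<^sup>2)" by linarith
    qed
  qed (use assms in \<open>simp add: L2_def\<close>)
qed

lemma L2_absolutely_integrable:
  assumes "g \<in> L2" "0 \<le> a" "b \<le> 1" shows "g absolutely_integrable_on {a..b}"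
proof -
  have "g absolutely_integrable_on {0..1}"
    unfolding set_integrable_def
    by (subst integrable_restrict_space[symmetric]) (auto intro: L2_integrable[OF assms(1)])
  then show ?thesis
    by (rule absolutely_integrable_on_subinterval) (use assms in auto)
qed

lemma L2_integrable_on:
  assumes "g \<in> L2" "0 \<le> a" "b \<le> 1" shows "g integrable_on {a..b}"
  using L2_absolutely_integrable[OF assms] set_lebesgue_integral_eq_integral(1) by blast

lemma norm_integral_le_nn:
  assumes g: "g \<in> L2" and ab: "0 \<le> a" "a \<le> b" "b \<le> 1"
  shows "ennreal (norm (integral {a..b} g)) \<le> (\<integral>\<^sup>+ t. ennreal (norm (g t)) * indicator {a..<b} t \<partial>leb01)"
proof -
  have ai: "g absolutely_integrable_on {a..b}" using L2_absolutely_integrable[OF g ab(1,3)] .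
  then have "integrable (lebesgue_on {a..b}) (\<lambda>t. norm (g t))"
    by (intro integrable_norm absolutely_integrable_imp_integrable) auto
  then have 1: "ennreal (integral {a..b} (\<lambda>t. norm (g t))) = (\<integral>\<^sup>+ t. ennreal (norm (g t)) \<partial>lebesgue_on {a..b})"
    by (subst lebesgue_integral_eq_integral[symmetric]) (auto simp: nn_integral_eq_integral)
  have "norm (integral {a..b} g) \<le> integral {a..b} (\<lambda>t. norm (g t))"
    using ai by (intro integral_norm_bound_integral) (auto simp: absolutely_integrable_on_def)
  then have "ennreal (norm (integral {a..b} g)) \<le> (\<integral>\<^sup>+ t. ennreal (norm (g t)) \<partial>lebesgue_on {a..b})"
    unfolding 1[symmetric] by (rule ennreal_leI)
  also have "\<dots> = (\<integral>\<^sup>+ t. ennreal (norm (g t)) * indicator {a..b} t \<partial>lebesgue)"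
    by (rule nn_integral_restrict_space) auto
  also have "\<dots> = (\<integral>\<^sup>+ t. ennreal (norm (g t)) * indicator {a..<b} t \<partial>lebesgue)"
  proof (rule nn_integral_cong_AE)
    have "AE t in lebesgue. t \<noteq> b" by (rule AE_I'[of "{b}"]) auto
    then show "AE t in lebesgue. ennreal (norm (g t)) * indicator {a..b} t = ennreal (norm (g t)) * indicator {a..<b} t"
      by eventually_elim (auto simp: indicator_def)
  qed
  also have "\<dots> = (\<integral>\<^sup>+ t. (ennreal (norm (g t)) * indicator {a..<b} t) * indicator {0..1} t \<partial>lebesgue)"
    using ab by (intro nn_integral_cong) (auto simp: indicator_def)
  also have "\<dots> = (\<integral>\<^sup>+ t. ennreal (norm (g t)) * indicator {a..<b} t \<partial>leb01)"
    by (rule nn_integral_restrict_space[symmetric]) auto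
  finally show ?thesis .
qed

lemma integral_Cauchy_Schwarz:
  assumes g: "g \<in> L2" and ab: "0 \<le> a" "a \<le> b" "b \<le> 1"
  shows "ennreal ((norm (integral {a..b} g))\<^sup>2) \<le> ennreal (b - a) * (\<integral>\<^sup>+ t. ennreal ((norm (g t))\<^sup>2) * indicator {a..<b} t \<partial>leb01)"
proof -
  have [measurable]: "g \<in> borel_measurable leb01" using L2D[OF g] by simp
  have "ennreal ((norm (integral {a..b} g))\<^sup>2) = (ennreal (norm (integral {a..b} g)))\<^sup>2"
    by (simp add: ennreal_power)
  also have "\<dots> \<le> (\<integral>\<^sup>+ t. ennreal (norm (g t)) * indicator {a..<b} t \<partial>leb01)\<^sup>2"
    by (rule power_mono[OF norm_integral_le_nn[OF g ab]]) simp
  also have "\<dots> \<le> ennreal (b - a) * (\<integral>\<^sup>+ t. (ennreal (norm (g t)))\<^sup>2 * indicator {a..<b} t \<partial>leb01)"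
    by (rule nn_Cauchy_Schwarz_Ico[OF ab]) measurable
  finally show ?thesis by (simp add: ennreal_power)
qed

lemma integral_diff_L2:
  assumes g: "g \<in> L2" and ab: "0 \<le> a" "a \<le> b" "b \<le> 1"
  shows "integral {0..b} g - integral {0..a} g = integral {a..b} g"
  using Henstock_Kurzweil_Integration.integral_combine[OF ab(1,2) L2_integrable_on[OF g order_refl ab(3)]]
  by (simp add: algebra_simps)

subsection \<open>Slopes along dyadic grids\<close>

text \<open>The difference quotients of \<open>v\<close> on the grid with \<open>n\<close> intervals form a step function, whose squared
  \<open>L\<^sup>2\<close> norm is the energy of the piecewise affine interpolation.\<close>

definition grid_slope :: "nat \<Rightarrow> (real \<Rightarrow> 'a::euclidean_space) \<Rightarrow> nat \<Rightarrow> 'a" where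
  "grid_slope n v k = real n *\<^sub>R (v (real (Suc k) / real n) - v (real k / real n))"

definition slope :: "nat \<Rightarrow> (real \<Rightarrow> 'a::euclidean_space) \<Rightarrow> real \<Rightarrow> 'a" where
  "slope n v t = grid_slope n v (nat \<lfloor>real n * t\<rfloor>)"

definition energy :: "nat \<Rightarrow> (real \<Rightarrow> 'a::euclidean_space) \<Rightarrow> real" where
  "energy n v = (\<Sum>k<n. (norm (grid_slope n v k))\<^sup>2) / real n"

lemma slope_measurable [measurable]: "slope n v \<in> borel_measurable leb01"
  unfolding slope_def[abs_def] by (rule floor_measurable_leb01)

lemma nn_integral_slope:
  assumes "0 < n"
  shows "(\<integral>\<^sup>+ t. ennreal ((norm (slope n v t))\<^sup>2) \<partial>leb01) = ennreal (energy n v)"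
proof -
  have "(\<integral>\<^sup>+ t. ennreal ((norm (slope n v t))\<^sup>2) \<partial>leb01)
      = (\<Sum>k<n. ennreal ((norm (grid_slope n v k))\<^sup>2)) * ennreal (1 / real n)"
    using nn_integral_step[OF assms, of "\<lambda>k. ennreal ((norm (grid_slope n v k))\<^sup>2)"] by (simp add: slope_def)
  also have "\<dots> = ennreal ((\<Sum>k<n. (norm (grid_slope n v k))\<^sup>2) * (1 / real n))"
    by (simp add: sum_ennreal ennreal_mult[symmetric] sum_nonneg)
  finally show ?thesis by (simp add: energy_def)
qed

text \<open>Slopes on nested grids form a martingale, so their increments are orthogonal.\<close>

lemma nn_integral_slope_diff:
  fixes v :: "real \<Rightarrow> 'a::euclidean_space"
  assumes n: "0 < n" and r: "0 < r"
  shows "(\<integral>\<^sup>+ t. ennreal ((norm (slope (n * r) v t - slope n v t))\<^sup>2) \<partial>leb01)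
      = ennreal (energy (n * r) v - energy n v)"
    and energy_refine_mono: "energy n v \<le> energy (n * r) v"
proof -
  define a where "a = grid_slope (n * r) v"
  define b where "b = grid_slope n v"
  have nr: "0 < n * r" using n r by simp
  have fl: "nat \<lfloor>real n * t\<rfloor> = nat \<lfloor>real (n * r) * t\<rfloor> div r" for t :: real
  proof -
    have "\<lfloor>real (n * r) * t / real_of_int (int r)\<rfloor> = \<lfloor>real (n * r) * t\<rfloor> div int r"
      by (rule floor_divide_real_eq_div) simp
    moreover have "real (n * r) * t / real_of_int (int r) = real n * t" using r by simp
    ultimately have "\<lfloor>real n * t\<rfloor> = \<lfloor>real (n * r) * t\<rfloor> div int r" by simp
    then show ?thesis by (simp add: nat_div_distrib')
  qed
  have block: "(\<Sum>k\<in>{j * r..<j * r + r}. (norm (a k - b (k div r)))\<^sup>2)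
      = (\<Sum>k\<in>{j * r..<j * r + r}. (norm (a k))\<^sup>2) - real r * (norm (b j))\<^sup>2" for j
  proof -
    have dv: "k div r = j" if "k \<in> {j * r..<j * r + r}" for k
      using that r by (intro div_nat_eqI) (auto simp: algebra_simps)
    have tel: "(\<Sum>k\<in>{j * r..<j * r + r}. a k) = real r *\<^sub>R b j"
    proof -
      have "(\<Sum>k\<in>{j * r..<j * r + r}. a k)
         = real (n * r) *\<^sub>R (\<Sum>k\<in>{j * r..<j * r + r}. v (real (Suc k) / real (n * r)) - v (real k / real (n * r)))"
        unfolding a_def grid_slope_def by (simp only: scaleR_sum_right)
      also have "(\<Sum>k\<in>{j * r..<j * r + r}. v (real (Suc k) / real (n * r)) - v (real k / real (n * r)))
         = v (real (j * r + r) / real (n * r)) - v (real (j * r) / real (n * r))"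
        by (rule sum_Suc_diff') simp
      also have "real (j * r + r) / real (n * r) = real (Suc j) / real n"
        using r n by (simp add: field_simps)
      also have "real (j * r) / real (n * r) = real j / real n"
        using r n by (simp add: field_simps)
      finally show ?thesis by (simp add: b_def grid_slope_def mult.commute)
    qed
    have "(\<Sum>k\<in>{j * r..<j * r + r}. (norm (a k - b (k div r)))\<^sup>2)
        = (\<Sum>k\<in>{j * r..<j * r + r}. (norm (a k))\<^sup>2 - 2 * (a k \<bullet> b j) + (norm (b j))\<^sup>2)"
      by (rule sum.cong) (auto simp: dv power2_norm_eq_inner inner_diff inner_commute)
    also have "\<dots> = (\<Sum>k\<in>{j * r..<j * r + r}. (norm (a k))\<^sup>2)
         - 2 * ((\<Sum>k\<in>{j * r..<j * r + r}. a k) \<bullet> b j) + real r * (norm (b j))\<^sup>2"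
      by (simp add: sum.distrib sum_subtractf inner_sum_left sum_distrib_left)
    also have "(\<Sum>k\<in>{j * r..<j * r + r}. a k) \<bullet> b j = real r * (norm (b j))\<^sup>2"
      by (simp add: tel power2_norm_eq_inner)
    finally show ?thesis by simp
  qed
  have "(\<Sum>k<n * r. (norm (a k - b (k div r)))\<^sup>2) = (\<Sum>k<n * r. (norm (a k))\<^sup>2) - real r * (\<Sum>j<n. (norm (b j))\<^sup>2)"
    by (simp add: sum.nat_group[symmetric] block sum_subtractf sum_distrib_left)
  then have eq: "(\<Sum>k<n * r. (norm (a k - b (k div r)))\<^sup>2) * (1 / real (n * r)) = energy (n * r) v - energy n v"
    using n r by (simp add: energy_def a_def b_def diff_divide_distrib)
  have "0 \<le> (\<Sum>k<n * r. (norm (a k - b (k div r)))\<^sup>2) * (1 / real (n * r))"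
    by (simp add: sum_nonneg)
  with eq show "energy n v \<le> energy (n * r) v" by simp
  have "(\<integral>\<^sup>+ t. ennreal ((norm (slope (n * r) v t - slope n v t))\<^sup>2) \<partial>leb01)
     = (\<integral>\<^sup>+ t. (\<lambda>k. ennreal ((norm (a k - b (k div r)))\<^sup>2)) (nat \<lfloor>real (n * r) * t\<rfloor>) \<partial>leb01)"
    unfolding slope_def a_def b_def fl by simp
  also have "\<dots> = (\<Sum>k<n * r. ennreal ((norm (a k - b (k div r)))\<^sup>2)) * ennreal (1 / real (n * r))"
    by (rule nn_integral_step[OF nr])
  also have "\<dots> = ennreal ((\<Sum>k<n * r. (norm (a k - b (k div r)))\<^sup>2) * (1 / real (n * r)))"
    by (simp add: sum_ennreal ennreal_mult[symmetric] sum_nonneg del: of_nat_mult)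
  finally show "(\<integral>\<^sup>+ t. ennreal ((norm (slope (n * r) v t - slope n v t))\<^sup>2) \<partial>leb01)
      = ennreal (energy (n * r) v - energy n v)" by (simp only: eq)
qed

lemma ennreal_power2_le_imp_le: "a\<^sup>2 \<le> b\<^sup>2 \<Longrightarrow> a \<le> b" for a b :: ennreal
  by (cases a; cases b) (auto simp: ennreal_power top_power_ennreal top_unique intro: power2_le_imp_le)

text \<open>Along a subsequence with summable increments the sequence converges absolutely almost everywhere, and the
  bounds pass to the limit by Fatou.\<close>

lemma L2_Cauchy_limit:
  fixes g :: "nat \<Rightarrow> real \<Rightarrow> 'a::euclidean_space"
  assumes g[measurable]: "\<And>N. g N \<in> borel_measurable leb01"
    and Q: "Q \<longlonglongrightarrow> L" "\<And>N. Q N \<le> L"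
    and inc: "\<And>M N. N \<le> M \<Longrightarrow> (\<integral>\<^sup>+ t. ennreal ((norm (g M t - g N t))\<^sup>2) \<partial>leb01) \<le> ennreal (Q M - Q N)"
  obtains h r where "h \<in> borel_measurable leb01" "strict_mono (r :: nat \<Rightarrow> nat)"
    "AE t in leb01. (\<lambda>i. g (r i) t) \<longlonglongrightarrow> h t"
    "\<And>N. (\<integral>\<^sup>+ t. ennreal ((norm (h t - g N t))\<^sup>2) \<partial>leb01) \<le> ennreal (L - Q N)"
proof -
  have "\<exists>f. \<forall>n\<ge>f. L - Q n < (1/4)^i" for i :: nat
  proof -
    have "(\<lambda>n. L - Q n) \<longlonglongrightarrow> L - L" by (intro tendsto_intros Q)
    then have "eventually (\<lambda>n. L - Q n < (1/4)^i) sequentially"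
      by (rule order_tendstoD) simp
    then show ?thesis by (simp add: eventually_sequentially)
  qed
  then obtain f where f: "\<And>i n. n \<ge> f i \<Longrightarrow> L - Q n < (1/4)^i" by metis
  define r where "r i = (\<Sum>j\<le>i. Suc (f j))" for i
  have rS: "strict_mono r" by (rule strict_mono_Suc_iff[THEN iffD2]) (simp add: r_def)
  have rf: "f i \<le> r i" for i
  proof -
    have "Suc (f i) \<le> (\<Sum>j\<le>i. Suc (f j))" by (rule member_le_sum) auto
    then show ?thesis by (simp add: r_def)
  qed
  have step: "(\<integral>\<^sup>+ t. ennreal (norm (g (r (Suc i)) t - g (r i) t)) \<partial>leb01) \<le> ennreal ((1/2)^i)" for i
  proof -
    let ?d = "\<lambda>t. norm (g (r (Suc i)) t - g (r i) t)"
    have "(\<integral>\<^sup>+ t. ennreal (?d t) * indicator {0..<1} t \<partial>leb01)\<^sup>2 \<le> ennreal (1 - 0) * (\<integral>\<^sup>+ t. (ennreal (?d t))\<^sup>2 * indicator {0..<1} t \<partial>leb01)"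
      by (rule nn_Cauchy_Schwarz_Ico) (simp_all, measurable)
    also have "\<dots> \<le> (\<integral>\<^sup>+ t. (ennreal (?d t))\<^sup>2 \<partial>leb01)"
      by (auto intro!: nn_integral_mono simp: indicator_def)
    also have "\<dots> \<le> ennreal (Q (r (Suc i)) - Q (r i))"
      using inc[of "r i" "r (Suc i)"] rS by (simp add: ennreal_power strict_mono_less_eq)
    also have "\<dots> \<le> ennreal ((1/4)^i)"
      using f[OF rf, of i] Q(2)[of "r (Suc i)"] by (intro ennreal_leI) linarith
    also have "\<dots> = (ennreal ((1/2)^i))\<^sup>2"
    proof -
      have "(1/4::real)^i = ((1/2)^i)\<^sup>2" by (simp add: power2_eq_square flip: power_mult_distrib)
      then show ?thesis by (simp only: ennreal_power zero_le_power zero_le_divide_1_iff zero_le_numeral)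
    qed
    finally have "(\<integral>\<^sup>+ t. ennreal (?d t) * indicator {0..<1} t \<partial>leb01) \<le> ennreal ((1/2)^i)"
      by (rule ennreal_power2_le_imp_le)
    moreover have "(\<integral>\<^sup>+ t. ennreal (?d t) * indicator {0..<1} t \<partial>leb01) = (\<integral>\<^sup>+ t. ennreal (?d t) \<partial>leb01)"
      by (rule nn_integral_cong_AE, use AE_leb01_less1 in eventually_elim) simp
    ultimately show ?thesis by simp
  qed
  have "(\<integral>\<^sup>+ t. (\<Sum>i. ennreal (norm (g (r (Suc i)) t - g (r i) t))) \<partial>leb01)
      = (\<Sum>i. \<integral>\<^sup>+ t. ennreal (norm (g (r (Suc i)) t - g (r i) t)) \<partial>leb01)"
    by (rule nn_integral_suminf) measurable
  also have "\<dots> \<le> (\<Sum>i. ennreal ((1/2)^i))" by (intro suminf_le step) auto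
  also have "\<dots> = ennreal (\<Sum>i. (1/2)^i)" by (rule suminf_ennreal2) (auto intro: summable_geometric)
  finally have "(\<integral>\<^sup>+ t. (\<Sum>i. ennreal (norm (g (r (Suc i)) t - g (r i) t))) \<partial>leb01) \<noteq> \<infinity>"
    by (auto simp: top_unique)
  then have "AE t in leb01. (\<Sum>i. ennreal (norm (g (r (Suc i)) t - g (r i) t))) \<noteq> \<infinity>"
    by (intro nn_integral_PInf_AE) measurable
  then have conv: "AE t in leb01. convergent (\<lambda>i. g (r i) t)"
  proof eventually_elim
    case (elim t)
    then have "summable (\<lambda>i. norm (g (r (Suc i)) t - g (r i) t))"
      by (intro summable_suminf_not_top) auto
    then have "summable (\<lambda>i. g (r (Suc i)) t - g (r i) t)" by (rule summable_norm_cancel)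
    then have "convergent (\<lambda>n. \<Sum>i<n. g (r (Suc i)) t - g (r i) t)" by (simp add: summable_iff_convergent)
    then have "convergent (\<lambda>n. (\<Sum>i<n. g (r (Suc i)) t - g (r i) t) + g (r 0) t)"
      by (rule convergent_add) (rule convergent_const)
    moreover have "(\<Sum>i<n. g (r (Suc i)) t - g (r i) t) = g (r n) t - g (r 0) t" for n
      by (rule sum_lessThan_telescope)
    ultimately show ?case by simp
  qed
  define h where "h t = lim (\<lambda>i. g (r i) t)" for t
  have h[measurable]: "h \<in> borel_measurable leb01"
    unfolding h_def[abs_def] by measurable
  have ae: "AE t in leb01. (\<lambda>i. g (r i) t) \<longlonglongrightarrow> h t"
    using conv by eventually_elim (simp add: h_def convergent_LIMSEQ_iff)
  have bd: "(\<integral>\<^sup>+ t. ennreal ((norm (h t - g N t))\<^sup>2) \<partial>leb01) \<le> ennreal (L - Q N)" for N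
  proof -
    have "(\<integral>\<^sup>+ t. ennreal ((norm (h t - g N t))\<^sup>2) \<partial>leb01)
        = (\<integral>\<^sup>+ t. liminf (\<lambda>i. ennreal ((norm (g (r i) t - g N t))\<^sup>2)) \<partial>leb01)"
    proof (rule nn_integral_cong_AE, use ae in eventually_elim)
      case (elim t)
      then have "(\<lambda>i. ennreal ((norm (g (r i) t - g N t))\<^sup>2)) \<longlonglongrightarrow> ennreal ((norm (h t - g N t))\<^sup>2)"
        by (intro tendsto_intros)
      then show ?case by (rule lim_imp_Liminf[OF trivial_limit_sequentially, symmetric])
    qed
    also have "\<dots> \<le> liminf (\<lambda>i. \<integral>\<^sup>+ t. ennreal ((norm (g (r i) t - g N t))\<^sup>2) \<partial>leb01)"
      by (rule nn_integral_liminf) measurable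
    also have "\<dots> \<le> liminf (\<lambda>i. ennreal (L - Q N))"
    proof (rule Liminf_mono)
      have "eventually (\<lambda>i. N \<le> r i) sequentially"
        by (rule eventually_sequentiallyI[of N]) (use seq_suble[OF rS] order_trans in blast)
      then show "eventually (\<lambda>i. (\<integral>\<^sup>+ t. ennreal ((norm (g (r i) t - g N t))\<^sup>2) \<partial>leb01) \<le> ennreal (L - Q N)) sequentially"
      proof eventually_elim
        case (elim i)
        then have "(\<integral>\<^sup>+ t. ennreal ((norm (g (r i) t - g N t))\<^sup>2) \<partial>leb01) \<le> ennreal (Q (r i) - Q N)" by (rule inc)
        also have "\<dots> \<le> ennreal (L - Q N)" using Q(2) by (intro ennreal_leI) simp
        finally show ?case .
      qed
    qed
    finally show ?thesis by (simp add: Liminf_const)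
  qed
  from that[OF h rS ae bd] show ?thesis .
qed


lemma grid_telescope:
  fixes v :: "real \<Rightarrow> 'a::euclidean_space"
  assumes n: "0 < n" and "j \<le> n"
  shows "(slope n v has_integral (v (real j / real n) - v 0)) {0..real j / real n}"
  using assms(2)
proof (induction j)
  case 0
  then show ?case by (simp add: has_integral_refl)
next
  case (Suc j)
  have "((\<lambda>_. grid_slope n v j) has_integral measure lborel (cbox (real j / real n) (real (Suc j) / real n)) *\<^sub>R grid_slope n v j)
      (cbox (real j / real n) (real (Suc j) / real n))"
    by (rule has_integral_const)
  then have "(slope n v has_integral measure lborel (cbox (real j / real n) (real (Suc j) / real n)) *\<^sub>R grid_slope n v j)
      (cbox (real j / real n) (real (Suc j) / real n))"
  proof (rule has_integral_spike_interior)
    fix t assume "t \<in> box (real j / real n) (real (Suc j) / real n)"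
    then have "real j < real n * t" "real n * t < real j + 1"
      using n by (auto simp: box_real field_simps)
    then have "\<lfloor>real n * t\<rfloor> = int j" by (simp add: floor_eq_iff)
    then show "slope n v t = grid_slope n v j" by (simp add: slope_def)
  qed
  moreover have "measure lborel (cbox (real j / real n) (real (Suc j) / real n)) *\<^sub>R grid_slope n v j = v (real (Suc j) / real n) - v (real j / real n)"
  proof -
    have "real (Suc j) / real n - real j / real n = 1 / real n" by (simp add: add_divide_distrib)
    moreover have "real j / real n \<le> real (Suc j) / real n" by (rule divide_right_mono) auto
    ultimately show ?thesis using n by (simp add: grid_slope_def)
  qed
  ultimately have 1: "(slope n v has_integral v (real (Suc j) / real n) - v (real j / real n)) {real j / real n..real (Suc j) / real n}"
    by (simp only: cbox_interval)
  have 2: "(slope n v has_integral (v (real j / real n) - v 0)) {0..real j / real n}"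
    using Suc by simp
  have 3: "0 \<le> real j / real n" by simp
  have 4: "real j / real n \<le> real (Suc j) / real n" by (rule divide_right_mono) auto
  from has_integral_combine[OF 3 4 2 1] show ?case by simp
qed

text \<open>The dyadic slopes are a martingale bounded in \<open>L\<^sup>2\<close>; its limit integrates to \<open>v\<close> because the slopes
  do so at all grid points.\<close>

theorem dyadic_energy_imp_primitive:
  fixes v :: "real \<Rightarrow> 'a::euclidean_space"
  assumes cont: "continuous_on {0..1} v" and bd: "\<And>N. N \<ge> N0 \<Longrightarrow> energy (2^N) v \<le> C"
  obtains g r where "g \<in> L2" "strict_mono (r :: nat \<Rightarrow> nat)"
    "AE t in leb01. (\<lambda>i. slope (2 ^ r i) v t) \<longlonglongrightarrow> g t"
    "\<And>t. t \<in> {0..1} \<Longrightarrow> v t = v 0 + integral {0..t} g"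
    "(\<integral>\<^sup>+ t. ennreal ((norm (g t))\<^sup>2) \<partial>leb01) \<le> ennreal C"
proof -
  define Q where "Q N = energy (2^N) v" for N
  have pw: "(2::nat)^M = 2^N * 2^(M - N)" if "N \<le> M" for M N
    using that by (simp flip: power_add)
  have sd: "(\<integral>\<^sup>+ t. ennreal ((norm (slope (2^M) v t - slope (2^N) v t))\<^sup>2) \<partial>leb01) = ennreal (Q M - Q N)"
    if "N \<le> M" for M N
    using nn_integral_slope_diff[of "2^N" "2^(M - N)" v] unfolding Q_def pw[OF that] by simp
  have Qmono: "Q N \<le> Q M" if "N \<le> M" for M N
    using energy_refine_mono[of "2^N" "2^(M - N)" v] by (simp add: Q_def pw[OF that])
  have QC: "Q N \<le> C" for N
    using Qmono[of N "max N N0"] bd[of "max N N0"] by (simp add: Q_def)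
  define L where "L = (SUP N. Q N)"
  have bdd: "bdd_above (range Q)" using QC by (auto simp: bdd_above_def)
  have QL: "Q \<longlonglongrightarrow> L" "\<And>N. Q N \<le> L"
    unfolding L_def using bdd Qmono by (auto intro: LIMSEQ_incseq_SUP cSUP_upper simp: mono_def)
  have LC: "L \<le> C" unfolding L_def by (rule cSUP_least) (auto intro: QC)
  obtain g r where g: "g \<in> borel_measurable leb01" "strict_mono (r :: nat \<Rightarrow> nat)"
    "AE t in leb01. (\<lambda>i. slope (2 ^ r i) v t) \<longlonglongrightarrow> g t"
    and gN: "\<And>N. (\<integral>\<^sup>+ t. ennreal ((norm (g t - slope (2^N) v t))\<^sup>2) \<partial>leb01) \<le> ennreal (L - Q N)"
    by (rule L2_Cauchy_limit[of "\<lambda>N. slope (2^N) v", OF slope_measurable QL])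
      (auto simp: sd)
  have sL2: "slope (2^N) v \<in> L2" for N
    by (rule L2I[OF slope_measurable]) (simp add: nn_integral_slope)
  have gC: "(\<integral>\<^sup>+ t. ennreal ((norm (g t))\<^sup>2) \<partial>leb01) \<le> ennreal C"
  proof -
    have "(\<integral>\<^sup>+ t. ennreal ((norm (g t))\<^sup>2) \<partial>leb01)
        = (\<integral>\<^sup>+ t. liminf (\<lambda>i. ennreal ((norm (slope (2 ^ r i) v t))\<^sup>2)) \<partial>leb01)"
    proof (rule nn_integral_cong_AE, use g(3) in eventually_elim)
      case (elim t)
      then have "(\<lambda>i. ennreal ((norm (slope (2 ^ r i) v t))\<^sup>2)) \<longlonglongrightarrow> ennreal ((norm (g t))\<^sup>2)"
        by (intro tendsto_intros)
      then show ?case by (rule lim_imp_Liminf[OF trivial_limit_sequentially, symmetric])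
    qed
    also have "\<dots> \<le> liminf (\<lambda>i. \<integral>\<^sup>+ t. ennreal ((norm (slope (2 ^ r i) v t))\<^sup>2) \<partial>leb01)"
      by (rule nn_integral_liminf) measurable
    also have "\<dots> \<le> liminf (\<lambda>i. ennreal C)"
      by (intro Liminf_mono always_eventually allI) (simp add: nn_integral_slope ennreal_leI QC[unfolded Q_def])
    finally show ?thesis by (simp add: Liminf_const)
  qed
  have gL2: "g \<in> L2"
    using le_less_trans[OF gC ennreal_less_top] by (intro L2I g(1)) simp
  have dL2: "(\<lambda>t. g t - slope (2^N) v t) \<in> L2" for N
    using le_less_trans[OF gN[of N] ennreal_less_top]
    by (intro L2I borel_measurable_diff g(1) slope_measurable) simp
  have lim: "(\<lambda>M. integral {0..x} (slope (2^M) v)) \<longlonglongrightarrow> integral {0..x} g" if x: "0 \<le> x" "x \<le> 1" for x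
  proof -
    have le: "(norm (integral {0..x} (slope (2^M) v) - integral {0..x} g))\<^sup>2 \<le> L - Q M" for M
    proof -
      have "integral {0..x} (\<lambda>t. g t - slope (2^M) v t) = integral {0..x} g - integral {0..x} (slope (2^M) v)"
        by (rule Henstock_Kurzweil_Integration.integral_diff) (intro L2_integrable_on gL2 sL2 x order_refl)+
      then have "ennreal ((norm (integral {0..x} (slope (2^M) v) - integral {0..x} g))\<^sup>2)
          = ennreal ((norm (integral {0..x} (\<lambda>t. g t - slope (2^M) v t)))\<^sup>2)"
        by (simp add: norm_minus_commute)
      also have "\<dots> \<le> ennreal (x - 0) * (\<integral>\<^sup>+ t. ennreal ((norm (g t - slope (2^M) v t))\<^sup>2) * indicator {0..<x} t \<partial>leb01)"
        by (rule integral_Cauchy_Schwarz[OF dL2]) (use x in auto)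
      also have "\<dots> \<le> 1 * (\<integral>\<^sup>+ t. ennreal ((norm (g t - slope (2^M) v t))\<^sup>2) \<partial>leb01)"
        using x by (intro mult_mono nn_integral_mono) (auto simp: indicator_def)
      also have "\<dots> \<le> ennreal (L - Q M)" using gN[of M] by simp
      finally show ?thesis using QL(2)[of M] by (simp add: ennreal_le_iff)
    qed
    have "(\<lambda>M. L - Q M) \<longlonglongrightarrow> L - L" by (intro tendsto_intros QL)
    from tendsto_real_sqrt[OF this] have s0: "(\<lambda>M. sqrt (L - Q M)) \<longlonglongrightarrow> 0" by simp
    have nb: "norm (integral {0..x} (slope (2^M) v) - integral {0..x} g) \<le> sqrt (L - Q M)" for M
      by (rule real_le_rsqrt[OF le])
    show ?thesis
      by (rule LIM_zero_cancel, rule Lim_null_comparison[OF _ s0]) (rule always_eventually, rule allI, rule nb)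
  qed
  have dyadic: "v (real j / 2^N) = v 0 + integral {0..real j / 2^N} g" if j: "j \<le> 2^N" for j N
  proof -
    have eq: "integral {0..real j / 2^N} (slope (2^M) v) = v (real j / 2^N) - v 0" if "N \<le> M" for M
    proof -
      have 1: "real (j * 2^(M-N)) / real (2^M) = real j / 2^N"
      proof -
        have "real (2^M) = 2^N * 2^(M-N)" by (simp only: pw[OF that] of_nat_mult of_nat_power of_nat_numeral)
        then show ?thesis by (simp only: of_nat_mult of_nat_power of_nat_numeral) simp
      qed
      have 2: "j * 2^(M-N) \<le> 2^M" using j by (simp only: pw[OF that] mult_le_mono1)
      show ?thesis using grid_telescope[OF _ 2, of v] unfolding 1 by (simp add: integral_unique)
    qed
    have "(\<lambda>M. integral {0..real j / 2^N} (slope (2^M) v)) \<longlonglongrightarrow> v (real j / 2^N) - v 0"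
      by (rule tendsto_eventually, rule eventually_sequentiallyI[of N]) (rule eq)
    moreover have "real j \<le> 2^N" using j by (metis of_nat_le_iff of_nat_numeral of_nat_power)
    then have "(\<lambda>M. integral {0..real j / 2^N} (slope (2^M) v)) \<longlonglongrightarrow> integral {0..real j / 2^N} g"
      by (intro lim) auto
    ultimately have "v (real j / 2^N) - v 0 = integral {0..real j / 2^N} g" by (rule LIMSEQ_unique)
    then show ?thesis by (simp only: diff_eq_eq add.commute)
  qed
  have "v t = v 0 + integral {0..t} g" if t: "t \<in> {0..1}" for t :: real
  proof -
    define x where "x N = real (nat \<lfloor>2^N * t\<rfloor>) / 2^N" for N :: nat
    have xr: "x N = real_of_int \<lfloor>2^N * t\<rfloor> / 2^N" for N using t by (simp add: x_def)
    have xb: "0 \<le> x N" "x N \<le> t" "t - x N \<le> 1 / 2^N" for N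
    proof -
      show "0 \<le> x N" by (simp add: x_def)
      have "real_of_int \<lfloor>2^N * t\<rfloor> \<le> 2^N * t" by simp
      then show "x N \<le> t" by (simp add: xr field_simps)
      have "2^N * t - real_of_int \<lfloor>2^N * t\<rfloor> \<le> 1" by linarith
      moreover have "t - x N = (2^N * t - real_of_int \<lfloor>2^N * t\<rfloor>) / 2^N" by (simp add: xr diff_divide_distrib)
      ultimately show "t - x N \<le> 1 / 2^N" by (simp only: divide_right_mono zero_le_power zero_le_numeral)
    qed
    have xlim: "x \<longlonglongrightarrow> t"
    proof (rule tendsto_sandwich[OF _ _ _ tendsto_const])
      have "(\<lambda>N. t - (1/2)^N) \<longlonglongrightarrow> t - 0" by (intro tendsto_intros) auto
      then show "(\<lambda>N. t - (1/2)^N) \<longlonglongrightarrow> t" by simp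
      show "\<forall>\<^sub>F N in sequentially. t - (1/2)^N \<le> x N"
        using xb(3) by (auto simp: power_divide algebra_simps)
    qed (use xb in auto)
    have x01: "x N \<in> {0..1}" for N using xb[of N] t by auto
    have "nat \<lfloor>2^N * t\<rfloor> \<le> 2^N" for N
    proof -
      have "2^N * t \<le> 2^N" using t by simp
      from order_trans[OF of_int_floor_le this] have "real_of_int \<lfloor>2^N * t\<rfloor> \<le> real_of_int (2^N)"
        by simp
      then have "\<lfloor>2^N * t\<rfloor> \<le> 2^N" by (simp only: of_int_le_iff)
      then show ?thesis by (simp add: nat_le_iff)
    qed
    then have eq: "v (x N) = v 0 + integral {0..x N} g" for N
      unfolding x_def by (rule dyadic)
    have "(\<lambda>N. v (x N)) \<longlonglongrightarrow> v t"
      by (rule continuous_on_tendsto_compose[OF cont xlim t]) (simp add: x01[simplified])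
    moreover have "continuous_on {0..1} (\<lambda>s. integral {0..s} g)"
      by (rule indefinite_integral_continuous_1[OF L2_integrable_on[OF gL2]]) auto
    then have "(\<lambda>N. integral {0..x N} g) \<longlonglongrightarrow> integral {0..t} g"
      by (rule continuous_on_tendsto_compose[OF _ xlim t]) (simp add: x01[simplified])
    then have "(\<lambda>N. v (x N)) \<longlonglongrightarrow> v 0 + integral {0..t} g"
      unfolding eq by (intro tendsto_intros)
    ultimately show ?thesis by (rule LIMSEQ_unique)
  qed
  from that[OF gL2 g(2,3) this gC] show ?thesis .
qed

subsection \<open>Primitives\<close>

lemma L2_absint_leb01:
  assumes "g \<in> L2" shows "integral\<^sup>L leb01 g = integral {0..1} g"
  by (rule lebesgue_integral_eq_integral[OF L2_integrable[OF assms]]) simp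

lemma primitive_continuous:
  assumes "g \<in> L2" and v: "\<And>t. t \<in> {0..1} \<Longrightarrow> v t = v 0 + integral {0..t} g"
  shows "continuous_on {0..1} v"
proof -
  have "continuous_on {0..1} (\<lambda>t. v 0 + integral {0..t} g)"
    by (intro continuous_intros indefinite_integral_continuous_1 L2_integrable_on[OF assms(1)]) auto
  then show ?thesis by (subst continuous_on_cong[OF refl v]) auto
qed

lemma primitive_diff:
  assumes g: "g \<in> L2" and v: "\<And>t. t \<in> {0..1} \<Longrightarrow> v t = v 0 + integral {0..t} g"
    and ab: "0 \<le> a" "a \<le> b" "b \<le> 1"
  shows "v b - v a = integral {a..b} g"
  using v[of a] v[of b] ab integral_diff_L2[OF g ab] by (simp add: algebra_simps)

lemma primitive_energy_le:
  assumes g: "g \<in> L2" and v: "\<And>t. t \<in> {0..1} \<Longrightarrow> v t = v 0 + integral {0..t} g" and n: "0 < n"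
  shows "ennreal (energy n v) \<le> (\<integral>\<^sup>+ t. ennreal ((norm (g t))\<^sup>2) \<partial>leb01)"
proof -
  let ?I = "\<lambda>k. {real k / real n..<real (Suc k) / real n}"
  have "ennreal (energy n v) = ennreal (\<Sum>k<n. (norm (grid_slope n v k))\<^sup>2 / real n)"
    by (simp add: energy_def sum_divide_distrib)
  also have "\<dots> = (\<Sum>k<n. ennreal ((norm (grid_slope n v k))\<^sup>2 / real n))"
    by (rule sum_ennreal[symmetric]) simp
  also have "\<dots> \<le> (\<Sum>k<n. \<integral>\<^sup>+ t. ennreal ((norm (g t))\<^sup>2) * indicator (?I k) t \<partial>leb01)"
  proof (rule sum_mono)
    fix k assume "k \<in> {..<n}" then have k: "k < n" by simp
    note gb = grid_bounds[OF k]
    have len: "real (Suc k) / real n - real k / real n = 1 / real n" by (simp add: add_divide_distrib)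
    have eq: "(norm (grid_slope n v k))\<^sup>2 / real n = real n * (norm (integral {real k / real n..real (Suc k) / real n} g))\<^sup>2"
    proof -
      have "v (real (Suc k) / real n) - v (real k / real n) = integral {real k / real n..real (Suc k) / real n} g"
        by (rule primitive_diff[OF g v gb(1-3)])
      then show ?thesis using n by (simp only: grid_slope_def) (simp add: power_mult_distrib power2_eq_square)
    qed
    have "ennreal ((norm (grid_slope n v k))\<^sup>2 / real n)
        = ennreal (real n) * ennreal ((norm (integral {real k / real n..real (Suc k) / real n} g))\<^sup>2)"
      unfolding eq by (rule ennreal_mult) auto
    also have "\<dots> \<le> ennreal (real n) * (ennreal (real (Suc k) / real n - real k / real n) *
         (\<integral>\<^sup>+ t. ennreal ((norm (g t))\<^sup>2) * indicator (?I k) t \<partial>leb01))"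
      by (intro mult_left_mono integral_Cauchy_Schwarz[OF g gb(1-3)]) simp
    also have "\<dots> = ennreal (real n * (1 / real n)) * (\<integral>\<^sup>+ t. ennreal ((norm (g t))\<^sup>2) * indicator (?I k) t \<partial>leb01)"
      unfolding len by (subst ennreal_mult) (auto simp: mult.assoc)
    finally show "ennreal ((norm (grid_slope n v k))\<^sup>2 / real n) \<le> (\<integral>\<^sup>+ t. ennreal ((norm (g t))\<^sup>2) * indicator (?I k) t \<partial>leb01)"
      using n by simp
  qed
  also have "\<dots> \<le> (\<integral>\<^sup>+ t. ennreal ((norm (g t))\<^sup>2) \<partial>leb01)"
    by (rule sum_grid_integral_le[OF n]) (use L2D(1)[OF g] in measurable)
  finally show ?thesis .
qed

lemma energy_compose_le:
  fixes q :: "real \<Rightarrow> 'b::euclidean_space" and v :: "real \<Rightarrow> 'a::euclidean_space"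
  assumes q: "\<And>s t. s \<in> {0..1} \<Longrightarrow> t \<in> {0..1} \<Longrightarrow> norm (q t - q s) \<le> A * norm (v t - v s) + B * \<bar>t - s\<bar>"
    and n: "0 < n"
  shows "energy n q \<le> 2 * A\<^sup>2 * energy n v + 2 * B\<^sup>2"
proof -
  have "(norm (grid_slope n q k))\<^sup>2 \<le> 2 * A\<^sup>2 * (norm (grid_slope n v k))\<^sup>2 + 2 * B\<^sup>2" if k: "k < n" for k
  proof -
    note gb = grid_bounds[OF k]
    define s where "s = real k / real n"
    define t where "t = real (Suc k) / real n"
    have st: "s \<in> {0..1}" "t \<in> {0..1}" using gb by (auto simp: s_def t_def)
    have "t - s = 1 / real n" by (simp add: s_def t_def add_divide_distrib)
    then have "real n * \<bar>t - s\<bar> = 1" using n by simp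
    then have w: "real n * (A * norm (v t - v s) + B * \<bar>t - s\<bar>) = A * (real n * norm (v t - v s)) + B"
      by (simp only: distrib_left mult.left_commute[of "real n"] mult_1_right)
    have gn: "norm (grid_slope n q k) = real n * norm (q t - q s)" "norm (grid_slope n v k) = real n * norm (v t - v s)"
      unfolding grid_slope_def s_def t_def by simp_all
    have "real n * norm (q t - q s) \<le> real n * (A * norm (v t - v s) + B * \<bar>t - s\<bar>)"
      using q[OF st] by (intro mult_left_mono) auto
    then have "norm (grid_slope n q k) \<le> A * norm (grid_slope n v k) + B"
      unfolding w gn .
    then have "(norm (grid_slope n q k))\<^sup>2 \<le> (A * norm (grid_slope n v k) + B)\<^sup>2"
      by (rule power_mono) simp
    also have "\<dots> \<le> 2 * (A * norm (grid_slope n v k))\<^sup>2 + 2 * B\<^sup>2"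
      using zero_le_power2[of "A * norm (grid_slope n v k) - B"] by (simp add: power2_sum power2_diff)
    finally show ?thesis by (simp add: power_mult_distrib)
  qed
  then have "(\<Sum>k<n. (norm (grid_slope n q k))\<^sup>2) \<le> (\<Sum>k<n. 2 * A\<^sup>2 * (norm (grid_slope n v k))\<^sup>2 + 2 * B\<^sup>2)"
    by (intro sum_mono) auto
  also have "\<dots> = 2 * A\<^sup>2 * (\<Sum>k<n. (norm (grid_slope n v k))\<^sup>2) + real n * (2 * B\<^sup>2)"
    by (simp add: sum.distrib sum_distrib_left)
  finally have "energy n q \<le> (2 * A\<^sup>2 * (\<Sum>k<n. (norm (grid_slope n v k))\<^sup>2) + real n * (2 * B\<^sup>2)) / real n"
    unfolding energy_def by (rule divide_right_mono) simp
  also have "\<dots> = 2 * A\<^sup>2 * energy n v + 2 * B\<^sup>2"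
    using n by (simp add: energy_def add_divide_distrib)
  finally show ?thesis .
qed

text \<open>The energies of \<open>q\<close> along all grids are controlled by those of \<open>v\<close>, so \<open>q\<close> is again a primitive. This
  serves for products with test functions and for \<open>\<phi>(v/\<epsilon>)\<close>, and replaces a chain rule.\<close>

lemma primitive_compose:
  fixes q :: "real \<Rightarrow> 'b::euclidean_space" and v :: "real \<Rightarrow> 'a::euclidean_space"
  assumes g: "g \<in> L2" and v: "\<And>t. t \<in> {0..1} \<Longrightarrow> v t = v 0 + integral {0..t} g"
    and q: "\<And>s t. s \<in> {0..1} \<Longrightarrow> t \<in> {0..1} \<Longrightarrow> norm (q t - q s) \<le> A * norm (v t - v s) + B * \<bar>t - s\<bar>"
    and qc: "continuous_on {0..1} q"
  obtains k where "k \<in> L2" "\<And>t. t \<in> {0..1} \<Longrightarrow> q t = q 0 + integral {0..t} k"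
proof -
  define G where "G = enn2real (\<integral>\<^sup>+ t. ennreal ((norm (g t))\<^sup>2) \<partial>leb01)"
  have G: "(\<integral>\<^sup>+ t. ennreal ((norm (g t))\<^sup>2) \<partial>leb01) = ennreal G"
    using L2D(2)[OF g] by (simp add: G_def)
  have Gv: "energy n v \<le> G" if "0 < n" for n
    using primitive_energy_le[OF g v that] unfolding G by (simp add: G_def ennreal_le_iff)
  have "energy (2^N) q \<le> 2 * A\<^sup>2 * G + 2 * B\<^sup>2" for N :: nat
  proof -
    have "energy (2^N) q \<le> 2 * A\<^sup>2 * energy (2^N) v + 2 * B\<^sup>2" by (rule energy_compose_le[OF q]) auto
    also have "\<dots> \<le> 2 * A\<^sup>2 * G + 2 * B\<^sup>2" using Gv[of "2^N"] by (intro add_mono mult_left_mono) auto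
    finally show ?thesis .
  qed
  then show ?thesis
    by (rule dyadic_energy_imp_primitive[OF qc, of 0 "2 * A\<^sup>2 * G + 2 * B\<^sup>2"]) (rule that)
qed

lemma AE_leb01_negligible:
  assumes "negligible {t \<in> {0<..<1}. \<not> P t}"
  shows "AE t in leb01. P t"
proof -
  have "{t \<in> {0<..<1}. \<not> P t} \<in> null_sets leb01"
    by (subst null_sets_restrict_space) (use assms in \<open>auto simp: negligible_iff_null_sets\<close>)
  then have "AE t in leb01. t \<notin> {t \<in> {0<..<1}. \<not> P t}" by (rule AE_not_in)
  with AE_leb01_less1 show ?thesis by eventually_elim auto
qed

lemma primitive_has_derivative:
  assumes g: "g \<in> L2" and v: "\<And>t. t \<in> {0..1} \<Longrightarrow> v t = v 0 + integral {0..t} g"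
  shows "AE t in leb01. (v has_vector_derivative g t) (at t)"
proof -
  have "AE t in leb01. ((\<lambda>s. integral {0..s} g) has_vector_derivative g t) (at t)"
    by (rule AE_leb01_negligible[OF integral_has_vector_derivative_ae[OF L2_integrable_on[OF g]]]) auto
  with AE_leb01_less1 show ?thesis
  proof eventually_elim
    case (elim t)
    have "((\<lambda>s. v 0 + integral {0..s} g) has_vector_derivative 0 + g t) (at t)"
      by (rule has_vector_derivative_add[OF has_vector_derivative_const elim(2)])
    then have d: "((\<lambda>s. v 0 + integral {0..s} g) has_vector_derivative g t) (at t)" by simp
    show ?case
    proof (rule has_vector_derivative_transform_within_open[OF d])
      show "open {0<..<1::real}" "t \<in> {0<..<1}" using elim by auto
      show "v 0 + integral {0..s} g = v s" if "s \<in> {0<..<1}" for s using v[of s] that by simp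
    qed
  qed
qed

lemma continuous_on_bound01:
  fixes f :: "real \<Rightarrow> 'a::real_normed_vector"
  assumes "continuous_on {0..1} f"
  obtains B where "\<And>t. t \<in> {0..1} \<Longrightarrow> norm (f t) \<le> B"
  using compact_imp_bounded[OF compact_continuous_image[OF assms]] unfolding bounded_iff by blast

lemma AE_leb01_nonempty: "AE t in leb01. P t \<Longrightarrow> \<exists>t\<in>{0..1}. P t"
proof (rule ccontr)
  assume ae: "AE t in leb01. P t" and n: "\<not> (\<exists>t\<in>{0..1}. P t)"
  have "AE t in leb01. False"
    using ae AE_leb01_less1 by eventually_elim (use n in auto)
  then obtain N where "{x \<in> space leb01. \<not> False} \<subseteq> N" "emeasure leb01 N = 0" "N \<in> sets leb01"
    by (rule AE_E)
  then have "{0..1} \<subseteq> N" by auto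
  with emeasure_mono[of "{0..1}" N leb01] \<open>N \<in> sets leb01\<close> \<open>emeasure leb01 N = 0\<close>
  have "emeasure leb01 {0..1} \<le> 0" by simp
  then show False using emeasure_leb01 by simp
qed

lemma continuous_AE_eq:
  fixes f h :: "real \<Rightarrow> 'a::euclidean_space"
  assumes c: "continuous_on {0..1} f" "continuous_on {0..1} h" and ae: "AE t in leb01. f t = h t" and t: "t \<in> {0..1}"
  shows "f t = h t"
proof -
  have "integral\<^sup>L leb01 (\<lambda>t. norm (f t - h t)) = integral\<^sup>L leb01 (\<lambda>t. 0)"
    by (rule integral_cong_AE) (use ae c in \<open>auto intro!: continuous_leb01 continuous_intros\<close>)
  moreover have "continuous_on {0..1} (\<lambda>t. norm (f t - h t))" using c by (intro continuous_intros)
  ultimately show ?thesis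
    using integralL_eq_0_iff[of 0 1 "\<lambda>t. norm (f t - h t)"] t by simp
qed

lemma test_function_bounds:
  assumes "f \<in> test_functions"
  shows "\<And>t. (f has_real_derivative deriv f t) (at t)" "continuous_on UNIV (deriv f)" "f 0 = 0" "f 1 = 0"
proof -
  obtain D where D: "\<And>x. (f has_vector_derivative D x) (at x)" "continuous_on UNIV D"
    using assms by (auto simp: test_functions_def C1_differentiable_on_def)
  then have d: "(f has_real_derivative D x) (at x)" for x
    by (simp add: has_real_derivative_iff_has_vector_derivative)
  then have "deriv f = D" using DERIV_imp_deriv by blast
  with d D show "\<And>t. (f has_real_derivative deriv f t) (at t)" "continuous_on UNIV (deriv f)" by auto
  obtain K where "K \<subseteq> {0<..<1}" "\<forall>t. t \<notin> K \<longrightarrow> f t = 0"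
    using assms by (auto simp: test_functions_def)
  then show "f 0 = 0" "f 1 = 0" by auto
qed

lemma L2_scaleR_continuous:
  assumes f: "continuous_on {0..1} (f :: real \<Rightarrow> real)" and g: "g \<in> L2"
  shows "integrable leb01 (\<lambda>t. f t *\<^sub>R g t)"
proof -
  obtain B where B: "\<And>t. t \<in> {0..1} \<Longrightarrow> norm (f t) \<le> B" using continuous_on_bound01[OF f] by metis
  have "integrable leb01 (\<lambda>t. B *\<^sub>R norm (g t))" using L2_integrable[OF g] by simp
  then show ?thesis
  proof (rule Bochner_Integration.integrable_bound)
    show "(\<lambda>t. f t *\<^sub>R g t) \<in> borel_measurable leb01"
      by (intro borel_measurable_scaleR continuous_leb01[OF f] L2D(1)[OF g])
    show "AE t in leb01. norm (f t *\<^sub>R g t) \<le> norm (B *\<^sub>R norm (g t))"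
      using AE_leb01_less1
    proof eventually_elim
      case (elim t)
      then have "norm (f t) * norm (g t) \<le> B * norm (g t)" using B[of t] by (intro mult_right_mono) auto
      then show ?case by (auto intro: order_trans[OF _ abs_ge_self])
    qed
  qed
qed

text \<open>The product of a primitive and a test function is a primitive, vanishes at the end points and has
  the derivative given by the product rule almost everywhere.\<close>

lemma primitive_is_weak_deriv:
  fixes v :: "real \<Rightarrow> 'a::euclidean_space"
  assumes g: "g \<in> L2" and v: "\<And>t. t \<in> {0..1} \<Longrightarrow> v t = v 0 + integral {0..t} g"
  shows "is_weak_deriv v g"
  unfolding is_weak_deriv_def
proof
  fix f assume f: "f \<in> test_functions"
  note tf = test_function_bounds[OF f]
  have vc: "continuous_on {0..1} v" by (rule primitive_continuous[OF g v])
  have dfc: "continuous_on {0..1} (deriv f)" using tf(2) continuous_on_subset by blast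
  have fc: "continuous_on S f" for S
    using tf(1) by (meson DERIV_continuous_on DERIV_subset subset_UNIV has_field_derivative_at_within)
  obtain B where B: "\<And>t. t \<in> {0..1} \<Longrightarrow> norm (v t) \<le> B" using continuous_on_bound01[OF vc] by metis
  obtain A where A: "\<And>t. t \<in> {0..1} \<Longrightarrow> norm (f t) \<le> A" using continuous_on_bound01[OF fc] by metis
  obtain D where D: "\<And>t. t \<in> {0..1} \<Longrightarrow> norm (deriv f t) \<le> D" using continuous_on_bound01[OF dfc] by metis
  have lip: "\<bar>f t - f s\<bar> \<le> D * \<bar>t - s\<bar>" if "s \<in> {0..1}" "t \<in> {0..1}" for s t
    using field_differentiable_bound[of "{0..1}" f "deriv f" D t s] that tf(1) D
    by (auto simp: has_field_derivative_at_within)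
  define y where "y t = f t *\<^sub>R v t" for t
  have yl: "norm (y t - y s) \<le> A * norm (v t - v s) + (D * B) * \<bar>t - s\<bar>" if st: "s \<in> {0..1}" "t \<in> {0..1}" for s t
  proof -
    have "y t - y s = f t *\<^sub>R (v t - v s) + (f t - f s) *\<^sub>R v s" by (simp add: y_def algebra_simps)
    then have "norm (y t - y s) \<le> norm (f t *\<^sub>R (v t - v s)) + norm ((f t - f s) *\<^sub>R v s)"
      by (simp only: norm_triangle_ineq)
    also have "\<dots> = \<bar>f t\<bar> * norm (v t - v s) + \<bar>f t - f s\<bar> * norm (v s)" by simp
    also have "\<dots> \<le> A * norm (v t - v s) + (D * \<bar>t - s\<bar>) * B"
      using A[OF st(2)] lip[OF st] B[OF st(1)] by (intro add_mono mult_mono) auto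
    finally show ?thesis by (simp add: algebra_simps)
  qed
  have "continuous_on {0..1} y" unfolding y_def[abs_def] by (intro continuous_intros fc vc)
  from primitive_compose[OF g v yl this] obtain k where k: "k \<in> L2"
    "\<And>t. t \<in> {0..1} \<Longrightarrow> y t = y 0 + integral {0..t} k" by blast
  have ke: "AE t in leb01. k t = deriv f t *\<^sub>R v t + f t *\<^sub>R g t"
  proof -
    have d1: "AE t in leb01. (y has_vector_derivative k t) (at t)" by (rule primitive_has_derivative[OF k])
    have d2: "AE t in leb01. (v has_vector_derivative g t) (at t)" by (rule primitive_has_derivative[OF g v])
    from d1 d2 show ?thesis
  proof eventually_elim
    case (elim t)
    have "(y has_vector_derivative (f t *\<^sub>R g t + deriv f t *\<^sub>R v t)) (at t)"
      unfolding y_def[abs_def] by (rule has_vector_derivative_scaleR[OF tf(1) elim(2)])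
    with elim(1) show ?case by (intro trans[OF vector_derivative_unique_at add.commute])
  qed
  qed
  have vL2: "integrable leb01 (\<lambda>t. deriv f t *\<^sub>R v t)"
    using continuous_on_scaleR[OF dfc vc] by (simp add: continuous_imp_integrable_real)
  have i1: "integrable leb01 (\<lambda>t. f t *\<^sub>R g t)" by (rule L2_scaleR_continuous[OF fc g])
  have "0 = y 1 - y 0" using tf by (simp add: y_def)
  also have "\<dots> = integral\<^sup>L leb01 k" using k(2)[of 1] by (simp add: L2_absint_leb01[OF k(1)])
  also have "\<dots> = integral\<^sup>L leb01 (\<lambda>t. deriv f t *\<^sub>R v t + f t *\<^sub>R g t)"
    by (rule integral_cong_AE[OF L2D(1)[OF k(1)] _ ke]) (use vL2 i1 in measurable)
  also have "\<dots> = integral\<^sup>L leb01 (\<lambda>t. deriv f t *\<^sub>R v t) + integral\<^sup>L leb01 (\<lambda>t. f t *\<^sub>R g t)"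
    by (rule Bochner_Integration.integral_add[OF vL2 i1])
  finally show "integral\<^sup>L leb01 (\<lambda>t. deriv f t *\<^sub>R v t) = - integral\<^sup>L leb01 (\<lambda>t. f t *\<^sub>R g t)"
    by (simp add: eq_neg_iff_add_eq_0)
qed

subsection \<open>The lemma of du Bois-Reymond\<close>

lemma has_real_derivative_max0_power2: "((\<lambda>x::real. (max 0 x)\<^sup>2) has_real_derivative 2 * max 0 x) (at x)"
proof -
  consider "x < 0" | "x = 0" | "x > 0" by linarith
  then show ?thesis
  proof cases
    case 1
    have "((\<lambda>x::real. 0) has_real_derivative 0) (at x)" by simp
    then have "((\<lambda>x::real. (max 0 x)\<^sup>2) has_real_derivative 0) (at x)"
      by (rule has_field_derivative_transform_within[of _ _ _ _ "- x"]) (use 1 in \<open>auto simp: dist_real_def max_def abs_if split: if_splits\<close>)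
    then show ?thesis using 1 by simp
  next
    case 2
    have "(\<lambda>h::real. (max 0 h)\<^sup>2 / h) \<midarrow>0\<rightarrow> 0"
    proof (rule Lim_null_comparison)
      show "\<forall>\<^sub>F h in at 0. norm ((max 0 h)\<^sup>2 / h) \<le> \<bar>h\<bar>"
        by (auto simp: eventually_at_filter max_def power2_eq_square intro!: always_eventually)
      show "(\<lambda>h::real. \<bar>h\<bar>) \<midarrow>0\<rightarrow> 0" by (rule tendsto_eq_intros) auto
    qed
    then show ?thesis using 2 by (simp add: DERIV_def)
  next
    case 3
    have "((\<lambda>x::real. x\<^sup>2) has_real_derivative 2 * x) (at x)" by (auto intro!: derivative_eq_intros)
    then have "((\<lambda>x::real. (max 0 x)\<^sup>2) has_real_derivative 2 * x) (at x)"
      by (rule has_field_derivative_transform_within[of _ _ _ _ x]) (use 3 in \<open>auto simp: dist_real_def max_def abs_if split: if_splits\<close>)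
    then show ?thesis using 3 by simp
  qed
qed

text \<open>A ramp starting at 0 whose corner is smoothed on \<open>[0, 1/n]\<close>, and its derivative. Second differences of translated
  ramps are compactly supported and of class \<open>C\<^sup>1\<close>.\<close>

definition soft_ramp :: "nat \<Rightarrow> real \<Rightarrow> real" where
  "soft_ramp n x = real n / 2 * ((max 0 x)\<^sup>2 - (max 0 (x - 1 / real n))\<^sup>2)"

definition soft_step :: "nat \<Rightarrow> real \<Rightarrow> real" where
  "soft_step n x = real n * (max 0 x - max 0 (x - 1 / real n))"

lemma soft_ramp_has_derivative:
  "((\<lambda>t. soft_ramp n (t - a)) has_real_derivative soft_step n (t - a)) (at t)"
proof -
  have d: "((\<lambda>t. (max 0 (t - c))\<^sup>2) has_real_derivative 2 * max 0 (t - c)) (at t)" for c :: real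
  proof -
    have "((\<lambda>t. t - c) has_real_derivative 1) (at t)" by (auto intro!: derivative_eq_intros)
    from DERIV_chain2[OF has_real_derivative_max0_power2 this] show ?thesis by simp
  qed
  have "((\<lambda>t. real n / 2 * ((max 0 (t - a))\<^sup>2 - (max 0 (t - (a + 1 / real n)))\<^sup>2)) has_real_derivative
      real n / 2 * (2 * max 0 (t - a) - 2 * max 0 (t - (a + 1 / real n)))) (at t)"
    by (intro DERIV_cmult DERIV_diff d)
  then show ?thesis
    by (simp add: soft_ramp_def soft_step_def algebra_simps)
qed

lemma soft_ramp_nonpos: "x \<le> 0 \<Longrightarrow> soft_ramp n x = 0"
proof -
  assume x: "x \<le> 0"
  have "0 \<le> 1 / real n" by simp
  then have "x - 1 / real n \<le> 0" using x by linarith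
  then show ?thesis using x by (simp add: soft_ramp_def max_def)
qed

lemma soft_ramp_ge: "0 < n \<Longrightarrow> 1 / real n \<le> x \<Longrightarrow> soft_ramp n x = x - 1 / (2 * real n)"
proof -
  assume n: "0 < n" and x: "1 / real n \<le> x"
  have "0 \<le> x" using x by (rule order_trans[rotated]) simp
  then have "soft_ramp n x = real n / 2 * (x\<^sup>2 - (x - 1 / real n)\<^sup>2)" using x by (simp add: soft_ramp_def max_def)
  also have "x\<^sup>2 - (x - 1 / real n)\<^sup>2 = 2 * x / real n - 1 / (real n * real n)"
    by (simp add: algebra_simps power2_eq_square)
  also have "real n / 2 * \<dots> = x - 1 / (2 * real n)" using n by (simp add: field_simps)
  finally show ?thesis .
qed

lemma soft_step_bounds: "0 < n \<Longrightarrow> 0 \<le> soft_step n x \<and> soft_step n x \<le> 1"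
proof -
  assume n: "0 < n"
  have "0 < 1 / real n" using n by simp
  then have d: "0 \<le> max 0 x - max 0 (x - 1 / real n)" "max 0 x - max 0 (x - 1 / real n) \<le> 1 / real n"
    by linarith+
  have "real n * (max 0 x - max 0 (x - 1 / real n)) \<le> real n * (1 / real n)"
    by (rule mult_left_mono[OF d(2)]) simp
  moreover have "0 \<le> real n * (max 0 x - max 0 (x - 1 / real n))"
    by (rule mult_nonneg_nonneg[OF _ d(1)]) simp
  ultimately show ?thesis using n by (simp add: soft_step_def)
qed

lemma soft_step_tendsto: "(\<lambda>n. soft_step (Suc n) x) \<longlonglongrightarrow> (if x > 0 then 1 else 0)"
proof (cases "x > 0")
  case True
  obtain N where N: "1 / real (Suc N) < x" using True by (metis nat_approx_posE)
  have "soft_step (Suc n) x = 1" if "N \<le> n" for n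
  proof -
    have "1 / real (Suc n) \<le> 1 / real (Suc N)" using that by (simp add: frac_le)
    then have "1 / real (Suc n) < x" using N by linarith
    then have "soft_step (Suc n) x = real (Suc n) * (x - (x - 1 / real (Suc n)))"
      using True by (simp add: soft_step_def max_def del: of_nat_Suc)
    then show ?thesis by simp
  qed
  then have "eventually (\<lambda>n. soft_step (Suc n) x = 1) sequentially" by (auto simp: eventually_sequentially)
  then show ?thesis using True by (simp add: tendsto_eventually)
next
  case False
  then have "soft_step (Suc n) x = 0" for n
  proof -
    have "x - 1 / real (Suc n) \<le> 0" using False by (smt (verit) divide_nonneg_nonneg of_nat_0_le_iff)
    then show ?thesis using False by (simp add: soft_step_def max_def del: of_nat_Suc)
  qed
  then show ?thesis using False by simp
qed

lemma soft_step_continuous: "continuous_on S (soft_step n)"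
  unfolding soft_step_def[abs_def] by (intro continuous_intros)

text \<open>Both brackets rise from 0 to the same height \<open>h\<close> and stay there, so the difference vanishes outside a
  compact interval.\<close>

lemma trapezoid_test_function:
  assumes n: "0 < n" and a: "0 < a" "0 < h" "a + h + 1 / real n < 1" and b: "0 < b" "b + h + 1 / real n < 1"
  defines "f \<equiv> \<lambda>t. (soft_ramp n (t - a) - soft_ramp n (t - (a + h))) - (soft_ramp n (t - b) - soft_ramp n (t - (b + h)))"
  shows "f \<in> test_functions"
    "deriv f = (\<lambda>t. (soft_step n (t - a) - soft_step n (t - (a + h))) - (soft_step n (t - b) - soft_step n (t - (b + h))))"
proof -
  define D where "D t = (soft_step n (t - a) - soft_step n (t - (a + h))) - (soft_step n (t - b) - soft_step n (t - (b + h)))" for t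
  have d: "(f has_real_derivative D t) (at t)" for t
    unfolding f_def D_def by (intro DERIV_diff soft_ramp_has_derivative)
  then have dd: "deriv f = D" using DERIV_imp_deriv by blast
  then show "deriv f = (\<lambda>t. (soft_step n (t - a) - soft_step n (t - (a + h))) - (soft_step n (t - b) - soft_step n (t - (b + h))))"
    by (simp add: D_def[abs_def])
  have "continuous_on UNIV D"
    unfolding D_def by (intro continuous_intros continuous_on_compose2[OF soft_step_continuous]) auto
  then have c1: "f C1_differentiable_on UNIV"
    using d by (auto simp: C1_differentiable_on_def has_real_derivative_iff_has_vector_derivative)
  define K where "K = {min a b..max a b + h + 1 / real n}"
  have inv: "0 < 1 / real n" using n by simp
  have "f t = 0" if "t \<notin> K" for t
  proof -
    consider "t < min a b" | "t > max a b + h + 1 / real n" 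
    proof -
      have "t < min a b \<or> max a b + h + 1 / real n < t"
        using \<open>t \<notin> K\<close> unfolding K_def atLeastAtMost_iff by linarith
      then show ?thesis using that by blast
    qed
    then show ?thesis
    proof cases
      case 1
      then show ?thesis using a by (simp add: f_def soft_ramp_nonpos)
    next
      case 2
      then have "1 / real n \<le> t - a" "1 / real n \<le> t - (a + h)" "1 / real n \<le> t - b" "1 / real n \<le> t - (b + h)"
        using a by (auto simp: max_def split: if_splits)
      then show ?thesis by (simp add: f_def soft_ramp_ge[OF n])
    qed
  qed
  moreover have "K \<subseteq> {0<..<1}" using a b by (auto simp: K_def max_def split: if_splits)
  moreover have "compact K" by (simp add: K_def)
  ultimately show "f \<in> test_functions" using c1 by (auto simp: test_functions_def)
qed

lemma soft_step_integral_tendsto: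
  fixes w :: "real \<Rightarrow> 'a::euclidean_space"
  assumes w: "w \<in> L2" and a: "0 \<le> a" "a \<le> 1"
  shows "(\<lambda>n. integral\<^sup>L leb01 (\<lambda>t. soft_step (Suc n) (t - a) *\<^sub>R w t)) \<longlonglongrightarrow> integral {a..1} w"
proof -
  have wm[measurable]: "w \<in> borel_measurable leb01" by (rule L2D(1)[OF w])
  have "(\<lambda>n. integral\<^sup>L leb01 (\<lambda>t. soft_step (Suc n) (t - a) *\<^sub>R w t)) \<longlonglongrightarrow> integral\<^sup>L leb01 (\<lambda>t. (if t - a > 0 then 1 else 0) *\<^sub>R w t)"
  proof (rule integral_dominated_convergence)
    show "(\<lambda>t. (if t - a > 0 then 1 else 0) *\<^sub>R w t) \<in> borel_measurable leb01"
      using ident_leb01 by (intro borel_measurable_scaleR wm) measurable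
    show "(\<lambda>t. soft_step (Suc n) (t - a) *\<^sub>R w t) \<in> borel_measurable leb01" for n
      by (intro borel_measurable_scaleR wm continuous_leb01 continuous_on_compose2[OF soft_step_continuous[of UNIV]] continuous_intros) auto
    show "integrable leb01 (\<lambda>t. norm (w t))" using L2_integrable[OF w] by simp
    show "AE t in leb01. (\<lambda>n. soft_step (Suc n) (t - a) *\<^sub>R w t) \<longlonglongrightarrow> (if t - a > 0 then 1 else 0) *\<^sub>R w t"
      by (intro AE_I2 tendsto_scaleR soft_step_tendsto tendsto_const)
    show "AE t in leb01. norm (soft_step (Suc n) (t - a) *\<^sub>R w t) \<le> norm (w t)" for n
      using soft_step_bounds[of "Suc n"] by (intro AE_I2) (simp add: mult_left_le_one_le)
  qed
  also have "integral\<^sup>L leb01 (\<lambda>t. (if t - a > 0 then 1 else 0) *\<^sub>R w t) = integral\<^sup>L leb01 (\<lambda>t. if t \<in> {a<..1} then w t else 0)"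
    by (rule Bochner_Integration.integral_cong) auto
  also have "\<dots> = integral\<^sup>L (lebesgue_on {a<..1}) w"
    by (rule integral_restrict) (use a in auto)
  also have "\<dots> = integral {a<..1} w"
  proof (rule lebesgue_integral_eq_integral)
    have "w absolutely_integrable_on {a<..1}"
      using L2_absolutely_integrable[OF w order_refl order_refl] by (rule set_integrable_subset) (use a in auto)
    then show "integrable (lebesgue_on {a<..1}) w" by (rule absolutely_integrable_imp_integrable) auto
  qed auto
  also have "\<dots> = integral {a..1} w"
    by (rule integral_subset_negligible) (auto intro: negligible_subset[of "{a}"])
  finally show ?thesis .
qed

text \<open>Testing with trapezoids and sharpening their corners shows that the integral of \<open>w\<close> over
  \<open>[a, a + h]\<close> does not depend on \<open>a\<close>. So the primitive of \<open>w\<close> is affine, and \<open>w\<close>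
  is its derivative almost everywhere.\<close>

lemma weak_deriv_zero_const:
  fixes w :: "real \<Rightarrow> 'a::euclidean_space"
  assumes w: "w \<in> L2" and z: "\<And>f. f \<in> test_functions \<Longrightarrow> integral\<^sup>L leb01 (\<lambda>t. deriv f t *\<^sub>R w t) = 0"
  obtains c where "AE t in leb01. w t = c"
proof -
  define V where "V t = integral {0..t} w" for t
  have Vd: "V b - V a = integral {a..b} w" if "0 \<le> a" "a \<le> b" "b \<le> 1" for a b
    unfolding V_def by (rule integral_diff_L2[OF w that])
  have eq: "V (a + h) - V a = V (b + h) - V b" if h: "0 < h" "0 < a" "a + h < 1" "0 < b" "b + h < 1" for a b h
  proof -
    define S where "S c n = integral\<^sup>L leb01 (\<lambda>t. soft_step (Suc n) (t - c) *\<^sub>R w t)" for c n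
    have int: "integrable leb01 (\<lambda>t. soft_step (Suc n) (t - c) *\<^sub>R w t)" for c n
      by (rule L2_scaleR_continuous[OF _ w])
        (intro continuous_on_compose2[OF soft_step_continuous[of UNIV]] continuous_intros, auto)
    have lim: "(\<lambda>n. (S a n - S (a + h) n) - (S b n - S (b + h) n)) \<longlonglongrightarrow>
        (integral {a..1} w - integral {a + h..1} w) - (integral {b..1} w - integral {b + h..1} w)"
      unfolding S_def by (intro tendsto_diff soft_step_integral_tendsto w) (use h in auto)
    obtain N where N: "1 / real (Suc N) < min (1 - (a + h)) (1 - (b + h))"
      using nat_approx_posE[of "min (1 - (a + h)) (1 - (b + h))"] h by auto
    have zero: "(S a n - S (a + h) n) - (S b n - S (b + h) n) = 0" if n: "N \<le> n" for n
    proof -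
      have "1 / real (Suc n) \<le> 1 / real (Suc N)" using n by (simp add: frac_le)
      then have lt: "a + h + 1 / real (Suc n) < 1" "b + h + 1 / real (Suc n) < 1" using N by auto
      note tf = trapezoid_test_function[OF _ h(2,1) lt(1) h(4) lt(2)]
      have "0 = integral\<^sup>L leb01 (\<lambda>t. ((soft_step (Suc n) (t - a) - soft_step (Suc n) (t - (a + h))) - (soft_step (Suc n) (t - b) - soft_step (Suc n) (t - (b + h)))) *\<^sub>R w t)"
        using z[OF tf(1)] unfolding tf(2)[OF zero_less_Suc] by simp
      also have "\<dots> = (S a n - S (a + h) n) - (S b n - S (b + h) n)"
        unfolding S_def scaleR_diff_left by (simp add: int)
      finally show ?thesis by simp
    qed
    have "eventually (\<lambda>n. (S a n - S (a + h) n) - (S b n - S (b + h) n) = 0) sequentially"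
      using zero by (auto simp: eventually_sequentially)
    then have "(\<lambda>n. (S a n - S (a + h) n) - (S b n - S (b + h) n)) \<longlonglongrightarrow> 0"
      by (rule tendsto_eventually)
    with lim have "(integral {a..1} w - integral {a + h..1} w) - (integral {b..1} w - integral {b + h..1} w) = 0"
      by (rule LIMSEQ_unique)
    moreover have "integral {a..1} w = V 1 - V a" "integral {a + h..1} w = V 1 - V (a + h)"
      "integral {b..1} w = V 1 - V b" "integral {b + h..1} w = V 1 - V (b + h)"
      using Vd[of a 1] Vd[of "a + h" 1] Vd[of b 1] Vd[of "b + h" 1] h by simp_all
    ultimately show ?thesis by (simp only: diff_diff_eq2 diff_add_eq) (simp add: algebra_simps)
  qed
  have "AE t in leb01. (V has_vector_derivative w t) (at t)"
    by (rule primitive_has_derivative[OF w]) (simp add: V_def)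
  with AE_leb01_less1 have ae: "AE t in leb01. 0 < t \<and> t < 1 \<and> (V has_vector_derivative w t) (at t)"
    by eventually_elim auto
  obtain b where b: "0 < b" "b < 1" "(V has_vector_derivative w b) (at b)"
    using AE_leb01_nonempty[OF ae] by auto
  have const: "w t = w b" if t: "0 < t" "t < 1" "(V has_vector_derivative w t) (at t)" for t
  proof -
    define D where "D h = (V (t + h) - V t) - (V (b + h) - V b)" for h
    define d where "d = min (1 - t) (1 - b) / 2"
    have d: "0 < d" "t + d < 1" "b + d < 1" using t b by (auto simp: d_def min_def field_simps)
    have sh: "((\<lambda>h. V (s + h)) has_vector_derivative w s) (at 0)" if "(V has_vector_derivative w s) (at s)" for s
    proof -
      have "((\<lambda>h. s + h) has_vector_derivative 1) (at 0)" by (auto intro!: derivative_eq_intros)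
      from vector_diff_chain_at[OF this, of V "w s"] that show ?thesis by (simp add: o_def)
    qed
    have "(D has_vector_derivative (w t - 0) - (w b - 0)) (at 0)"
      unfolding D_def by (intro has_vector_derivative_diff has_vector_derivative_const sh t b)
    then have D1: "(D has_vector_derivative (w t - w b)) (at 0 within cbox 0 d)"
      by (simp add: has_vector_derivative_at_within)
    have D0: "D h = 0" if "h \<in> cbox 0 d" for h
      using eq[of h t b] that t b d by (cases "h = 0") (auto simp: D_def)
    have "(D has_vector_derivative 0) (at 0 within cbox 0 d)"
      by (rule has_vector_derivative_transform[of _ _ D "\<lambda>_. 0"]) (use d D0 in auto)
    then have "w t - w b = 0"
      using vector_derivative_unique_within_closed_interval[OF d(1) _ D1] d by simp
    then show ?thesis by simp
  qed
  from ae have "AE t in leb01. w t = w b" by eventually_elim (use const in auto)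
  then show ?thesis by (rule that)
qed

subsection \<open>Absolutely continuous representatives\<close>

lemma L2_diff:
  assumes "f \<in> L2" "g \<in> L2" shows "(\<lambda>t. f t - g t) \<in> L2"
proof (rule L2I)
  have [measurable]: "f \<in> borel_measurable leb01" "g \<in> borel_measurable leb01" using assms L2D(1) by auto
  show "(\<lambda>t. f t - g t) \<in> borel_measurable leb01" by measurable
  have le: "(norm (f t - g t))\<^sup>2 \<le> 2 * (norm (f t))\<^sup>2 + 2 * (norm (g t))\<^sup>2" for t
  proof -
    have "(norm (f t - g t))\<^sup>2 \<le> (norm (f t) + norm (g t))\<^sup>2" by (intro power_mono norm_triangle_ineq4) simp
    also have "\<dots> \<le> 2 * (norm (f t))\<^sup>2 + 2 * (norm (g t))\<^sup>2"
      using zero_le_power2[of "norm (f t) - norm (g t)"] by (simp add: power2_sum power2_diff)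
    finally show ?thesis .
  qed
  have "(\<integral>\<^sup>+ t. ennreal ((norm (f t - g t))\<^sup>2) \<partial>leb01) \<le> (\<integral>\<^sup>+ t. ennreal 2 * ennreal ((norm (f t))\<^sup>2) + ennreal 2 * ennreal ((norm (g t))\<^sup>2) \<partial>leb01)"
    by (intro nn_integral_mono) (simp add: ennreal_mult[symmetric] ennreal_plus[symmetric] le del: ennreal_plus ennreal_numeral)
  also have "\<dots> = ennreal 2 * (\<integral>\<^sup>+ t. ennreal ((norm (f t))\<^sup>2) \<partial>leb01) + ennreal 2 * (\<integral>\<^sup>+ t. ennreal ((norm (g t))\<^sup>2) \<partial>leb01)"
    by (subst nn_integral_add) (auto simp: nn_integral_cmult simp del: ennreal_numeral)
  also have "\<dots> < \<infinity>" using L2D(2)[OF assms(1)] L2D(2)[OF assms(2)] by (simp add: ennreal_mult_less_top)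
  finally show "(\<integral>\<^sup>+ t. ennreal ((norm (f t - g t))\<^sup>2) \<partial>leb01) < \<infinity>" .
qed

lemma continuous_L2: "continuous_on {0..1} f \<Longrightarrow> f \<in> L2"
proof -
  assume c: "continuous_on {0..1} f"
  then have "continuous_on {0..1} (\<lambda>t. (norm (f t))\<^sup>2)" by (intro continuous_intros)
  then show ?thesis by (simp add: L2_def continuous_leb01[OF c] continuous_imp_integrable_real)
qed

lemma is_weak_deriv_cong_AE:
  assumes u: "u \<in> L2" "v \<in> L2" and ae: "AE t in leb01. u t = v t" and v: "is_weak_deriv v g"
  shows "is_weak_deriv u g"
  unfolding is_weak_deriv_def
proof
  fix f assume f: "f \<in> test_functions"
  have c: "continuous_on {0..1} (deriv f)" using test_function_bounds(2)[OF f] continuous_on_subset by blast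
  have "integral\<^sup>L leb01 (\<lambda>t. deriv f t *\<^sub>R u t) = integral\<^sup>L leb01 (\<lambda>t. deriv f t *\<^sub>R v t)"
    by (rule integral_cong_AE) (use ae L2D(1)[OF u(1)] L2D(1)[OF u(2)] continuous_leb01[OF c] in \<open>auto intro!: borel_measurable_scaleR\<close>)
  then show "integral\<^sup>L leb01 (\<lambda>t. deriv f t *\<^sub>R u t) = - integral\<^sup>L leb01 (\<lambda>t. f t *\<^sub>R g t)"
    using v f by (simp add: is_weak_deriv_def)
qed

lemma weak_deriv_primitive:
  fixes u g :: "real \<Rightarrow> 'a::euclidean_space"
  assumes u: "u \<in> L2" and g: "g \<in> L2" and wd: "is_weak_deriv u g"
  obtains c where "AE t in leb01. u t = c + integral {0..t} g"
proof -
  define P where "P t = integral {0..t} g" for t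
  have P: "P t = P 0 + integral {0..t} g" for t by (simp add: P_def)
  have Pc: "continuous_on {0..1} P" by (rule primitive_continuous[OF g P])
  have PL2: "P \<in> L2" by (rule continuous_L2[OF Pc])
  have wP: "is_weak_deriv P g" by (rule primitive_is_weak_deriv[OF g P])
  obtain c where c: "AE t in leb01. u t - P t = c"
  proof (rule weak_deriv_zero_const[OF L2_diff[OF u PL2]])
    fix f assume f: "f \<in> test_functions"
    have dc: "continuous_on {0..1} (deriv f)" using test_function_bounds(2)[OF f] continuous_on_subset by blast
    show "integral\<^sup>L leb01 (\<lambda>t. deriv f t *\<^sub>R (u t - P t)) = 0"
      using wd wP f by (simp add: is_weak_deriv_def scaleR_diff_right L2_scaleR_continuous[OF dc] u PL2)
  qed
  then have "AE t in leb01. u t = c + integral {0..t} g"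
    by eventually_elim (simp add: P_def algebra_simps)
  then show ?thesis by (rule that)
qed

text \<open>The choices made in \<open>weak_deriv\<close> and \<open>cont_rep\<close> are tied together by the fundamental theorem of calculus.
  Together with its converse below this reduces everything about \<open>H1\<close> to primitives.\<close>

theorem H1_repr:
  assumes u: "u \<in> H1"
  shows "weak_deriv u \<in> L2"
    "\<And>t. t \<in> {0..1} \<Longrightarrow> cont_rep u t = cont_rep u 0 + integral {0..t} (weak_deriv u)"
    "AE t in leb01. cont_rep u t = u t"
proof -
  have uL: "u \<in> L2" and ex: "\<exists>g. g \<in> L2 \<and> is_weak_deriv u g" using u by (auto simp: H1_def)
  from ex have wd: "weak_deriv u \<in> L2 \<and> is_weak_deriv u (weak_deriv u)"
    unfolding weak_deriv_def by (rule someI_ex[of "\<lambda>g. g \<in> L2 \<and> is_weak_deriv u g"])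
  then show g: "weak_deriv u \<in> L2" by simp
  obtain c where c: "AE t in leb01. u t = c + integral {0..t} (weak_deriv u)"
    using weak_deriv_primitive[OF uL g] wd by blast
  define v where "v t = c + integral {0..t} (weak_deriv u)" for t
  have v: "v t = v 0 + integral {0..t} (weak_deriv u)" for t by (simp add: v_def)
  have vc: "continuous_on {0..1} v" by (rule primitive_continuous[OF g v])
  have "\<exists>v. continuous_on {0..1} v \<and> (AE t in leb01. v t = u t)"
    by (rule exI[of _ v]) (use vc c in \<open>auto simp: v_def\<close>)
  then have cr: "continuous_on {0..1} (cont_rep u) \<and> (AE t in leb01. cont_rep u t = u t)"
    unfolding cont_rep_def by (rule someI_ex[of "\<lambda>v. continuous_on {0..1} v \<and> (AE t in leb01. v t = u t)"])
  then show ae: "AE t in leb01. cont_rep u t = u t" by simp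
  have "AE t in leb01. cont_rep u t = v t"
    using ae c by eventually_elim (simp add: v_def)
  then have eq: "cont_rep u t = v t" if "t \<in> {0..1}" for t
    using continuous_AE_eq[of "cont_rep u" v, OF _ vc _ that] cr by simp
  show "cont_rep u t = cont_rep u 0 + integral {0..t} (weak_deriv u)" if "t \<in> {0..1}" for t
    using eq[OF that] eq[of 0] v[of t] by simp
qed

theorem primitive_H1:
  fixes u :: "real \<Rightarrow> 'a::euclidean_space"
  assumes u: "u \<in> L2" and g: "g \<in> L2" and v: "\<And>t. t \<in> {0..1} \<Longrightarrow> v t = v 0 + integral {0..t} g"
    and ae: "AE t in leb01. u t = v t"
  shows "u \<in> H1" "\<And>t. t \<in> {0..1} \<Longrightarrow> cont_rep u t = v t" "AE t in leb01. weak_deriv u t = g t"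
proof -
  have vc: "continuous_on {0..1} v" by (rule primitive_continuous[OF g v])
  have "is_weak_deriv u g"
    by (rule is_weak_deriv_cong_AE[OF u continuous_L2[OF vc] ae primitive_is_weak_deriv[OF g v]])
  then show H: "u \<in> H1" using u g by (auto simp: H1_def)
  note R = H1_repr[OF H]
  have cc: "continuous_on {0..1} (cont_rep u)" by (rule primitive_continuous[OF R(1,2)])
  have "AE t in leb01. cont_rep u t = v t" using ae R(3) by eventually_elim simp
  then show eq: "cont_rep u t = v t" if "t \<in> {0..1}" for t
    using continuous_AE_eq[OF cc vc _ that] by simp
  have d1: "AE t in leb01. (v has_vector_derivative g t) (at t)" by (rule primitive_has_derivative[OF g v])
  have v2: "v t = v 0 + integral {0..t} (weak_deriv u)" if "t \<in> {0..1}" for t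
    using R(2)[OF that] eq[OF that] eq[of 0] by simp
  have "AE t in leb01. (v has_vector_derivative weak_deriv u t) (at t)" by (rule primitive_has_derivative[OF R(1) v2])
  with d1 show "AE t in leb01. weak_deriv u t = g t"
    by eventually_elim (rule vector_derivative_unique_at)
qed

text \<open>The derivative of \<open>\<phi>(u/\<epsilon>)\<close>, which the functional takes pointwise, is the density of a primitive
  because \<open>\<phi>\<close> is Lipschitz.\<close>

lemma F_eps_repr:
  fixes \<phi> :: "real^2 \<Rightarrow> real"
  assumes u: "u \<in> H1" and \<phi>: "L-lipschitz_on UNIV \<phi>" and e: "0 < \<epsilon>"
  obtains k where "k \<in> L2"
    "\<And>t. t \<in> {0..1} \<Longrightarrow> \<phi> (cont_rep u t /\<^sub>R \<epsilon>) = \<phi> (cont_rep u 0 /\<^sub>R \<epsilon>) + integral {0..t} k"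
    "F_eps \<delta> \<phi> \<epsilon> u = (\<integral>\<^sup>+ t. ennreal ((norm (weak_deriv u t))\<^sup>2 + (\<delta> \<epsilon> / \<epsilon>)\<^sup>2 * (\<epsilon> * k t)\<^sup>2) \<partial>leb01)"
proof -
  note R = H1_repr[OF u]
  define q where "q s = \<phi> (cont_rep u s /\<^sub>R \<epsilon>)" for s
  have cc: "continuous_on {0..1} (cont_rep u)" by (rule primitive_continuous[OF R(1,2)])
  have ql: "norm (q t - q s) \<le> (L / \<epsilon>) * norm (cont_rep u t - cont_rep u s) + 0 * \<bar>t - s\<bar>" for s t
  proof -
    have "norm (q t - q s) \<le> L * norm (cont_rep u t /\<^sub>R \<epsilon> - cont_rep u s /\<^sub>R \<epsilon>)"
      using lipschitz_onD[OF \<phi>, of "cont_rep u t /\<^sub>R \<epsilon>" "cont_rep u s /\<^sub>R \<epsilon>"] by (simp add: q_def dist_norm)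
    also have "cont_rep u t /\<^sub>R \<epsilon> - cont_rep u s /\<^sub>R \<epsilon> = (cont_rep u t - cont_rep u s) /\<^sub>R \<epsilon>"
      by (simp add: scaleR_diff_right)
    finally show ?thesis using e by (simp add: divide_inverse mult_ac)
  qed
  have "continuous_on {0..1} q"
    unfolding q_def
    by (rule continuous_on_compose2[OF lipschitz_on_continuous_on[OF \<phi>]]) (auto intro!: continuous_intros cc)
  from primitive_compose[OF R(1,2) ql this] obtain k where
    k: "k \<in> L2" "\<And>t. t \<in> {0..1} \<Longrightarrow> q t = q 0 + integral {0..t} k" by blast
  have d: "AE t in leb01. (q has_vector_derivative k t) (at t)" by (rule primitive_has_derivative[OF k])
  have "F_eps \<delta> \<phi> \<epsilon> u = (\<integral>\<^sup>+ t. ennreal ((norm (weak_deriv u t))\<^sup>2 + (\<delta> \<epsilon> / \<epsilon>)\<^sup>2 * (\<epsilon> * k t)\<^sup>2) \<partial>leb01)"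
    unfolding F_eps_def if_P[OF u]
  proof (rule nn_integral_cong_AE, use d in eventually_elim)
    case (elim t)
    then have "(q has_real_derivative k t) (at t)" by (simp add: has_real_derivative_iff_has_vector_derivative)
    then have "deriv (\<lambda>s. \<phi> (cont_rep u s /\<^sub>R \<epsilon>)) t = k t" by (simp add: DERIV_imp_deriv q_def[abs_def])
    then show ?case by simp
  qed
  from that[OF k(1) k(2)[unfolded q_def] this] show ?thesis .
qed

section \<open>An abstract homogenization theorem\<close>

text \<open>The square of the support function of \<open>P \<union> -P\<close>.\<close>

definition dual_sq :: "(real^2) set \<Rightarrow> real^2 \<Rightarrow> ennreal" where
  "dual_sq P w = (SUP p\<in>P. ennreal ((p \<bullet> w)\<^sup>2))"

text \<open>A bounded perturbation \<open>h\<close> of the linear function \<open>p\<close> whose slope along the level sets of \<open>\<phi>\<close> is at most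
  \<open>1 + \<theta>\<close>: a calibration, showing that level paths with displacement \<open>w\<close> have length at least \<open>|p \<bullet> w|\<close> up to a
  relative error \<open>\<theta>\<close> and a constant.\<close>

definition has_correctors :: "(real^2 \<Rightarrow> real) \<Rightarrow> real^2 \<Rightarrow> bool" where
  "has_correctors \<phi> p \<longleftrightarrow> (\<forall>\<theta>>0. \<exists>h C r B. 0 \<le> C \<and> 0 < r \<and> (\<forall>x. \<bar>h x - p \<bullet> x\<bar> \<le> B) \<and>
     (\<forall>x y. norm (x - y) \<le> r \<longrightarrow> \<bar>h x - h y\<bar> \<le> (1 + \<theta>) * norm (x - y) + C * \<bar>\<phi> x - \<phi> y\<bar>))"

definition level_path :: "(real^2 \<Rightarrow> real) \<Rightarrow> real^2 \<Rightarrow> real^2 \<Rightarrow> real \<Rightarrow> bool" where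
  "level_path \<phi> x y l \<longleftrightarrow> 0 \<le> l \<and> (\<exists>\<gamma>. \<gamma> 0 = x \<and> \<gamma> l = y \<and> 1-lipschitz_on {0..l} \<gamma> \<and> (\<forall>s\<in>{0..l}. \<phi> (\<gamma> s) = 0))"

lemma dual_sq_upper: "p \<in> P \<Longrightarrow> ennreal ((p \<bullet> w)\<^sup>2) \<le> dual_sq P w"
  unfolding dual_sq_def by (rule SUP_upper)

lemma dual_sq_scaleR:
  assumes "P \<noteq> {}" shows "dual_sq P (c *\<^sub>R w) = ennreal (c\<^sup>2) * dual_sq P w"
  unfolding dual_sq_def
  by (subst SUP_mult_left_ennreal) (auto simp: power_mult_distrib ennreal_mult)

lemma dual_sq_measurable [measurable]: "dual_sq P \<in> borel_measurable borel"
proof (rule borel_measurableI_greater)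
  fix a
  have "{w. a < dual_sq P w} = (\<Union>p\<in>P. {w. a < ennreal ((p \<bullet> w)\<^sup>2)})"
    by (auto simp: dual_sq_def less_SUP_iff)
  moreover have "open {w. a < ennreal ((p \<bullet> w)\<^sup>2)}" for p :: "real^2"
    by (intro open_Collect_less continuous_on_ennreal continuous_intros)
  ultimately show "{w \<in> space borel. a < dual_sq P w} \<in> sets borel"
    by (auto intro!: borel_open open_UN)
qed

lemma dual_sq_liminf:
  assumes "x \<longlonglongrightarrow> w" shows "dual_sq P w \<le> liminf (\<lambda>i. dual_sq P (x i))"
  unfolding dual_sq_def[of P w]
proof (rule SUP_least)
  fix p assume p: "p \<in> P"
  have "(\<lambda>i. ennreal ((p \<bullet> x i)\<^sup>2)) \<longlonglongrightarrow> ennreal ((p \<bullet> w)\<^sup>2)" by (intro tendsto_intros assms)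
  then have "ennreal ((p \<bullet> w)\<^sup>2) = liminf (\<lambda>i. ennreal ((p \<bullet> x i)\<^sup>2))"
    by (rule lim_imp_Liminf[OF trivial_limit_sequentially, symmetric])
  also have "\<dots> \<le> liminf (\<lambda>i. dual_sq P (x i))"
    by (intro Liminf_mono always_eventually allI dual_sq_upper p)
  finally show "ennreal ((p \<bullet> w)\<^sup>2) \<le> liminf (\<lambda>i. dual_sq P (x i))" .
qed

text \<open>The maximizing slope may be chosen independently for every grid interval.\<close>

lemma sum_SUP_le:
  fixes f :: "'i \<Rightarrow> 'p \<Rightarrow> ennreal"
  assumes "finite K" and P: "P \<noteq> {}"
    and le: "\<And>p. (\<forall>k\<in>K. p k \<in> P) \<Longrightarrow> a + (\<Sum>k\<in>K. f k (p k)) \<le> c"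
  shows "a + (\<Sum>k\<in>K. SUP p\<in>P. f k p) \<le> c"
  using assms(1) le
proof (induction K arbitrary: a rule: finite_induct)
  case empty
  then show ?case using P by auto
next
  case (insert k K)
  have "(a + (\<Sum>k\<in>K. SUP p\<in>P. f k p)) + f k q \<le> c" if q: "q \<in> P" for q
  proof -
    have "(a + f k q) + (\<Sum>k\<in>K. SUP p\<in>P. f k p) \<le> c"
    proof (rule insert.IH)
      fix p assume p: "\<forall>k\<in>K. p k \<in> P"
      have "a + (\<Sum>i\<in>insert k K. f i ((p(k := q)) i)) \<le> c"
        by (rule insert.prems) (use p q in auto)
      moreover have "(\<Sum>i\<in>insert k K. f i ((p(k := q)) i)) = f k q + (\<Sum>i\<in>K. f i (p i))"
        using insert.hyps by (auto intro!: sum.cong)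
      ultimately show "(a + f k q) + (\<Sum>i\<in>K. f i (p i)) \<le> c" by (simp add: add.assoc)
    qed
    then show ?thesis by (simp add: ac_simps)
  qed
  then have "(SUP q\<in>P. (a + (\<Sum>k\<in>K. SUP p\<in>P. f k p)) + f k q) \<le> c" by (intro SUP_least)
  then have "(a + (\<Sum>k\<in>K. SUP p\<in>P. f k p)) + (SUP q\<in>P. f k q) \<le> c"
    by (subst (asm) ennreal_SUP_add_right[OF P, symmetric])
  then show ?case using insert.hyps by (simp add: ac_simps)
qed

text \<open>Correctors control small increments only; additivity of the integral extends the bound to all increments.\<close>

lemma interval_chain:
  fixes f :: "real \<Rightarrow> real"
  assumes d: "0 < d" and q[measurable]: "q \<in> borel_measurable leb01"
    and loc: "\<And>s t. 0 \<le> s \<Longrightarrow> s \<le> t \<Longrightarrow> t \<le> 1 \<Longrightarrow> t - s \<le> d \<Longrightarrow>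
        ennreal \<bar>f t - f s\<bar> \<le> (\<integral>\<^sup>+ x. q x * indicator {s..<t} x \<partial>leb01)"
    and ab: "0 \<le> a" "a \<le> b" "b \<le> 1"
  shows "ennreal \<bar>f b - f a\<bar> \<le> (\<integral>\<^sup>+ x. q x * indicator {a..<b} x \<partial>leb01)"
proof -
  have "ennreal \<bar>f t - f a\<bar> \<le> (\<integral>\<^sup>+ x. q x * indicator {a..<t} x \<partial>leb01)"
    if "a \<le> t" "t \<le> b" "t - a \<le> real n * d" for n t
    using that
  proof (induction n arbitrary: t)
    case 0
    then show ?case by simp
  next
    case (Suc n)
    define s where "s = max a (t - d)"
    have s: "a \<le> s" "s \<le> t" "t - s \<le> d" "s - a \<le> real n * d"
      using Suc.prems d by (auto simp: s_def max_def algebra_simps)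
    have [measurable]: "{a..<s} \<in> sets leb01" "{s..<t} \<in> sets leb01" using s ab Suc.prems by auto
    have "ennreal \<bar>f t - f a\<bar> \<le> ennreal (\<bar>f s - f a\<bar> + \<bar>f t - f s\<bar>)" by (rule ennreal_leI) linarith
    also have "\<dots> = ennreal \<bar>f s - f a\<bar> + ennreal \<bar>f t - f s\<bar>" by (rule ennreal_plus) auto
    also have "\<dots> \<le> (\<integral>\<^sup>+ x. q x * indicator {a..<s} x \<partial>leb01) + (\<integral>\<^sup>+ x. q x * indicator {s..<t} x \<partial>leb01)"
      using s Suc.prems ab by (intro add_mono Suc.IH loc) auto
    also have "\<dots> = (\<integral>\<^sup>+ x. q x * indicator {a..<s} x + q x * indicator {s..<t} x \<partial>leb01)"
      by (rule nn_integral_add[symmetric]) measurable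
    also have "\<dots> = (\<integral>\<^sup>+ x. q x * indicator {a..<t} x \<partial>leb01)"
      using s by (intro nn_integral_cong) (auto simp: indicator_def)
    finally show ?case .
  qed
  moreover obtain n :: nat where "b - a \<le> real n * d"
    using reals_Archimedean3[OF d] less_imp_le by blast
  ultimately show ?thesis using ab by blast
qed

lemma power2_sum_le_theta:
  fixes x y \<theta> :: real
  assumes "0 < \<theta>" shows "(x + y)\<^sup>2 \<le> (1 + \<theta>) * x\<^sup>2 + (1 + 1 / \<theta>) * y\<^sup>2"
proof -
  define z where "z = y / \<theta>"
  have y: "y = \<theta> * z" and yz: "1 / \<theta> * y\<^sup>2 = \<theta> * z\<^sup>2"
    using assms by (simp_all add: z_def power2_eq_square)
  have "(1 + \<theta>) * x\<^sup>2 + (1 + 1 / \<theta>) * y\<^sup>2 - (x + y)\<^sup>2 = \<theta> * x\<^sup>2 + \<theta> * z\<^sup>2 - 2 * (x * y)"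
    unfolding distrib_right yz power2_sum by simp
  also have "\<dots> = \<theta> * (x - z)\<^sup>2" unfolding y power2_diff by (simp add: algebra_simps)
  finally have "(1 + \<theta>) * x\<^sup>2 + (1 + 1 / \<theta>) * y\<^sup>2 - (x + y)\<^sup>2 = \<theta> * (x - z)\<^sup>2" .
  moreover have "0 \<le> \<theta> * (x - z)\<^sup>2" using assms by simp
  ultimately show ?thesis by linarith
qed

text \<open>Along a curve of finite energy the corrected linear function \<open>\<epsilon> h (u / \<epsilon>)\<close> moves at most as
  fast as the energy allows, since moving off the level lines is heavily penalized.\<close>

lemma corrector_increment_le:
  fixes \<phi> :: "real^2 \<Rightarrow> real"
  assumes u: "u \<in> H1" and \<phi>: "L-lipschitz_on UNIV \<phi>" and e: "0 < \<epsilon>"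
  obtains D where "D \<in> borel_measurable leb01" "integral\<^sup>N leb01 D = F_eps \<delta> \<phi> \<epsilon> u"
    "\<And>\<theta> C r h a b. 0 < \<theta> \<Longrightarrow> 0 \<le> C \<Longrightarrow> 0 < r \<Longrightarrow>
      (\<And>x y. norm (x - y) \<le> r \<Longrightarrow> \<bar>h x - h y\<bar> \<le> (1 + \<theta>) * norm (x - y) + C * \<bar>\<phi> x - \<phi> y\<bar>) \<Longrightarrow>
      (1 + 1 / \<theta>) * C\<^sup>2 \<le> (\<delta> \<epsilon> / \<epsilon>)\<^sup>2 \<Longrightarrow> 0 \<le> a \<Longrightarrow> a \<le> b \<Longrightarrow> b \<le> 1 \<Longrightarrow>
      ennreal ((\<epsilon> * h (cont_rep u b /\<^sub>R \<epsilon>) - \<epsilon> * h (cont_rep u a /\<^sub>R \<epsilon>))\<^sup>2)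
        \<le> ennreal ((b - a) * (1 + \<theta>)^3) * (\<integral>\<^sup>+ t. D t * indicator {a..<b} t \<partial>leb01)"
proof -
  define v where "v = cont_rep u"
  define g where "g = weak_deriv u"
  note R = H1_repr[OF u, folded v_def g_def]
  obtain k where k: "k \<in> L2"
    "\<And>t. t \<in> {0..1} \<Longrightarrow> \<phi> (v t /\<^sub>R \<epsilon>) = \<phi> (v 0 /\<^sub>R \<epsilon>) + integral {0..t} k"
    and F: "F_eps \<delta> \<phi> \<epsilon> u = (\<integral>\<^sup>+ t. ennreal ((norm (g t))\<^sup>2 + (\<delta> \<epsilon> / \<epsilon>)\<^sup>2 * (\<epsilon> * k t)\<^sup>2) \<partial>leb01)"
    using F_eps_repr[OF u \<phi> e, of \<delta>, folded v_def g_def] by blast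
  have [measurable]: "g \<in> borel_measurable leb01" "k \<in> borel_measurable leb01" using L2D(1) R(1) k(1) by auto
  define D where "D t = ennreal ((norm (g t))\<^sup>2 + (\<delta> \<epsilon> / \<epsilon>)\<^sup>2 * (\<epsilon> * k t)\<^sup>2)" for t
  have [measurable]: "D \<in> borel_measurable leb01" unfolding D_def[abs_def] by measurable
  have "uniformly_continuous_on {0..1} v"
    by (rule compact_uniformly_continuous[OF primitive_continuous[OF R(1,2)]]) auto
  have inc: "ennreal ((\<epsilon> * h (v b /\<^sub>R \<epsilon>) - \<epsilon> * h (v a /\<^sub>R \<epsilon>))\<^sup>2)
      \<le> ennreal ((b - a) * (1 + \<theta>)^3) * (\<integral>\<^sup>+ t. D t * indicator {a..<b} t \<partial>leb01)"
    if \<theta>: "0 < \<theta>" and C: "0 \<le> C" and r: "0 < r"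
      and h: "\<And>x y. norm (x - y) \<le> r \<Longrightarrow> \<bar>h x - h y\<bar> \<le> (1 + \<theta>) * norm (x - y) + C * \<bar>\<phi> x - \<phi> y\<bar>"
      and K: "(1 + 1 / \<theta>) * C\<^sup>2 \<le> (\<delta> \<epsilon> / \<epsilon>)\<^sup>2"
      and ab: "0 \<le> a" "a \<le> b" "b \<le> 1" for \<theta> C r h a b
  proof -
  define w where "w t = \<epsilon> * h (v t /\<^sub>R \<epsilon>)" for t
  define q where "q t = (1 + \<theta>) * norm (g t) + C * \<epsilon> * \<bar>k t\<bar>" for t
  have q0: "0 \<le> q t" for t using \<theta> C e by (simp add: q_def)
  have [measurable]: "q \<in> borel_measurable leb01"
    unfolding q_def[abs_def] by measurable
  from \<open>uniformly_continuous_on {0..1} v\<close> obtain d where d: "0 < d" and dv: "\<And>s t. s \<in> {0..1} \<Longrightarrow> t \<in> {0..1} \<Longrightarrow> dist t s < d \<Longrightarrow> dist (v t) (v s) < \<epsilon> * r"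
    unfolding uniformly_continuous_on_def using e r by (metis mult_pos_pos)
  have loc: "ennreal \<bar>w t - w s\<bar> \<le> (\<integral>\<^sup>+ x. ennreal (q x) * indicator {s..<t} x \<partial>leb01)"
    if st: "0 \<le> s" "s \<le> t" "t \<le> 1" "t - s \<le> d / 2" for s t
  proof -
    have [measurable]: "{s..<t} \<in> sets leb01" using st by auto
    have "dist (v t) (v s) < \<epsilon> * r" using st d by (intro dv) (auto simp: dist_real_def)
    moreover have 3: "norm (v t /\<^sub>R \<epsilon> - v s /\<^sub>R \<epsilon>) = norm (v t - v s) / \<epsilon>"
      unfolding scaleR_diff_right[symmetric] norm_scaleR using e by (simp add: divide_inverse)
    ultimately have "norm (v t /\<^sub>R \<epsilon> - v s /\<^sub>R \<epsilon>) \<le> r"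
      unfolding 3 dist_norm using e by (simp add: pos_divide_le_eq mult.commute)
    from h[OF this] have "\<bar>w t - w s\<bar> \<le> \<epsilon> * ((1 + \<theta>) * norm (v t /\<^sub>R \<epsilon> - v s /\<^sub>R \<epsilon>) + C * \<bar>\<phi> (v t /\<^sub>R \<epsilon>) - \<phi> (v s /\<^sub>R \<epsilon>)\<bar>)"
      using e by (simp add: w_def right_diff_distrib[symmetric] abs_mult)
    also have "\<dots> = (1 + \<theta>) * norm (integral {s..t} g) + C * \<epsilon> * norm (integral {s..t} k)"
    proof -
      have 1: "v t - v s = integral {s..t} g" by (rule primitive_diff[OF R(1,2) st(1-3)])
      have 2: "\<phi> (v t /\<^sub>R \<epsilon>) - \<phi> (v s /\<^sub>R \<epsilon>) = integral {s..t} k"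
        by (rule primitive_diff[of k "\<lambda>t. \<phi> (v t /\<^sub>R \<epsilon>)", OF k st(1-3)])
      have "\<epsilon> * (norm (integral {s..t} g) / \<epsilon>) = norm (integral {s..t} g)" using e by simp
      then show ?thesis unfolding 2 3 1 real_norm_def
        by (simp only: distrib_left mult.left_commute[of \<epsilon>] mult.assoc)
    qed
    finally have "ennreal \<bar>w t - w s\<bar> \<le> ennreal ((1 + \<theta>) * norm (integral {s..t} g) + C * \<epsilon> * norm (integral {s..t} k))"
      by (rule ennreal_leI)
    also have "\<dots> = ennreal (1 + \<theta>) * ennreal (norm (integral {s..t} g)) + ennreal (C * \<epsilon>) * ennreal (norm (integral {s..t} k))"
      using \<theta> C e by (simp add: ennreal_mult)
    also have "\<dots> \<le> ennreal (1 + \<theta>) * (\<integral>\<^sup>+ x. ennreal (norm (g x)) * indicator {s..<t} x \<partial>leb01)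
        + ennreal (C * \<epsilon>) * (\<integral>\<^sup>+ x. ennreal (norm (k x)) * indicator {s..<t} x \<partial>leb01)"
      by (intro add_mono mult_left_mono norm_integral_le_nn R(1) k(1) st(1-3)) auto
    also have "\<dots> = (\<integral>\<^sup>+ x. ennreal (1 + \<theta>) * (ennreal (norm (g x)) * indicator {s..<t} x) + ennreal (C * \<epsilon>) * (ennreal (norm (k x)) * indicator {s..<t} x) \<partial>leb01)"
      by (subst nn_integral_add) (auto simp: nn_integral_cmult)
    also have "\<dots> = (\<integral>\<^sup>+ x. ennreal (q x) * indicator {s..<t} x \<partial>leb01)"
      using \<theta> C e by (intro nn_integral_cong) (auto simp: q_def indicator_def ennreal_mult)
    finally show ?thesis .
  qed
  have q2: "(q t)\<^sup>2 \<le> (1 + \<theta>)^3 * ((norm (g t))\<^sup>2 + (\<delta> \<epsilon> / \<epsilon>)\<^sup>2 * (\<epsilon> * k t)\<^sup>2)" for t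
  proof -
    have "(q t)\<^sup>2 \<le> (1 + \<theta>) * ((1 + \<theta>) * norm (g t))\<^sup>2 + (1 + 1 / \<theta>) * (C * \<epsilon> * \<bar>k t\<bar>)\<^sup>2"
      unfolding q_def by (rule power2_sum_le_theta[OF \<theta>])
    also have "\<dots> = (1 + \<theta>)^3 * (norm (g t))\<^sup>2 + ((1 + 1 / \<theta>) * C\<^sup>2) * (\<epsilon> * k t)\<^sup>2"
      by (simp add: power_mult_distrib power2_eq_square power3_eq_cube algebra_simps)
    also have "\<dots> \<le> (1 + \<theta>)^3 * (norm (g t))\<^sup>2 + (1 + \<theta>)^3 * ((\<delta> \<epsilon> / \<epsilon>)\<^sup>2 * (\<epsilon> * k t)\<^sup>2)"
    proof -
      have "((1 + 1 / \<theta>) * C\<^sup>2) * (\<epsilon> * k t)\<^sup>2 \<le> 1 * ((\<delta> \<epsilon> / \<epsilon>)\<^sup>2 * (\<epsilon> * k t)\<^sup>2)"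
        using K by (simp add: mult_right_mono)
      also have "\<dots> \<le> (1 + \<theta>)^3 * ((\<delta> \<epsilon> / \<epsilon>)\<^sup>2 * (\<epsilon> * k t)\<^sup>2)"
        using \<theta> by (intro mult_right_mono one_le_power) auto
      finally show ?thesis by simp
    qed
    finally show ?thesis by (simp add: distrib_left)
  qed
    have [measurable]: "{a..<b} \<in> sets leb01" using ab by auto
    have "ennreal \<bar>w b - w a\<bar> \<le> (\<integral>\<^sup>+ x. ennreal (q x) * indicator {a..<b} x \<partial>leb01)"
      by (rule interval_chain[of "d / 2", OF _ _ loc ab]) (use d in auto)
    then have "(ennreal \<bar>w b - w a\<bar>)\<^sup>2 \<le> (\<integral>\<^sup>+ x. ennreal (q x) * indicator {a..<b} x \<partial>leb01)\<^sup>2"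
      by (rule power_mono) simp
    also have "\<dots> \<le> ennreal (b - a) * (\<integral>\<^sup>+ x. (ennreal (q x))\<^sup>2 * indicator {a..<b} x \<partial>leb01)"
      by (rule nn_Cauchy_Schwarz_Ico[OF ab]) measurable
    also have "\<dots> \<le> ennreal (b - a) * (\<integral>\<^sup>+ x. ennreal ((1 + \<theta>)^3) * (D x * indicator {a..<b} x) \<partial>leb01)"
    proof (intro mult_left_mono nn_integral_mono)
      fix x
      have "(ennreal (q x))\<^sup>2 \<le> ennreal ((1 + \<theta>)^3) * D x"
        using ennreal_leI[OF q2[of x]] \<theta> unfolding D_def
        by (subst ennreal_mult[symmetric]) (auto simp: ennreal_power q0)
      then show "(ennreal (q x))\<^sup>2 * indicator {a..<b} x \<le> ennreal ((1 + \<theta>)^3) * (D x * indicator {a..<b} x)"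
        by (auto simp: indicator_def)
    qed simp
    also have "\<dots> = ennreal ((b - a) * (1 + \<theta>)^3) * (\<integral>\<^sup>+ t. D t * indicator {a..<b} t \<partial>leb01)"
      using ab \<theta> by (subst nn_integral_cmult) (auto simp: ennreal_mult mult.assoc)
    finally show ?thesis by (simp add: ennreal_power w_def)
  qed
  have "integral\<^sup>N leb01 D = F_eps \<delta> \<phi> \<epsilon> u" unfolding F D_def ..
  from that[OF \<open>D \<in> borel_measurable leb01\<close> this inc[unfolded v_def]] show ?thesis .
qed

subsection \<open>Lower bound\<close>

lemma liminf_less_subseq:
  fixes X :: "nat \<Rightarrow> ennreal"
  assumes "liminf X < z"
  shows "\<exists>r. strict_mono (r :: nat \<Rightarrow> nat) \<and> (\<forall>j. X (r j) < z)"
proof -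
  have "\<not> eventually (\<lambda>n. z \<le> X n) sequentially"
    using Liminf_bounded[of z X sequentially] assms by (auto simp: not_le)
  then have "\<forall>m. \<exists>n\<ge>m. n \<in> {n. X n < z}"
    by (auto simp: eventually_sequentially not_le)
  then have "infinite {n. X n < z}" by (simp add: infinite_nat_iff_unbounded_le)
  from infinite_enumerate[OF this] show ?thesis by simp
qed

lemma L2_tendsto_AE_subseq:
  fixes U :: "nat \<Rightarrow> real \<Rightarrow> 'a::euclidean_space"
  assumes U: "\<And>j. U j \<in> L2" and u: "u \<in> L2" and c: "L2_tendsto U u"
  obtains r where "strict_mono (r :: nat \<Rightarrow> nat)" "AE t in leb01. (\<lambda>j. U (r j) t) \<longlonglongrightarrow> u t"
proof -
  have int: "integrable leb01 (\<lambda>t. (norm (U j t - u t))\<^sup>2)" for j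
    using L2_diff[OF U[of j] u] by (simp add: L2_def)
  have lim: "(\<lambda>j. \<integral>t. norm ((norm (U j t - u t))\<^sup>2) \<partial>leb01) \<longlonglongrightarrow> 0"
    using c by (simp add: L2_tendsto_def)
  obtain r where r: "strict_mono (r :: nat \<Rightarrow> nat)" and ae: "AE t in leb01. (\<lambda>j. (norm (U (r j) t - u t))\<^sup>2) \<longlonglongrightarrow> 0"
    using tendsto_L1_AE_subseq[OF int lim] by blast
  have "AE t in leb01. (\<lambda>j. U (r j) t) \<longlonglongrightarrow> u t"
    using ae
  proof eventually_elim
    case (elim t)
    from tendsto_real_sqrt[OF elim] have "(\<lambda>j. norm (U (r j) t - u t)) \<longlonglongrightarrow> 0" by simp
    then show ?case by (rule LIM_zero_cancel[OF tendsto_norm_zero_cancel])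
  qed
  with r show ?thesis by (rule that)
qed

lemma AE_leb01_dense:
  assumes ae: "AE t in leb01. P t" and t: "t \<in> {0..1}" and d: "0 < d"
  shows "\<exists>s\<in>{0..1}. \<bar>s - t\<bar> \<le> d \<and> P s"
proof (rule ccontr)
  assume n: "\<not> ?thesis"
  define a where "a = max 0 (t - d)"
  define b where "b = min 1 (t + d)"
  have ab: "0 \<le> a" "a < b" "b \<le> 1" "t - d \<le> a" "b \<le> t + d" using t d by (auto simp: a_def b_def max_def min_def)
  have "AE s in leb01. s \<notin> {a..<b}"
    using ae AE_leb01_less1
  proof eventually_elim
    case (elim s)
    show ?case
    proof
      assume "s \<in> {a..<b}"
      then have "\<bar>s - t\<bar> \<le> d" using ab by (auto simp: abs_le_iff)
      with n elim show False by auto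
    qed
  qed
  moreover have "{a..<b} \<in> sets leb01" using ab by auto
  ultimately have "{a..<b} \<in> null_sets leb01" using AE_iff_null_sets by blast
  then have "ennreal (b - a) = 0" using emeasure_leb01_Ico[of a b] ab by (auto dest: null_setsD1)
  with ab show False by simp
qed

lemma H1_Holder:
  assumes u: "u \<in> H1" and c: "(\<integral>\<^sup>+ t. ennreal ((norm (weak_deriv u t))\<^sup>2) \<partial>leb01) \<le> ennreal c" "0 \<le> c"
    and st: "0 \<le> s" "s \<le> t" "t \<le> 1"
  shows "(norm (cont_rep u t - cont_rep u s))\<^sup>2 \<le> c * (t - s)"
proof -
  note R = H1_repr[OF u]
  have [measurable]: "{s..<t} \<in> sets leb01" using st by auto
  have eq: "cont_rep u t - cont_rep u s = integral {s..t} (weak_deriv u)" by (rule primitive_diff[OF R(1,2) st])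
  have "ennreal ((norm (cont_rep u t - cont_rep u s))\<^sup>2) \<le> ennreal (t - s) * (\<integral>\<^sup>+ x. ennreal ((norm (weak_deriv u x))\<^sup>2) * indicator {s..<t} x \<partial>leb01)"
    unfolding eq by (rule integral_Cauchy_Schwarz[OF R(1) st])
  also have "\<dots> \<le> ennreal (t - s) * (\<integral>\<^sup>+ t. ennreal ((norm (weak_deriv u t))\<^sup>2) \<partial>leb01)"
    by (intro mult_left_mono nn_integral_mono) (auto simp: indicator_def)
  also have "\<dots> \<le> ennreal (t - s) * ennreal c" by (intro mult_left_mono c) simp
  also have "\<dots> = ennreal (c * (t - s))" using st c by (simp add: ennreal_mult mult.commute)
  finally show ?thesis using st c by (simp add: ennreal_le_iff)
qed

text \<open>By the uniform Hoelder bound, convergence on a dense set implies convergence everywhere.\<close>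

lemma equicontinuous_pointwise_limit:
  fixes v :: "nat \<Rightarrow> real \<Rightarrow> 'a::euclidean_space"
  assumes H: "\<And>j s t. 0 \<le> s \<Longrightarrow> s \<le> t \<Longrightarrow> t \<le> 1 \<Longrightarrow> (norm (v j t - v j s))\<^sup>2 \<le> c * (t - s)" and c: "0 \<le> c"
    and ae: "AE t in leb01. convergent (\<lambda>j. v j t)"
    and t: "t \<in> {0..1}"
  shows "convergent (\<lambda>j. v j t)"
proof -
  have H': "norm (v j t - v j s) \<le> sqrt (c * \<bar>t - s\<bar>)" if "s \<in> {0..1}" for j s
  proof (cases "s \<le> t")
    case True
    then show ?thesis using H[of s t j] that t by (intro real_le_rsqrt) auto
  next
    case False
    then show ?thesis using H[of t s j] that t by (intro real_le_rsqrt) (auto simp: norm_minus_commute)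
  qed
  have "Cauchy (\<lambda>j. v j t)"
  proof (rule metric_CauchyI)
    fix \<eta> :: real assume \<eta>: "0 < \<eta>"
    define d where "d = (\<eta> / 4)\<^sup>2 / (c + 1)"
    have d: "0 < d" using \<eta> c by (simp add: d_def)
    obtain s where s: "s \<in> {0..1}" "\<bar>s - t\<bar> \<le> d" "convergent (\<lambda>j. v j s)"
      using AE_leb01_dense[OF ae t d] by blast
    have "c * \<bar>t - s\<bar> \<le> (c + 1) * d" using s c d by (intro mult_mono) auto
    also have "\<dots> = (\<eta> / 4)\<^sup>2" using c by (simp add: d_def)
    finally have "sqrt (c * \<bar>t - s\<bar>) \<le> \<eta> / 4" using \<eta> by (intro real_le_lsqrt) (auto simp: c)
    then have near: "norm (v j t - v j s) \<le> \<eta> / 4" for j using H'[OF s(1), of j] by linarith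
    obtain M where M: "\<And>m n. m \<ge> M \<Longrightarrow> n \<ge> M \<Longrightarrow> dist (v m s) (v n s) < \<eta> / 4"
      using metric_CauchyD[OF convergent_Cauchy[OF s(3)], of "\<eta> / 4"] \<eta> by auto
    have "dist (v m t) (v n t) < \<eta>" if "m \<ge> M" "n \<ge> M" for m n
    proof -
      have "dist (v m t) (v n t) \<le> dist (v m t) (v m s) + dist (v m s) (v n s) + dist (v n s) (v n t)"
        by (meson add_right_mono dist_triangle order_trans)
      then show ?thesis using near[of m] near[of n] M[OF that] \<eta> by (simp add: dist_norm norm_minus_commute)
    qed
    then show "\<exists>M. \<forall>m\<ge>M. \<forall>n\<ge>M. dist (v m t) (v n t) < \<eta>" by blast
  qed
  then show ?thesis by (simp add: Cauchy_convergent_iff)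
qed

lemma F_eps_ge_Dirichlet:
  assumes "u \<in> H1"
  shows "(\<integral>\<^sup>+ t. ennreal ((norm (weak_deriv u t))\<^sup>2) \<partial>leb01) \<le> F_eps \<delta> \<phi> \<epsilon> u"
  unfolding F_eps_def if_P[OF assms] by (intro nn_integral_mono ennreal_leI) simp

text \<open>On each grid interval the increment of \<open>e j * h(u / e j)\<close> converges to that of \<open>p \<bullet> v\<close>, as \<open>h\<close> is at bounded distance
  from \<open>p\<close>, while its square is bounded by the energy spent on that interval.\<close>

lemma discrete_lower_bound:
  fixes \<phi> :: "real^2 \<Rightarrow> real"
  assumes \<phi>: "L-lipschitz_on UNIV \<phi>" and P: "P \<noteq> {}" "\<And>p. p \<in> P \<Longrightarrow> has_correctors \<phi> p"
    and U: "\<And>j. U j \<in> H1" and e: "\<And>j. 0 < e j" "e \<longlonglongrightarrow> 0"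
    and K: "filterlim (\<lambda>j. \<delta> (e j) / e j) at_top sequentially"
    and F: "\<And>j. F_eps \<delta> \<phi> (e j) (U j) \<le> ennreal c" and c: "0 \<le> c"
    and lim: "\<And>t. t \<in> {0..1} \<Longrightarrow> (\<lambda>j. cont_rep (U j) t) \<longlonglongrightarrow> v t"
    and n: "0 < n"
  shows "(\<Sum>k<n. dual_sq P (grid_slope n v k)) * ennreal (1 / real n) \<le> ennreal c"
proof -
  let ?t = "\<lambda>k. real k / real n"
  define \<Delta> where "\<Delta> k = v (?t (Suc k)) - v (?t k)" for k
  have one: "(\<Sum>k<n. ennreal (real n * (p k \<bullet> \<Delta> k)\<^sup>2)) \<le> ennreal c" if p: "\<forall>k\<in>{..<n}. p k \<in> P" for p
  proof -
    have th: "(\<Sum>k<n. real n * (p k \<bullet> \<Delta> k)\<^sup>2) \<le> (1 + \<theta>)^3 * c" if \<theta>: "0 < \<theta>" for \<theta>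
    proof -
      have "\<forall>k\<in>{..<n}. \<exists>h C r B. 0 \<le> C \<and> 0 < r \<and> (\<forall>x. \<bar>h x - p k \<bullet> x\<bar> \<le> B) \<and>
         (\<forall>x y. norm (x - y) \<le> r \<longrightarrow> \<bar>h x - h y\<bar> \<le> (1 + \<theta>) * norm (x - y) + C * \<bar>\<phi> x - \<phi> y\<bar>)"
        using P(2) p \<theta> unfolding has_correctors_def by blast
      then obtain h C r B where h: "\<And>k. k < n \<Longrightarrow> 0 \<le> C k \<and> 0 < r k \<and> (\<forall>x. \<bar>h k x - p k \<bullet> x\<bar> \<le> B k) \<and>
         (\<forall>x y. norm (x - y) \<le> r k \<longrightarrow> \<bar>h k x - h k y\<bar> \<le> (1 + \<theta>) * norm (x - y) + C k * \<bar>\<phi> x - \<phi> y\<bar>)"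
        unfolding lessThan_iff[symmetric] Ball_def[symmetric] by (metis (no_types, lifting))
      define w where "w k j t = e j * h k (cont_rep (U j) t /\<^sub>R e j)" for k j t
      have wl: "(\<lambda>j. w k j t) \<longlonglongrightarrow> p k \<bullet> v t" if k: "k < n" and t: "t \<in> {0..1}" for k t
      proof -
        have "(\<lambda>j. w k j t - p k \<bullet> cont_rep (U j) t) \<longlonglongrightarrow> 0"
        proof (rule Lim_null_comparison)
          show "\<forall>\<^sub>F j in sequentially. norm (w k j t - p k \<bullet> cont_rep (U j) t) \<le> e j * B k"
          proof (rule always_eventually, rule allI)
            fix j
            have "w k j t - p k \<bullet> cont_rep (U j) t = e j * (h k (cont_rep (U j) t /\<^sub>R e j) - p k \<bullet> (cont_rep (U j) t /\<^sub>R e j))"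
              using e(1)[of j] by (simp add: w_def right_diff_distrib)
            then have "norm (w k j t - p k \<bullet> cont_rep (U j) t) = e j * \<bar>h k (cont_rep (U j) t /\<^sub>R e j) - p k \<bullet> (cont_rep (U j) t /\<^sub>R e j)\<bar>"
              using e(1)[of j] by (simp add: abs_mult)
            also have "\<dots> \<le> e j * B k" 
            proof (rule mult_left_mono)
              show "\<bar>h k (cont_rep (U j) t /\<^sub>R e j) - p k \<bullet> (cont_rep (U j) t /\<^sub>R e j)\<bar> \<le> B k" using h[OF k] by blast
            qed (use e(1)[of j] in simp)
            finally show "norm (w k j t - p k \<bullet> cont_rep (U j) t) \<le> e j * B k" .
          qed
          show "(\<lambda>j. e j * B k) \<longlonglongrightarrow> 0" using tendsto_mult_right[OF e(2), of "B k"] by simp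
        qed
        from tendsto_add[OF this tendsto_inner[OF tendsto_const[of "p k"] lim[OF t]]] show ?thesis by simp
      qed
      have gb: "?t k \<in> {0..1}" "?t (Suc k) \<in> {0..1}" if "k < n" for k
        using grid_bounds[OF that] by auto
      have l: "(\<lambda>j. \<Sum>k<n. real n * (w k j (?t (Suc k)) - w k j (?t k))\<^sup>2) \<longlonglongrightarrow> (\<Sum>k<n. real n * (p k \<bullet> v (?t (Suc k)) - p k \<bullet> v (?t k))\<^sup>2)"
        by (intro tendsto_sum tendsto_mult tendsto_const tendsto_power tendsto_diff wl gb) auto
      define M where "M = (\<Sum>k<n. (1 + 1 / \<theta>) * (C k)\<^sup>2)"
      have MK: "(1 + 1 / \<theta>) * (C k)\<^sup>2 \<le> M" if "k < n" for k
        unfolding M_def using that \<theta> by (intro member_le_sum[of k "{..<n}" "\<lambda>k. (1 + 1 / \<theta>) * (C k)\<^sup>2"]) auto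
      have ev: "eventually (\<lambda>j. M + 1 \<le> \<delta> (e j) / e j) sequentially"
        using K by (simp add: filterlim_at_top)
      have M0: "0 \<le> M" unfolding M_def using \<theta> by (intro sum_nonneg) auto
      have "eventually (\<lambda>j. (\<Sum>k<n. real n * (w k j (?t (Suc k)) - w k j (?t k))\<^sup>2) \<le> (1 + \<theta>)^3 * c) sequentially"
        using ev
      proof eventually_elim
        case (elim j)
        have "M \<le> (M + 1) * (M + 1)" using M0 by (simp add: algebra_simps)
        also have "\<dots> \<le> (\<delta> (e j) / e j)\<^sup>2"
          unfolding power2_eq_square using elim M0 by (intro mult_mono) auto
        finally have MM: "M \<le> (\<delta> (e j) / e j)\<^sup>2" .
        obtain D where D: "D \<in> borel_measurable leb01" "integral\<^sup>N leb01 D = F_eps \<delta> \<phi> (e j) (U j)"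
          and Dinc: "\<And>\<theta> C r h a b. 0 < \<theta> \<Longrightarrow> 0 \<le> C \<Longrightarrow> 0 < r \<Longrightarrow>
            (\<And>x y. norm (x - y) \<le> r \<Longrightarrow> \<bar>h x - h y\<bar> \<le> (1 + \<theta>) * norm (x - y) + C * \<bar>\<phi> x - \<phi> y\<bar>) \<Longrightarrow>
            (1 + 1 / \<theta>) * C\<^sup>2 \<le> (\<delta> (e j) / e j)\<^sup>2 \<Longrightarrow> 0 \<le> a \<Longrightarrow> a \<le> b \<Longrightarrow> b \<le> 1 \<Longrightarrow>
            ennreal ((e j * h (cont_rep (U j) b /\<^sub>R e j) - e j * h (cont_rep (U j) a /\<^sub>R e j))\<^sup>2)
              \<le> ennreal ((b - a) * (1 + \<theta>)^3) * (\<integral>\<^sup>+ t. D t * indicator {a..<b} t \<partial>leb01)"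
          using corrector_increment_le[OF U[of j] \<phi> e(1)[of j], of \<delta>] by blast
        have inc: "ennreal (real n * (w k j (?t (Suc k)) - w k j (?t k))\<^sup>2) \<le> ennreal ((1 + \<theta>)^3) * (\<integral>\<^sup>+ t. D t * indicator {?t k..<?t (Suc k)} t \<partial>leb01)"
          if k: "k < n" for k
        proof -
          have len: "?t (Suc k) - ?t k = 1 / real n" by (simp add: add_divide_distrib)
          have D: "ennreal ((w k j (?t (Suc k)) - w k j (?t k))\<^sup>2)
             \<le> ennreal ((?t (Suc k) - ?t k) * (1 + \<theta>)^3) * (\<integral>\<^sup>+ t. D t * indicator {?t k..<?t (Suc k)} t \<partial>leb01)"
            unfolding w_def by (rule Dinc[OF \<theta>, of "C k" "r k"])
              (use h[OF k] order_trans[OF MK[OF k] MM] grid_bounds[OF k] in auto)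
          have "ennreal (real n * (w k j (?t (Suc k)) - w k j (?t k))\<^sup>2) = ennreal (real n) * ennreal ((w k j (?t (Suc k)) - w k j (?t k))\<^sup>2)"
            by (rule ennreal_mult) auto
          also have "\<dots> \<le> ennreal (real n) * (ennreal (1 / real n * (1 + \<theta>)^3) * (\<integral>\<^sup>+ t. D t * indicator {?t k..<?t (Suc k)} t \<partial>leb01))"
            using D unfolding len by (intro mult_left_mono) auto
          also have "\<dots> = ennreal (real n * (1 / real n * (1 + \<theta>)^3)) * (\<integral>\<^sup>+ t. D t * indicator {?t k..<?t (Suc k)} t \<partial>leb01)"
            using \<theta> by (subst ennreal_mult) (auto simp: mult.assoc)
          also have "real n * (1 / real n * (1 + \<theta>)^3) = (1 + \<theta>)^3" using n by simp
          finally show ?thesis .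
        qed
        have "ennreal (\<Sum>k<n. real n * (w k j (?t (Suc k)) - w k j (?t k))\<^sup>2) = (\<Sum>k<n. ennreal (real n * (w k j (?t (Suc k)) - w k j (?t k))\<^sup>2))"
          by (rule sum_ennreal[symmetric]) simp
        also have "\<dots> \<le> (\<Sum>k<n. ennreal ((1 + \<theta>)^3) * (\<integral>\<^sup>+ t. D t * indicator {?t k..<?t (Suc k)} t \<partial>leb01))"
          by (intro sum_mono inc) simp
        also have "\<dots> \<le> ennreal ((1 + \<theta>)^3) * F_eps \<delta> \<phi> (e j) (U j)"
          unfolding sum_distrib_left[symmetric] D(2)[symmetric]
          by (intro mult_left_mono sum_grid_integral_le[OF n D(1)]) simp
        also have "\<dots> \<le> ennreal ((1 + \<theta>)^3) * ennreal c" by (intro mult_left_mono F) simp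
        also have "\<dots> = ennreal ((1 + \<theta>)^3 * c)" using \<theta> c by (simp add: ennreal_mult)
        finally show ?case using \<theta> c by (subst (asm) ennreal_le_iff) auto
      qed
      then have "(\<Sum>k<n. real n * (p k \<bullet> v (?t (Suc k)) - p k \<bullet> v (?t k))\<^sup>2) \<le> (1 + \<theta>)^3 * c"
        by (rule tendsto_upperbound[OF l]) simp
      then show ?thesis by (simp add: \<Delta>_def inner_diff_right)
    qed
    have "((\<lambda>\<theta>. (1 + \<theta>)^3 * c) \<longlongrightarrow> (1 + 0)^3 * c) (at_right 0)"
      by (intro tendsto_intros)
    moreover have "eventually (\<lambda>\<theta>. (\<Sum>k<n. real n * (p k \<bullet> \<Delta> k)\<^sup>2) \<le> (1 + \<theta>)^3 * c) (at_right 0)"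
      using eventually_at_right_less[of "0::real"] by eventually_elim (rule th)
    ultimately have "(\<Sum>k<n. real n * (p k \<bullet> \<Delta> k)\<^sup>2) \<le> c"
      using tendsto_lowerbound[of _ _ "at_right (0::real)"] by fastforce
    then show ?thesis by (simp add: sum_ennreal ennreal_leI)
  qed
  have "0 + (\<Sum>k<n. SUP p\<in>P. ennreal (real n * (p \<bullet> \<Delta> k)\<^sup>2)) \<le> ennreal c"
    by (rule sum_SUP_le[OF _ P(1)]) (use one in auto)
  moreover have "(SUP p\<in>P. ennreal (real n * (p \<bullet> \<Delta> k)\<^sup>2)) = dual_sq P (grid_slope n v k) * ennreal (1 / real n)" for k
  proof -
    have "dual_sq P (grid_slope n v k) * ennreal (1 / real n) = dual_sq P (\<Delta> k) * (ennreal ((real n)\<^sup>2) * ennreal (1 / real n))"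
      by (simp add: grid_slope_def \<Delta>_def dual_sq_scaleR[OF P(1)] mult_ac)
    also have "ennreal ((real n)\<^sup>2) * ennreal (1 / real n) = ennreal (real n)"
      using n by (simp add: ennreal_mult[symmetric] power2_eq_square)
    also have "dual_sq P (\<Delta> k) * ennreal (real n) = (SUP p\<in>P. ennreal (real n * (p \<bullet> \<Delta> k)\<^sup>2))"
      unfolding dual_sq_def by (simp add: SUP_mult_left_ennreal mult.commute[of _ "ennreal (real n)"] ennreal_mult)
    finally show ?thesis by simp
  qed
  ultimately show ?thesis by (simp add: sum_distrib_right)
qed

lemma dyadic_energy_imp_primitive_ex:
  fixes v :: "real \<Rightarrow> 'a::euclidean_space"
  assumes cont: "continuous_on {0..1} v" and bd: "\<And>N. N \<ge> N0 \<Longrightarrow> energy (2^N) v \<le> C"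
  shows "\<exists>g r. g \<in> L2 \<and> strict_mono (r :: nat \<Rightarrow> nat) \<and> (AE t in leb01. (\<lambda>i. slope (2 ^ r i) v t) \<longlonglongrightarrow> g t) \<and>
    (\<forall>t\<in>{0..1}. v t = v 0 + integral {0..t} g) \<and> (\<integral>\<^sup>+ t. ennreal ((norm (g t))\<^sup>2) \<partial>leb01) \<le> ennreal C"
proof (rule dyadic_energy_imp_primitive[OF cont bd])
  fix g and r :: "nat \<Rightarrow> nat"
  assume "g \<in> L2" "strict_mono r" "AE t in leb01. (\<lambda>i. slope (2 ^ r i) v t) \<longlonglongrightarrow> g t"
    and "\<And>t. t \<in> {0..1} \<Longrightarrow> v t = v 0 + integral {0..t} g" "(\<integral>\<^sup>+ t. ennreal ((norm (g t))\<^sup>2) \<partial>leb01) \<le> ennreal C"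
  then show ?thesis by (intro exI[of _ g] exI[of _ r] conjI ballI)
qed

text \<open>A subsequence with bounded energies is equicontinuous, so a further one converges at every point. The
  discrete bounds then show that the limit is a primitive, and they pass to the limit along dyadic grids by Fatou and
  lower semicontinuity of \<open>dual_sq P\<close>.\<close>

theorem Gamma_liminf_inequality:
  fixes \<phi> :: "real^2 \<Rightarrow> real" and u :: "real \<Rightarrow> real^2"
  assumes \<phi>: "L-lipschitz_on UNIV \<phi>" and P: "P \<noteq> {}" "\<And>p. p \<in> P \<Longrightarrow> has_correctors \<phi> p"
    and coercive: "\<And>w. ennreal ((norm w)\<^sup>2) \<le> dual_sq P w"
    and e: "\<And>j. 0 < e j" "e \<longlonglongrightarrow> 0"
    and K: "filterlim (\<lambda>j. \<delta> (e j) / e j) at_top sequentially"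
    and U: "\<And>j. U j \<in> L2" and u: "u \<in> L2" and conv: "L2_tendsto U u"
  shows "F_lim (dual_sq P) u \<le> liminf (\<lambda>j. F_eps \<delta> \<phi> (e j) (U j))"
proof (rule dense_ge)
  fix z assume z: "liminf (\<lambda>j. F_eps \<delta> \<phi> (e j) (U j)) < z"
  show "F_lim (dual_sq P) u \<le> z"
  proof (cases "z = \<infinity>")
    case False
    define c where "c = enn2real z"
    have c: "z = ennreal c" "0 \<le> c" using False by (simp_all add: c_def less_top)
    obtain r0 where r0: "strict_mono (r0 :: nat \<Rightarrow> nat)" "\<And>j. F_eps \<delta> \<phi> (e (r0 j)) (U (r0 j)) < z"
      using liminf_less_subseq[OF z] by blast
    have "L2_tendsto (\<lambda>j. U (r0 j)) u"
      using conv LIMSEQ_subseq_LIMSEQ[OF _ r0(1)] unfolding L2_tendsto_def by (simp add: o_def)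
    then obtain r1 where r1: "strict_mono (r1 :: nat \<Rightarrow> nat)" "AE t in leb01. (\<lambda>j. U (r0 (r1 j)) t) \<longlonglongrightarrow> u t"
      using L2_tendsto_AE_subseq[of "\<lambda>j. U (r0 j)" u] U u by blast
    define s where "s j = r0 (r1 j)" for j
    have s: "strict_mono s" using strict_mono_compose[OF r0(1) r1(1)] by (simp add: s_def[abs_def] o_def)
    have F: "F_eps \<delta> \<phi> (e (s j)) (U (s j)) \<le> ennreal c" for j
      using r0(2)[of "r1 j"] c by (simp add: s_def)
    have H: "U (s j) \<in> H1" for j
    proof (rule ccontr)
      assume "U (s j) \<notin> H1"
      then have "F_eps \<delta> \<phi> (e (s j)) (U (s j)) = \<infinity>" by (simp add: F_eps_def)
      with F[of j] show False by (simp add: top_unique)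
    qed
    define V where "V j = cont_rep (U (s j))" for j
    have Hol: "(norm (V j t - V j x))\<^sup>2 \<le> c * (t - x)" if "0 \<le> x" "x \<le> t" "t \<le> 1" for j t x
      unfolding V_def by (rule H1_Holder[OF H order_trans[OF F_eps_ge_Dirichlet[OF H] F] c(2) that])
    have "AE t in leb01. \<forall>j. V j t = U (s j) t"
      unfolding V_def AE_all_countable using H1_repr(3)[OF H] by blast
    with r1(2) have Vu: "AE t in leb01. (\<lambda>j. V j t) \<longlonglongrightarrow> u t"
      by eventually_elim (simp add: s_def)
    then have aec: "AE t in leb01. convergent (\<lambda>j. V j t)"
      by eventually_elim (auto simp: convergent_def)
    have cv: "convergent (\<lambda>j. V j t)" if "t \<in> {0..1}" for t
      by (rule equicontinuous_pointwise_limit[OF Hol c(2) aec that])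
    define v where "v t = lim (\<lambda>j. V j t)" for t
    have Vv: "(\<lambda>j. V j t) \<longlonglongrightarrow> v t" if "t \<in> {0..1}" for t
      using cv[OF that] by (simp add: v_def convergent_LIMSEQ_iff)
    have uv: "AE t in leb01. u t = v t"
      using Vu AE_leb01_less1
    proof eventually_elim
      case (elim t)
      then have "t \<in> {0..1}" by auto
      from LIMSEQ_unique[OF elim(1) Vv[OF this]] show ?case .
    qed
    have vH: "(norm (v t - v x))\<^sup>2 \<le> c * (t - x)" if "0 \<le> x" "x \<le> t" "t \<le> 1" for t x
    proof (rule tendsto_upperbound)
      show "(\<lambda>j. (norm (V j t - V j x))\<^sup>2) \<longlonglongrightarrow> (norm (v t - v x))\<^sup>2"
        using that by (intro tendsto_intros Vv) auto
    qed (use Hol that in auto)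
    have vH': "norm (v t - v x) \<le> sqrt (c * \<bar>t - x\<bar>)" if "t \<in> {0..1}" "x \<in> {0..1}" for t x
    proof (cases "x \<le> t")
      case True
      then show ?thesis using vH[of x t] that by (intro real_le_rsqrt) auto
    next
      case False
      then show ?thesis using vH[of t x] that by (intro real_le_rsqrt) (auto simp: norm_minus_commute)
    qed
    have vc: "continuous_on {0..1} v"
      unfolding continuous_on_def
    proof
      fix x :: real assume x: "x \<in> {0..1}"
      have "((\<lambda>t. v t - v x) \<longlongrightarrow> 0) (at x within {0..1})"
      proof (rule Lim_null_comparison)
        show "\<forall>\<^sub>F t in at x within {0..1}. norm (v t - v x) \<le> sqrt (c * \<bar>t - x\<bar>)"
          using vH' x by (auto simp: eventually_at_filter)
        have "((\<lambda>t. sqrt (c * \<bar>t - x\<bar>)) \<longlongrightarrow> sqrt (c * \<bar>x - x\<bar>)) (at x within {0..1})"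
          by (intro tendsto_intros)
        then show "((\<lambda>t. sqrt (c * \<bar>t - x\<bar>)) \<longlongrightarrow> 0) (at x within {0..1})" by simp
      qed
      then show "(v \<longlongrightarrow> v x) (at x within {0..1})" by (rule LIM_zero_cancel)
    qed
    have es: "(\<lambda>j. e (s j)) \<longlonglongrightarrow> 0" using LIMSEQ_subseq_LIMSEQ[OF e(2) s] by (simp add: o_def)
    have Ks: "filterlim (\<lambda>j. \<delta> (e (s j)) / e (s j)) at_top sequentially"
      using filterlim_compose[OF K filterlim_subseq[OF s]] .
    have lower: "(\<Sum>k<n. dual_sq P (grid_slope n v k)) * ennreal (1 / real n) \<le> ennreal c" if n: "0 < n" for n
      by (rule discrete_lower_bound[OF \<phi> P H e(1) es Ks F c(2) _ n]) (use Vv in \<open>auto simp: V_def\<close>)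
    have "energy n v \<le> c" if n: "0 < n" for n
    proof -
      have "ennreal (energy n v) = (\<Sum>k<n. ennreal ((norm (grid_slope n v k))\<^sup>2)) * ennreal (1 / real n)"
        by (simp add: energy_def sum_ennreal ennreal_mult[symmetric] sum_nonneg)
      also have "\<dots> \<le> (\<Sum>k<n. dual_sq P (grid_slope n v k)) * ennreal (1 / real n)"
        by (intro mult_right_mono sum_mono coercive) simp
      also have "\<dots> \<le> ennreal c" by (rule lower[OF n])
      finally show ?thesis using c(2) by (simp add: ennreal_le_iff)
    qed
    then have "energy (2^N) v \<le> c" for N by simp
    then obtain g r where g: "g \<in> L2" "strict_mono (r :: nat \<Rightarrow> nat)"
      "AE t in leb01. (\<lambda>i. slope (2 ^ r i) v t) \<longlonglongrightarrow> g t"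
      and vg: "\<And>t. t \<in> {0..1} \<Longrightarrow> v t = v 0 + integral {0..t} g"
      using dyadic_energy_imp_primitive_ex[OF vc, of 0 c] by blast
    have uH: "u \<in> H1" "AE t in leb01. weak_deriv u t = g t"
      by (rule primitive_H1[OF u g(1) vg uv], assumption)+
    have "F_lim (dual_sq P) u = (\<integral>\<^sup>+ t. dual_sq P (weak_deriv u t) \<partial>leb01)" by (simp add: F_lim_def uH(1))
    also have "\<dots> = (\<integral>\<^sup>+ t. dual_sq P (g t) \<partial>leb01)"
      by (rule nn_integral_cong_AE, use uH(2) in eventually_elim) simp
    also have "\<dots> \<le> (\<integral>\<^sup>+ t. liminf (\<lambda>i. dual_sq P (slope (2 ^ r i) v t)) \<partial>leb01)"
      by (rule nn_integral_mono_AE, use g(3) in eventually_elim) (rule dual_sq_liminf)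
    also have "\<dots> \<le> liminf (\<lambda>i. \<integral>\<^sup>+ t. dual_sq P (slope (2 ^ r i) v t) \<partial>leb01)"
      by (rule nn_integral_liminf) measurable
    also have "\<dots> \<le> liminf (\<lambda>i. ennreal c)"
    proof (intro Liminf_mono always_eventually allI)
      fix i
      have "(\<integral>\<^sup>+ t. dual_sq P (slope (2 ^ r i) v t) \<partial>leb01) = (\<Sum>k<2 ^ r i. dual_sq P (grid_slope (2 ^ r i) v k)) * ennreal (1 / real (2 ^ r i))"
        unfolding slope_def by (rule nn_integral_step[of "2 ^ r i" "\<lambda>k. dual_sq P (grid_slope (2 ^ r i) v k)"]) simp
      also have "\<dots> \<le> ennreal c" by (rule lower) simp
      finally show "(\<integral>\<^sup>+ t. dual_sq P (slope (2 ^ r i) v t) \<partial>leb01) \<le> ennreal c" .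
    qed
    finally show ?thesis using c by (simp add: Liminf_const)
  qed simp
qed

subsection \<open>Upper bound\<close>

text \<open>Jensen's inequality: \<open>dual_sq P\<close> is a supremum of squares of linear functions.\<close>

lemma integral_dual_sq_le:
  assumes P: "P \<noteq> {}" and g: "g \<in> L2" and ab: "0 \<le> a" "a \<le> b" "b \<le> 1"
  shows "dual_sq P (integral {a..b} g) \<le> ennreal (b - a) * (\<integral>\<^sup>+ t. dual_sq P (g t) * indicator {a..<b} t \<partial>leb01)"
  unfolding dual_sq_def[of P "integral {a..b} g"]
proof (rule SUP_least)
  fix p assume p: "p \<in> P"
  have [measurable]: "g \<in> borel_measurable leb01" by (rule L2D(1)[OF g])
  have "(\<lambda>t. p \<bullet> g t) \<in> L2"
  proof (rule L2I)
    show "(\<lambda>t. p \<bullet> g t) \<in> borel_measurable leb01" by measurable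
    have "(norm (p \<bullet> g t))\<^sup>2 \<le> (norm p)\<^sup>2 * (norm (g t))\<^sup>2" for t
      using power_mono[OF Cauchy_Schwarz_ineq2[of p "g t"], of 2] by (simp add: power_mult_distrib)
    then have "(\<integral>\<^sup>+ t. ennreal ((norm (p \<bullet> g t))\<^sup>2) \<partial>leb01) \<le> (\<integral>\<^sup>+ t. ennreal ((norm p)\<^sup>2) * ennreal ((norm (g t))\<^sup>2) \<partial>leb01)"
      by (intro nn_integral_mono) (simp add: ennreal_mult[symmetric] ennreal_leI)
    also have "\<dots> = ennreal ((norm p)\<^sup>2) * (\<integral>\<^sup>+ t. ennreal ((norm (g t))\<^sup>2) \<partial>leb01)" by (simp add: nn_integral_cmult)
    also have "\<dots> < \<infinity>" using L2D(2)[OF g] by (simp add: ennreal_mult_less_top)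
    finally show "(\<integral>\<^sup>+ t. ennreal ((norm (p \<bullet> g t))\<^sup>2) \<partial>leb01) < \<infinity>" .
  qed
  from integral_Cauchy_Schwarz[OF this ab]
  have "ennreal ((norm (integral {a..b} (\<lambda>t. p \<bullet> g t)))\<^sup>2) \<le> ennreal (b - a) * (\<integral>\<^sup>+ t. ennreal ((norm (p \<bullet> g t))\<^sup>2) * indicator {a..<b} t \<partial>leb01)" .
  also have "integral {a..b} (\<lambda>t. p \<bullet> g t) = p \<bullet> integral {a..b} g"
    using integral_linear[OF L2_integrable_on[OF g ab(1,3)] bounded_linear_inner_right[of p]] by (simp add: o_def)
  also have "ennreal (b - a) * (\<integral>\<^sup>+ t. ennreal ((norm (p \<bullet> g t))\<^sup>2) * indicator {a..<b} t \<partial>leb01)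
      \<le> ennreal (b - a) * (\<integral>\<^sup>+ t. dual_sq P (g t) * indicator {a..<b} t \<partial>leb01)"
    using dual_sq_upper[OF p] by (intro mult_left_mono nn_integral_mono mult_right_mono) auto
  finally show "ennreal ((p \<bullet> integral {a..b} g)\<^sup>2) \<le> ennreal (b - a) * (\<integral>\<^sup>+ t. dual_sq P (g t) * indicator {a..<b} t \<partial>leb01)"
    by simp
qed

lemma sum_power2_add_le:
  fixes N :: "nat \<Rightarrow> real"
  assumes N: "\<And>k. k < n \<Longrightarrow> 0 \<le> N k" and I: "(\<Sum>k<n. real n * (N k)\<^sup>2) \<le> I" and c: "0 \<le> c" and n: "0 < n"
  shows "(\<Sum>k<n. real n * (N k + c)\<^sup>2) \<le> I + 2 * (c * real n) * sqrt I + (c * real n)\<^sup>2"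
proof -
  have I0: "0 \<le> I" by (rule order_trans[OF _ I]) (intro sum_nonneg, simp)
  have "(\<Sum>k<n. N k * 1)\<^sup>2 \<le> (\<Sum>k<n. (N k)\<^sup>2) * (\<Sum>k<n. 1\<^sup>2)" by (rule Cauchy_Schwarz_ineq_sum)
  also have "\<dots> = (\<Sum>k<n. real n * (N k)\<^sup>2)" by (simp add: sum_distrib_left mult.commute)
  finally have "(\<Sum>k<n. N k)\<^sup>2 \<le> I" using I by simp
  then have s: "(\<Sum>k<n. N k) \<le> sqrt I" by (rule real_le_rsqrt)
  have "(\<Sum>k<n. real n * (N k + c)\<^sup>2) = (\<Sum>k<n. real n * (N k)\<^sup>2 + 2 * (c * real n) * N k + c\<^sup>2 * real n)"
    by (rule sum.cong) (auto simp: power2_sum algebra_simps)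
  also have "\<dots> = (\<Sum>k<n. real n * (N k)\<^sup>2) + 2 * (c * real n) * (\<Sum>k<n. N k) + (c * real n)\<^sup>2"
    unfolding sum.distrib sum_distrib_left[symmetric] by (simp add: power2_eq_square)
  also have "\<dots> \<le> I + 2 * (c * real n) * sqrt I + (c * real n)\<^sup>2"
    using I s c by (intro add_mono mult_left_mono) auto
  finally show ?thesis .
qed

text \<open>A curve that stays in \<open>{\<phi> = 0}\<close> after rescaling pays no penalty.\<close>

lemma F_eps_constant_phase:
  fixes W :: "real \<Rightarrow> real^2"
  assumes c: "continuous_on {0..1} W" and E: "\<And>N. N \<ge> N0 \<Longrightarrow> energy (2^N) W \<le> E"
    and z: "\<And>t. t \<in> {0..1} \<Longrightarrow> \<phi> (W t /\<^sub>R \<epsilon>) = 0"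
  shows "F_eps \<delta> \<phi> \<epsilon> W \<le> ennreal E"
proof -
  obtain g where g: "g \<in> L2" and Wg: "\<And>t. t \<in> {0..1} \<Longrightarrow> W t = W 0 + integral {0..t} g"
    and gE: "(\<integral>\<^sup>+ t. ennreal ((norm (g t))\<^sup>2) \<partial>leb01) \<le> ennreal E"
    using dyadic_energy_imp_primitive_ex[OF c E] by blast
  have "AE t in leb01. W t = W t" by simp
  then have H: "W \<in> H1" "\<And>t. t \<in> {0..1} \<Longrightarrow> cont_rep W t = W t" "AE t in leb01. weak_deriv W t = g t"
    using primitive_H1[OF continuous_L2[OF c] g Wg] by blast+
  have "F_eps \<delta> \<phi> \<epsilon> W = (\<integral>\<^sup>+ t. ennreal ((norm (g t))\<^sup>2) \<partial>leb01)"
    unfolding F_eps_def if_P[OF H(1)]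
  proof (rule nn_integral_cong_AE, use H(3) AE_leb01_less1 in eventually_elim)
    case (elim t)
    have "((\<lambda>s. \<phi> (cont_rep W s /\<^sub>R \<epsilon>)) has_real_derivative 0) (at t)"
    proof (rule has_field_derivative_transform_within_open[of "\<lambda>_. 0" 0 t "{0<..<1}"])
      show "0 = \<phi> (cont_rep W s /\<^sub>R \<epsilon>)" if "s \<in> {0<..<1}" for s using that z H(2) by simp
    qed (use elim in auto)
    then have "deriv (\<lambda>s. \<phi> (cont_rep W s /\<^sub>R \<epsilon>)) t = 0" by (rule DERIV_imp_deriv)
    with elim show ?case by simp
  qed
  with gE show ?thesis by simp
qed

lemma grid_cover:
  assumes n0: "0 < n" and t: "t \<in> {0..1}"
  shows "\<exists>k<n. t \<in> {real k / real n..real (Suc k) / real n}"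
proof (cases "t = 1")
  case True
  have "real n / real n = 1" using n0 by simp
  moreover have "real (n - 1) / real n \<le> 1" using n0 by simp
  ultimately have "t \<in> {real (n - 1) / real n..real (Suc (n - 1)) / real n}" using True n0 by simp
  then show ?thesis using n0 by (intro exI[of _ "n - 1"]) auto
next
  case False
  define k where "k = nat \<lfloor>real n * t\<rfloor>"
  have "real k = real_of_int \<lfloor>real n * t\<rfloor>" using t by (simp add: k_def)
  then have k: "real k \<le> real n * t" "real n * t \<le> real (Suc k)" by linarith+
  have "real n * t < real n" using False t n0 by simp
  then have "real k < real n" using k(1) by linarith
  moreover have "t \<in> {real k / real n..real (Suc k) / real n}"
    using k n0 by (simp add: pos_divide_le_eq pos_le_divide_eq mult.commute)
  ultimately show ?thesis by auto
qed

text \<open>Following level paths between nodes at the grid points gives a competitor whose energy is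
  that of the grid slopes, up to the cost of reaching the nodes.\<close>

lemma grid_competitor:
  fixes \<phi> :: "real^2 \<Rightarrow> real" and v :: "real \<Rightarrow> real^2" and X :: "nat \<Rightarrow> real^2"
  assumes e: "0 < \<epsilon>" and n: "n = 2^Q"
    and path: "\<And>k. k \<le> n \<Longrightarrow> level_path \<phi> (X k) (X (Suc k)) (l k)"
  obtains W where "continuous_on {0..1} W" "\<And>t. t \<in> {0..1} \<Longrightarrow> \<phi> (W t /\<^sub>R \<epsilon>) = 0"
    "\<And>N. N \<ge> Q \<Longrightarrow> energy (2^N) W \<le> (\<Sum>k<n. real n * (\<epsilon> * l k)\<^sup>2)"
    "\<And>k t. k < n \<Longrightarrow> t \<in> {real k / real n..real (Suc k) / real n} \<Longrightarrow> norm (W t - \<epsilon> *\<^sub>R X k) \<le> \<epsilon> * l k"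
proof -
  have n0: "0 < n" using n by simp
  have l0: "0 \<le> l k" if "k \<le> n" for k using path[OF that] by (simp add: level_path_def)
  have "\<forall>k\<in>{..n}. \<exists>\<gamma>. \<gamma> 0 = X k \<and> \<gamma> (l k) = X (Suc k) \<and> 1-lipschitz_on {0..l k} \<gamma> \<and> (\<forall>s\<in>{0..l k}. \<phi> (\<gamma> s) = 0)"
    using path by (auto simp: level_path_def)
  then have "\<exists>\<gamma>. \<forall>k\<in>{..n}. \<gamma> k 0 = X k \<and> \<gamma> k (l k) = X (Suc k) \<and> 1-lipschitz_on {0..l k} (\<gamma> k) \<and> (\<forall>s\<in>{0..l k}. \<phi> (\<gamma> k s) = 0)"
    by (rule bchoice)
  then obtain \<gamma> where \<gamma>0: "\<forall>k\<in>{..n}. \<gamma> k 0 = X k \<and> \<gamma> k (l k) = X (Suc k) \<and> 1-lipschitz_on {0..l k} (\<gamma> k) \<and> (\<forall>s\<in>{0..l k}. \<phi> (\<gamma> k s) = 0)"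
    by blast
  have \<gamma>: "\<And>k. k \<le> n \<Longrightarrow> \<gamma> k 0 = X k" "\<And>k. k \<le> n \<Longrightarrow> \<gamma> k (l k) = X (Suc k)"
    "\<And>k. k \<le> n \<Longrightarrow> 1-lipschitz_on {0..l k} (\<gamma> k)" "\<And>k s. k \<le> n \<Longrightarrow> s \<in> {0..l k} \<Longrightarrow> \<phi> (\<gamma> k s) = 0"
    using \<gamma>0 by auto
  define W where "W t = \<epsilon> *\<^sub>R \<gamma> (nat \<lfloor>real n * t\<rfloor>) (l (nat \<lfloor>real n * t\<rfloor>) * (real n * t - real (nat \<lfloor>real n * t\<rfloor>)))" for t
  let ?I = "\<lambda>k. {real k / real n..real (Suc k) / real n}"
  have param: "0 \<le> real n * t - real k \<and> real n * t - real k \<le> 1" if "t \<in> ?I k" for k t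
  proof -
    have "real k \<le> real n * t" "real n * t \<le> real (Suc k)"
      using that n0 by (auto simp: pos_divide_le_eq pos_le_divide_eq mult.commute simp del: of_nat_Suc)
    then show ?thesis by simp
  qed
  have arg: "l k * (real n * t - real k) \<in> {0..l k}" if "t \<in> ?I k" "k \<le> n" for k t
    using param[OF that(1)] l0[OF that(2)] by (auto intro: mult_left_le)
  have Weq: "W t = \<epsilon> *\<^sub>R \<gamma> k (l k * (real n * t - real k))" if k: "k < n" and t: "t \<in> ?I k" for k t
  proof (cases "real n * t - real k = 1")
    case False
    then have "\<lfloor>real n * t\<rfloor> = int k" using param[OF t] by (simp add: floor_eq_iff)
    then show ?thesis by (simp add: W_def)
  next
    case True
    then have fl: "\<lfloor>real n * t\<rfloor> = int (Suc k)" by (simp add: floor_eq_iff)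
    have z: "real n * t - real (Suc k) = 0" using True by simp
    have "W t = \<epsilon> *\<^sub>R \<gamma> (Suc k) (l (Suc k) * (real n * t - real (Suc k)))" unfolding W_def fl nat_int ..
    also have "\<dots> = \<epsilon> *\<^sub>R X (Suc k)" unfolding z using k \<gamma>(1)[of "Suc k"] by simp
    also have "\<dots> = \<epsilon> *\<^sub>R \<gamma> k (l k * (real n * t - real k))" unfolding True using k \<gamma>(2)[of k] by simp
    finally show ?thesis .
  qed
  have Wlip: "norm (W t - W s) \<le> \<epsilon> * (l k * (real n * \<bar>t - s\<bar>))" if k: "k < n" and st: "s \<in> ?I k" "t \<in> ?I k" for k s t
  proof -
    have "dist (\<gamma> k (l k * (real n * t - real k))) (\<gamma> k (l k * (real n * s - real k)))
        \<le> 1 * dist (l k * (real n * t - real k)) (l k * (real n * s - real k))"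
      using k by (intro lipschitz_onD[OF \<gamma>(3)] arg st) auto
    also have "\<dots> = \<bar>l k * (real n * (t - s))\<bar>" by (simp add: dist_real_def algebra_simps)
    also have "\<dots> = l k * (real n * \<bar>t - s\<bar>)" using l0[of k] k by (simp add: abs_mult)
    finally have "norm (\<gamma> k (l k * (real n * t - real k)) - \<gamma> k (l k * (real n * s - real k))) \<le> l k * (real n * \<bar>t - s\<bar>)"
      by (simp only: dist_norm)
    then show ?thesis
      unfolding Weq[OF k st(1)] Weq[OF k st(2)] scaleR_diff_right[symmetric] norm_scaleR using e by simp
  qed
  have cover: "\<exists>k<n. t \<in> ?I k" if t: "t \<in> {0..1}" for t
    by (rule grid_cover[OF n0 t])
  have Wc: "continuous_on {0..1} W"
  proof -
    have "continuous_on (\<Union>k\<in>{..<n}. ?I k) W"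
    proof (rule continuous_on_closed_Union)
      fix k assume "k \<in> {..<n}"
      then have k: "k < n" by simp
      have "(\<epsilon> * (l k * real n))-lipschitz_on (?I k) W"
        using Wlip[OF k] l0[of k] k e by (intro lipschitz_onI) (auto simp: dist_norm mult.assoc)
      then show "continuous_on (?I k) W" by (rule lipschitz_on_continuous_on)
    qed auto
    then show ?thesis by (rule continuous_on_subset) (use cover in blast)
  qed
  have Wz: "\<phi> (W t /\<^sub>R \<epsilon>) = 0" if t: "t \<in> {0..1}" for t
  proof -
    obtain k where k: "k < n" "t \<in> ?I k" using cover[OF t] by blast
    show ?thesis unfolding Weq[OF k] using \<gamma>(4)[OF _ arg[OF k(2)]] k e by simp
  qed
  have WE: "energy (2^N) W \<le> (\<Sum>k<n. real n * (\<epsilon> * l k)\<^sup>2)" if N: "N \<ge> Q" for N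
  proof -
    define r where "r = (2::nat)^(N - Q)"
    have "(2::nat)^(Q + (N - Q)) = n * r" unfolding n r_def by (rule power_add)
    then have M: "(2::nat)^N = n * r" using N by simp
    have r0: "0 < r" by (simp add: r_def)
    have cell: "norm (grid_slope (n * r) W i) \<le> \<epsilon> * l k * real n" if k: "k < n" and i: "i \<in> {k * r..<k * r + r}" for k i
    proof -
      have c: "k * r \<le> i" "Suc i \<le> Suc k * r" using i by auto
      have krg: "real j / real n = real (j * r) / real (n * r)" for j using r0 by simp
      note kr = krg[of k] krg[of "Suc k"]
      have 1: "real k / real n \<le> real i / real (n * r)" unfolding kr using c(1)
        by (intro divide_right_mono) (simp_all only: of_nat_le_iff of_nat_0_le_iff)
      have 2: "real (Suc i) / real (n * r) \<le> real (Suc k) / real n" unfolding kr using c(2)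
        by (intro divide_right_mono) (simp_all only: of_nat_le_iff of_nat_0_le_iff)
      have 3: "real i / real (n * r) \<le> real (Suc i) / real (n * r)" by (intro divide_right_mono) auto
      have len: "real (Suc i) / real (n * r) - real i / real (n * r) = 1 / real (n * r)" by (simp add: add_divide_distrib)
      have "norm (W (real (Suc i) / real (n * r)) - W (real i / real (n * r))) \<le> \<epsilon> * (l k * (real n * \<bar>real (Suc i) / real (n * r) - real i / real (n * r)\<bar>))"
      proof (rule Wlip[OF k])
        show "real i / real (n * r) \<in> ?I k" unfolding atLeastAtMost_iff using 1 order_trans[OF 3 2] by blast
        show "real (Suc i) / real (n * r) \<in> ?I k" unfolding atLeastAtMost_iff using 2 order_trans[OF 1 3] by blast
      qed
      then have "real (n * r) * norm (W (real (Suc i) / real (n * r)) - W (real i / real (n * r))) \<le> real (n * r) * (\<epsilon> * (l k * (real n * (1 / real (n * r)))))"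
        unfolding len by (intro mult_left_mono) auto
      also have "\<dots> = \<epsilon> * l k * real n" using n0 r0 by simp
      finally show ?thesis by (simp only: grid_slope_def norm_scaleR abs_of_nat)
    qed
    have "(\<Sum>i<n * r. (norm (grid_slope (n * r) W i))\<^sup>2) = (\<Sum>k<n. \<Sum>i\<in>{k * r..<k * r + r}. (norm (grid_slope (n * r) W i))\<^sup>2)"
      by (simp only: sum.nat_group)
    also have "\<dots> \<le> (\<Sum>k<n. \<Sum>i\<in>{k * r..<k * r + r}. (\<epsilon> * l k * real n)\<^sup>2)"
      by (intro sum_mono power_mono cell) auto
    also have "\<dots> = (\<Sum>k<n. real r * (\<epsilon> * l k * real n)\<^sup>2)" by simp
    also have "\<dots> = real (n * r) * (\<Sum>k<n. real n * (\<epsilon> * l k)\<^sup>2)"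
      unfolding sum_distrib_left by (rule sum.cong) (auto simp: power_mult_distrib power2_eq_square)
    finally have "energy (n * r) W \<le> real (n * r) * (\<Sum>k<n. real n * (\<epsilon> * l k)\<^sup>2) / real (n * r)"
      unfolding energy_def by (rule divide_right_mono) simp
    then show ?thesis unfolding M using n0 r0 by simp
  qed
  have Wd: "norm (W t - \<epsilon> *\<^sub>R X k) \<le> \<epsilon> * l k" if k: "k < n" and t: "t \<in> ?I k" for k t
  proof -
    have k0: "real k / real n \<in> ?I k" using grid_bounds(2)[OF k] by simp
    have "W (real k / real n) = \<epsilon> *\<^sub>R X k"
      unfolding Weq[OF k k0] using n0 k \<gamma>(1)[of k] by simp
    then have "norm (W t - \<epsilon> *\<^sub>R X k) \<le> \<epsilon> * (l k * (real n * \<bar>t - real k / real n\<bar>))"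
      using Wlip[OF k k0 t] by simp
    also have "real n * \<bar>t - real k / real n\<bar> = real n * t - real k"
    proof -
      have "\<bar>t - real k / real n\<bar> = t - real k / real n" using t by simp
      then show ?thesis using n0 by (simp add: right_diff_distrib)
    qed
    also have "\<epsilon> * (l k * (real n * t - real k)) \<le> \<epsilon> * l k"
      using e arg[OF t] k by simp
    finally show ?thesis .
  qed
  from that[OF Wc Wz WE Wd] show ?thesis .
qed

text \<open>The grid must be fine in the limit, but its spacing must dominate \<open>\<epsilon>\<close>, since each grid
  point costs an additional length of order \<open>\<epsilon>\<close>.\<close>

lemma slow_refinement:
  fixes e :: "nat \<Rightarrow> real"
  assumes e: "\<And>j. 0 < e j" "e \<longlonglongrightarrow> 0"
  obtains q :: "nat \<Rightarrow> nat" where "(\<lambda>j. e j * 2 ^ q j) \<longlonglongrightarrow> 0" "(\<lambda>j. 1 / 2 ^ q j :: real) \<longlonglongrightarrow> 0"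
proof -
  define S where "S j = {q. q \<le> j \<and> e j * 4 ^ q \<le> 1}" for j
  define q where "q j = Max (insert 0 (S j))" for j
  have fin: "finite (insert 0 (S j))" for j
    by (rule finite.insertI, rule finite_subset[of _ "{..j}"]) (auto simp: S_def)
  have large: "eventually (\<lambda>j. m \<le> q j) sequentially" for m
  proof -
    have "(\<lambda>j. e j * 4 ^ m) \<longlonglongrightarrow> 0 * 4 ^ m" by (intro tendsto_intros e)
    then have "eventually (\<lambda>j. e j * 4 ^ m < 1) sequentially" by (rule order_tendstoD) simp
    with eventually_ge_at_top[of m] show ?thesis
      by eventually_elim (auto simp: q_def S_def intro!: Max_ge[OF fin, unfolded S_def])
  qed
  have small: "eventually (\<lambda>j. e j * 4 ^ q j \<le> 1) sequentially"
  proof -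
    have "eventually (\<lambda>j. e j < 1) sequentially" using e(2) by (rule order_tendstoD) simp
    then show ?thesis
    proof eventually_elim
      case (elim j)
      have "q j \<in> insert 0 (S j)" unfolding q_def by (rule Max_in[OF fin]) simp
      then show ?case using elim by (auto simp: S_def)
    qed
  qed
  have "filterlim q at_top sequentially" unfolding filterlim_at_top using large by blast
  then have "((\<lambda>n. (1/2::real) ^ n) \<circ> q) \<longlonglongrightarrow> 0"
    unfolding o_def by (rule filterlim_compose[rotated]) (rule LIMSEQ_power_zero, simp)
  then have h: "(\<lambda>j. 1 / 2 ^ q j :: real) \<longlonglongrightarrow> 0" by (simp add: o_def power_divide)
  have "(\<lambda>j. e j * 2 ^ q j) \<longlonglongrightarrow> 0"
  proof (rule Lim_null_comparison[OF _ h])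
    show "eventually (\<lambda>j. norm (e j * 2 ^ q j) \<le> 1 / 2 ^ q j) sequentially"
      using small
    proof eventually_elim
      case (elim j)
      have "(4::real) ^ q j = 2 ^ q j * 2 ^ q j" by (simp flip: power_mult_distrib)
      then show ?case using elim e(1)[of j] by (simp add: pos_le_divide_eq mult.assoc)
    qed
  qed
  from that[OF this h] show ?thesis .
qed

text \<open>The curve joins the nodes of the rescaled grid values \<open>u(k/n)/\<epsilon>\<close>. By Jensen the lengths add up to the
  limit energy, and the additive constants contribute terms in \<open>\<epsilon> C n\<close>.\<close>

lemma recovery_function:
  fixes \<phi> :: "real^2 \<Rightarrow> real" and u :: "real \<Rightarrow> real^2"
  assumes P: "P \<noteq> {}" and coercive: "\<And>w. ennreal ((norm w)\<^sup>2) \<le> dual_sq P w"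
    and nd: "\<And>x. norm (nd x - x) \<le> C"
    and path: "\<And>x y. dual_sq P (y - x) < \<infinity> \<Longrightarrow> \<exists>l. level_path \<phi> (nd x) (nd y) l \<and> l \<le> sqrt (enn2real (dual_sq P (y - x))) + C"
    and u: "u \<in> H1" and I: "(\<integral>\<^sup>+ t. dual_sq P (weak_deriv u t) \<partial>leb01) = ennreal I" "0 \<le> I"
    and e: "0 < \<epsilon>" and n: "n = 2^Q"
  shows "\<exists>W. W \<in> L2 \<and> F_eps \<delta> \<phi> \<epsilon> W \<le> ennreal (I + 2 * (\<epsilon> * C * real n) * sqrt I + (\<epsilon> * C * real n)\<^sup>2) \<and>
    (\<forall>t\<in>{0..1}. norm (W t - cont_rep u t) \<le> 2 * sqrt (I / real n) + 2 * (\<epsilon> * C))"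
proof -
  have n0: "0 < n" using n by simp
  have C0: "0 \<le> C" using nd[of 0] norm_ge_zero order_trans by blast
  define v where "v = cont_rep u"
  define g where "g = weak_deriv u"
  have g: "g \<in> L2" using H1_repr(1)[OF u] by (simp add: g_def)
  have vg: "\<And>t. t \<in> {0..1} \<Longrightarrow> v t = v 0 + integral {0..t} g"
    unfolding v_def g_def by (rule H1_repr(2)[OF u])
  have [measurable]: "g \<in> borel_measurable leb01" by (rule L2D(1)[OF g])
  let ?t = "\<lambda>k. real k / real n"
  define J where "J k = dual_sq P (v (?t (Suc k)) - v (?t k))" for k
  have J: "ennreal (real n) * J k \<le> (\<integral>\<^sup>+ t. dual_sq P (g t) * indicator {?t k..<?t (Suc k)} t \<partial>leb01)" if k: "k < n" for k
  proof -
    note gb = grid_bounds(1-3)[OF k]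
    have len: "?t (Suc k) - ?t k = 1 / real n" by (simp add: add_divide_distrib)
    have "v (?t (Suc k)) - v (?t k) = integral {?t k..?t (Suc k)} g" by (rule primitive_diff[OF g vg gb])
    then have "ennreal (real n) * J k \<le> ennreal (real n) * (ennreal (1 / real n) * (\<integral>\<^sup>+ t. dual_sq P (g t) * indicator {?t k..<?t (Suc k)} t \<partial>leb01))"
      using integral_dual_sq_le[OF P g gb] unfolding J_def len by (intro mult_left_mono) auto
    also have "\<dots> = ennreal (real n * (1 / real n)) * (\<integral>\<^sup>+ t. dual_sq P (g t) * indicator {?t k..<?t (Suc k)} t \<partial>leb01)"
      by (subst ennreal_mult) (auto simp: mult.assoc)
    finally show ?thesis using n0 by simp
  qed
  have Jsum: "(\<Sum>k<n. ennreal (real n) * J k) \<le> ennreal I"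
  proof -
    have "(\<Sum>k<n. ennreal (real n) * J k) \<le> (\<Sum>k<n. \<integral>\<^sup>+ t. dual_sq P (g t) * indicator {?t k..<?t (Suc k)} t \<partial>leb01)"
      by (intro sum_mono J) simp
    also have "\<dots> \<le> (\<integral>\<^sup>+ t. dual_sq P (g t) \<partial>leb01)"
      by (rule sum_grid_integral_le[OF n0]) measurable
    finally show ?thesis using I by (simp add: g_def)
  qed
  have Jfin: "J k < \<infinity>" if k: "k < n" for k
  proof -
    have "ennreal (real n) * J k \<le> (\<Sum>k<n. ennreal (real n) * J k)" by (rule member_le_sum) (use k in auto)
    from le_less_trans[OF order_trans[OF this Jsum] ennreal_less_top]
    have "ennreal (real n) * J k < \<infinity>" by simp
    then show ?thesis using n0 by (auto simp: ennreal_mult_less_top)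
  qed
  define N where "N k = sqrt (enn2real (J k))" for k
  have N0: "0 \<le> N k" for k by (simp add: N_def)
  have N2: "ennreal ((N k)\<^sup>2) = J k" if "k < n" for k
    using Jfin[OF that] by (simp add: N_def)
  have Nsum: "(\<Sum>k<n. real n * (N k)\<^sup>2) \<le> I"
  proof -
    have "ennreal (\<Sum>k<n. real n * (N k)\<^sup>2) = (\<Sum>k<n. ennreal (real n * (N k)\<^sup>2))"
      by (rule sum_ennreal[symmetric]) simp
    also have "\<dots> = (\<Sum>k<n. ennreal (real n) * J k)"
      by (rule sum.cong) (auto simp: ennreal_mult N2)
    finally have "ennreal (\<Sum>k<n. real n * (N k)\<^sup>2) \<le> ennreal I" using Jsum by simp
    then show ?thesis using I(2) by (simp add: ennreal_le_iff)
  qed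
  define x where "x k = v (min 1 (?t k)) /\<^sub>R \<epsilon>" for k
  have xk: "x k = v (?t k) /\<^sub>R \<epsilon>" if "k \<le> n" for k
    using that n0 by (simp add: x_def min_def)
  have ex: "\<exists>l. level_path \<phi> (nd (x k)) (nd (x (Suc k))) l \<and> (k < n \<longrightarrow> \<epsilon> * l \<le> N k + \<epsilon> * C)" if k: "k \<le> n" for k
  proof (cases "k < n")
    case True
    have "x (Suc k) - x k = (1 / \<epsilon>) *\<^sub>R (v (?t (Suc k)) - v (?t k))"
      using xk[of k] xk[of "Suc k"] True by (simp add: scaleR_diff_right divide_inverse)
    then have "dual_sq P (x (Suc k) - x k) = ennreal ((1 / \<epsilon>)\<^sup>2) * J k"
      by (simp only: dual_sq_scaleR[OF P] J_def)
    also have "\<dots> = ennreal ((1 / \<epsilon>)\<^sup>2) * ennreal ((N k)\<^sup>2)" by (simp only: N2[OF True])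
    also have "\<dots> = ennreal ((1 / \<epsilon>)\<^sup>2 * (N k)\<^sup>2)" by (rule ennreal_mult[symmetric]) simp_all
    also have "(1 / \<epsilon>)\<^sup>2 * (N k)\<^sup>2 = (N k / \<epsilon>)\<^sup>2" by (simp add: power_divide)
    finally have d: "dual_sq P (x (Suc k) - x k) = ennreal ((N k / \<epsilon>)\<^sup>2)" .
    then obtain l where l: "level_path \<phi> (nd (x k)) (nd (x (Suc k))) l" "l \<le> sqrt (enn2real (dual_sq P (x (Suc k) - x k))) + C"
      using path[of "x (Suc k)" "x k"] by auto
    have "sqrt (enn2real (dual_sq P (x (Suc k) - x k))) = N k / \<epsilon>"
      unfolding d using N0[of k] e by (simp add: real_sqrt_abs)
    then have "\<epsilon> * l \<le> \<epsilon> * (N k / \<epsilon> + C)" using l(2) e by (intro mult_left_mono) auto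
    also have "\<dots> = N k + \<epsilon> * C" using e by (simp add: distrib_left)
    finally show ?thesis using l(1) by blast
  next
    case False
    then have "x (Suc k) = x k" using k n0 by (simp add: x_def min_def divide_simps)
    moreover have "dual_sq P 0 = 0" using dual_sq_scaleR[OF P, of 0 0] by simp
    ultimately show ?thesis using path[of "x (Suc k)" "x k"] False by auto
  qed
  have "\<forall>k\<in>{..n}. \<exists>l. level_path \<phi> (nd (x k)) (nd (x (Suc k))) l \<and> (k < n \<longrightarrow> \<epsilon> * l \<le> N k + \<epsilon> * C)"
    using ex by blast
  from bchoice[OF this] obtain l where "\<forall>k\<in>{..n}. level_path \<phi> (nd (x k)) (nd (x (Suc k))) (l k) \<and> (k < n \<longrightarrow> \<epsilon> * l k \<le> N k + \<epsilon> * C)"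
    by blast
  then have l: "\<And>k. k \<le> n \<Longrightarrow> level_path \<phi> (nd (x k)) (nd (x (Suc k))) (l k)"
    "\<And>k. k < n \<Longrightarrow> \<epsilon> * l k \<le> N k + \<epsilon> * C" by auto
  have l0: "0 \<le> \<epsilon> * l k" if "k < n" for k using l(1)[of k] that e by (simp add: level_path_def)
  have El: "(\<Sum>k<n. real n * (\<epsilon> * l k)\<^sup>2) \<le> I + 2 * (\<epsilon> * C * real n) * sqrt I + (\<epsilon> * C * real n)\<^sup>2"
  proof -
    have "(\<Sum>k<n. real n * (\<epsilon> * l k)\<^sup>2) \<le> (\<Sum>k<n. real n * (N k + \<epsilon> * C)\<^sup>2)"
      by (intro sum_mono mult_left_mono power_mono l l0) auto
    also have "\<dots> \<le> I + 2 * (\<epsilon> * C * real n) * sqrt I + (\<epsilon> * C * real n)\<^sup>2"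
      by (rule sum_power2_add_le[OF N0 Nsum _ n0]) (use e C0 in auto)
    finally show ?thesis .
  qed
  show ?thesis
  proof (rule grid_competitor[of \<epsilon> n Q \<phi> "\<lambda>k. nd (x k)" l, OF e n l(1)])
    fix W
    assume Wc: "continuous_on {0..1} W" and Wz: "\<And>t. t \<in> {0..1} \<Longrightarrow> \<phi> (W t /\<^sub>R \<epsilon>) = 0"
      and WE: "\<And>N. N \<ge> Q \<Longrightarrow> energy (2^N) W \<le> (\<Sum>k<n. real n * (\<epsilon> * l k)\<^sup>2)"
      and Wd: "\<And>k t. k < n \<Longrightarrow> t \<in> {?t k..?t (Suc k)} \<Longrightarrow> norm (W t - \<epsilon> *\<^sub>R nd (x k)) \<le> \<epsilon> * l k"
    have "F_eps \<delta> \<phi> \<epsilon> W \<le> ennreal (I + 2 * (\<epsilon> * C * real n) * sqrt I + (\<epsilon> * C * real n)\<^sup>2)"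
      using F_eps_constant_phase[of W Q _ \<phi> \<epsilon>, OF Wc order_trans[OF WE El] Wz] by blast
    moreover have "norm (W t - v t) \<le> 2 * sqrt (I / real n) + 2 * (\<epsilon> * C)" if t: "t \<in> {0..1}" for t
    proof -
      from grid_cover[OF n0 t] obtain k where k: "k < n" "t \<in> {?t k..?t (Suc k)}" by blast
      note gb = grid_bounds(1-3)[OF k(1)]
      have "real n * (N k)\<^sup>2 \<le> I"
        by (rule order_trans[OF member_le_sum[of k "{..<n}" "\<lambda>k. real n * (N k)\<^sup>2"] Nsum]) (use k in auto)
      then have Nk: "N k \<le> sqrt (I / real n)" using n0 by (intro real_le_rsqrt) (simp add: pos_le_divide_eq mult.commute)
      have "(norm (v t - v (?t k)))\<^sup>2 \<le> I * (t - ?t k)"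
        unfolding v_def
      proof (rule H1_Holder[OF u _ I(2)])
        show "(\<integral>\<^sup>+ t. ennreal ((norm (weak_deriv u t))\<^sup>2) \<partial>leb01) \<le> ennreal I"
          unfolding I(1)[symmetric] by (intro nn_integral_mono coercive)
      qed (use k gb t in auto)
      also have "\<dots> \<le> I * (1 / real n)"
      proof (rule mult_left_mono[OF _ I(2)])
        have "?t (Suc k) - ?t k = 1 / real n" by (simp add: add_divide_distrib)
        then show "t - ?t k \<le> 1 / real n" using k by auto
      qed
      finally have vk: "norm (v t - v (?t k)) \<le> sqrt (I / real n)" by (intro real_le_rsqrt) simp
      have "\<epsilon> *\<^sub>R nd (x k) - v (?t k) = \<epsilon> *\<^sub>R (nd (x k) - x k)"
        using xk[of k] k e by (simp add: scaleR_diff_right)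
      then have "norm (\<epsilon> *\<^sub>R nd (x k) - v (?t k)) \<le> \<epsilon> * C" using nd[of "x k"] e by simp
      moreover have "norm (W t - v t) \<le> norm (W t - \<epsilon> *\<^sub>R nd (x k)) + norm (\<epsilon> *\<^sub>R nd (x k) - v (?t k)) + norm (v (?t k) - v t)"
        using norm_triangle_ineq[of "W t - \<epsilon> *\<^sub>R nd (x k)" "\<epsilon> *\<^sub>R nd (x k) - v t"]
          norm_triangle_ineq[of "\<epsilon> *\<^sub>R nd (x k) - v (?t k)" "v (?t k) - v t"] by simp
      ultimately show ?thesis using Wd[OF k] l(2)[OF k(1)] Nk vk by (simp add: norm_minus_commute)
    qed
    ultimately show ?thesis using continuous_L2[OF Wc] by (auto simp: v_def)
  qed
qed

theorem Gamma_limsup_inequality: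
  fixes \<phi> :: "real^2 \<Rightarrow> real" and u :: "real \<Rightarrow> real^2"
  assumes P: "P \<noteq> {}" and coercive: "\<And>w. ennreal ((norm w)\<^sup>2) \<le> dual_sq P w"
    and nd: "\<And>x. norm (nd x - x) \<le> C"
    and path: "\<And>x y. dual_sq P (y - x) < \<infinity> \<Longrightarrow> \<exists>l. level_path \<phi> (nd x) (nd y) l \<and> l \<le> sqrt (enn2real (dual_sq P (y - x))) + C"
    and e: "\<And>j. 0 < e j" "e \<longlonglongrightarrow> 0" and u: "u \<in> L2"
  shows "\<exists>U. (\<forall>j. U j \<in> L2) \<and> L2_tendsto U u \<and> limsup (\<lambda>j. F_eps \<delta> \<phi> (e j) (U j)) \<le> F_lim (dual_sq P) u"
proof (cases "F_lim (dual_sq P) u = \<infinity>")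
  case True
  then show ?thesis by (intro exI[of _ "\<lambda>_. u"]) (use u in \<open>auto simp: L2_tendsto_def\<close>)
next
  case False
  then have uH: "u \<in> H1" by (auto simp: F_lim_def split: if_splits)
  define I where "I = enn2real (F_lim (dual_sq P) u)"
  have I: "F_lim (dual_sq P) u = ennreal I" "0 \<le> I" using False by (simp_all add: I_def less_top)
  then have I': "(\<integral>\<^sup>+ t. dual_sq P (weak_deriv u t) \<partial>leb01) = ennreal I" using uH by (simp add: F_lim_def)
  obtain q where q: "(\<lambda>j. e j * 2 ^ q j) \<longlonglongrightarrow> 0" "(\<lambda>j. 1 / 2 ^ q j :: real) \<longlonglongrightarrow> 0"
    by (rule slow_refinement[OF e])
  define a where "a j = e j * C * real (2 ^ q j)" for j
  define b where "b j = 2 * sqrt (I / real (2 ^ q j)) + 2 * (e j * C)" for j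
  have "\<forall>j. \<exists>W. W \<in> L2 \<and> F_eps \<delta> \<phi> (e j) W \<le> ennreal (I + 2 * a j * sqrt I + (a j)\<^sup>2) \<and>
    (\<forall>t\<in>{0..1}. norm (W t - cont_rep u t) \<le> b j)"
    unfolding a_def b_def using recovery_function[OF P coercive nd path uH I' I(2) e(1) refl] by blast
  from choice[OF this] obtain U where U0: "\<forall>j. U j \<in> L2 \<and> F_eps \<delta> \<phi> (e j) (U j) \<le> ennreal (I + 2 * a j * sqrt I + (a j)\<^sup>2) \<and>
    (\<forall>t\<in>{0..1}. norm (U j t - cont_rep u t) \<le> b j)" by blast
  have U: "\<And>j. U j \<in> L2" "\<And>j. F_eps \<delta> \<phi> (e j) (U j) \<le> ennreal (I + 2 * a j * sqrt I + (a j)\<^sup>2)"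
    "\<And>j t. t \<in> {0..1} \<Longrightarrow> norm (U j t - cont_rep u t) \<le> b j" using U0 by auto
  have a0: "a \<longlonglongrightarrow> 0"
    using tendsto_mult_left[OF q(1), of C] by (simp add: a_def[abs_def] mult_ac)
  have b0: "b \<longlonglongrightarrow> 0"
  proof -
    have "(\<lambda>j. 2 * sqrt (I * (1 / 2 ^ q j)) + 2 * (e j * C)) \<longlonglongrightarrow> 2 * sqrt (I * 0) + 2 * (0 * C)"
      by (intro tendsto_intros q e)
    then have "(\<lambda>j. 2 * sqrt (I * (1 / 2 ^ q j)) + 2 * (e j * C)) \<longlonglongrightarrow> 0" by simp
    then show ?thesis unfolding b_def[abs_def] by simp
  qed
  have "limsup (\<lambda>j. F_eps \<delta> \<phi> (e j) (U j)) \<le> limsup (\<lambda>j. ennreal (I + 2 * a j * sqrt I + (a j)\<^sup>2))"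
    by (intro Limsup_mono always_eventually allI U)
  also have "limsup (\<lambda>j. ennreal (I + 2 * a j * sqrt I + (a j)\<^sup>2)) = ennreal (I + 2 * 0 * sqrt I + 0\<^sup>2)"
    by (intro lim_imp_Limsup trivial_limit_sequentially tendsto_ennrealI tendsto_add tendsto_mult tendsto_power tendsto_const a0)
  finally have ls: "limsup (\<lambda>j. F_eps \<delta> \<phi> (e j) (U j)) \<le> F_lim (dual_sq P) u" using I by simp
  have "L2_tendsto U u"
    unfolding L2_tendsto_def
  proof (rule tendsto_sandwich[OF _ _ tendsto_const])
    show "\<forall>\<^sub>F j in sequentially. 0 \<le> integral\<^sup>L leb01 (\<lambda>t. (norm (U j t - u t))\<^sup>2)" by (simp add: integral_nonneg_AE)
    show "(\<lambda>j. (b j)\<^sup>2) \<longlonglongrightarrow> 0" using tendsto_power[OF b0, of 2] by simp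
    show "\<forall>\<^sub>F j in sequentially. integral\<^sup>L leb01 (\<lambda>t. (norm (U j t - u t))\<^sup>2) \<le> (b j)\<^sup>2"
    proof (rule always_eventually, rule allI)
      fix j
      interpret finite_measure leb01 by (rule finite_measure_leb01)
      have "integral\<^sup>L leb01 (\<lambda>t. (norm (U j t - u t))\<^sup>2) \<le> integral\<^sup>L leb01 (\<lambda>t. (b j)\<^sup>2)"
      proof (rule integral_mono_AE)
        show "integrable leb01 (\<lambda>t. (norm (U j t - u t))\<^sup>2)" using L2_diff[OF U(1) u] by (simp add: L2_def)
        show "AE t in leb01. (norm (U j t - u t))\<^sup>2 \<le> (b j)\<^sup>2"
          using H1_repr(3)[OF uH] AE_leb01_less1
        proof eventually_elim
          case (elim t)
          then show ?case using U(3)[of t j] by (intro power_mono) auto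
        qed
      qed simp
      also have "\<dots> = (b j)\<^sup>2" by (simp add: measure_def emeasure_leb01)
      finally show "integral\<^sup>L leb01 (\<lambda>t. (norm (U j t - u t))\<^sup>2) \<le> (b j)\<^sup>2" .
    qed
  qed
  with U(1) ls show ?thesis by blast
qed

theorem Gamma_convergence_of_network:
  fixes \<phi> :: "real^2 \<Rightarrow> real"
  assumes \<phi>: "L-lipschitz_on UNIV \<phi>" and P: "P \<noteq> {}" "\<And>p. p \<in> P \<Longrightarrow> has_correctors \<phi> p"
    and coercive: "\<And>w. ennreal ((norm w)\<^sup>2) \<le> dual_sq P w"
    and nd: "\<And>x. norm (nd x - x) \<le> C"
    and path: "\<And>x y. dual_sq P (y - x) < \<infinity> \<Longrightarrow> \<exists>l. level_path \<phi> (nd x) (nd y) l \<and> l \<le> sqrt (enn2real (dual_sq P (y - x))) + C"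
    and ratio: "filterlim (\<lambda>\<epsilon>. \<delta> \<epsilon> / \<epsilon>) at_top (at_right 0)"
  shows "Gamma_converges L2 L2_tendsto (F_eps \<delta> \<phi>) (F_lim (dual_sq P))"
  unfolding Gamma_converges_def
proof (intro allI impI ballI conjI)
  fix e :: "nat \<Rightarrow> real" and u :: "real \<Rightarrow> real^2"
  assume e: "(\<forall>j. 0 < e j) \<and> e \<longlonglongrightarrow> 0" and u: "u \<in> L2"
  have "filterlim e (at_right 0) sequentially"
    using e by (auto simp: filterlim_at intro!: always_eventually) (metis less_irrefl)
  from filterlim_compose[OF ratio this] have K: "filterlim (\<lambda>j. \<delta> (e j) / e j) at_top sequentially" .
  show "F_lim (dual_sq P) u \<le> liminf (\<lambda>j. F_eps \<delta> \<phi> (e j) (U j))" if "(\<forall>j. U j \<in> L2) \<and> L2_tendsto U u" for U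
    by (rule Gamma_liminf_inequality[OF \<phi> P coercive _ _ K _ u]) (use that e in auto)
  show "\<exists>U. (\<forall>j. U j \<in> L2) \<and> L2_tendsto U u \<and> limsup (\<lambda>j. F_eps \<delta> \<phi> (e j) (U j)) \<le> F_lim (dual_sq P) u"
    by (rule Gamma_limsup_inequality[OF P(1) coercive nd path _ _ u]) (use e in auto)
qed

section \<open>Slow curves\<close>

text \<open>A profile is a periodic oscillation \<open>\<zeta>\<close> together with its arc length \<open>\<sigma>\<close>; one period has length \<open>\<mu>\<close>.\<close>

locale profile =
  fixes \<zeta> dz \<sigma> :: "real \<Rightarrow> real" and \<mu> A M :: real
  assumes dz: "\<And>s. (\<zeta> has_real_derivative dz s) (at s)"
    and dz_lip: "\<And>s s'. \<bar>dz s - dz s'\<bar> \<le> M * \<bar>s - s'\<bar>"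
    and dz_bound: "\<And>s. \<bar>dz s\<bar> \<le> M"
    and periodic: "\<And>s. \<zeta> (s + 1) = \<zeta> s"
    and small: "\<And>s z. z \<in> \<int> \<Longrightarrow> \<bar>\<zeta> s\<bar> \<le> A * \<bar>s - z\<bar>"
    and \<sigma>: "\<And>s. (\<sigma> has_real_derivative sqrt (1 + (dz s)\<^sup>2)) (at s)"
    and \<sigma>0: "\<sigma> 0 = 0" and \<sigma>1: "\<And>s. \<sigma> (s + 1) = \<sigma> s + \<mu>"
    and A0: "0 \<le> A" and M0: "0 \<le> M"
begin

text \<open>The sine of the angle between the curve and its axis.\<close>

definition q :: "real \<Rightarrow> real" where "q s = dz s / sqrt (1 + (dz s)\<^sup>2)"

lemma add_int: "\<zeta> (s + of_int z) = \<zeta> s" "\<sigma> (s + of_int z) = \<sigma> s + \<mu> * of_int z"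
proof -
  have n: "\<zeta> (s + real k) = \<zeta> s \<and> \<sigma> (s + real k) = \<sigma> s + \<mu> * real k" for k s
  proof (induction k)
    case (Suc k)
    then show ?case using periodic[of "s + real k"] \<sigma>1[of "s + real k"] by (simp add: algebra_simps)
  qed simp
  have "\<zeta> (s + of_int z) = \<zeta> s \<and> \<sigma> (s + of_int z) = \<sigma> s + \<mu> * of_int z"
  proof (cases z rule: int_cases2)
    case (nonneg k)
    then show ?thesis using n[of s k] by simp
  next
    case (nonpos k)
    then show ?thesis using n[of "s - real k" k] by simp
  qed
  then show "\<zeta> (s + of_int z) = \<zeta> s" "\<sigma> (s + of_int z) = \<sigma> s + \<mu> * of_int z" by auto
qed

lemma sqrt_lip: "\<bar>sqrt (1 + x\<^sup>2) - sqrt (1 + y\<^sup>2)\<bar> \<le> \<bar>x - y\<bar>"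
proof -
  have "\<bar>norm (Complex 1 x) - norm (Complex 1 y)\<bar> \<le> norm (Complex 1 x - Complex 1 y)"
    by (rule norm_triangle_ineq3)
  then show ?thesis by (simp add: cmod_def)
qed

lemma sqrt_ge1: "1 \<le> sqrt (1 + x\<^sup>2)" "\<bar>x\<bar> \<le> sqrt (1 + x\<^sup>2)"
  by (auto intro: real_le_rsqrt)

lemma q_bound: "\<bar>q s\<bar> \<le> 1"
proof -
  have pos: "0 < sqrt (1 + (dz s)\<^sup>2)" using sqrt_ge1(1)[of "dz s"] by linarith
  show ?thesis unfolding q_def abs_divide abs_of_pos[OF pos] divide_le_eq_1_pos[OF pos]
    by (rule sqrt_ge1(2))
qed

lemma q_lip: "\<bar>q s' - q s\<bar> \<le> 2 * M * \<bar>s' - s\<bar>"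
proof -
  define w where "w = sqrt (1 + (dz s)\<^sup>2)"
  define w' where "w' = sqrt (1 + (dz s')\<^sup>2)"
  have w: "1 \<le> w" "1 \<le> w'" "\<bar>dz s\<bar> \<le> w" "\<bar>w' - w\<bar> \<le> \<bar>dz s' - dz s\<bar>"
    using sqrt_ge1 sqrt_lip by (auto simp: w_def w'_def)
  have "q s' - q s = (dz s' - dz s) / w' + (dz s / w) * ((w - w') / w')"
    using w by (simp add: q_def w_def[symmetric] w'_def[symmetric] field_simps)
  then have "\<bar>q s' - q s\<bar> \<le> \<bar>(dz s' - dz s) / w'\<bar> + \<bar>dz s / w\<bar> * \<bar>(w - w') / w'\<bar>"
    by (simp only: abs_mult[symmetric] abs_triangle_ineq)
  also have "\<dots> \<le> \<bar>dz s' - dz s\<bar> + 1 * \<bar>dz s' - dz s\<bar>"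
  proof (intro add_mono mult_mono)
    show "\<bar>(dz s' - dz s) / w'\<bar> \<le> \<bar>dz s' - dz s\<bar>"
      using w(2) divide_left_mono[of 1 w' "\<bar>dz s' - dz s\<bar>"] by (simp add: abs_divide)
    show "\<bar>dz s / w\<bar> \<le> 1" using w by (simp add: abs_divide)
    have "\<bar>(w - w') / w'\<bar> \<le> \<bar>w - w'\<bar>"
      using w(2) divide_left_mono[of 1 w' "\<bar>w - w'\<bar>"] by (simp add: abs_divide)
    then show "\<bar>(w - w') / w'\<bar> \<le> \<bar>dz s' - dz s\<bar>" using w(4) by (simp add: abs_minus_commute)
  qed auto
  also have "\<dots> \<le> 2 * M * \<bar>s' - s\<bar>" using dz_lip[of s' s] by simp
  finally show ?thesis .
qed

lemma taylor_bound:
  assumes d: "\<And>s. (F has_real_derivative G s) (at s)" and G: "\<And>s s'. \<bar>G s - G s'\<bar> \<le> M * \<bar>s - s'\<bar>"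
  shows "\<bar>F s' - F s - G s * (s' - s)\<bar> \<le> M * \<bar>s' - s\<bar> * \<bar>s' - s\<bar>"
proof -
  have d': "((\<lambda>x. F x - G s * x) has_real_derivative G x - G s) (at x)" for x
    by (auto intro!: derivative_eq_intros d)
  have "\<bar>(F s' - G s * s') - (F s - G s * s)\<bar> \<le> M * \<bar>s' - s\<bar> * \<bar>s' - s\<bar>"
  proof (rule field_differentiable_bound[of "closed_segment s s'" "\<lambda>x. F x - G s * x" "\<lambda>x. G x - G s", simplified real_norm_def])
    fix x assume x: "x \<in> closed_segment s s'"
    show "((\<lambda>x. F x - G s * x) has_real_derivative G x - G s) (at x within closed_segment s s')"
      by (rule has_field_derivative_at_within[OF d'])
    have "\<bar>x - s\<bar> \<le> \<bar>s' - s\<bar>" using x by (auto simp: closed_segment_eq_real_ivl split: if_splits)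
    then show "\<bar>G x - G s\<bar> \<le> M * \<bar>s' - s\<bar>" using order_trans[OF G[of x s] mult_left_mono[OF _ M0]] by blast
  qed auto
  then show ?thesis by (simp add: algebra_simps)
qed

text \<open>The function \<open>\<sigma> + \<tau> q\<close> is the arc length corrected to first order off the curve: its gradient on
  the curve is the unit tangent.\<close>

lemma corrected_arclength_lip:
  assumes \<tau>: "\<bar>\<tau>'\<bar> \<le> c"
  shows "\<bar>(\<sigma> s' + \<tau>' * q s') - (\<sigma> s + \<tau> * q s)\<bar>
    \<le> (1 + 2 * M * \<bar>s' - s\<bar> + 2 * M * c) * sqrt ((s' - s)\<^sup>2 + (t' - t)\<^sup>2)
      + \<bar>((t' - \<zeta> s') - (t - \<zeta> s)) - (\<tau>' - \<tau>)\<bar>"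
proof -
  define w where "w = sqrt (1 + (dz s)\<^sup>2)"
  define D where "D = sqrt ((s' - s)\<^sup>2 + (t' - t)\<^sup>2)"
  define a where "a = \<sigma> s' - \<sigma> s - w * (s' - s)"
  define b where "b = \<zeta> s' - \<zeta> s - dz s * (s' - s)"
  have w1: "1 \<le> w" "w * w = 1 + (dz s)\<^sup>2" using sqrt_ge1 by (auto simp: w_def)
  have G: "\<bar>sqrt (1 + (dz s)\<^sup>2) - sqrt (1 + (dz s')\<^sup>2)\<bar> \<le> M * \<bar>s - s'\<bar>" for s s'
    using sqrt_lip dz_lip order_trans by blast
  have sD: "\<bar>s' - s\<bar> \<le> D" unfolding D_def by (rule real_le_rsqrt) simp
  have ab: "\<bar>a\<bar> \<le> M * \<bar>s' - s\<bar> * \<bar>s' - s\<bar>" "\<bar>b\<bar> \<le> M * \<bar>s' - s\<bar> * \<bar>s' - s\<bar>"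
    unfolding a_def b_def w_def using taylor_bound[OF \<sigma> G] taylor_bound[OF dz dz_lip] by blast+
  have MD: "M * \<bar>s' - s\<bar> * \<bar>s' - s\<bar> \<le> M * \<bar>s' - s\<bar> * D"
    using M0 sD by (intro mult_left_mono) auto
  have q: "q s = dz s / w" by (simp add: q_def w_def)
  have tangent: "w * (s' - s) + q s * ((t' - t) - dz s * (s' - s)) = ((s' - s) + dz s * (t' - t)) / w"
  proof -
    have "w * (w * (s' - s) + q s * ((t' - t) - dz s * (s' - s))) = (w * w) * (s' - s) + dz s * ((t' - t) - dz s * (s' - s))"
      using w1(1) by (simp add: q distrib_left)
    also have "\<dots> = (s' - s) + dz s * (t' - t)" unfolding w1(2) by (simp add: algebra_simps power2_eq_square)
    finally show ?thesis using w1(1) by (simp add: eq_divide_eq mult.commute)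
  qed
  have "\<bar>(s' - s) + dz s * (t' - t)\<bar> \<le> w * D"
  proof -
    have "((s' - s) + dz s * (t' - t))\<^sup>2 \<le> (1 + (dz s)\<^sup>2) * ((s' - s)\<^sup>2 + (t' - t)\<^sup>2)"
      using zero_le_power2[of "dz s * (s' - s) - (t' - t)"] by (simp add: power2_eq_square algebra_simps)
    then have "sqrt (((s' - s) + dz s * (t' - t))\<^sup>2) \<le> sqrt ((1 + (dz s)\<^sup>2) * ((s' - s)\<^sup>2 + (t' - t)\<^sup>2))"
      by (rule real_sqrt_le_mono)
    then show ?thesis by (simp add: real_sqrt_mult w_def D_def)
  qed
  then have tan_le: "\<bar>((s' - s) + dz s * (t' - t)) / w\<bar> \<le> D"
    using w1(1) by (simp add: abs_divide pos_divide_le_eq mult.commute)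
  have "(\<sigma> s' + \<tau>' * q s') - (\<sigma> s + \<tau> * q s)
      = ((s' - s) + dz s * (t' - t)) / w + a + q s * (- b) + q s * ((\<tau>' - \<tau>) - ((t' - \<zeta> s') - (t - \<zeta> s))) + \<tau>' * (q s' - q s)"
    unfolding tangent[symmetric] by (simp add: a_def b_def algebra_simps)
  also have "\<bar>\<dots>\<bar> \<le> \<bar>((s' - s) + dz s * (t' - t)) / w\<bar> + \<bar>a\<bar> + \<bar>q s * (- b)\<bar>
      + \<bar>q s * ((\<tau>' - \<tau>) - ((t' - \<zeta> s') - (t - \<zeta> s)))\<bar> + \<bar>\<tau>' * (q s' - q s)\<bar>"
    by linarith
  also have "\<dots> \<le> D + M * \<bar>s' - s\<bar> * D + M * \<bar>s' - s\<bar> * D + \<bar>((t' - \<zeta> s') - (t - \<zeta> s)) - (\<tau>' - \<tau>)\<bar> + 2 * M * c * D"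
  proof (intro add_mono tan_le)
    show "\<bar>a\<bar> \<le> M * \<bar>s' - s\<bar> * D" using ab(1) MD by linarith
    have le1: "\<bar>q s * x\<bar> \<le> \<bar>x\<bar>" for x
      using mult_right_mono[OF q_bound[of s], of "\<bar>x\<bar>"] by (simp add: abs_mult)
    show "\<bar>q s * (- b)\<bar> \<le> M * \<bar>s' - s\<bar> * D" using le1[of "- b"] ab(2) MD by simp
    show "\<bar>q s * ((\<tau>' - \<tau>) - ((t' - \<zeta> s') - (t - \<zeta> s)))\<bar> \<le> \<bar>((t' - \<zeta> s') - (t - \<zeta> s)) - (\<tau>' - \<tau>)\<bar>"
      using le1[of "(\<tau>' - \<tau>) - ((t' - \<zeta> s') - (t - \<zeta> s))"] by (simp add: abs_minus_commute)
    have "\<bar>\<tau>'\<bar> * \<bar>q s' - q s\<bar> \<le> c * (2 * M * \<bar>s' - s\<bar>)"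
      using \<tau> q_lip[of s' s] by (intro mult_mono) auto
    also have "\<dots> \<le> c * (2 * M * D)" using \<tau> sD M0 by (intro mult_left_mono) auto
    finally show "\<bar>\<tau>' * (q s' - q s)\<bar> \<le> 2 * M * c * D" by (simp add: abs_mult mult_ac)
  qed
  also have "\<dots> = (1 + 2 * M * \<bar>s' - s\<bar> + 2 * M * c) * D + \<bar>((t' - \<zeta> s') - (t - \<zeta> s)) - (\<tau>' - \<tau>)\<bar>"
    by (simp add: algebra_simps)
  finally show ?thesis unfolding D_def .
qed

lemma \<zeta>_lip: "\<bar>\<zeta> s' - \<zeta> s\<bar> \<le> M * \<bar>s' - s\<bar>"
  using field_differentiable_bound[of UNIV \<zeta> dz M s' s] dz dz_bound by simp

lemma \<zeta>_bound: "\<bar>\<zeta> s\<bar> \<le> A"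
proof -
  have "\<bar>\<zeta> s\<bar> \<le> A * \<bar>s - of_int \<lfloor>s\<rfloor>\<bar>" by (rule small) simp
  also have "\<dots> \<le> A * 1" by (rule mult_left_mono[OF _ A0]) linarith
  finally show ?thesis by simp
qed

lemma \<sigma>_lip: "\<bar>\<sigma> s' - \<sigma> s\<bar> \<le> (1 + M) * \<bar>s' - s\<bar>"
proof -
  have "norm (sqrt (1 + (dz x)\<^sup>2)) \<le> 1 + M" for x
  proof -
    have "sqrt (1 + (dz x)\<^sup>2) \<le> 1 + \<bar>dz x\<bar>" using sqrt_lip[of "dz x" 0] by simp
    then show ?thesis using dz_bound[of x] by simp
  qed
  then show ?thesis using field_differentiable_bound[of UNIV \<sigma> "\<lambda>s. sqrt (1 + (dz s)\<^sup>2)" "1 + M" s' s] \<sigma> by simp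
qed

lemma \<sigma>_near_linear: "\<bar>\<sigma> s - \<mu> * s\<bar> \<le> 1 + M + \<bar>\<mu>\<bar>"
proof -
  define z where "z = \<lfloor>s\<rfloor>"
  have f: "0 \<le> s - of_int z" "s - of_int z \<le> 1" unfolding z_def by linarith+
  have "\<sigma> s = \<sigma> (s - of_int z) + \<mu> * of_int z" using add_int(2)[of "s - of_int z" z] by simp
  then have "\<sigma> s - \<mu> * s = \<sigma> (s - of_int z) - \<mu> * (s - of_int z)" by (simp add: algebra_simps)
  moreover have "\<bar>\<sigma> (s - of_int z)\<bar> \<le> 1 + M"
  proof -
    have "\<bar>\<sigma> (s - of_int z)\<bar> \<le> (1 + M) * (s - of_int z)"
      using \<sigma>_lip[of "s - of_int z" 0] \<sigma>0 f by simp
    also have "\<dots> \<le> (1 + M) * 1" by (rule mult_left_mono[OF f(2)]) (use M0 in simp)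
    finally show ?thesis by simp
  qed
  moreover have "\<bar>\<mu> * (s - of_int z)\<bar> \<le> \<bar>\<mu>\<bar>" using f by (simp add: abs_mult mult_left_le)
  ultimately show ?thesis by linarith
qed

text \<open>The arc length minus the linear function given by the unit vector of the chord is nondecreasing.\<close>

lemma chord_le_arc:
  assumes "s \<le> s'" shows "sqrt ((s' - s)\<^sup>2 + (\<zeta> s' - \<zeta> s)\<^sup>2) \<le> \<sigma> s' - \<sigma> s"
proof (cases "s = s'")
  case False
  define D where "D = sqrt ((s' - s)\<^sup>2 + (\<zeta> s' - \<zeta> s)\<^sup>2)"
  define a where "a = (s' - s) / D"
  define b where "b = (\<zeta> s' - \<zeta> s) / D"
  have D: "0 < D" using False by (simp add: D_def sum_power2_gt_zero_iff)
  have D2: "D\<^sup>2 = (s' - s)\<^sup>2 + (\<zeta> s' - \<zeta> s)\<^sup>2" by (simp add: D_def)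
  have "a\<^sup>2 + b\<^sup>2 = ((s' - s)\<^sup>2 + (\<zeta> s' - \<zeta> s)\<^sup>2) / D\<^sup>2"
    by (simp only: a_def b_def power_divide add_divide_distrib)
  then have ab: "a\<^sup>2 + b\<^sup>2 = 1" unfolding D2[symmetric] using D by simp
  have "\<sigma> s - a * s - b * \<zeta> s \<le> \<sigma> s' - a * s' - b * \<zeta> s'"
  proof (rule DERIV_nonneg_imp_nondecreasing[OF assms], intro exI conjI)
    fix x
    show "((\<lambda>x. \<sigma> x - a * x - b * \<zeta> x) has_real_derivative sqrt (1 + (dz x)\<^sup>2) - a - b * dz x) (at x)"
      by (auto intro!: derivative_eq_intros \<sigma> dz)
    have "(a + b * dz x)\<^sup>2 \<le> (a\<^sup>2 + b\<^sup>2) * (1 + (dz x)\<^sup>2)"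
      using zero_le_power2[of "a * dz x - b"] by (simp add: power2_eq_square algebra_simps)
    then have "a + b * dz x \<le> sqrt (1 + (dz x)\<^sup>2)" unfolding ab by (intro real_le_rsqrt) simp
    then show "0 \<le> sqrt (1 + (dz x)\<^sup>2) - a - b * dz x" by simp
  qed
  then have "a * (s' - s) + b * (\<zeta> s' - \<zeta> s) \<le> \<sigma> s' - \<sigma> s" by (simp add: algebra_simps)
  moreover have "a * (s' - s) + b * (\<zeta> s' - \<zeta> s) = D\<^sup>2 / D"
    unfolding D2 a_def b_def by (simp add: power2_eq_square add_divide_distrib)
  moreover have "D\<^sup>2 / D = D" using D by (simp add: power2_eq_square)
  ultimately show ?thesis unfolding D_def[symmetric] by simp
qed simp

lemma arclength_param:
  obtains \<alpha> where "\<And>y. \<sigma> (\<alpha> y) = y" "\<And>s. \<alpha> (\<sigma> s) = s"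
    "\<And>y y'. sqrt ((\<alpha> y' - \<alpha> y)\<^sup>2 + (\<zeta> (\<alpha> y') - \<zeta> (\<alpha> y))\<^sup>2) \<le> \<bar>y' - y\<bar>"
proof -
  have mono: "s' - s \<le> \<sigma> s' - \<sigma> s" if "s \<le> s'" for s s'
    by (rule order_trans[OF real_le_rsqrt chord_le_arc[OF that]]) simp
  have inj: "s = s'" if "\<sigma> s = \<sigma> s'" for s s'
    using mono[of s s'] mono[of s' s] that by linarith
  have "\<exists>s. \<sigma> s = y" for y
  proof -
    have "\<sigma> (- \<bar>y\<bar>) \<le> y" "y \<le> \<sigma> \<bar>y\<bar>" using mono[of "- \<bar>y\<bar>" 0] mono[of 0 "\<bar>y\<bar>"] \<sigma>0 by auto
    moreover have "continuous_on {- \<bar>y\<bar>..\<bar>y\<bar>} \<sigma>"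
      by (intro continuous_at_imp_continuous_on ballI DERIV_isCont[OF \<sigma>])
    ultimately show ?thesis using IVT'[of \<sigma> "- \<bar>y\<bar>" y "\<bar>y\<bar>"] by auto
  qed
  then have "\<forall>y. \<exists>s. \<sigma> s = y" by blast
  from choice[OF this] obtain \<alpha> where "\<forall>y. \<sigma> (\<alpha> y) = y" by blast
  then have \<alpha>: "\<And>y. \<sigma> (\<alpha> y) = y" by blast
  have lip: "sqrt ((\<alpha> y' - \<alpha> y)\<^sup>2 + (\<zeta> (\<alpha> y') - \<zeta> (\<alpha> y))\<^sup>2) \<le> \<bar>y' - y\<bar>" for y y'
  proof (cases "\<alpha> y \<le> \<alpha> y'")
    case True
    from chord_le_arc[OF True] show ?thesis unfolding \<alpha> by (rule order_trans) simp
  next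
    case False
    then have "\<alpha> y' \<le> \<alpha> y" by simp
    from chord_le_arc[OF this] show ?thesis
      unfolding \<alpha> power2_commute[of "\<alpha> y" "\<alpha> y'"] power2_commute[of "\<zeta> (\<alpha> y)" "\<zeta> (\<alpha> y')"]
      by (rule order_trans) simp
  qed
  have "\<alpha> (\<sigma> s) = s" for s by (rule inj) (rule \<alpha>)
  from that[OF \<alpha> this lip] show ?thesis .
qed

end

text \<open>The difference of two cosines of neighbouring frequencies is \<open>2 sin ((2 j + 1) \<pi> s) sin (\<pi> s)\<close> in absolute value, so its
  growth near the integers is bounded independently of the frequency \<open>j\<close>, while its length grows with \<open>j\<close>. The length depends continuously on
  the amplitude, and the intermediate value theorem provides the prescribed one.\<close>

theorem exists_profile:
  assumes A: "0 < A" and \<mu>: "1 \<le> \<mu>"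
  shows "\<exists>\<zeta> dz \<sigma> M. profile \<zeta> dz \<sigma> \<mu> A M"
proof -
  obtain j :: nat where j: "2 * \<mu> / A \<le> real j" using real_arch_simple by blast
  define a where "a = 2 * pi * real j"
  define b where "b = 2 * pi * real (Suc j)"
  define G where "G s = - a * sin (a * s) + b * sin (b * s)" for s :: real
  define Z where "Z s = cos (a * s) - cos (b * s)" for s :: real
  have Zd: "(Z has_real_derivative G s) (at s)" for s
    unfolding Z_def G_def by (auto intro!: derivative_eq_intros)
  have Gc: "continuous_on S G" for S unfolding G_def by (intro continuous_intros)
  have ab0: "0 \<le> a" "0 \<le> b" by (simp_all add: a_def b_def)
  define len where "len B = integral {0..1} (\<lambda>s. sqrt (1 + (B * G s)\<^sup>2))" for B :: real
  have intg: "(\<lambda>s. sqrt (1 + (B * G s)\<^sup>2)) integrable_on {0..1}" for B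
    by (intro integrable_continuous_real continuous_intros Gc)
  define B1 where "B1 = A / (2 * pi)"
  have B1: "0 < B1" using A by (simp add: B1_def)
  have len0: "len 0 = 1" by (simp add: len_def)
  have len1: "\<mu> \<le> len B1"
  proof -
    \<comment> \<open>The derivative of the oscillation, integrated against \<open>sin (a s)\<close>, bounds its total variation from below; \<open>\<Psi>\<close> is
      the primitive of that product.\<close>
    define \<Psi> where "\<Psi> s = B1 * (pi * real j * s - sin (2 * a * s) / 4 - real (Suc j) / 2 * (sin (2 * pi * s) - sin ((a + b) * s) / real (2 * j + 1)))" for s
    have ab: "b - a = 2 * pi" "a + b = 2 * pi * real (2 * j + 1)" by (simp_all add: a_def b_def algebra_simps)
    have \<Psi>d: "(\<Psi> has_real_derivative - (B1 * G s) * sin (a * s)) (at s)" for s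
    proof -
      have "(\<Psi> has_real_derivative B1 * (pi * real j - cos (2 * a * s) * (2 * a) / 4 - real (Suc j) / 2 * (cos (2 * pi * s) * (2 * pi) - cos ((a + b) * s) * (a + b) / real (2 * j + 1)))) (at s)"
        unfolding \<Psi>_def by (auto intro!: derivative_eq_intros)
      also have "cos ((a + b) * s) * (a + b) / real (2 * j + 1) = cos ((a + b) * s) * (2 * pi)"
        unfolding ab(2) by (simp del: of_nat_add of_nat_mult)
      also have "cos (2 * a * s) = 1 - 2 * (sin (a * s))\<^sup>2"
        using cos_double_sin[of "a * s"] by (simp add: mult.assoc)
      also have "cos (2 * pi * s) * (2 * pi) - cos ((a + b) * s) * (2 * pi) = 2 * pi * (2 * sin (b * s) * sin (a * s))"
      proof -
        have e: "2 * pi * s = b * s - a * s" "(a + b) * s = b * s + a * s" unfolding ab(1)[symmetric] by (simp_all add: algebra_simps)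
        show ?thesis unfolding e cos_add cos_diff by (simp add: algebra_simps)
      qed
      also have "B1 * (pi * real j - (1 - 2 * (sin (a * s))\<^sup>2) * (2 * a) / 4 - real (Suc j) / 2 * (2 * pi * (2 * sin (b * s) * sin (a * s)))) = - (B1 * G s) * sin (a * s)"
      proof -
        have pj: "pi * real j = a / 2" "real (Suc j) * pi = b / 2" by (simp_all add: a_def b_def)
        have 1: "pi * real j - (1 - 2 * x\<^sup>2) * (2 * a) / 4 = a * x\<^sup>2" for x
          unfolding pj by (simp add: field_simps)
        have "real (Suc j) / 2 * (2 * pi * (2 * y * x)) = (real (Suc j) * pi) * (2 * y * x)" for x y :: real
          by (simp only: times_divide_eq_left times_divide_eq_right)
        then have 2: "real (Suc j) / 2 * (2 * pi * (2 * y * x)) = b * y * x" for x y :: real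
          unfolding pj by simp
        show ?thesis unfolding 1 2 G_def by (simp add: power2_eq_square algebra_simps)
      qed
      finally show ?thesis .
    qed
    have hi: "((\<lambda>s. - (B1 * G s) * sin (a * s)) has_integral \<Psi> 1 - \<Psi> 0) {0..1}"
      by (rule fundamental_theorem_of_calculus)
        (use \<Psi>d in \<open>auto intro: has_field_derivative_at_within simp: has_real_derivative_iff_has_vector_derivative[symmetric]\<close>)
    have \<Psi>1: "\<Psi> 1 - \<Psi> 0 = B1 * pi * real j"
    proof -
      have "sin (2 * a) = 0" using sin_npi[of "4 * j"] by (simp add: a_def mult_ac)
      moreover have "sin (a + b) = 0" using sin_npi[of "2 * (2 * j + 1)"] unfolding ab(2) by (simp add: mult_ac)
      ultimately show ?thesis by (simp add: \<Psi>_def)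
    qed
    have le: "- (B1 * G s) * sin (a * s) \<le> sqrt (1 + (B1 * G s)\<^sup>2)" for s
    proof -
      have "- (B1 * G s) * sin (a * s) \<le> \<bar>B1 * G s\<bar> * \<bar>sin (a * s)\<bar>"
        unfolding abs_mult[symmetric] minus_mult_left[symmetric] by (rule abs_ge_minus_self)
      also have "\<dots> \<le> \<bar>B1 * G s\<bar> * 1" by (intro mult_left_mono) auto
      also have "\<dots> \<le> sqrt (1 + (B1 * G s)\<^sup>2)" by (auto intro: real_le_rsqrt)
      finally show ?thesis .
    qed
    have "B1 * pi * real j \<le> len B1"
      unfolding len_def \<Psi>1[symmetric] by (rule has_integral_le[OF hi integrable_integral[OF intg]]) (rule le)
    moreover have "\<mu> \<le> B1 * pi * real j"
      using j A by (simp add: B1_def pos_divide_le_eq mult.commute)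
    ultimately show ?thesis by simp
  qed
  have "continuous_on {0..B1} len"
  proof -
    have "continuous_on {0..B1} (\<lambda>B. integral (cbox 0 1) (\<lambda>s. sqrt (1 + (B * G s)\<^sup>2)))"
      by (rule integral_continuous_on_param)
        (auto simp: case_prod_beta intro!: continuous_intros continuous_on_compose2[OF Gc[of UNIV]])
    then show ?thesis by (simp add: len_def[abs_def])
  qed
  with len0 len1 \<mu> B1 obtain B where B: "0 \<le> B" "B \<le> B1" "len B = \<mu>"
    using IVT'[of len 0 \<mu> B1] by auto
  define dz where "dz s = B * G s" for s
  define \<zeta> where "\<zeta> s = B * Z s" for s
  define M where "M = B * (a * a + b * b) + B * (a + b)"
  have cs: "isCont (\<lambda>s. sqrt (1 + (dz s)\<^sup>2)) x" for x
    unfolding dz_def G_def by (intro continuous_intros)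
  obtain \<sigma>' where "\<forall>x. - \<infinity> < ereal x \<longrightarrow> ereal x < \<infinity> \<longrightarrow> (\<sigma>' has_vector_derivative sqrt (1 + (dz x)\<^sup>2)) (at x)"
    using einterval_antiderivative[of "-\<infinity>" "\<infinity>" "\<lambda>s. sqrt (1 + (dz s)\<^sup>2)"] cs by auto
  then have \<sigma>': "(\<sigma>' has_real_derivative sqrt (1 + (dz x)\<^sup>2)) (at x)" for x
    by (simp add: has_real_derivative_iff_has_vector_derivative)
  define \<sigma> where "\<sigma> s = \<sigma>' s - \<sigma>' 0" for s
  have \<sigma>d: "(\<sigma> has_real_derivative sqrt (1 + (dz x)\<^sup>2)) (at x)" for x
    unfolding \<sigma>_def by (auto intro!: derivative_eq_intros \<sigma>')
  have per: "sin (c * (s + 1)) = sin (c * s)" "cos (c * (s + 1)) = cos (c * s)" if "c = 2 * pi * real i" for c s i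
  proof -
    have "sin c = 0" "cos c = 1" using sin_2npi[of i] cos_2npi[of i] that by (simp_all add: mult_ac)
    then show "sin (c * (s + 1)) = sin (c * s)" "cos (c * (s + 1)) = cos (c * s)"
      by (simp_all add: distrib_left sin_add cos_add)
  qed
  have dzp: "dz (s + 1) = dz s" for s
    unfolding dz_def G_def per(1)[OF a_def] per(1)[OF b_def] ..
  show ?thesis
  proof (intro exI, unfold_locales)
    show "(\<zeta> has_real_derivative dz s) (at s)" for s
      unfolding \<zeta>_def dz_def by (intro DERIV_cmult Zd)
    show "\<bar>dz s\<bar> \<le> M" for s
    proof -
      have "\<bar>G s\<bar> \<le> \<bar>a * sin (a * s)\<bar> + \<bar>b * sin (b * s)\<bar>" unfolding G_def by linarith
      also have "\<dots> \<le> a + b" using ab0 by (intro add_mono) (auto simp: abs_mult mult_left_le)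
      finally have "\<bar>dz s\<bar> \<le> B * (a + b)" using B by (simp add: dz_def abs_mult mult_left_mono)
      moreover have "0 \<le> B * (a * a + b * b)" using B by simp
      ultimately show ?thesis unfolding M_def by linarith
    qed
    show "\<bar>dz s - dz s'\<bar> \<le> M * \<bar>s - s'\<bar>" for s s'
    proof -
      have "norm (dz s - dz s') \<le> (B * (a * a + b * b)) * norm (s - s')"
      proof (rule field_differentiable_bound[of UNIV dz "\<lambda>s. B * (- a * (a * cos (a * s)) + b * (b * cos (b * s)))"])
        show "(dz has_real_derivative B * (- a * (a * cos (a * s)) + b * (b * cos (b * s)))) (at s within UNIV)" for s
          unfolding dz_def G_def by (auto intro!: derivative_eq_intros)
        fix s
        have "\<bar>- a * (a * cos (a * s)) + b * (b * cos (b * s))\<bar> \<le> \<bar>a * a * cos (a * s)\<bar> + \<bar>b * b * cos (b * s)\<bar>"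
          by (simp add: mult.assoc)
        also have "\<dots> \<le> a * a + b * b" using ab0 by (intro add_mono) (auto simp: abs_mult mult_left_le)
        finally show "norm (B * (- a * (a * cos (a * s)) + b * (b * cos (b * s)))) \<le> B * (a * a + b * b)"
          using B by (simp add: abs_mult mult_left_mono)
      qed auto
      moreover have "(B * (a * a + b * b)) * \<bar>s - s'\<bar> \<le> M * \<bar>s - s'\<bar>"
        using B ab0 by (intro mult_right_mono) (auto simp: M_def)
      ultimately show ?thesis by simp
    qed
    show "\<zeta> (s + 1) = \<zeta> s" for s
      unfolding \<zeta>_def Z_def per(2)[OF a_def] per(2)[OF b_def] ..
    show "\<bar>\<zeta> s\<bar> \<le> A * \<bar>s - z\<bar>" if "z \<in> \<int>" for s z
    proof -
      have e: "a * s = (a + b) / 2 * s - pi * s" "b * s = (a + b) / 2 * s + pi * s"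
        by (simp_all add: a_def b_def algebra_simps)
      have "Z s = 2 * sin ((a + b) / 2 * s) * sin (pi * s)"
        unfolding Z_def e cos_add cos_diff by (simp add: algebra_simps)
      then have "\<bar>Z s\<bar> = 2 * (\<bar>sin ((a + b) / 2 * s)\<bar> * \<bar>sin (pi * s)\<bar>)" by (simp add: abs_mult)
      also have "\<dots> \<le> 2 * (1 * \<bar>sin (pi * s)\<bar>)" by (intro mult_left_mono mult_right_mono) auto
      also have "\<bar>sin (pi * s)\<bar> = \<bar>sin (pi * (s - z))\<bar>"
      proof -
        obtain i where i: "z = of_int i" using \<open>z \<in> \<int>\<close> by (auto elim: Ints_cases)
        have "sin (pi * s) = sin (pi * (s - z)) * cos (pi * z)"
          using sin_add[of "pi * (s - z)" "pi * z"] sin_int_times_real[of i] by (simp add: i algebra_simps sin_zero_iff_int2)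
        moreover have "\<bar>cos (pi * z)\<bar> = 1"
        proof -
          have "sin (pi * z) = 0" unfolding i sin_zero_iff_int2 by (intro exI[of _ i]) simp
          then have "(cos (pi * z))\<^sup>2 = 1" using sin_cos_squared_add[of "pi * z"] by simp
          then show ?thesis by (auto simp: power2_eq_1_iff)
        qed
        ultimately show ?thesis by (simp add: abs_mult)
      qed
      also have "2 * (1 * \<bar>sin (pi * (s - z))\<bar>) \<le> 2 * (1 * \<bar>pi * (s - z)\<bar>)"
        by (intro mult_left_mono abs_sin_x_le_abs_x) auto
      finally have "\<bar>\<zeta> s\<bar> \<le> B1 * (2 * (1 * \<bar>pi * (s - z)\<bar>))"
        unfolding \<zeta>_def abs_mult using B by (intro mult_mono) auto
      then show ?thesis by (simp add: B1_def abs_mult)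
    qed
    show "(\<sigma> has_real_derivative sqrt (1 + (dz s)\<^sup>2)) (at s)" for s by (rule \<sigma>d)
    show "\<sigma> 0 = 0" by (simp add: \<sigma>_def)
    show "\<sigma> (s + 1) = \<sigma> s + \<mu>" for s
    proof -
      have d: "((\<lambda>s. \<sigma> (s + 1) - \<sigma> s) has_real_derivative 0) (at s)" for s
      proof -
        have "((\<lambda>s. \<sigma> (s + 1)) has_real_derivative sqrt (1 + (dz (s + 1))\<^sup>2)) (at s)"
          using \<sigma>d[of "s + 1"] by (simp add: DERIV_shift)
        from DERIV_diff[OF this \<sigma>d[of s]] show ?thesis by (simp add: dzp)
      qed
      have "\<sigma> (s + 1) - \<sigma> s = \<sigma> (0 + 1) - \<sigma> 0"
        using DERIV_isconst_all[of "\<lambda>s. \<sigma> (s + 1) - \<sigma> s" s 0] d by simp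
      moreover have "((\<lambda>s. sqrt (1 + (dz s)\<^sup>2)) has_integral \<sigma> 1 - \<sigma> 0) {0..1}"
        by (rule fundamental_theorem_of_calculus)
          (use \<sigma>d in \<open>auto intro: has_field_derivative_at_within simp: has_real_derivative_iff_has_vector_derivative[symmetric]\<close>)
      then have "\<sigma> 1 - \<sigma> 0 = \<mu>" using B(3) by (simp add: integral_unique len_def dz_def)
      ultimately show ?thesis by simp
    qed
    show "0 \<le> A" using A by simp
    show "0 \<le> M" using B ab0 by (simp add: M_def)
  qed
qed

section \<open>Geometry of the plane\<close>

definition perp :: "real^2 \<Rightarrow> real^2" where "perp m = vector [- m$2, m$1]"

lemma perp_nth [simp]: "perp m $ 1 = - m$2" "perp m $ 2 = m$1" by (simp_all add: perp_def)

lemma inner2: "x \<bullet> y = x$1 * y$1 + x$2 * y$2" for x y :: "real^2"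
  by (simp add: inner_vec_def sum_2)

lemma norm2_sq: "(norm x)\<^sup>2 = (x$1)\<^sup>2 + (x$2)\<^sup>2" for x :: "real^2"
  unfolding power2_norm_eq_inner inner2 by (simp add: power2_eq_square)

lemma vec2_eq_iff: "x = y \<longleftrightarrow> x$1 = y$1 \<and> x$2 = y$2" for x y :: "real^2"
  by (simp add: vec_eq_iff forall_2)

text \<open>Coordinates with respect to the orthogonal basis \<open>m\<close>, \<open>perp m\<close>; for a lattice vector \<open>m\<close> they take
  integer values on a sublattice.\<close>

definition along :: "real^2 \<Rightarrow> real^2 \<Rightarrow> real" where "along m x = (m \<bullet> x) / (norm m)\<^sup>2"

definition across :: "real^2 \<Rightarrow> real^2 \<Rightarrow> real" where "across m x = (perp m \<bullet> x) / (norm m)\<^sup>2"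

lemma along_across_decomp:
  assumes "m \<noteq> 0" shows "x = along m x *\<^sub>R m + across m x *\<^sub>R perp m"
proof -
  define N where "N = (m$1)\<^sup>2 + (m$2)\<^sup>2"
  have N: "N \<noteq> 0" using assms unfolding N_def norm2_sq[symmetric] by simp
  have "along m x * m$1 + across m x * (- m$2) = x$1 * N / N"
    unfolding along_def across_def norm2_sq N_def[symmetric] inner2 perp_nth
    by (simp add: N_def power2_eq_square algebra_simps add_divide_distrib[symmetric] diff_divide_distrib[symmetric])
  moreover have "along m x * m$2 + across m x * m$1 = x$2 * N / N"
    unfolding along_def across_def norm2_sq N_def[symmetric] inner2 perp_nth
    by (simp add: N_def power2_eq_square algebra_simps add_divide_distrib[symmetric] diff_divide_distrib[symmetric])
  ultimately show ?thesis using N by (simp add: vec2_eq_iff)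
qed

lemma along_diff: "along m x - along m y = along m (x - y)"
  by (simp add: along_def inner_diff_right diff_divide_distrib)

lemma across_diff: "across m x - across m y = across m (x - y)"
  by (simp add: across_def inner_diff_right diff_divide_distrib)

lemma along_comb [simp]: "m \<noteq> 0 \<Longrightarrow> along m (s *\<^sub>R m + t *\<^sub>R perp m) = s"
  by (simp add: along_def inner_add_right power2_norm_eq_inner[symmetric]) (simp add: inner2)

lemma across_comb [simp]: "m \<noteq> 0 \<Longrightarrow> across m (s *\<^sub>R m + t *\<^sub>R perp m) = t"
proof -
  assume m: "m \<noteq> 0"
  have "perp m \<bullet> (s *\<^sub>R m + t *\<^sub>R perp m) = t * (norm m)\<^sup>2"
    unfolding norm2_sq inner2 by (simp add: power2_eq_square algebra_simps)
  then show ?thesis using m by (simp add: across_def)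
qed

lemma norm_comb: "norm (s *\<^sub>R m + t *\<^sub>R perp m) = norm m * sqrt (s\<^sup>2 + t\<^sup>2)"
proof -
  have "(norm (s *\<^sub>R m + t *\<^sub>R perp m))\<^sup>2 = (norm m)\<^sup>2 * (s\<^sup>2 + t\<^sup>2)"
    unfolding norm2_sq by (simp add: power2_eq_square algebra_simps)
  then have "sqrt ((norm (s *\<^sub>R m + t *\<^sub>R perp m))\<^sup>2) = sqrt ((norm m)\<^sup>2 * (s\<^sup>2 + t\<^sup>2))" by simp
  then show ?thesis by (simp add: real_sqrt_mult)
qed

lemma norm_along_across:
  assumes "m \<noteq> 0" shows "norm x = norm m * sqrt ((along m x)\<^sup>2 + (across m x)\<^sup>2)"
  using norm_comb[of "along m x" m "across m x"] along_across_decomp[OF assms, of x] by simp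

lemma along_across_le:
  assumes "m \<noteq> 0" shows "\<bar>along m x\<bar> \<le> norm x / norm m" "\<bar>across m x\<bar> \<le> norm x / norm m"
proof -
  have 1: "\<bar>along m x\<bar> \<le> sqrt ((along m x)\<^sup>2 + (across m x)\<^sup>2)" "\<bar>across m x\<bar> \<le> sqrt ((along m x)\<^sup>2 + (across m x)\<^sup>2)"
    by (auto intro: real_le_rsqrt)
  have "sqrt ((along m x)\<^sup>2 + (across m x)\<^sup>2) = norm x / norm m"
    using norm_along_across[OF assms, of x] assms by simp
  with 1 show "\<bar>along m x\<bar> \<le> norm x / norm m" "\<bar>across m x\<bar> \<le> norm x / norm m" by simp_all
qed

lemma inner_comb: "p \<bullet> (s *\<^sub>R m + t *\<^sub>R n) = s * (p \<bullet> m) + t * (p \<bullet> n)"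
  by (simp add: inner_add_right)

subsection \<open>Level paths\<close>

lemma level_path_refl: "\<phi> x = 0 \<Longrightarrow> level_path \<phi> x x 0"
  unfolding level_path_def by (intro conjI exI[of _ "\<lambda>_. x"]) (auto intro: lipschitz_onI)

lemma level_path_trans:
  assumes 1: "level_path \<phi> x y l" and 2: "level_path \<phi> y z k"
  shows "level_path \<phi> x z (l + k)"
proof -
  obtain \<gamma> where l: "0 \<le> l" and \<gamma>: "\<gamma> 0 = x" "\<gamma> l = y" "1-lipschitz_on {0..l} \<gamma>" "\<forall>s\<in>{0..l}. \<phi> (\<gamma> s) = 0"
    using 1 by (auto simp: level_path_def)
  obtain \<beta> where k: "0 \<le> k" and \<beta>: "\<beta> 0 = y" "\<beta> k = z" "1-lipschitz_on {0..k} \<beta>" "\<forall>s\<in>{0..k}. \<phi> (\<beta> s) = 0"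
    using 2 by (auto simp: level_path_def)
  define \<rho> where "\<rho> s = (if s \<le> l then \<gamma> s else \<beta> (s - l))" for s
  have mix: "dist (\<rho> s) (\<rho> t) \<le> t - s" if st: "0 \<le> s" "s \<le> t" "t \<le> l + k" for s t
  proof -
    consider "t \<le> l" | "s \<le> l" "l < t" | "l < s" using st by linarith
    then show ?thesis
    proof cases
      case 1
      then show ?thesis using lipschitz_onD[OF \<gamma>(3), of s t] st by (simp add: \<rho>_def dist_real_def)
    next
      case 2
      have "dist (\<gamma> s) (\<gamma> l) \<le> l - s" using lipschitz_onD[OF \<gamma>(3), of s l] 2 st by (simp add: dist_real_def)
      moreover have "dist (\<beta> 0) (\<beta> (t - l)) \<le> t - l" using lipschitz_onD[OF \<beta>(3), of 0 "t - l"] 2 st by (simp add: dist_real_def)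
      ultimately show ?thesis using dist_triangle[of "\<gamma> s" "\<beta> (t - l)" y] 2 \<gamma>(2) \<beta>(1) by (simp add: \<rho>_def)
    next
      case 3
      then show ?thesis using lipschitz_onD[OF \<beta>(3), of "s - l" "t - l"] st by (simp add: \<rho>_def dist_real_def)
    qed
  qed
  have "1-lipschitz_on {0..l + k} \<rho>"
  proof (rule lipschitz_onI)
    fix s t assume "s \<in> {0..l + k}" "t \<in> {0..l + k}"
    then show "dist (\<rho> s) (\<rho> t) \<le> 1 * dist s t"
      using mix[of s t] mix[of t s] by (cases "s \<le> t") (auto simp: dist_real_def dist_commute)
  qed simp
  moreover have "\<rho> 0 = x" "\<rho> (l + k) = z" using l k \<gamma> \<beta> by (auto simp: \<rho>_def)
  moreover have "\<forall>s\<in>{0..l + k}. \<phi> (\<rho> s) = 0" using \<gamma>(4) \<beta>(4) by (auto simp: \<rho>_def)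
  ultimately show ?thesis using l k unfolding level_path_def by (intro conjI exI[of _ \<rho>]) auto
qed

lemma (in profile) level_path_along_curve:
  assumes m: "m \<noteq> 0" and z: "\<And>s. \<phi> (s *\<^sub>R m + (b + \<zeta> s) *\<^sub>R perp m) = 0"
  shows "level_path \<phi> (s *\<^sub>R m + (b + \<zeta> s) *\<^sub>R perp m) (s' *\<^sub>R m + (b + \<zeta> s') *\<^sub>R perp m) (norm m * \<bar>\<sigma> s' - \<sigma> s\<bar>)"
proof -
  define c where "c s = s *\<^sub>R m + (b + \<zeta> s) *\<^sub>R perp m" for s
  obtain \<alpha> where \<alpha>: "\<And>y. \<sigma> (\<alpha> y) = y" "\<And>s. \<alpha> (\<sigma> s) = s"
    "\<And>y y'. sqrt ((\<alpha> y' - \<alpha> y)\<^sup>2 + (\<zeta> (\<alpha> y') - \<zeta> (\<alpha> y))\<^sup>2) \<le> \<bar>y' - y\<bar>"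
    using arclength_param by blast
  have cl: "norm (c (\<alpha> y') - c (\<alpha> y)) \<le> norm m * \<bar>y' - y\<bar>" for y y'
  proof -
    have "c (\<alpha> y') - c (\<alpha> y) = (\<alpha> y' - \<alpha> y) *\<^sub>R m + (\<zeta> (\<alpha> y') - \<zeta> (\<alpha> y)) *\<^sub>R perp m"
      by (simp add: c_def algebra_simps)
    then have "norm (c (\<alpha> y') - c (\<alpha> y)) = norm m * sqrt ((\<alpha> y' - \<alpha> y)\<^sup>2 + (\<zeta> (\<alpha> y') - \<zeta> (\<alpha> y))\<^sup>2)"
      by (simp only: norm_comb)
    also have "\<dots> \<le> norm m * \<bar>y' - y\<bar>" by (intro mult_left_mono \<alpha>(3)) simp
    finally show ?thesis .
  qed
  define d where "d = sgn (\<sigma> s' - \<sigma> s)"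
  define \<gamma> where "\<gamma> y = c (\<alpha> (\<sigma> s + d * y / norm m))" for y
  have d: "\<bar>d\<bar> \<le> 1" "d * \<bar>\<sigma> s' - \<sigma> s\<bar> = \<sigma> s' - \<sigma> s"
    by (auto simp: d_def sgn_if)
  have "1-lipschitz_on S \<gamma>" for S
  proof (rule lipschitz_onI)
    fix x y
    have "dist (\<gamma> x) (\<gamma> y) \<le> norm m * \<bar>(\<sigma> s + d * x / norm m) - (\<sigma> s + d * y / norm m)\<bar>"
      unfolding \<gamma>_def dist_norm by (rule cl)
    also have "(\<sigma> s + d * x / norm m) - (\<sigma> s + d * y / norm m) = d * (x - y) / norm m"
      by (simp add: diff_divide_distrib right_diff_distrib)
    also have "norm m * \<bar>d * (x - y) / norm m\<bar> = \<bar>d\<bar> * \<bar>x - y\<bar>" using m by (simp add: abs_mult abs_divide)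
    also have "\<dots> \<le> 1 * dist x y" unfolding dist_real_def by (rule mult_right_mono[OF d(1)]) simp
    finally show "dist (\<gamma> x) (\<gamma> y) \<le> 1 * dist x y" .
  qed simp
  moreover have "\<gamma> 0 = c s" by (simp add: \<gamma>_def \<alpha>(2))
  moreover have "\<gamma> (norm m * \<bar>\<sigma> s' - \<sigma> s\<bar>) = c s'"
  proof -
    have "d * (norm m * \<bar>\<sigma> s' - \<sigma> s\<bar>) / norm m = d * \<bar>\<sigma> s' - \<sigma> s\<bar>" using m by simp
    then have "\<sigma> s + d * (norm m * \<bar>\<sigma> s' - \<sigma> s\<bar>) / norm m = \<sigma> s'" using d(2) by simp
    then show ?thesis unfolding \<gamma>_def by (simp only: \<alpha>(2))
  qed
  moreover have "\<phi> (\<gamma> y) = 0" for y unfolding \<gamma>_def c_def by (rule z)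
  ultimately show ?thesis unfolding level_path_def c_def[symmetric] by (intro conjI exI[of _ \<gamma>]) auto
qed

subsection \<open>Staircases\<close>

text \<open>Composing a corrector with a staircase keeps it within \<open>\<kappa>\<close> of the original and multiplies its slope by at
  most \<open>1 / (1 - 2\<kappa>)\<close>, but makes it locally constant wherever the original is within \<open>\<kappa>\<close> of an integer.\<close>

definition stair :: "real \<Rightarrow> real \<Rightarrow> real" where
  "stair \<kappa> y = of_int \<lfloor>y\<rfloor> + max 0 (min 1 ((y - of_int \<lfloor>y\<rfloor> - \<kappa>) / (1 - 2 * \<kappa>)))"

context
  fixes \<kappa> :: real assumes \<kappa>: "0 < \<kappa>" "\<kappa> < 1/2"
begin

lemma stair_flat: assumes z: "z \<in> \<int>" and y: "\<bar>y - z\<bar> \<le> \<kappa>" shows "stair \<kappa> y = z"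
proof -
  obtain i where i: "z = of_int i" using z by (auto elim: Ints_cases)
  show ?thesis
  proof (cases "z \<le> y")
    case True
    then have "\<lfloor>y\<rfloor> = i" using y \<kappa> i by (simp add: floor_eq_iff)
    moreover have "(y - z - \<kappa>) / (1 - 2 * \<kappa>) \<le> 0" using y \<kappa> by (intro divide_nonpos_pos) auto
    ultimately show ?thesis by (simp add: stair_def i)
  next
    case False
    then have f: "\<lfloor>y\<rfloor> = i - 1" using y \<kappa> i by (simp add: floor_eq_iff)
    have "1 \<le> (y - (z - 1) - \<kappa>) / (1 - 2 * \<kappa>)" using y \<kappa> by (simp add: pos_le_divide_eq)
    then show ?thesis by (simp add: stair_def f i)
  qed
qed

lemma stair_near: "\<bar>stair \<kappa> y - y\<bar> \<le> \<kappa>"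
proof -
  define u where "u = y - of_int \<lfloor>y\<rfloor>"
  have u: "0 \<le> u" "u < 1" unfolding u_def by linarith+
  have pos: "0 < 1 - 2 * \<kappa>" using \<kappa> by simp
  have k: "0 \<le> \<kappa> * u" "\<kappa> * u \<le> \<kappa>" using u \<kappa> by (auto simp: mult_left_le)
  have "\<bar>max 0 (min 1 ((u - \<kappa>) / (1 - 2 * \<kappa>))) - u\<bar> \<le> \<kappa>"
  proof -
    consider "u \<le> \<kappa>" | "1 - \<kappa> \<le> u" | "\<kappa> < u" "u < 1 - \<kappa>" by linarith
    then show ?thesis
    proof cases
      case 1
      then have "(u - \<kappa>) / (1 - 2 * \<kappa>) \<le> 0" using pos by (intro divide_nonpos_pos) auto
      then show ?thesis using u 1 by simp
    next
      case 2
      then have "1 \<le> (u - \<kappa>) / (1 - 2 * \<kappa>)" using pos by (simp add: pos_le_divide_eq)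
      then show ?thesis using u 2 by simp
    next
      case 3
      have e: "0 \<le> (u - \<kappa>) / (1 - 2 * \<kappa>)" "(u - \<kappa>) / (1 - 2 * \<kappa>) \<le> 1"
        using 3 pos by (auto simp: pos_divide_le_eq)
      have "(u - \<kappa>) / (1 - 2 * \<kappa>) - u \<le> \<kappa>"
      proof -
        have "\<kappa> * u * 2 \<le> \<kappa> * (1 - \<kappa>) * 2" using 3 \<kappa> by (intro mult_left_mono mult_right_mono) auto
        then have "u - \<kappa> \<le> (u + \<kappa>) * (1 - 2 * \<kappa>)" by (simp add: algebra_simps)
        then have "(u - \<kappa>) / (1 - 2 * \<kappa>) \<le> u + \<kappa>" using pos by (simp add: pos_divide_le_eq)
        then show ?thesis by simp
      qed
      moreover have "- \<kappa> \<le> (u - \<kappa>) / (1 - 2 * \<kappa>) - u"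
      proof -
        have "\<kappa> * \<kappa> * 2 \<le> \<kappa> * u * 2" using 3 \<kappa> by (intro mult_left_mono mult_right_mono) auto
        then have "(u - \<kappa>) * (1 - 2 * \<kappa>) \<le> u - \<kappa>" by (simp add: algebra_simps)
        then have "u - \<kappa> \<le> (u - \<kappa>) / (1 - 2 * \<kappa>)" using pos by (simp add: pos_le_divide_eq)
        then show ?thesis by simp
      qed
      ultimately show ?thesis using e by (simp add: abs_le_iff)
    qed
  qed
  then show ?thesis unfolding stair_def u_def[symmetric] by (simp add: u_def algebra_simps)
qed

lemma stair_same_floor:
  assumes "\<lfloor>y\<rfloor> = \<lfloor>y'\<rfloor>" shows "\<bar>stair \<kappa> y - stair \<kappa> y'\<bar> \<le> \<bar>y - y'\<bar> / (1 - 2 * \<kappa>)"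
proof -
  have clamp: "\<bar>max 0 (min 1 a) - max 0 (min 1 b)\<bar> \<le> \<bar>a - b\<bar>" for a b :: real by linarith
  have "\<bar>stair \<kappa> y - stair \<kappa> y'\<bar> \<le> \<bar>(y - of_int \<lfloor>y\<rfloor> - \<kappa>) / (1 - 2 * \<kappa>) - (y' - of_int \<lfloor>y\<rfloor> - \<kappa>) / (1 - 2 * \<kappa>)\<bar>"
    unfolding stair_def assms by (simp add: clamp)
  also have "\<dots> = \<bar>y - y'\<bar> / (1 - 2 * \<kappa>)"
    unfolding diff_divide_distrib[symmetric] abs_divide using \<kappa> by simp
  finally show ?thesis .
qed

lemma near_floor_cases:
  assumes "\<bar>y - y'\<bar> \<le> \<kappa>"
  shows "\<lfloor>y\<rfloor> = \<lfloor>y'\<rfloor> \<or> (\<exists>z\<in>\<int>. \<bar>y - z\<bar> \<le> \<kappa> \<and> \<bar>y' - z\<bar> \<le> \<kappa>)"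
proof -
  consider "\<lfloor>y\<rfloor> = \<lfloor>y'\<rfloor>" | "\<lfloor>y\<rfloor> < \<lfloor>y'\<rfloor>" | "\<lfloor>y'\<rfloor> < \<lfloor>y\<rfloor>" by linarith
  then show ?thesis
  proof cases
    case 2
    then have "y < of_int \<lfloor>y'\<rfloor>" unfolding floor_less_iff .
    then have "\<bar>y - of_int \<lfloor>y'\<rfloor>\<bar> \<le> \<kappa>" "\<bar>y' - of_int \<lfloor>y'\<rfloor>\<bar> \<le> \<kappa>"
      using assms of_int_floor_le[of y'] by linarith+
    then show ?thesis by (intro disjI2 bexI[of _ "of_int \<lfloor>y'\<rfloor>"]) auto
  next
    case 3
    then have "y' < of_int \<lfloor>y\<rfloor>" unfolding floor_less_iff .
    then have "\<bar>y - of_int \<lfloor>y\<rfloor>\<bar> \<le> \<kappa>" "\<bar>y' - of_int \<lfloor>y\<rfloor>\<bar> \<le> \<kappa>"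
      using assms of_int_floor_le[of y] by linarith+
    then show ?thesis by (intro disjI2 bexI[of _ "of_int \<lfloor>y\<rfloor>"]) auto
  qed simp
qed

lemma stair_lip:
  assumes "\<bar>y - y'\<bar> \<le> \<kappa>" shows "\<bar>stair \<kappa> y - stair \<kappa> y'\<bar> \<le> \<bar>y - y'\<bar> / (1 - 2 * \<kappa>)"
  using near_floor_cases[OF assms]
proof
  assume "\<exists>z\<in>\<int>. \<bar>y - z\<bar> \<le> \<kappa> \<and> \<bar>y' - z\<bar> \<le> \<kappa>"
  then obtain z where "z \<in> \<int>" "\<bar>y - z\<bar> \<le> \<kappa>" "\<bar>y' - z\<bar> \<le> \<kappa>" by blast
  then show ?thesis using stair_flat[of z y] stair_flat[of z y'] \<kappa> by simp
qed (rule stair_same_floor)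

end

section \<open>Metrics that are finite on a line\<close>

text \<open>The distance to the even integers: its slope is \<open>\<plusminus> 1\<close> between consecutive integers.\<close>

definition tri :: "real \<Rightarrow> real" where "tri y = infdist y (range (\<lambda>k::int. 2 * of_int k))"

lemma tri_eq: assumes "\<bar>y - 2 * of_int j\<bar> \<le> 1" shows "tri y = \<bar>y - 2 * of_int j\<bar>"
proof (rule antisym)
  have "tri y \<le> dist y (2 * of_int j)" unfolding tri_def by (rule infdist_le) simp
  then show "tri y \<le> \<bar>y - 2 * of_int j\<bar>" by (simp add: dist_real_def)
  have "\<bar>y - 2 * of_int j\<bar> \<le> dist y (2 * of_int k)" for k :: int
  proof (cases "k = j")
    case False
    then have "1 \<le> \<bar>k - j\<bar>" by simp
    then have "1 \<le> \<bar>real_of_int (k - j)\<bar>" by linarith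
    then show ?thesis using assms unfolding dist_real_def of_int_diff by linarith
  qed (simp add: dist_real_def)
  then show "\<bar>y - 2 * of_int j\<bar> \<le> tri y"
    unfolding tri_def infdist_def by (auto intro!: cINF_greatest)
qed

lemma near_even: "\<bar>y - 2 * of_int (round (y / 2))\<bar> \<le> 1"
  using of_int_round_abs_le[of "y / 2"] by linarith

lemma tri_zero: "tri (2 * of_int j) = 0"
  using tri_eq[of "2 * of_int j" j] by simp

lemma tri_periodic: "tri (y + 2) = tri y"
proof -
  have "\<bar>y + 2 - 2 * of_int (round (y / 2) + 1)\<bar> \<le> 1" using near_even[of y] by simp
  then show ?thesis using tri_eq[OF near_even[of y]] tri_eq[of "y + 2" "round (y / 2) + 1"] by simp
qed

lemma tri_lip: "\<bar>tri y - tri y'\<bar> \<le> \<bar>y - y'\<bar>"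
  using infdist_triangle_abs[of y _ y'] unfolding tri_def dist_real_def .

lemma tri_isometry: assumes "\<lfloor>y\<rfloor> = \<lfloor>y'\<rfloor>" shows "\<bar>tri y - tri y'\<bar> = \<bar>y - y'\<bar>"
proof -
  define k where "k = \<lfloor>y\<rfloor>"
  have y: "of_int k \<le> y" "y \<le> of_int k + 1" "of_int k \<le> y'" "y' \<le> of_int k + 1"
    using assms unfolding k_def by linarith+
  obtain j where "k = 2 * j \<or> k = 2 * j - 1" by (metis evenE oddE add_diff_cancel_right' odd_two_times_div_two_succ even_plus_one_iff dvdE)
  then show ?thesis
  proof
    assume k: "k = 2 * j"
    show ?thesis using tri_eq[of y j] tri_eq[of y' j] y unfolding k by simp
  next
    assume k: "k = 2 * j - 1"
    show ?thesis using tri_eq[of y j] tri_eq[of y' j] y unfolding k by simp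
  qed
qed

text \<open>The strip is unbounded across \<open>m\<close>, so moving across costs infinitely much.\<close>

lemma dual_sq_strip:
  assumes m: "norm m = 1" and c: "0 \<le> c"
  shows "dual_sq {p. \<bar>p \<bullet> m\<bar> \<le> c} w = (if across m w = 0 then ennreal ((c * along m w)\<^sup>2) else \<infinity>)"
proof -
  have m0: "m \<noteq> 0" using m by auto
  have mm: "m \<bullet> m = 1" using m by (simp add: norm_eq_1)
  have mn: "perp m \<bullet> m = 0" by (simp add: inner2)
  have pw: "p \<bullet> w = along m w * (p \<bullet> m) + across m w * (p \<bullet> perp m)" for p
    by (subst along_across_decomp[OF m0, of w]) (rule inner_comb)
  show ?thesis
  proof (cases "across m w = 0")
    case True
    have "dual_sq {p. \<bar>p \<bullet> m\<bar> \<le> c} w \<le> ennreal ((c * along m w)\<^sup>2)"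
      unfolding dual_sq_def
    proof (rule SUP_least)
      fix p assume "p \<in> {p. \<bar>p \<bullet> m\<bar> \<le> c}"
      then have "\<bar>p \<bullet> m\<bar> * \<bar>along m w\<bar> \<le> c * \<bar>along m w\<bar>" by (intro mult_right_mono) auto
      then have "\<bar>p \<bullet> w\<bar> \<le> \<bar>c * along m w\<bar>" using pw[of p] True c by (simp add: abs_mult mult.commute)
      then show "ennreal ((p \<bullet> w)\<^sup>2) \<le> ennreal ((c * along m w)\<^sup>2)" by (intro ennreal_leI) (simp add: abs_le_square_iff)
    qed
    moreover have "ennreal ((c * along m w)\<^sup>2) \<le> dual_sq {p. \<bar>p \<bullet> m\<bar> \<le> c} w"
    proof -
      have "(c *\<^sub>R m) \<bullet> w = c * along m w" unfolding pw[of "c *\<^sub>R m"] using True mm by simp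
      moreover have "c *\<^sub>R m \<in> {p. \<bar>p \<bullet> m\<bar> \<le> c}" using c mm by simp
      ultimately show ?thesis using dual_sq_upper[of "c *\<^sub>R m" "{p. \<bar>p \<bullet> m\<bar> \<le> c}" w] by (simp only:)
    qed
    ultimately show ?thesis using True by simp
  next
    case False
    have "dual_sq {p. \<bar>p \<bullet> m\<bar> \<le> c} w = \<infinity>"
    proof (rule ccontr)
      assume "dual_sq {p. \<bar>p \<bullet> m\<bar> \<le> c} w \<noteq> \<infinity>"
      then obtain r where r: "0 \<le> r" "dual_sq {p. \<bar>p \<bullet> m\<bar> \<le> c} w = ennreal r"
        by (cases "dual_sq {p. \<bar>p \<bullet> m\<bar> \<le> c} w") auto
      define p where "p = ((r + 1) / across m w) *\<^sub>R perp m"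
      have "perp m \<bullet> perp m = 1" using mm by (simp add: inner2)
      then have "p \<bullet> w = r + 1" using pw[of p] False mn by (simp add: p_def)
      moreover have "p \<in> {p. \<bar>p \<bullet> m\<bar> \<le> c}" using c mn by (simp add: p_def)
      ultimately have "ennreal ((r + 1)\<^sup>2) \<le> ennreal r"
        using dual_sq_upper[of p "{p. \<bar>p \<bullet> m\<bar> \<le> c}" w] r by simp
      then have "(r + 1)\<^sup>2 \<le> r" using r(1) by (simp add: ennreal_le_iff)
      then show False using r(1) by (simp add: power2_eq_square algebra_simps) (metis add_nonneg_nonneg add_pos_nonneg linorder_not_less mult_nonneg_nonneg zero_less_one add.commute)
    qed
    then show ?thesis using False by simp
  qed
qed

text \<open>Level curves are translated copies of one slow curve. Across the curves the corrector follows
  a staircase, whose steps are controlled by the variation of \<open>\<phi>\<close>.\<close>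

theorem line_network:
  assumes m: "norm m = 1" and c: "1 \<le> c"
    and ratio: "filterlim (\<lambda>\<epsilon>. \<delta> \<epsilon> / \<epsilon>) at_top (at_right 0)"
  shows "\<exists>\<phi>. periodic \<phi> \<and> (\<exists>L. L-lipschitz_on UNIV \<phi>) \<and>
    Gamma_converges L2 L2_tendsto (F_eps \<delta> \<phi>) (F_lim (dual_sq {p. \<bar>p \<bullet> m\<bar> \<le> c}))"
proof -
  obtain \<zeta> dz \<sigma> M where "profile \<zeta> dz \<sigma> c 1 M" using exists_profile[OF zero_less_one c] by blast
  then interpret profile \<zeta> dz \<sigma> c 1 M .
  define P where "P = {p. \<bar>p \<bullet> m\<bar> \<le> c}"
  have m0: "m \<noteq> 0" using m by auto
  define f where "f x = across m x - \<zeta> (along m x)" for x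
  define \<phi> where "\<phi> x = tri (f x)" for x
  have al: "\<bar>along m x - along m y\<bar> \<le> norm (x - y)" "\<bar>across m x - across m y\<bar> \<le> norm (x - y)" for x y
    using along_across_le[OF m0, of "x - y"] m by (auto simp: along_diff across_diff)
  have f_lip: "\<bar>f x - f y\<bar> \<le> (1 + M) * norm (x - y)" for x y
  proof -
    have "\<bar>\<zeta> (along m x) - \<zeta> (along m y)\<bar> \<le> M * norm (x - y)"
      by (rule order_trans[OF \<zeta>_lip]) (rule mult_left_mono[OF al(1) M0])
    then show ?thesis using al(2)[of x y] unfolding f_def distrib_right by linarith
  qed
  have lip: "(1 + M)-lipschitz_on UNIV \<phi>"
  proof (rule lipschitz_onI)
    show "dist (\<phi> x) (\<phi> y) \<le> (1 + M) * dist x y" for x y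
      unfolding \<phi>_def dist_real_def dist_norm by (rule order_trans[OF tri_lip f_lip])
  qed (use M0 in simp)
  have comb: "along m (x + (a *\<^sub>R m + b *\<^sub>R perp m)) = along m x + a"
    "across m (x + (a *\<^sub>R m + b *\<^sub>R perp m)) = across m x + b" for x a b
    using along_diff[of m "x + (a *\<^sub>R m + b *\<^sub>R perp m)" x] across_diff[of m "x + (a *\<^sub>R m + b *\<^sub>R perp m)" x]
      along_comb[OF m0, of a b] across_comb[OF m0, of a b] by auto
  have per: "periodic \<phi>"
  proof -
    have sh1: "\<phi> (x + m) = \<phi> x" for x
      using comb[of x 1 0] add_int(1)[of "along m x" 1] by (simp add: \<phi>_def f_def)
    have sh2: "\<phi> (x + 2 *\<^sub>R perp m) = \<phi> x" for x
      using comb[of x 0 2] tri_periodic[of "f x"] by (simp add: \<phi>_def f_def algebra_simps)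
    have ind: "independent {m, 2 *\<^sub>R perp m} \<and> m \<noteq> 2 *\<^sub>R perp m"
    proof -
      have o: "m \<bullet> (2 *\<^sub>R perp m) = 0" by (simp add: inner2)
      have n0: "perp m \<noteq> 0" using m0 by (auto simp: vec2_eq_iff)
      have "m \<noteq> 2 *\<^sub>R perp m"
      proof
        assume "m = 2 *\<^sub>R perp m"
        then have "m \<bullet> m = m \<bullet> (2 *\<^sub>R perp m)" by (rule arg_cong)
        then show False using o m0 by simp
      qed
      moreover have "pairwise orthogonal {m, 2 *\<^sub>R perp m}"
        using o by (auto simp: pairwise_def orthogonal_def inner_commute)
      moreover have "0 \<notin> {m, 2 *\<^sub>R perp m}" using m0 n0 by auto
      ultimately show ?thesis using pairwise_orthogonal_independent by blast
    qed
    show ?thesis unfolding periodic_def using ind sh1 sh2 by blast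
  qed
  have corr: "has_correctors \<phi> p" if p: "p \<in> P" for p
    unfolding has_correctors_def
  proof (intro allI impI)
    fix \<theta> :: real assume \<theta>: "0 < \<theta>"
    define \<kappa> where "\<kappa> = min (1/4) (\<theta> / (4 * M + 4))"
    have \<kappa>: "0 < \<kappa>" "\<kappa> < 1/2" "\<kappa> \<le> 1/4" proof -
      show "\<kappa> \<le> 1/4" unfolding \<kappa>_def by (rule min.cobounded1)
      then show "\<kappa> < 1/2" by simp
      show "0 < \<kappa>" using \<theta> M0 by (simp add: \<kappa>_def)
    qed
    have \<kappa>\<theta>: "4 * M * \<kappa> \<le> \<theta>"
    proof -
      have "(4 * M + 4) * \<kappa> \<le> (4 * M + 4) * (\<theta> / (4 * M + 4))" using M0 by (intro mult_left_mono) (auto simp: \<kappa>_def)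
      also have "\<dots> = \<theta>" using M0 by simp
      finally show ?thesis using \<kappa>(1) unfolding distrib_right by linarith
    qed
    define r where "r = \<kappa> / (1 + M)"
    have r: "0 < r" "(1 + M) * r = \<kappa>" using \<kappa> M0 by (auto simp: r_def)
    have r\<kappa>: "r \<le> \<kappa>" proof -
      have "0 \<le> M * r" using M0 r(1) by simp
      then show ?thesis using r(2) unfolding distrib_right by linarith
    qed
    define T where "T x = stair \<kappa> (f x)" for x
    define \<tau> where "\<tau> x = f x - T x" for x
    define a where "a = p \<bullet> m / c"
    define b where "b = p \<bullet> perp m"
    have a: "\<bar>a\<bar> \<le> 1" using p c by (simp add: a_def P_def abs_divide)
    have \<tau>: "\<bar>\<tau> x\<bar> \<le> \<kappa>" for x using stair_near[OF \<kappa>(1,2), of "f x"] by (simp add: \<tau>_def T_def abs_minus_commute)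
    define h where "h x = a * (\<sigma> (along m x) + \<tau> x * q (along m x)) + b * T x" for x
    have shrink: "\<bar>u * v\<bar> \<le> \<bar>v\<bar>" if "\<bar>u\<bar> \<le> 1" for u v :: real
      using mult_right_mono[OF that, of "\<bar>v\<bar>"] by (simp add: abs_mult)
    have near: "\<bar>h x - p \<bullet> x\<bar> \<le> (1 + M + c) + \<kappa> + \<bar>b\<bar> * (\<kappa> + 1)" for x
    proof -
      have "p \<bullet> x = along m x * (p \<bullet> m) + across m x * b"
        unfolding b_def by (subst along_across_decomp[OF m0, of x]) (rule inner_comb)
      also have "p \<bullet> m = a * c" using c by (simp add: a_def)
      finally have "h x - p \<bullet> x = a * (\<sigma> (along m x) - c * along m x) + a * (q (along m x) * \<tau> x) + b * (T x - across m x)"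
        by (simp add: h_def algebra_simps)
      also have "\<bar>\<dots>\<bar> \<le> \<bar>a * (\<sigma> (along m x) - c * along m x)\<bar> + \<bar>a * (q (along m x) * \<tau> x)\<bar> + \<bar>b * (T x - across m x)\<bar>"
        by linarith
      also have "\<dots> \<le> (1 + M + c) + \<kappa> + \<bar>b\<bar> * (\<kappa> + 1)"
      proof (intro add_mono)
        show "\<bar>a * (\<sigma> (along m x) - c * along m x)\<bar> \<le> 1 + M + c"
          using order_trans[OF shrink[OF a] \<sigma>_near_linear] c by simp
        show "\<bar>a * (q (along m x) * \<tau> x)\<bar> \<le> \<kappa>"
          by (rule order_trans[OF shrink[OF a] order_trans[OF shrink[OF q_bound] \<tau>]])
        have "\<bar>T x - across m x\<bar> \<le> \<kappa> + 1" using \<tau>[of x] \<zeta>_bound[of "along m x"] by (simp add: \<tau>_def f_def)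
        then show "\<bar>b * (T x - across m x)\<bar> \<le> \<bar>b\<bar> * (\<kappa> + 1)" by (simp add: abs_mult mult_left_mono)
      qed
      finally show ?thesis .
    qed
    have T\<phi>: "\<bar>T x - T y\<bar> \<le> 2 * \<bar>\<phi> x - \<phi> y\<bar>" if xy: "norm (x - y) \<le> r" for x y
    proof -
      have "\<bar>f x - f y\<bar> \<le> \<kappa>"
        using f_lip[of x y] mult_left_mono[OF xy, of "1 + M"] M0 r(2) by linarith
      from near_floor_cases[OF \<kappa>(1,2) this] show ?thesis
      proof
        assume 1: "\<lfloor>f x\<rfloor> = \<lfloor>f y\<rfloor>"
        have "\<bar>T x - T y\<bar> \<le> \<bar>f x - f y\<bar> / (1 - 2 * \<kappa>)" unfolding T_def by (rule stair_same_floor[OF \<kappa>(1,2) 1])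
        also have "\<dots> \<le> \<bar>f x - f y\<bar> / (1/2)" using \<kappa> by (intro divide_left_mono) auto
        finally show ?thesis unfolding \<phi>_def tri_isometry[OF 1] by simp
      next
        assume "\<exists>z\<in>\<int>. \<bar>f x - z\<bar> \<le> \<kappa> \<and> \<bar>f y - z\<bar> \<le> \<kappa>"
        then obtain z where z: "z \<in> \<int>" "\<bar>f x - z\<bar> \<le> \<kappa>" "\<bar>f y - z\<bar> \<le> \<kappa>" by blast
        then show ?thesis using stair_flat[OF \<kappa>(1,2) z(1,2)] stair_flat[OF \<kappa>(1,2) z(1,3)] by (simp add: T_def)
      qed
    qed
    have incr: "\<bar>h x - h y\<bar> \<le> (1 + \<theta>) * norm (x - y) + (2 * (1 + \<bar>b\<bar>)) * \<bar>\<phi> x - \<phi> y\<bar>" if xy: "norm (x - y) \<le> r" for x y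
    proof -
      define D where "D = (\<sigma> (along m x) + \<tau> x * q (along m x)) - (\<sigma> (along m y) + \<tau> y * q (along m y))"
      have ns: "sqrt ((along m x - along m y)\<^sup>2 + (across m x - across m y)\<^sup>2) = norm (x - y)"
        using norm_along_across[OF m0, of "x - y"] m by (simp add: along_diff across_diff)
      have "\<bar>D\<bar> \<le> (1 + 2 * M * \<bar>along m x - along m y\<bar> + 2 * M * \<kappa>) * norm (x - y) + \<bar>(f x - f y) - (\<tau> x - \<tau> y)\<bar>"
        unfolding D_def f_def ns[symmetric] by (rule corrected_arclength_lip[OF \<tau>])
      also have "(f x - f y) - (\<tau> x - \<tau> y) = T x - T y" by (simp add: \<tau>_def)
      also have "(1 + 2 * M * \<bar>along m x - along m y\<bar> + 2 * M * \<kappa>) * norm (x - y) \<le> (1 + \<theta>) * norm (x - y)"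
      proof (rule mult_right_mono)
        have "2 * M * \<bar>along m x - along m y\<bar> \<le> 2 * M * \<kappa>"
          using al(1)[of x y] xy r\<kappa> M0 by (intro mult_left_mono) auto
        then show "1 + 2 * M * \<bar>along m x - along m y\<bar> + 2 * M * \<kappa> \<le> 1 + \<theta>" using \<kappa>\<theta> by simp
      qed simp
      finally have D: "\<bar>D\<bar> \<le> (1 + \<theta>) * norm (x - y) + \<bar>T x - T y\<bar>" by simp
      have "h x - h y = a * D + b * (T x - T y)" by (simp add: h_def D_def algebra_simps)
      also have "\<bar>\<dots>\<bar> \<le> \<bar>a * D\<bar> + \<bar>b * (T x - T y)\<bar>" by (rule abs_triangle_ineq)
      also have "\<dots> \<le> (1 + \<theta>) * norm (x - y) + (1 + \<bar>b\<bar>) * \<bar>T x - T y\<bar>"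
        using shrink[OF a, of D] D by (simp add: abs_mult distrib_right)
      also have "\<dots> \<le> (1 + \<theta>) * norm (x - y) + (1 + \<bar>b\<bar>) * (2 * \<bar>\<phi> x - \<phi> y\<bar>)"
        using mult_left_mono[OF T\<phi>[OF xy], of "1 + \<bar>b\<bar>"] by simp
      finally show ?thesis by (simp only: mult_ac)
    qed
    show "\<exists>h C r B. 0 \<le> C \<and> 0 < r \<and> (\<forall>x. \<bar>h x - p \<bullet> x\<bar> \<le> B) \<and>
        (\<forall>x y. norm (x - y) \<le> r \<longrightarrow> \<bar>h x - h y\<bar> \<le> (1 + \<theta>) * norm (x - y) + C * \<bar>\<phi> x - \<phi> y\<bar>)"
    proof (intro exI conjI allI impI)
      show "\<bar>h x - p \<bullet> x\<bar> \<le> (1 + M + c) + \<kappa> + \<bar>b\<bar> * (\<kappa> + 1)" for x by (rule near)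
      show "\<bar>h x - h y\<bar> \<le> (1 + \<theta>) * norm (x - y) + (2 * (1 + \<bar>b\<bar>)) * \<bar>\<phi> x - \<phi> y\<bar>" if "norm (x - y) \<le> r" for x y
        by (rule incr[OF that])
    qed (use r in auto)
  qed
  define nd where "nd x = along m x *\<^sub>R m + (2 * of_int (round (across m x / 2)) + \<zeta> (along m x)) *\<^sub>R perp m" for x
  have nd: "norm (nd x - x) \<le> 2" for x
  proof -
    define d where "d = (2 * of_int (round (across m x / 2)) + \<zeta> (along m x)) - across m x"
    have "nd x - (along m x *\<^sub>R m + across m x *\<^sub>R perp m) = 0 *\<^sub>R m + d *\<^sub>R perp m"
      by (simp add: nd_def d_def algebra_simps)
    then have "nd x - x = 0 *\<^sub>R m + d *\<^sub>R perp m" using along_across_decomp[OF m0, of x] by simp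
    then have "norm (nd x - x) = \<bar>d\<bar>" using m by (simp only: norm_comb) simp
    then show ?thesis using near_even[of "across m x"] \<zeta>_bound[of "along m x"] unfolding d_def by linarith
  qed
  have path: "\<exists>l. level_path \<phi> (nd x) (nd y) l \<and> l \<le> sqrt (enn2real (dual_sq P (y - x))) + (2 + 2 * (1 + M + c))"
    if fin: "dual_sq P (y - x) < \<infinity>" for x y
  proof -
    have t: "across m (y - x) = 0" and d: "dual_sq P (y - x) = ennreal ((c * along m (y - x))\<^sup>2)"
      using fin dual_sq_strip[OF m, of c "y - x"] c unfolding P_def by (auto split: if_splits)
    have tt: "across m y = across m x" using t across_diff[of m y x] by simp
    have "level_path \<phi> (nd x) (nd y) (norm m * \<bar>\<sigma> (along m y) - \<sigma> (along m x)\<bar>)"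
      unfolding nd_def tt
    proof (rule level_path_along_curve[OF m0])
      show "\<phi> (s *\<^sub>R m + (2 * of_int (round (across m x / 2)) + \<zeta> s) *\<^sub>R perp m) = 0" for s
        unfolding \<phi>_def f_def along_comb[OF m0] across_comb[OF m0] by (simp add: tri_zero)
    qed
    moreover have "\<bar>\<sigma> (along m y) - \<sigma> (along m x)\<bar> \<le> c * \<bar>along m (y - x)\<bar> + 2 * (1 + M + c)"
    proof -
      have "\<sigma> (along m y) - \<sigma> (along m x) = (\<sigma> (along m y) - c * along m y) - (\<sigma> (along m x) - c * along m x) + c * along m (y - x)"
        unfolding along_diff[symmetric] by (simp add: algebra_simps)
      moreover have "\<bar>c * along m (y - x)\<bar> = c * \<bar>along m (y - x)\<bar>" using c by (simp add: abs_mult)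
      moreover have "\<bar>a - b + u\<bar> \<le> v + 2 * K" if "\<bar>a\<bar> \<le> K" "\<bar>b\<bar> \<le> K" "\<bar>u\<bar> = v" for a b u v K :: real
        using that by linarith
      ultimately show ?thesis using \<sigma>_near_linear[of "along m y"] \<sigma>_near_linear[of "along m x"] c by (simp only: abs_of_nonneg)
    qed
    moreover have "sqrt (enn2real (dual_sq P (y - x))) = c * \<bar>along m (y - x)\<bar>"
      unfolding d using c by (simp add: abs_mult)
    ultimately show ?thesis using m by (intro exI[of _ "norm m * \<bar>\<sigma> (along m y) - \<sigma> (along m x)\<bar>"]) simp
  qed
  have "Gamma_converges L2 L2_tendsto (F_eps \<delta> \<phi>) (F_lim (dual_sq P))"
  proof (rule Gamma_convergence_of_network[OF lip _ corr _ _ path ratio])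
    show "P \<noteq> {}" using c by (auto simp: P_def intro!: exI[of _ 0])
    show "norm (nd x - x) \<le> 2 + 2 * (1 + M + c)" for x by (rule order_trans[OF nd]) (use M0 c in simp)
    show "ennreal ((norm w)\<^sup>2) \<le> dual_sq P w" for w
    proof (cases "across m w = 0")
      case True
      have "norm w = \<bar>along m w\<bar>" using norm_along_across[OF m0, of w] True m by simp
      moreover have "1 * \<bar>along m w\<bar> \<le> c * \<bar>along m w\<bar>" using c by (intro mult_right_mono) auto
      ultimately have "norm w \<le> \<bar>c * along m w\<bar>" using c by (simp add: abs_mult)
      then have "(norm w)\<^sup>2 \<le> (c * along m w)\<^sup>2" using abs_le_square_iff[of "norm w" "c * along m w"] by simp
      then show ?thesis using dual_sq_strip[OF m, of c w] c True by (simp add: P_def ennreal_leI)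
    next
      case False
      then show ?thesis using dual_sq_strip[OF m, of c w] c by (simp add: P_def)
    qed
  qed
  then show ?thesis using per lip unfolding P_def by blast
qed

section \<open>Networks of slow curves\<close>

text \<open>Curves run along all lattice lines with directions in \<open>V\<close> whose offset is a multiple of \<open>E\<close>; a unit
  step \<open>m\<close> has length \<open>L m\<close>. By the divisibility conditions on \<open>E\<close>, two such lines meet at a point that
  is an integer multiple of a lattice step along both of them, where neither curve deviates from its line.\<close>

locale network =
  fixes V :: "(real^2) set" and L :: "real^2 \<Rightarrow> real" and \<zeta> dz \<sigma> :: "real^2 \<Rightarrow> real \<Rightarrow> real" and A M E mx :: real
  assumes fin: "finite V"
    and V_int: "\<And>m. m \<in> V \<Longrightarrow> m$1 \<in> \<int> \<and> m$2 \<in> \<int>"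
    and V0: "\<And>m. m \<in> V \<Longrightarrow> m \<noteq> 0"
    and e1: "vector [1, 0] \<in> V" and e2: "vector [0, 1] \<in> V"
    and prof: "\<And>m. m \<in> V \<Longrightarrow> profile (\<zeta> m) (dz m) (\<sigma> m) (L m / norm m) A M"
    and len: "\<And>m. m \<in> V \<Longrightarrow> norm m \<le> L m"
    and mx: "\<And>m. m \<in> V \<Longrightarrow> norm m \<le> mx"
    and A: "4 * mx ^ 3 * A \<le> 1"
    and E_int: "E \<in> \<int>" and E1: "1 \<le> E"
    and E_det: "\<And>m m'. m \<in> V \<Longrightarrow> m' \<in> V \<Longrightarrow> m \<noteq> m' \<Longrightarrow> perp m' \<bullet> m \<noteq> 0 \<and> E / (perp m' \<bullet> m) \<in> \<int>"
    and E_norm: "\<And>m. m \<in> V \<Longrightarrow> E / (norm m)\<^sup>2 \<in> \<int>"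
begin

definition f :: "real^2 \<Rightarrow> real^2 \<Rightarrow> real" where "f m x = across m x - \<zeta> m (along m x)"

definition Z :: "(real^2) set" where "Z = {x. \<exists>m\<in>V. \<exists>k\<in>\<int>. f m x = E * k}"

definition \<phi> :: "real^2 \<Rightarrow> real" where "\<phi> x = infdist x Z"

text \<open>The factor \<open>E\<^sup>2\<close> makes the along coordinates of nodes integers and their offsets multiples of \<open>E\<close>,
  in all directions at once. So every node lies on a curve of each direction.\<close>

definition nodes :: "(real^2) set" where "nodes = {z. z$1 / E\<^sup>2 \<in> \<int> \<and> z$2 / E\<^sup>2 \<in> \<int>}"

lemma A0: "0 \<le> A" and M0: "0 \<le> M"
  using profile.A0[OF prof[OF e1]] profile.M0[OF prof[OF e1]] by auto

lemma norm_ge1: assumes "m \<in> V" shows "1 \<le> norm m"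
proof -
  have "(norm m)\<^sup>2 \<in> \<int>" unfolding norm2_sq using V_int[OF assms] by (intro Ints_add Ints_power) auto
  then have "1 \<le> \<bar>(norm m)\<^sup>2\<bar>" using V0[OF assms] by (intro Ints_nonzero_abs_ge1) auto
  then have "1\<^sup>2 \<le> (norm m)\<^sup>2" by simp
  then show ?thesis by (rule power2_le_imp_le) simp
qed

lemma mx1: "1 \<le> mx" using norm_ge1[OF e1] mx[OF e1] by simp

lemma L1: "m \<in> V \<Longrightarrow> 1 \<le> L m" using norm_ge1 len order_trans by blast

lemma \<zeta>_int: "m \<in> V \<Longrightarrow> s \<in> \<int> \<Longrightarrow> \<zeta> m s = 0"
  using profile.small[OF prof, of m s s] by simp

lemma \<sigma>_int: assumes "m \<in> V" "s \<in> \<int>" shows "\<sigma> m s = L m / norm m * s"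
proof -
  obtain z where "s = of_int z" using assms(2) by (auto elim: Ints_cases)
  then show ?thesis using profile.add_int(2)[OF prof[OF assms(1)], of 0 z] profile.\<sigma>0[OF prof[OF assms(1)]] by simp
qed

lemma along_across_le': assumes "m \<in> V" shows "\<bar>along m x\<bar> \<le> norm x" "\<bar>across m x\<bar> \<le> norm x"
proof -
  have "norm x / norm m \<le> norm x / 1" using norm_ge1[OF assms] by (intro divide_left_mono) auto
  then show "\<bar>along m x\<bar> \<le> norm x" "\<bar>across m x\<bar> \<le> norm x"
    using along_across_le[OF V0[OF assms], of x] by auto
qed

lemma f_lip: assumes m: "m \<in> V" shows "\<bar>f m x - f m y\<bar> \<le> (1 + M) * norm (x - y)"
proof -
  have "\<bar>\<zeta> m (along m x) - \<zeta> m (along m y)\<bar> \<le> M * \<bar>along m x - along m y\<bar>"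
    by (rule profile.\<zeta>_lip[OF prof[OF m]])
  also have "\<dots> \<le> M * norm (x - y)" unfolding along_diff by (rule mult_left_mono[OF along_across_le'(1)[OF m] M0])
  finally show ?thesis using along_across_le'(2)[OF m, of "x - y"]
    unfolding f_def across_diff[symmetric] distrib_right by linarith
qed

lemma \<phi>_lip: "\<bar>\<phi> x - \<phi> y\<bar> \<le> norm (x - y)"
  unfolding \<phi>_def dist_norm[symmetric] by (rule infdist_triangle_abs)

lemma \<phi>_le: assumes "z \<in> Z" shows "\<phi> x \<le> norm (x - z)"
  using infdist_le[OF assms, of x] by (simp add: \<phi>_def dist_norm)

lemma \<phi>_zero: "x \<in> Z \<Longrightarrow> \<phi> x = 0" by (simp add: \<phi>_def)

subsection \<open>Nodes\<close>

lemma node_coords: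
  assumes m: "m \<in> V" and z: "z \<in> nodes"
  shows "along m z \<in> \<int>" "\<exists>k\<in>\<int>. across m z = E * k"
proof -
  define a where "a = z$1 / E\<^sup>2"
  define b where "b = z$2 / E\<^sup>2"
  have ab: "a \<in> \<int>" "b \<in> \<int>" "z$1 = E * E * a" "z$2 = E * E * b"
    using z E1 by (auto simp: nodes_def a_def b_def power2_eq_square)
  have "along m z = (E / (norm m)\<^sup>2) * (E * (m$1 * a + m$2 * b))"
    unfolding along_def inner2 ab(3,4) by (simp add: algebra_simps add_divide_distrib)
  also have "\<dots> \<in> \<int>" using V_int[OF m] ab(1,2) by (intro Ints_mult Ints_add E_norm[OF m] E_int) auto
  finally show "along m z \<in> \<int>" .
  have "across m z = E * ((E / (norm m)\<^sup>2) * (m$1 * b - m$2 * a))"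
    unfolding across_def inner2 ab(3,4) by (simp add: algebra_simps diff_divide_distrib)
  moreover have "(E / (norm m)\<^sup>2) * (m$1 * b - m$2 * a) \<in> \<int>"
    using V_int[OF m] ab(1,2) by (intro Ints_mult Ints_diff E_norm[OF m]) auto
  ultimately show "\<exists>k\<in>\<int>. across m z = E * k" by blast
qed

lemma f_shift:
  assumes m: "m \<in> V" and z: "z \<in> nodes"
  shows "\<exists>k\<in>\<int>. \<forall>x. f m (x + z) = f m x + E * k"
proof -
  obtain k where k: "k \<in> \<int>" "across m z = E * k" using node_coords(2)[OF m z] by blast
  obtain i where i: "along m z = of_int i" using node_coords(1)[OF m z] by (auto elim: Ints_cases)
  have "f m (x + z) = f m x + E * k" for x
  proof -
    have "along m (x + z) = along m x + of_int i" "across m (x + z) = across m x + E * k"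
      using along_diff[of m "x + z" x] across_diff[of m "x + z" x] i k(2) by auto
    then show ?thesis unfolding f_def using profile.add_int(1)[OF prof[OF m], of "along m x" i] by simp
  qed
  then show ?thesis using k(1) by blast
qed

lemma Z_shift: assumes "z \<in> nodes" "x \<in> Z" shows "x + z \<in> Z"
proof -
  obtain m k where m: "m \<in> V" "k \<in> \<int>" "f m x = E * k" using assms(2) by (auto simp: Z_def)
  obtain l where "l \<in> \<int>" "f m (x + z) = f m x + E * l" using f_shift[OF m(1) assms(1)] by blast
  then have "f m (x + z) = E * (k + l)" "k + l \<in> \<int>" using m by (auto simp: algebra_simps)
  then show ?thesis using m(1) unfolding Z_def by blast
qed

lemma uminus_node: "z \<in> nodes \<Longrightarrow> - z \<in> nodes"
  by (auto simp: nodes_def)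

lemma node_Z: assumes z: "z \<in> nodes" shows "z \<in> Z"
proof -
  obtain k where k: "k \<in> \<int>" "across (vector [1,0]) z = E * k" using node_coords(2)[OF e1 z] by blast
  have "f (vector [1,0]) z = E * k" unfolding f_def \<zeta>_int[OF e1 node_coords(1)[OF e1 z]] using k(2) by simp
  then show ?thesis unfolding Z_def using e1 k(1) by blast
qed

lemma Z_ne: "Z \<noteq> {}" using node_Z[of 0] by (auto simp: nodes_def)

lemma \<phi>_shift_le: assumes z: "z \<in> nodes" shows "\<phi> (x + z) \<le> \<phi> x"
  unfolding \<phi>_def infdist_notempty[OF Z_ne, of x]
proof (rule cINF_greatest[OF Z_ne])
  fix y assume "y \<in> Z"
  then have "infdist (x + z) Z \<le> dist (x + z) (y + z)" by (intro infdist_le Z_shift[OF z])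
  then show "infdist (x + z) Z \<le> dist x y" by simp
qed

lemma \<phi>_shift: assumes z: "z \<in> nodes" shows "\<phi> (x + z) = \<phi> x"
  using \<phi>_shift_le[OF z, of x] \<phi>_shift_le[OF uminus_node[OF z], of "x + z"] by simp

lemma \<phi>_periodic: "periodic \<phi>"
proof -
  define a :: "real^2" where "a = vector [E\<^sup>2, 0]"
  define b :: "real^2" where "b = vector [0, E\<^sup>2]"
  have n: "a \<in> nodes" "b \<in> nodes" using E1 by (auto simp: nodes_def a_def b_def)
  have "a \<noteq> b" using E1 by (auto simp: a_def b_def vec2_eq_iff)
  moreover have "independent {a, b}"
  proof (rule pairwise_orthogonal_independent)
    show "pairwise orthogonal {a, b}"
      by (auto simp: pairwise_def orthogonal_def inner2 a_def b_def)
    show "0 \<notin> {a, b}" using E1 by (auto simp: a_def b_def vec2_eq_iff)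
  qed
  ultimately show ?thesis unfolding periodic_def using \<phi>_shift n by blast
qed

lemma node_add:
  assumes z: "z \<in> nodes" and i: "i \<in> \<int>" and v: "v$1 \<in> \<int>" "v$2 \<in> \<int>"
  shows "z + (E\<^sup>2 * i) *\<^sub>R v \<in> nodes"
proof -
  have "(z + (E\<^sup>2 * i) *\<^sub>R v) $ j / E\<^sup>2 = z$j / E\<^sup>2 + i * v$j" for j
    using E1 by (simp add: add_divide_distrib)
  then show ?thesis using z i v unfolding nodes_def by auto
qed

text \<open>The oscillation vanishes at integer along coordinates, so the curve through a node returns to its axis
  at the end of the step.\<close>

lemma step_path:
  assumes m: "m \<in> V" and z: "z \<in> nodes" and i: "i \<in> \<int>"
  shows "level_path \<phi> z (z + (E\<^sup>2 * i) *\<^sub>R m) (L m * (E\<^sup>2 * \<bar>i\<bar>))"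
proof -
  have m0: "m \<noteq> 0" by (rule V0[OF m])
  define s where "s = along m z"
  define s' where "s' = s + E\<^sup>2 * i"
  obtain k where k: "k \<in> \<int>" "across m z = E * k" using node_coords(2)[OF m z] by blast
  have s: "s \<in> \<int>" "s' \<in> \<int>" using node_coords(1)[OF m z] i E_int by (auto simp: s_def s'_def)
  have "level_path \<phi> (s *\<^sub>R m + (E * k + \<zeta> m s) *\<^sub>R perp m) (s' *\<^sub>R m + (E * k + \<zeta> m s') *\<^sub>R perp m) (norm m * \<bar>\<sigma> m s' - \<sigma> m s\<bar>)"
  proof (rule profile.level_path_along_curve[OF prof[OF m] m0])
    fix s
    have "f m (s *\<^sub>R m + (E * k + \<zeta> m s) *\<^sub>R perp m) = E * k"
      unfolding f_def along_comb[OF m0] across_comb[OF m0] by simp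
    then have "s *\<^sub>R m + (E * k + \<zeta> m s) *\<^sub>R perp m \<in> Z" unfolding Z_def using m k(1) by blast
    then show "\<phi> (s *\<^sub>R m + (E * k + \<zeta> m s) *\<^sub>R perp m) = 0" by (rule \<phi>_zero)
  qed
  moreover have "s *\<^sub>R m + (E * k + \<zeta> m s) *\<^sub>R perp m = z"
    using along_across_decomp[OF m0, of z] \<zeta>_int[OF m s(1)] k(2) by (simp add: s_def)
  moreover have "s' *\<^sub>R m + (E * k + \<zeta> m s') *\<^sub>R perp m = z + (E\<^sup>2 * i) *\<^sub>R m"
    using along_across_decomp[OF m0, of z] \<zeta>_int[OF m s(2)] k(2) by (simp add: s_def s'_def algebra_simps)
  moreover have "norm m * \<bar>\<sigma> m s' - \<sigma> m s\<bar> = L m * (E\<^sup>2 * \<bar>i\<bar>)"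
  proof -
    have "\<sigma> m s' - \<sigma> m s = L m / norm m * (E\<^sup>2 * i)"
      unfolding \<sigma>_int[OF m s(1)] \<sigma>_int[OF m s(2)] right_diff_distrib[symmetric] by (simp add: s'_def)
    then show ?thesis using m0 L1[OF m] by (simp add: abs_mult)
  qed
  ultimately show ?thesis by simp
qed

lemma steps_path:
  assumes "finite W" "W \<subseteq> V" and z: "z \<in> nodes" and j: "\<And>m. j m \<in> \<int>"
  shows "z + (\<Sum>m\<in>W. (E\<^sup>2 * j m) *\<^sub>R m) \<in> nodes \<and>
    level_path \<phi> z (z + (\<Sum>m\<in>W. (E\<^sup>2 * j m) *\<^sub>R m)) (\<Sum>m\<in>W. L m * (E\<^sup>2 * \<bar>j m\<bar>))"
  using assms(1,2)
proof (induction W rule: finite_induct)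
  case empty
  show ?case using z level_path_refl[of \<phi> z] \<phi>_zero[OF node_Z[OF z]] by simp
next
  case (insert m W)
  define y where "y = z + (\<Sum>m\<in>W. (E\<^sup>2 * j m) *\<^sub>R m)"
  have y: "y \<in> nodes" "level_path \<phi> z y (\<Sum>m\<in>W. L m * (E\<^sup>2 * \<bar>j m\<bar>))"
    using insert unfolding y_def by auto
  have m: "m \<in> V" using insert by simp
  have "y + (E\<^sup>2 * j m) *\<^sub>R m \<in> nodes" using node_add[OF y(1) j] V_int[OF m] by blast
  moreover have "level_path \<phi> z (y + (E\<^sup>2 * j m) *\<^sub>R m) ((\<Sum>m\<in>W. L m * (E\<^sup>2 * \<bar>j m\<bar>)) + L m * (E\<^sup>2 * \<bar>j m\<bar>))"
    by (rule level_path_trans[OF y(2) step_path[OF m y(1) j]])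
  ultimately show ?case using insert(1,2) by (simp add: y_def add_ac)
qed

subsection \<open>Crossings\<close>

text \<open>Cramer's rule.\<close>

lemma det_coords:
  assumes "perp m' \<bullet> m \<noteq> 0"
  shows "y = ((perp m' \<bullet> y) / (perp m' \<bullet> m)) *\<^sub>R m - ((perp m \<bullet> y) / (perp m' \<bullet> m)) *\<^sub>R m'"
proof -
  define D where "D = perp m' \<bullet> m"
  have D: "D \<noteq> 0" "D = m'$1 * m$2 - m'$2 * m$1" using assms by (auto simp: D_def inner2)
  have "(perp m' \<bullet> y) * m$i - (perp m \<bullet> y) * m'$i = D * y$i" for i
  proof -
    have "i = 1 \<or> i = 2" using exhaust_2 by blast
    then show ?thesis by (auto simp: inner2 D(2) algebra_simps)
  qed
  then have "y$i = (perp m' \<bullet> y) / D * m$i - (perp m \<bullet> y) / D * m'$i" for i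
    using D(1) by (simp add: diff_divide_distrib[symmetric] eq_divide_eq mult.commute)
  then show ?thesis unfolding D_def[symmetric] by (simp add: vec_eq_iff)
qed

text \<open>At the crossing of the two axes both along coordinates are integers, and the deviation of a curve from its axis grows at
  most like \<open>A\<close> times the distance from there. As \<open>A\<close> is small, the distance \<open>|x - z|\<close> can be absorbed, and the
  tubes of width \<open>c\<close> overlap only within a multiple of \<open>c\<close> from the crossing.\<close>

lemma crossing:
  assumes m: "m \<in> V" "m' \<in> V" "m \<noteq> m'" and k: "k \<in> \<int>" "l \<in> \<int>"
    and x: "\<bar>f m x - E * k\<bar> \<le> c" "\<bar>f m' x - E * l\<bar> \<le> c"
  shows "\<exists>z. along m z \<in> \<int> \<and> along m' z \<in> \<int> \<and> across m z = E * k \<and> across m' z = E * l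
    \<and> norm (x - z) \<le> 4 * mx ^ 3 * c"
proof -
  define D where "D = perp m' \<bullet> m"
  have D: "D \<noteq> 0" "E / D \<in> \<int>" using E_det[OF m] by (auto simp: D_def)
  have D1: "1 \<le> \<bar>D\<bar>"
    using D(1) V_int[OF m(1)] V_int[OF m(2)] unfolding D_def inner2 perp_nth by (intro Ints_nonzero_abs_ge1) auto
  define N where "N = (norm m)\<^sup>2"
  define N' where "N' = (norm m')\<^sup>2"
  have N: "N \<noteq> 0" "N' \<noteq> 0" "m \<bullet> m = N" "m' \<bullet> m' = N'" using V0 m by (auto simp: N_def N'_def power2_norm_eq_inner)
  have NZ: "N \<in> \<int>" "N' \<in> \<int>" "m \<bullet> m' \<in> \<int>"
    unfolding N(3,4)[symmetric] inner2 using V_int[OF m(1)] V_int[OF m(2)] by auto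
  define z where "z = (E * l * N' / D) *\<^sub>R m - (E * k * N / D) *\<^sub>R m'"
  have perps: "perp m \<bullet> m = 0" "perp m' \<bullet> m' = 0" "perp m \<bullet> m' = - D" "perp m' \<bullet> m = D"
    by (simp_all add: inner2 D_def)
  have az: "across m z = E * k" "across m' z = E * l"
    unfolding across_def z_def inner_diff_right inner_scaleR_right perps N_def[symmetric] N'_def[symmetric]
    using D(1) N(1,2) by simp_all
  have "along m z = (E / D) * (l * N' - k * (m \<bullet> m'))"
    unfolding along_def z_def inner_diff_right inner_scaleR_right N N_def[symmetric]
    using N(1) D(1) by (simp add: field_simps)
  moreover have "(E / D) * (l * N' - k * (m \<bullet> m')) \<in> \<int>" by (intro Ints_mult Ints_diff D(2) NZ k)
  ultimately have i1: "along m z \<in> \<int>" by (simp only:)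
  have "along m' z = (E / D) * (l * (m \<bullet> m') - k * N)"
    unfolding along_def z_def inner_diff_right inner_scaleR_right N N'_def[symmetric] inner_commute[of m' m]
    using N(2) D(1) by (simp add: field_simps)
  moreover have "(E / D) * (l * (m \<bullet> m') - k * N) \<in> \<int>" by (intro Ints_mult Ints_diff D(2) NZ k)
  ultimately have i2: "along m' z \<in> \<int>" by (simp only:)
  define y where "y = x - z"
  have a: "\<bar>across v y\<bar> \<le> c + A * norm y" if v: "v \<in> V" "along v z \<in> \<int>" "across v z = E * i" "\<bar>f v x - E * i\<bar> \<le> c" for v i
  proof -
    have "across v y = (f v x - E * i) + \<zeta> v (along v x)"
      unfolding y_def across_diff[symmetric] v(3) f_def by simp
    moreover have "\<bar>\<zeta> v (along v x)\<bar> \<le> A * norm y"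
    proof -
      have "\<bar>\<zeta> v (along v x)\<bar> \<le> A * \<bar>along v x - along v z\<bar>" by (rule profile.small[OF prof[OF v(1)] v(2)])
      also have "\<dots> \<le> A * norm y" unfolding along_diff y_def by (rule mult_left_mono[OF along_across_le'(1)[OF v(1)] A0])
      finally show ?thesis .
    qed
    ultimately show ?thesis using v(4) by linarith
  qed
  have a1: "\<bar>across m y\<bar> \<le> c + A * norm y" by (rule a[OF m(1) i1 az(1) x(1)])
  have a2: "\<bar>across m' y\<bar> \<le> c + A * norm y" by (rule a[OF m(2) i2 az(2) x(2)])
  have term_le: "\<bar>(perp v \<bullet> y) / D\<bar> * norm v' \<le> mx ^ 3 * (c + A * norm y)"
    if v: "v \<in> V" "v' \<in> V" "\<bar>across v y\<bar> \<le> c + A * norm y" for v v'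
  proof -
    have v0: "v \<noteq> 0" by (rule V0[OF v(1)])
    have "\<bar>(perp v \<bullet> y) / D\<bar> \<le> \<bar>perp v \<bullet> y\<bar> / 1" unfolding abs_divide using D1 by (intro divide_left_mono) auto
    also have "\<dots> = (norm v)\<^sup>2 * \<bar>across v y\<bar>" using v0 by (simp add: across_def abs_mult)
    also have "\<dots> \<le> mx\<^sup>2 * (c + A * norm y)" using mx[OF v(1)] v(3) mx1 by (intro mult_mono power_mono) auto
    finally have "\<bar>(perp v \<bullet> y) / D\<bar> * norm v' \<le> (mx\<^sup>2 * (c + A * norm y)) * mx"
      using mx[OF v(2)] v(3) by (intro mult_mono) auto
    then show ?thesis by (simp add: power2_eq_square power3_eq_cube mult_ac)
  qed
  have "norm y \<le> \<bar>(perp m' \<bullet> y) / D\<bar> * norm m + \<bar>(perp m \<bullet> y) / D\<bar> * norm m'"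
  proof -
    have "y = ((perp m' \<bullet> y) / D) *\<^sub>R m - ((perp m \<bullet> y) / D) *\<^sub>R m'"
      unfolding D_def by (rule det_coords[OF D(1)[unfolded D_def]])
    then have "norm y = norm (((perp m' \<bullet> y) / D) *\<^sub>R m - ((perp m \<bullet> y) / D) *\<^sub>R m')" by (rule arg_cong)
    also have "\<dots> \<le> norm (((perp m' \<bullet> y) / D) *\<^sub>R m) + norm (((perp m \<bullet> y) / D) *\<^sub>R m')" by (rule norm_triangle_ineq4)
    finally show ?thesis by (simp only: norm_scaleR)
  qed
  also have "\<dots> \<le> mx ^ 3 * (c + A * norm y) + mx ^ 3 * (c + A * norm y)"
    by (intro add_mono term_le m a1 a2)
  also have "\<dots> = 2 * mx ^ 3 * c + (4 * mx ^ 3 * A) * norm y / 2" by (simp add: algebra_simps)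
  also have "\<dots> \<le> 2 * mx ^ 3 * c + norm y / 2"
    using mult_right_mono[OF A norm_ge_zero[of y]] by linarith
  finally have "norm y \<le> 4 * mx ^ 3 * c" by simp
  then show ?thesis using i1 i2 az unfolding y_def by blast
qed

end

section \<open>Correctors for networks\<close>

text \<open>A function with small slope near the zero set of \<open>\<phi>\<close> can be cut off to a locally constant function
  away from it: the cutoff is a function of \<open>\<phi>\<close>, so its cost is controlled by the variation of \<open>\<phi>\<close>.\<close>

lemma has_correctors_blend:
  fixes \<phi> :: "real^2 \<Rightarrow> real"
  assumes lip: "\<And>x y. \<bar>\<phi> x - \<phi> y\<bar> \<le> norm (x - y)"
    and blend: "\<And>\<theta>. 0 < \<theta> \<Longrightarrow> \<exists>c B r u v. 0 < c \<and> 0 < r \<and>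
      (\<forall>x. \<phi> x < c \<longrightarrow> \<bar>u x - p \<bullet> x\<bar> \<le> B) \<and> (\<forall>x. \<bar>v x - p \<bullet> x\<bar> \<le> B) \<and>
      (\<forall>x y. norm (x - y) \<le> r \<and> \<phi> x < c \<and> \<phi> y < c \<longrightarrow> \<bar>u x - u y\<bar> \<le> (1 + \<theta>) * norm (x - y)) \<and>
      (\<forall>x y. norm (x - y) < \<phi> x \<longrightarrow> v x = v y)"
  shows "has_correctors \<phi> p"
  unfolding has_correctors_def
proof (intro allI impI)
  fix \<theta> :: real assume \<theta>: "0 < \<theta>"
  obtain c B r u v where bl: "0 < c \<and> 0 < r \<and>
      (\<forall>x. \<phi> x < c \<longrightarrow> \<bar>u x - p \<bullet> x\<bar> \<le> B) \<and> (\<forall>x. \<bar>v x - p \<bullet> x\<bar> \<le> B) \<and>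
      (\<forall>x y. norm (x - y) \<le> r \<and> \<phi> x < c \<and> \<phi> y < c \<longrightarrow> \<bar>u x - u y\<bar> \<le> (1 + \<theta>) * norm (x - y)) \<and>
      (\<forall>x y. norm (x - y) < \<phi> x \<longrightarrow> v x = v y)"
    using blend[OF \<theta>] by (elim exE) (rule that)
  have c: "0 < c" and r: "0 < r"
    and u: "\<And>x. \<phi> x < c \<Longrightarrow> \<bar>u x - p \<bullet> x\<bar> \<le> B" and v: "\<And>x. \<bar>v x - p \<bullet> x\<bar> \<le> B"
    and uu: "\<And>x y. norm (x - y) \<le> r \<Longrightarrow> \<phi> x < c \<Longrightarrow> \<phi> y < c \<Longrightarrow> \<bar>u x - u y\<bar> \<le> (1 + \<theta>) * norm (x - y)"
    and vv: "\<And>x y. norm (x - y) < \<phi> x \<Longrightarrow> v x = v y"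
    using bl by blast+
  define cut where "cut y = max 0 (min 1 ((2 * c / 3 - y) * (3 / c)))" for y
  have cut01: "0 \<le> cut y" "cut y \<le> 1" for y by (auto simp: cut_def)
  have cut1: "cut y = 1" if "y \<le> c / 3" for y
  proof -
    have "1 \<le> (2 * c / 3 - y) * (3 / c)" using that c by (simp add: field_simps)
    then show ?thesis by (simp add: cut_def)
  qed
  have cut0: "cut y = 0" if "2 * c / 3 \<le> y" for y
  proof -
    have "(2 * c / 3 - y) * (3 / c) \<le> 0" using that c by (intro mult_nonpos_nonneg) auto
    then show ?thesis by (simp add: cut_def)
  qed
  have cutlip: "\<bar>cut y - cut y'\<bar> \<le> 3 / c * \<bar>y - y'\<bar>" for y y'
  proof -
    have "\<bar>cut y - cut y'\<bar> \<le> \<bar>(2 * c / 3 - y) * (3 / c) - (2 * c / 3 - y') * (3 / c)\<bar>"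
      unfolding cut_def by linarith
    also have "\<dots> = \<bar>y' - y\<bar> * \<bar>3 / c\<bar>" unfolding left_diff_distrib[symmetric] abs_mult by simp
    finally show ?thesis using c by (simp add: abs_minus_commute mult.commute)
  qed
  define h where "h x = cut (\<phi> x) * u x + (1 - cut (\<phi> x)) * v x" for x
  define \<rho> where "\<rho> = min r (c / 6)"
  have B: "0 \<le> B" using v[of 0] by linarith
  have "\<exists>h C r B. 0 \<le> C \<and> 0 < r \<and> (\<forall>x. \<bar>h x - p \<bullet> x\<bar> \<le> B) \<and>
      (\<forall>x y. norm (x - y) \<le> r \<longrightarrow> \<bar>h x - h y\<bar> \<le> (1 + \<theta>) * norm (x - y) + C * \<bar>\<phi> x - \<phi> y\<bar>)"
  proof (intro exI conjI allI impI)
    show "0 < \<rho>" using r c by (simp add: \<rho>_def)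
    show "0 \<le> (3 / c) * (2 * B)" using c B by simp
    fix x
    show "\<bar>h x - p \<bullet> x\<bar> \<le> B"
    proof (cases "\<phi> x < c")
      case True
      have "h x - p \<bullet> x = cut (\<phi> x) * (u x - p \<bullet> x) + (1 - cut (\<phi> x)) * (v x - p \<bullet> x)" by (simp add: h_def algebra_simps)
      also have "\<bar>\<dots>\<bar> \<le> cut (\<phi> x) * \<bar>u x - p \<bullet> x\<bar> + (1 - cut (\<phi> x)) * \<bar>v x - p \<bullet> x\<bar>"
        using cut01[of "\<phi> x"] by (intro order_trans[OF abs_triangle_ineq]) (simp add: abs_mult)
      also have "\<dots> \<le> cut (\<phi> x) * B + (1 - cut (\<phi> x)) * B"
        using cut01[of "\<phi> x"] u[OF True] v[of x] by (intro add_mono mult_left_mono) auto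
      finally show ?thesis by (simp add: algebra_simps)
    next
      case False
      then show ?thesis using cut0[of "\<phi> x"] c v[of x] by (simp add: h_def)
    qed
    fix y assume xy: "norm (x - y) \<le> \<rho>"
    have xr: "norm (x - y) \<le> r" "norm (x - y) \<le> c / 6" using xy by (auto simp: \<rho>_def)
    have d: "\<bar>\<phi> x - \<phi> y\<bar> \<le> c / 6" using lip[of x y] xr by linarith
    have nn: "0 \<le> (3 / c) * (2 * B) * \<bar>\<phi> x - \<phi> y\<bar>" "0 \<le> (1 + \<theta>) * norm (x - y)" using c B \<theta> by simp_all
    consider "\<phi> x \<le> c / 6" | "5 * c / 6 \<le> \<phi> x" | "c / 6 < \<phi> x" "\<phi> x < 5 * c / 6" by linarith
    then show "\<bar>h x - h y\<bar> \<le> (1 + \<theta>) * norm (x - y) + (3 / c) * (2 * B) * \<bar>\<phi> x - \<phi> y\<bar>"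
    proof cases
      case 1
      then have "\<phi> x \<le> c / 3" "\<phi> y \<le> c / 3" "\<phi> x < c" "\<phi> y < c" using d c by linarith+
      then show ?thesis using uu[OF xr(1)] nn(1) cut1 by (simp add: h_def)
    next
      case 2
      then have b: "2 * c / 3 \<le> \<phi> x" "2 * c / 3 \<le> \<phi> y" "norm (x - y) < \<phi> x" using d c xr by linarith+
      then show ?thesis using vv[OF b(3)] nn cut0 by (simp add: h_def)
    next
      case 3
      then have b: "\<phi> x < c" "\<phi> y < c" "norm (x - y) < \<phi> x" using d c xr by linarith+
      have "h x - h y = cut (\<phi> x) * (u x - u y) + (cut (\<phi> x) - cut (\<phi> y)) * (u y - v y)"
        unfolding h_def vv[OF b(3)] by (simp add: algebra_simps)
      also have "\<bar>\<dots>\<bar> \<le> cut (\<phi> x) * \<bar>u x - u y\<bar> + \<bar>cut (\<phi> x) - cut (\<phi> y)\<bar> * \<bar>u y - v y\<bar>"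
        using cut01[of "\<phi> x"] by (intro order_trans[OF abs_triangle_ineq]) (simp add: abs_mult)
      also have "\<dots> \<le> 1 * ((1 + \<theta>) * norm (x - y)) + (3 / c * \<bar>\<phi> x - \<phi> y\<bar>) * (2 * B)"
      proof (intro add_mono mult_mono)
        show "\<bar>u y - v y\<bar> \<le> 2 * B" using u[OF b(2)] v[of y] by linarith
      qed (use cut01 cutlip uu[OF xr(1) b(1,2)] c in auto)
      finally show ?thesis by (simp add: mult_ac)
    qed
  qed
  then show "\<exists>h C r B. 0 \<le> C \<and> 0 < r \<and> (\<forall>x. \<bar>h x - p \<bullet> x\<bar> \<le> B) \<and>
      (\<forall>x y. norm (x - y) \<le> r \<longrightarrow> \<bar>h x - h y\<bar> \<le> (1 + \<theta>) * norm (x - y) + C * \<bar>\<phi> x - \<phi> y\<bar>)" .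
qed

context network
begin

definition level :: "real^2 \<Rightarrow> real^2 \<Rightarrow> real" where "level m x = of_int (round (f m x / E))"

definition arc :: "real^2 \<Rightarrow> real^2 \<Rightarrow> real" where
  "arc m x = \<sigma> m (along m x) + (f m x - E * level m x) * profile.q (dz m) (along m x)"

text \<open>Near a curve the corrector is, up to a staircase that is flat around the crossings, proportional to
  the arc length.\<close>

definition H :: "real^2 \<Rightarrow> real \<Rightarrow> real^2 \<Rightarrow> real^2 \<Rightarrow> real" where
  "H p \<kappa> m x = (p \<bullet> perp m) * (E * level m x) + (p \<bullet> m) * stair \<kappa> (arc m x / (L m / norm m))"

lemma level_eq:
  assumes k: "k \<in> \<int>" and x: "\<bar>f m x - E * k\<bar> \<le> d" and d: "d < 1/2"
  shows "level m x = k"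
proof -
  obtain i where i: "k = of_int i" using k by (auto elim: Ints_cases)
  have "f m x / E - k = (f m x - E * k) / E" using E1 by (simp add: diff_divide_distrib)
  then have "\<bar>f m x / E - k\<bar> = \<bar>f m x - E * k\<bar> / E" using E1 by (simp add: abs_divide)
  also have "\<dots> \<le> \<bar>f m x - E * k\<bar> / 1" using E1 by (intro divide_left_mono) auto
  also have "\<dots> < 1/2" using x d by simp
  finally have "round (f m x / E) = i" unfolding i by (rule round_unique')
  then show ?thesis by (simp add: level_def i)
qed

lemma \<mu>: assumes "m \<in> V" shows "1 \<le> L m / norm m" "L m / norm m \<le> L m"
proof -
  have n: "1 \<le> norm m" by (rule norm_ge1[OF assms])
  then have "0 < norm m" by linarith
  then show "1 \<le> L m / norm m" using len[OF assms] by (simp only: le_divide_eq_1_pos)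
  have "L m / norm m \<le> L m / 1" using n L1[OF assms] by (intro divide_left_mono) auto
  then show "L m / norm m \<le> L m" by simp
qed

lemma div_\<mu>_le: assumes "m \<in> V" shows "\<bar>a / (L m / norm m)\<bar> \<le> \<bar>a\<bar>"
proof -
  have "\<bar>a\<bar> / (L m / norm m) \<le> \<bar>a\<bar> / 1" using \<mu>[OF assms] by (intro divide_left_mono) auto
  moreover have "\<bar>L m / norm m\<bar> = L m / norm m" using \<mu>(1)[OF assms] by linarith
  ultimately show ?thesis by (simp only: abs_divide[of a] div_by_1)
qed

lemma tail_le: assumes m: "m \<in> V" and t: "\<bar>t\<bar> \<le> d" shows "\<bar>t * profile.q (dz m) s\<bar> \<le> d"
  using mult_left_mono[OF profile.q_bound[OF prof[OF m], of s], of "\<bar>t\<bar>"] t by (simp add: abs_mult)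

text \<open>Close to a crossing \<open>z\<close> the arc length is close to an integer number of periods, so the staircase is flat.
  The value \<open>p \<bullet> z\<close> does not refer to the direction \<open>m\<close> any more.\<close>

lemma H_vertex:
  assumes m: "m \<in> V" and k: "k \<in> \<int>" and x: "\<bar>f m x - E * k\<bar> \<le> d" and d: "d < 1/2"
    and z: "along m z \<in> \<int>" "across m z = E * k" "norm (x - z) \<le> K * d"
    and \<kappa>: "0 < \<kappa>" "\<kappa> < 1/2" "((1 + M) * K + 1) * d \<le> \<kappa>"
  shows "H p \<kappa> m x = p \<bullet> z"
proof -
  have lv: "level m x = k" by (rule level_eq[OF k x d])
  have "\<bar>\<sigma> m (along m x) - \<sigma> m (along m z)\<bar> \<le> (1 + M) * \<bar>along m x - along m z\<bar>"
    by (rule profile.\<sigma>_lip[OF prof[OF m]])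
  also have "\<dots> \<le> (1 + M) * (K * d)"
    unfolding along_diff using M0 order_trans[OF along_across_le'(1)[OF m] z(3)] by (intro mult_left_mono) auto
  finally have "\<bar>arc m x - \<sigma> m (along m z)\<bar> \<le> \<kappa>"
    using tail_le[OF m x, of "along m x"] \<kappa>(3) unfolding arc_def lv by (simp add: distrib_right mult.assoc)
  then have "\<bar>(arc m x - \<sigma> m (along m z)) / (L m / norm m)\<bar> \<le> \<kappa>" by (rule order_trans[OF div_\<mu>_le[OF m]])
  moreover have "\<sigma> m (along m z) / (L m / norm m) = along m z"
    unfolding \<sigma>_int[OF m z(1)] using \<mu>(1)[OF m] by (intro nonzero_mult_div_cancel_left) linarith
  ultimately have "\<bar>arc m x / (L m / norm m) - along m z\<bar> \<le> \<kappa>" by (simp only: diff_divide_distrib)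
  then have "stair \<kappa> (arc m x / (L m / norm m)) = along m z" by (rule stair_flat[OF \<kappa>(1,2) z(1)])
  then have "H p \<kappa> m x = along m z * (p \<bullet> m) + across m z * (p \<bullet> perp m)"
    unfolding H_def lv z(2) by (simp add: mult_ac)
  also have "\<dots> = p \<bullet> z" unfolding inner_comb[symmetric] along_across_decomp[OF V0[OF m], symmetric] ..
  finally show ?thesis .
qed

lemma H_consistent:
  assumes m: "m \<in> V" "m' \<in> V" and k: "k \<in> \<int>" "l \<in> \<int>"
    and x: "\<bar>f m x - E * k\<bar> \<le> d" "\<bar>f m' x - E * l\<bar> \<le> d" and d: "d < 1/2"
    and \<kappa>: "0 < \<kappa>" "\<kappa> < 1/2" "((1 + M) * (4 * mx ^ 3) + 1) * d \<le> \<kappa>"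
  shows "H p \<kappa> m x = H p \<kappa> m' x"
proof (cases "m = m'")
  case False
  obtain z where z: "along m z \<in> \<int>" "along m' z \<in> \<int>" "across m z = E * k" "across m' z = E * l" "norm (x - z) \<le> 4 * mx ^ 3 * d"
    using crossing[OF m False k x] by blast
  show ?thesis
    using H_vertex[OF m(1) k(1) x(1) d z(1,3,5) \<kappa>] H_vertex[OF m(2) k(2) x(2) d z(2,4,5) \<kappa>] by simp
qed simp

text \<open>Unlike for parallel curves, the offset \<open>f m x - E k\<close> itself is the correction of the arc length here, so no
  variation of \<open>\<phi>\<close> appears.\<close>

lemma H_lip:
  assumes m: "m \<in> V" and k: "k \<in> \<int>" and x: "\<bar>f m x - E * k\<bar> \<le> d" and y: "\<bar>f m y - E * k\<bar> \<le> d" and d: "d < 1/2"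
    and p: "\<bar>p \<bullet> m\<bar> \<le> L m" and r: "norm (x - y) \<le> r"
    and \<kappa>: "0 < \<kappa>" "\<kappa> < 1/2" "(1 + 2 * M * r + 2 * M * d) * r \<le> \<kappa>"
  shows "\<bar>H p \<kappa> m x - H p \<kappa> m y\<bar> \<le> (1 + 2 * M * r + 2 * M * d) / (1 - 2 * \<kappa>) * norm (x - y)"
proof -
  have n1: "1 \<le> norm m" by (rule norm_ge1[OF m])
  have d0: "0 \<le> d" and r0: "0 \<le> r" using x r norm_ge_zero[of "x - y"] by linarith+
  have lv: "level m x = k" "level m y = k" by (rule level_eq[OF k x d], rule level_eq[OF k y d])
  define Q where "Q = 1 + 2 * M * r + 2 * M * d"
  define a where "a v = arc m v / (L m / norm m)" for v
  have Q0: "0 \<le> Q" unfolding Q_def using M0 d0 r0 by simp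
  have ns: "sqrt ((along m x - along m y)\<^sup>2 + (across m x - across m y)\<^sup>2) = norm (x - y) / norm m"
    using norm_along_across[OF V0[OF m], of "x - y"] V0[OF m] by (simp add: along_diff across_diff)
  have "\<bar>arc m x - arc m y\<bar> \<le> (1 + 2 * M * \<bar>along m x - along m y\<bar> + 2 * M * d) * (norm (x - y) / norm m)
      + \<bar>(f m x - f m y) - ((f m x - E * k) - (f m y - E * k))\<bar>"
    unfolding arc_def lv ns[symmetric]
    using profile.corrected_arclength_lip[OF prof[OF m] x, of "along m x" "along m y" "f m y - E * k" "across m x" "across m y"]
    by (simp only: f_def)
  also have "(f m x - f m y) - ((f m x - E * k) - (f m y - E * k)) = 0" by simp
  also have "(1 + 2 * M * \<bar>along m x - along m y\<bar> + 2 * M * d) * (norm (x - y) / norm m) \<le> Q * (norm (x - y) / norm m)"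
  proof (rule mult_right_mono)
    have "2 * M * \<bar>along m x - along m y\<bar> \<le> 2 * M * r"
      unfolding along_diff using M0 order_trans[OF along_across_le'(1)[OF m] r] by (intro mult_left_mono) auto
    then show "1 + 2 * M * \<bar>along m x - along m y\<bar> + 2 * M * d \<le> Q" by (simp add: Q_def)
  qed simp
  finally have arc: "\<bar>arc m x - arc m y\<bar> \<le> Q * (norm (x - y) / norm m)" by simp
  have "norm (x - y) / norm m \<le> norm (x - y) / 1" using n1 by (intro divide_left_mono) auto
  then have "Q * (norm (x - y) / norm m) \<le> Q * r" using r Q0 by (intro mult_left_mono) auto
  then have "\<bar>arc m x - arc m y\<bar> \<le> \<kappa>" using arc \<kappa>(3) unfolding Q_def[symmetric] by linarith
  then have "\<bar>a x - a y\<bar> \<le> \<kappa>"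
    unfolding a_def diff_divide_distrib[symmetric] by (rule order_trans[OF div_\<mu>_le[OF m]])
  then have "\<bar>stair \<kappa> (a x) - stair \<kappa> (a y)\<bar> \<le> \<bar>a x - a y\<bar> / (1 - 2 * \<kappa>)" by (rule stair_lip[OF \<kappa>(1,2)])
  then have "L m * \<bar>stair \<kappa> (a x) - stair \<kappa> (a y)\<bar> \<le> L m * (\<bar>a x - a y\<bar> / (1 - 2 * \<kappa>))"
    using L1[OF m] by (intro mult_left_mono) auto
  also have "L m * (\<bar>a x - a y\<bar> / (1 - 2 * \<kappa>)) = norm m * \<bar>arc m x - arc m y\<bar> / (1 - 2 * \<kappa>)"
  proof -
    have "\<bar>a x - a y\<bar> = \<bar>arc m x - arc m y\<bar> / (L m / norm m)"
      unfolding a_def diff_divide_distrib[symmetric] abs_divide using L1[OF m] by simp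
    then show ?thesis using L1[OF m] by simp
  qed
  also have "\<dots> \<le> norm m * (Q * (norm (x - y) / norm m)) / (1 - 2 * \<kappa>)"
    using arc \<kappa>(2) by (intro divide_right_mono mult_left_mono) auto
  also have "\<dots> = Q / (1 - 2 * \<kappa>) * norm (x - y)" using V0[OF m] by simp
  finally have "L m * \<bar>stair \<kappa> (a x) - stair \<kappa> (a y)\<bar> \<le> Q / (1 - 2 * \<kappa>) * norm (x - y)" .
  moreover have "H p \<kappa> m x - H p \<kappa> m y = (p \<bullet> m) * (stair \<kappa> (a x) - stair \<kappa> (a y))"
    unfolding H_def lv a_def by (simp add: right_diff_distrib)
  moreover have "\<bar>p \<bullet> m\<bar> * \<bar>stair \<kappa> (a x) - stair \<kappa> (a y)\<bar> \<le> L m * \<bar>stair \<kappa> (a x) - stair \<kappa> (a y)\<bar>"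
    by (rule mult_right_mono[OF p]) simp
  ultimately show ?thesis unfolding Q_def[symmetric] by (simp add: abs_mult)
qed

lemma H_near:
  assumes m: "m \<in> V" and k: "k \<in> \<int>" and x: "\<bar>f m x - E * k\<bar> \<le> d" and d: "d < 1/2"
    and p: "\<bar>p \<bullet> m\<bar> \<le> L m" and \<kappa>: "0 < \<kappa>" "\<kappa> < 1/2"
  shows "\<bar>H p \<kappa> m x - p \<bullet> x\<bar> \<le> norm p * mx * (1 + A) + sum L V * (3 + M + sum L V)"
proof -
  have lv: "level m x = k" by (rule level_eq[OF k x d])
  have Ls: "L m \<le> sum L V" by (rule member_le_sum[OF m _ fin]) (use L1 in force)
  define \<mu> where "\<mu> = L m / norm m"
  have \<mu>: "1 \<le> \<mu>" "\<mu> \<le> sum L V" using \<mu>[OF m] Ls by (auto simp: \<mu>_def)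
  have px: "p \<bullet> x = along m x * (p \<bullet> m) + across m x * (p \<bullet> perp m)"
    by (subst along_across_decomp[OF V0[OF m], of x]) (rule inner_comb)
  have a: "\<bar>E * k - across m x\<bar> \<le> 1 + A"
    using x d profile.\<zeta>_bound[OF prof[OF m], of "along m x"] unfolding f_def by linarith
  have np: "norm (perp m) = norm m" using norm_comb[of 0 m 1] by simp
  have pn: "\<bar>p \<bullet> perp m\<bar> \<le> norm p * mx"
  proof -
    have "\<bar>p \<bullet> perp m\<bar> \<le> norm p * norm (perp m)" by (rule Cauchy_Schwarz_ineq2)
    also have "\<dots> \<le> norm p * mx" unfolding np using mx[OF m] by (intro mult_left_mono) auto
    finally show ?thesis .
  qed
  have "\<bar>stair \<kappa> (arc m x / \<mu>) - along m x\<bar> \<le> 3 + M + sum L V"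
  proof -
    have "\<bar>arc m x - \<mu> * along m x\<bar> \<le> (1 + M + \<bar>\<mu>\<bar>) + d"
      using profile.\<sigma>_near_linear[OF prof[OF m], of "along m x"] tail_le[OF m x, of "along m x"]
      unfolding arc_def lv \<mu>_def[symmetric] by linarith
    moreover have "\<bar>(arc m x - \<mu> * along m x) / \<mu>\<bar> \<le> \<bar>arc m x - \<mu> * along m x\<bar>"
      unfolding \<mu>_def by (rule div_\<mu>_le[OF m])
    moreover have "(arc m x - \<mu> * along m x) / \<mu> = arc m x / \<mu> - along m x"
      using \<mu> by (simp add: diff_divide_distrib)
    ultimately show ?thesis using stair_near[OF \<kappa>, of "arc m x / \<mu>"] \<mu> \<kappa> d by linarith
  qed
  then have s: "\<bar>p \<bullet> m\<bar> * \<bar>stair \<kappa> (arc m x / \<mu>) - along m x\<bar> \<le> sum L V * (3 + M + sum L V)"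
    using p Ls \<mu> by (intro mult_mono) auto
  have t: "\<bar>p \<bullet> perp m\<bar> * \<bar>E * k - across m x\<bar> \<le> norm p * mx * (1 + A)"
    using pn a mx1 by (intro mult_mono) auto
  have "H p \<kappa> m x - p \<bullet> x = (p \<bullet> perp m) * (E * k - across m x) + (p \<bullet> m) * (stair \<kappa> (arc m x / \<mu>) - along m x)"
    unfolding H_def lv px \<mu>_def by (simp add: algebra_simps)
  then have "\<bar>H p \<kappa> m x - p \<bullet> x\<bar> \<le> \<bar>p \<bullet> perp m\<bar> * \<bar>E * k - across m x\<bar> + \<bar>p \<bullet> m\<bar> * \<bar>stair \<kappa> (arc m x / \<mu>) - along m x\<bar>"
    unfolding abs_mult[symmetric] by (simp only: abs_triangle_ineq)
  then show ?thesis using s t by linarith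
qed

subsection \<open>The complement of the network\<close>

text \<open>By the intermediate value theorem, a segment on which \<open>f m\<close> passes a multiple of \<open>E\<close> meets the network.\<close>

lemma floor_const:
  assumes m: "m \<in> V" and xy: "norm (x - y) < \<phi> x"
  shows "\<lfloor>f m x / E\<rfloor> = \<lfloor>f m y / E\<rfloor>"
proof (rule ccontr)
  assume ne: "\<lfloor>f m x / E\<rfloor> \<noteq> \<lfloor>f m y / E\<rfloor>"
  define F where "F t = f m (x + t *\<^sub>R (y - x)) / E" for t
  have "(1 + M)-lipschitz_on UNIV (f m)"
    by (rule lipschitz_onI) (use f_lip[OF m] M0 in \<open>auto simp: dist_real_def dist_norm\<close>)
  then have "continuous_on UNIV (f m)" by (rule lipschitz_on_continuous_on)
  then have "continuous_on {0..1} (\<lambda>t. f m (x + t *\<^sub>R (y - x)))"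
    by (rule continuous_on_compose2) (auto intro!: continuous_intros)
  then have cF: "continuous_on {0..1} F" unfolding F_def by (rule continuous_on_divide) (use E1 in \<open>auto intro: continuous_intros\<close>)
  have F01: "F 0 = f m x / E" "F 1 = f m y / E" by (simp_all add: F_def)
  have "\<exists>t k. 0 \<le> t \<and> t \<le> 1 \<and> F t = real_of_int k"
  proof (cases "\<lfloor>F 0\<rfloor> < \<lfloor>F 1\<rfloor>")
    case True
    then have "F 0 < of_int \<lfloor>F 1\<rfloor>" unfolding floor_less_iff .
    then show ?thesis using IVT'[of F 0 "of_int \<lfloor>F 1\<rfloor>" 1, OF _ _ _ cF] of_int_floor_le[of "F 1"] by force
  next
    case False
    then have "\<lfloor>F 1\<rfloor> < \<lfloor>F 0\<rfloor>" using ne F01 by simp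
    then have "F 1 < of_int \<lfloor>F 0\<rfloor>" unfolding floor_less_iff .
    then show ?thesis using IVT2'[of F 1 "of_int \<lfloor>F 0\<rfloor>" 0, OF _ _ _ cF] of_int_floor_le[of "F 0"] by force
  qed
  then obtain t k where t: "0 \<le> t" "t \<le> 1" "F t = real_of_int k" by blast
  define z where "z = x + t *\<^sub>R (y - x)"
  have "f m z = E * of_int k" using t(3) E1 by (simp add: F_def z_def field_simps)
  then have "z \<in> Z" unfolding Z_def by (intro CollectI bexI[OF _ m] bexI[of _ "of_int k"]) auto
  then have "\<phi> x \<le> norm (x - z)" by (rule \<phi>_le)
  also have "x - z = t *\<^sub>R (x - y)" by (simp add: z_def algebra_simps)
  also have "norm (t *\<^sub>R (x - y)) \<le> norm (x - y)" using t by (simp add: mult_left_le_one_le)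
  finally show False using xy by simp
qed

text \<open>A function at bounded distance from \<open>x \<mapsto> p \<bullet> x\<close> that is constant on each cell cut out by the curves in the two coordinate directions. The
  second summand is negative as \<open>across\<close> of the second unit vector is minus the first coordinate.\<close>

definition cell :: "real^2 \<Rightarrow> real^2 \<Rightarrow> real" where
  "cell p x = E * of_int \<lfloor>f (vector [1,0]) x / E\<rfloor> * p$2 - E * of_int \<lfloor>f (vector [0,1]) x / E\<rfloor> * p$1"

lemma cell_near: "\<bar>cell p x - p \<bullet> x\<bar> \<le> (\<bar>p$1\<bar> + \<bar>p$2\<bar>) * (E + A)"
proof -
  have fl: "\<bar>E * of_int \<lfloor>f m x / E\<rfloor> - across m x\<bar> \<le> E + A" if m: "m \<in> V" for m
  proof -
    define u where "u = f m x / E"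
    have "E * of_int \<lfloor>u\<rfloor> \<le> E * u" "E * u \<le> E * (of_int \<lfloor>u\<rfloor> + 1)"
      using E1 by (intro mult_left_mono; linarith)+
    moreover have "E * u = f m x" using E1 by (simp add: u_def)
    ultimately have "\<bar>E * of_int \<lfloor>u\<rfloor> - f m x\<bar> \<le> E" by (simp add: algebra_simps)
    then show ?thesis using profile.\<zeta>_bound[OF prof[OF m], of "along m x"] unfolding f_def u_def by linarith
  qed
  have "across (vector [1,0]) x = x$2" "across (vector [0,1]) x = - x$1"
    unfolding across_def norm2_sq inner2 by simp_all
  then have "cell p x - p \<bullet> x = (E * of_int \<lfloor>f (vector [1,0]) x / E\<rfloor> - across (vector [1,0]) x) * p$2
      - (E * of_int \<lfloor>f (vector [0,1]) x / E\<rfloor> - across (vector [0,1]) x) * p$1"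
    unfolding cell_def inner2[of p x] by (simp add: algebra_simps)
  also have "\<bar>\<dots>\<bar> \<le> \<bar>E * of_int \<lfloor>f (vector [1,0]) x / E\<rfloor> - across (vector [1,0]) x\<bar> * \<bar>p$2\<bar>
      + \<bar>E * of_int \<lfloor>f (vector [0,1]) x / E\<rfloor> - across (vector [0,1]) x\<bar> * \<bar>p$1\<bar>"
    unfolding abs_mult[symmetric] by (rule abs_triangle_ineq4)
  also have "\<dots> \<le> (E + A) * \<bar>p$2\<bar> + (E + A) * \<bar>p$1\<bar>"
    by (intro add_mono mult_right_mono fl e1 e2) auto
  finally show ?thesis by (simp add: algebra_simps)
qed

lemma cell_const: "norm (x - y) < \<phi> x \<Longrightarrow> cell p x = cell p y"
  unfolding cell_def by (simp only: floor_const[OF e1] floor_const[OF e2])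

lemma tube:
  assumes "\<phi> x < c" shows "\<exists>m\<in>V. \<exists>k\<in>\<int>. \<bar>f m x - E * k\<bar> \<le> (1 + M) * c"
proof -
  have "\<exists>z\<in>Z. dist x z < c"
    using assms Z_ne unfolding \<phi>_def infdist_notempty[OF Z_ne] by (subst (asm) cINF_less_iff) auto
  then obtain z m k where z: "dist x z < c" "m \<in> V" "k \<in> \<int>" "f m z = E * k" unfolding Z_def by blast
  have "\<bar>f m x - f m z\<bar> \<le> (1 + M) * norm (x - z)" by (rule f_lip[OF z(2)])
  also have "\<dots> \<le> (1 + M) * c" using z(1) M0 by (intro mult_left_mono) (auto simp: dist_norm)
  finally show ?thesis using z by auto
qed

text \<open>The corrector is \<open>H\<close> in the tubes around the curves, which is consistent where tubes overlap, and it is cut off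
  to \<open>cell\<close> away from the network.\<close>

theorem correctors:
  assumes p: "\<And>m. m \<in> V \<Longrightarrow> \<bar>p \<bullet> m\<bar> \<le> L m"
  shows "has_correctors \<phi> p"
proof (rule has_correctors_blend[OF \<phi>_lip])
  fix \<theta> :: real assume \<theta>: "0 < \<theta>"
  define \<theta>' where "\<theta>' = min \<theta> 1"
  have \<theta>': "0 < \<theta>'" "\<theta>' \<le> \<theta>" "\<theta>' \<le> 1" using \<theta> by (auto simp: \<theta>'_def)
  \<comment> \<open>The loss \<open>1 / (1 - 2\<kappa>)\<close> of the staircase and the loss \<open>Q\<close> off the curves together stay below \<open>1 + \<theta>\<close>.\<close>
  define \<kappa> where "\<kappa> = \<theta>' / 8"
  have \<kappa>: "0 < \<kappa>" "\<kappa> < 1/2" "\<kappa> \<le> 1/8" using \<theta>' by (auto simp: \<kappa>_def)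
  define K where "K = 4 * mx ^ 3"
  have K: "0 \<le> K" using mx1 by (simp add: K_def)
  define N where "N = (1 + M) * (1 + K)"
  have N: "1 \<le> N" "M \<le> N" "(1 + M) * K + 1 \<le> N"
    using M0 K mult_nonneg_nonneg[OF M0 K] by (auto simp: N_def distrib_right distrib_left)
  \<comment> \<open>Tubes of width \<open>2d\<close> overlap only where the staircases are flat: points of one tube may be
    moved by \<open>c\<close> without leaving the tube of double width.\<close>
  define d where "d = \<kappa> / (24 * N)"
  have d: "0 < d" "24 * N * d = \<kappa>" using \<kappa> N by (auto simp: d_def)
  have d24: "24 * d \<le> \<kappa>" "24 * (M * d) \<le> \<kappa>" "24 * (((1 + M) * K + 1) * d) \<le> \<kappa>"
    using mult_right_mono[OF N(1), of d] mult_right_mono[OF N(2), of d] mult_right_mono[OF N(3), of d] d by linarith+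
  define c where "c = d / (1 + M)"
  have c: "0 < c" "(1 + M) * c = d" "c \<le> d"
    using d M0 divide_left_mono[of 1 "1 + M" d] by (auto simp: c_def)
  have Md: "M * c \<le> M * d" "0 \<le> M * d" using c M0 d by (auto intro: mult_left_mono)
  define Q where "Q = 1 + 2 * M * c + 2 * M * (2 * d)"
  have Q: "1 \<le> Q" "Q \<le> 1 + \<kappa> / 4" using Md M0 c d24 unfolding Q_def by (auto simp: mult_ac) 
  have Qr: "Q * c \<le> \<kappa>"
  proof -
    have "Q * c \<le> 2 * d" using Q \<kappa> c by (intro mult_mono) auto
    then show ?thesis using d24 d by linarith
  qed
  have Q\<theta>: "Q / (1 - 2 * \<kappa>) \<le> 1 + \<theta>"
  proof -
    have "\<theta>' * \<theta>' \<le> 1 * \<theta>'" using \<theta>' by (intro mult_right_mono) auto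
    moreover have "(1 + \<theta>') * (1 - 2 * \<kappa>) = 1 + \<theta>' - \<theta>' / 4 - \<theta>' * \<theta>' / 4" by (simp add: \<kappa>_def field_simps)
    ultimately have "1 + \<kappa> / 4 \<le> (1 + \<theta>') * (1 - 2 * \<kappa>)" using \<theta>'(1) unfolding \<kappa>_def by linarith
    also have "\<dots> \<le> (1 + \<theta>) * (1 - 2 * \<kappa>)" using \<theta>' \<kappa> by (intro mult_right_mono) auto
    finally show ?thesis using Q \<kappa> by (simp add: pos_divide_le_eq)
  qed
  define w where "w x = (SOME m. m \<in> V \<and> (\<exists>k\<in>\<int>. \<bar>f m x - E * k\<bar> \<le> d))" for x
  have w: "w x \<in> V \<and> (\<exists>k\<in>\<int>. \<bar>f (w x) x - E * k\<bar> \<le> d)" if "\<phi> x < c" for x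
  proof -
    have "\<exists>m. m \<in> V \<and> (\<exists>k\<in>\<int>. \<bar>f m x - E * k\<bar> \<le> d)" using tube[OF that] unfolding c(2) by blast
    then show ?thesis unfolding w_def by (rule someI_ex)
  qed
  define u where "u x = H p \<kappa> (w x) x" for x
  define B where "B = max (norm p * mx * (1 + A) + sum L V * (3 + M + sum L V)) ((\<bar>p$1\<bar> + \<bar>p$2\<bar>) * (E + A))"
  have d12: "2 * d < 1/2" "d < 1/2" using d24(1) \<kappa> d by linarith+
  have near: "\<bar>u x - p \<bullet> x\<bar> \<le> B" if x: "\<phi> x < c" for x
  proof -
    obtain k where k: "k \<in> \<int>" "\<bar>f (w x) x - E * k\<bar> \<le> d" using w[OF x] by blast
    have m: "w x \<in> V" using w[OF x] by blast
    from H_near[OF m k d12(2) p[OF m] \<kappa>(1,2)] show ?thesis unfolding u_def B_def by linarith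
  qed
  have incr: "\<bar>u x - u y\<bar> \<le> (1 + \<theta>) * norm (x - y)" if xy: "norm (x - y) \<le> c" "\<phi> x < c" "\<phi> y < c" for x y
  proof -
    obtain k where k: "k \<in> \<int>" "\<bar>f (w x) x - E * k\<bar> \<le> d" using w[OF xy(2)] by blast
    obtain l where l: "l \<in> \<int>" "\<bar>f (w y) y - E * l\<bar> \<le> d" using w[OF xy(3)] by blast
    have m: "w x \<in> V" "w y \<in> V" using w[OF xy(2)] w[OF xy(3)] by blast+
    have "\<bar>f (w x) x - f (w x) y\<bar> \<le> d"
      using order_trans[OF f_lip[OF m(1), of x y] mult_left_mono[OF xy(1), of "1 + M"]] M0 c(2) by simp
    then have y2: "\<bar>f (w x) y - E * k\<bar> \<le> 2 * d" and x2: "\<bar>f (w x) x - E * k\<bar> \<le> 2 * d" and l2: "\<bar>f (w y) y - E * l\<bar> \<le> 2 * d"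
      using k(2) l(2) d(1) by linarith+
    have "((1 + M) * (4 * mx ^ 3) + 1) * (2 * d) \<le> \<kappa>" using d24(3) \<kappa>(1) unfolding K_def by linarith
    from H_consistent[OF m k(1) l(1) y2 l2 d12(1) \<kappa>(1,2) this]
    have "u x - u y = H p \<kappa> (w x) x - H p \<kappa> (w x) y" by (simp add: u_def)
    moreover have "\<bar>H p \<kappa> (w x) x - H p \<kappa> (w x) y\<bar> \<le> Q / (1 - 2 * \<kappa>) * norm (x - y)"
      unfolding Q_def by (rule H_lip[OF m(1) k(1) x2 y2 d12(1) p[OF m(1)] xy(1) \<kappa>(1,2) Qr[unfolded Q_def]])
    ultimately show ?thesis using mult_right_mono[OF Q\<theta>, of "norm (x - y)"] by simp
  qed
  show "\<exists>c B r u v. 0 < c \<and> 0 < r \<and>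
      (\<forall>x. \<phi> x < c \<longrightarrow> \<bar>u x - p \<bullet> x\<bar> \<le> B) \<and> (\<forall>x. \<bar>v x - p \<bullet> x\<bar> \<le> B) \<and>
      (\<forall>x y. norm (x - y) \<le> r \<and> \<phi> x < c \<and> \<phi> y < c \<longrightarrow> \<bar>u x - u y\<bar> \<le> (1 + \<theta>) * norm (x - y)) \<and>
      (\<forall>x y. norm (x - y) < \<phi> x \<longrightarrow> v x = v y)"
  proof (intro exI conjI allI impI)
    show "0 < c" "0 < c" by (rule c)+
    show "\<bar>u x - p \<bullet> x\<bar> \<le> B" if "\<phi> x < c" for x by (rule near[OF that])
    show "\<bar>cell p x - p \<bullet> x\<bar> \<le> B" for x unfolding B_def by (rule max.coboundedI2[OF cell_near])
    show "\<bar>u x - u y\<bar> \<le> (1 + \<theta>) * norm (x - y)" if "norm (x - y) \<le> c \<and> \<phi> x < c \<and> \<phi> y < c" for x y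
      using incr that by blast
    show "cell p x = cell p y" if "norm (x - y) < \<phi> x" for x y by (rule cell_const[OF that])
  qed
qed

end

section \<open>Optimal paths in networks\<close>

context network
begin

definition P :: "(real^2) set" where "P = {p. \<forall>m\<in>V. \<bar>p \<bullet> m\<bar> \<le> L m}"

text \<open>By duality, the support function of \<open>P\<close> is the least cost of writing a vector as a combination
  of the directions in \<open>V\<close>.\<close>

lemma cheap_combination:
  assumes \<nu>: "0 < \<nu>" and w: "\<And>p. p \<in> P \<Longrightarrow> \<bar>p \<bullet> w\<bar> \<le> \<nu>"
  shows "\<exists>a. w = (\<Sum>m\<in>V. a m *\<^sub>R m) \<and> (\<Sum>m\<in>V. L m * \<bar>a m\<bar>) \<le> \<nu>"
proof -
  define S where "S = (\<lambda>m. m /\<^sub>R L m) ` V \<union> (\<lambda>m. - (m /\<^sub>R L m)) ` V"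
  define K where "K = {x. \<exists>a. x = (\<Sum>m\<in>V. a m *\<^sub>R m) \<and> (\<Sum>m\<in>V. L m * \<bar>a m\<bar>) \<le> 1}"
  have L0: "0 < L m" if "m \<in> V" for m using L1[OF that] by linarith
  have in_K: "(b / L m) *\<^sub>R m \<in> K" if m: "m \<in> V" and b: "\<bar>b\<bar> = 1" for m b
  proof -
    define a where "a v = (if v = m then b / L m else 0)" for v
    have "(\<Sum>v\<in>V. a v *\<^sub>R v) = (\<Sum>v\<in>V. if v = m then (b / L m) *\<^sub>R m else 0)"
      by (rule sum.cong) (auto simp: a_def)
    also have "\<dots> = (b / L m) *\<^sub>R m" using m fin by simp
    finally have "(b / L m) *\<^sub>R m = (\<Sum>v\<in>V. a v *\<^sub>R v)" ..
    moreover have "(\<Sum>v\<in>V. L v * \<bar>a v\<bar>) = (\<Sum>v\<in>V. if v = m then 1 else 0)"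
      by (rule sum.cong) (use b L0[OF m] in \<open>auto simp: a_def abs_divide\<close>)
    ultimately show ?thesis unfolding K_def using m fin by (intro CollectI exI[of _ a]) auto
  qed
  have SK: "S \<subseteq> K" using in_K[of _ 1] in_K[of _ "-1"] by (auto simp: S_def divide_inverse)
  have "convex K"
  proof (rule convexI)
    fix x y and s t :: real assume "x \<in> K" "y \<in> K" and st: "0 \<le> s" "0 \<le> t" "s + t = 1"
    then obtain a b where a: "x = (\<Sum>m\<in>V. a m *\<^sub>R m)" "(\<Sum>m\<in>V. L m * \<bar>a m\<bar>) \<le> 1"
      and b: "y = (\<Sum>m\<in>V. b m *\<^sub>R m)" "(\<Sum>m\<in>V. L m * \<bar>b m\<bar>) \<le> 1" by (auto simp: K_def)
    have "s *\<^sub>R x + t *\<^sub>R y = (\<Sum>m\<in>V. (s * a m + t * b m) *\<^sub>R m)"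
      by (simp add: a b scaleR_sum_right scaleR_add_left sum.distrib)
    moreover have "(\<Sum>m\<in>V. L m * \<bar>s * a m + t * b m\<bar>) \<le> 1"
    proof -
      have "(\<Sum>m\<in>V. L m * \<bar>s * a m + t * b m\<bar>) \<le> (\<Sum>m\<in>V. s * (L m * \<bar>a m\<bar>) + t * (L m * \<bar>b m\<bar>))"
      proof (rule sum_mono)
        fix m assume m: "m \<in> V"
        have "\<bar>s * a m + t * b m\<bar> \<le> s * \<bar>a m\<bar> + t * \<bar>b m\<bar>"
          using abs_triangle_ineq[of "s * a m" "t * b m"] st by (simp add: abs_mult)
        then have "L m * \<bar>s * a m + t * b m\<bar> \<le> L m * (s * \<bar>a m\<bar> + t * \<bar>b m\<bar>)" using L0[OF m] by simp
        then show "L m * \<bar>s * a m + t * b m\<bar> \<le> s * (L m * \<bar>a m\<bar>) + t * (L m * \<bar>b m\<bar>)" by (simp add: algebra_simps)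
      qed
      also have "\<dots> = s * (\<Sum>m\<in>V. L m * \<bar>a m\<bar>) + t * (\<Sum>m\<in>V. L m * \<bar>b m\<bar>)"
        by (simp add: sum.distrib sum_distrib_left)
      also have "\<dots> \<le> s * 1 + t * 1" using a b st by (intro add_mono mult_left_mono) auto
      finally show ?thesis using st by simp
    qed
    ultimately show "s *\<^sub>R x + t *\<^sub>R y \<in> K" 
      unfolding K_def by (intro CollectI exI[of _ "\<lambda>m. s * a m + t * b m"] conjI)
  qed
  then have hull: "convex hull S \<subseteq> K" by (rule hull_minimal[OF SK])
  have "w /\<^sub>R \<nu> \<in> convex hull S"
  proof (rule ccontr)
    assume out: "w /\<^sub>R \<nu> \<notin> convex hull S"
    have "closed (convex hull S)"
      using fin by (intro compact_imp_closed compact_convex_hull finite_imp_compact) (simp add: S_def)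
    from separating_hyperplane_closed_point[OF convex_convex_hull this out]
    obtain q b where q: "q \<bullet> (w /\<^sub>R \<nu>) < b" "\<forall>x\<in>convex hull S. b < q \<bullet> x" by blast
    have qm: "\<bar>q \<bullet> m\<bar> / L m < - b" if m: "m \<in> V" for m
    proof -
      have "m /\<^sub>R L m \<in> convex hull S" "- (m /\<^sub>R L m) \<in> convex hull S" using m by (auto simp: S_def intro: hull_inc)
      then have "b < q \<bullet> (m /\<^sub>R L m)" "b < q \<bullet> (- (m /\<^sub>R L m))" using q(2) by blast+
      then have "\<bar>(q \<bullet> m) / L m\<bar> < - b" by (simp add: divide_inverse mult.commute abs_less_iff)
      then show ?thesis using L0[OF m] by (simp add: abs_divide)
    qed
    have b: "0 < - b"
    proof -
      have "0 \<le> \<bar>q \<bullet> vector [1,0]\<bar> / L (vector [1,0])" using L0[OF e1] by simp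
      then show ?thesis using qm[OF e1] by linarith
    qed
    define p where "p = q /\<^sub>R (- b)"
    have "p \<in> P" unfolding P_def
    proof (intro CollectI ballI)
      fix m assume m: "m \<in> V"
      have "\<bar>q \<bullet> m\<bar> \<le> L m * (- b)" using qm[OF m] L0[OF m] by (simp add: pos_divide_less_eq mult.commute)
      then have "\<bar>q \<bullet> m\<bar> / (- b) \<le> L m" using b by (simp only: pos_divide_le_eq)
      moreover have "\<bar>p \<bullet> m\<bar> = \<bar>q \<bullet> m\<bar> / (- b)"
        using b by (simp add: p_def abs_mult divide_inverse mult.commute)
      ultimately show "\<bar>p \<bullet> m\<bar> \<le> L m" by simp
    qed
    from w[OF this] have "\<bar>q \<bullet> w\<bar> / (- b) \<le> \<nu>"
      using b by (simp add: p_def abs_mult divide_inverse mult.commute)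
    then have "\<bar>q \<bullet> w\<bar> \<le> \<nu> * (- b)" using b by (simp only: pos_divide_le_eq)
    moreover have "(q \<bullet> w) / \<nu> < b" using q(1) by (simp add: divide_inverse mult.commute)
    then have "q \<bullet> w < b * \<nu>" using \<nu> by (simp only: pos_divide_less_eq)
    ultimately show False by (simp add: abs_le_iff mult.commute)
  qed
  with hull obtain a where a: "w /\<^sub>R \<nu> = (\<Sum>m\<in>V. a m *\<^sub>R m)" "(\<Sum>m\<in>V. L m * \<bar>a m\<bar>) \<le> 1" by (auto simp: K_def)
  have "w = \<nu> *\<^sub>R (w /\<^sub>R \<nu>)" using \<nu> by simp
  also have "\<dots> = (\<Sum>m\<in>V. (\<nu> * a m) *\<^sub>R m)" unfolding a(1) by (simp add: scaleR_sum_right)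
  finally have "w = (\<Sum>m\<in>V. (\<nu> * a m) *\<^sub>R m)" .
  moreover have "(\<Sum>m\<in>V. L m * \<bar>\<nu> * a m\<bar>) = \<nu> * (\<Sum>m\<in>V. L m * \<bar>a m\<bar>)"
    using \<nu> by (simp add: abs_mult sum_distrib_left mult_ac)
  moreover have "\<nu> * (\<Sum>m\<in>V. L m * \<bar>a m\<bar>) \<le> \<nu>" using mult_left_mono[OF a(2), of \<nu>] \<nu> by simp
  ultimately show ?thesis by (intro exI[of _ "\<lambda>m. \<nu> * a m"]) simp
qed

lemma dual_sq_P_real:
  assumes "dual_sq P w < \<infinity>"
  obtains N where "0 \<le> N" "dual_sq P w = ennreal (N\<^sup>2)" "sqrt (enn2real (dual_sq P w)) = N" "\<And>p. p \<in> P \<Longrightarrow> \<bar>p \<bullet> w\<bar> \<le> N"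
proof -
  define N where "N = sqrt (enn2real (dual_sq P w))"
  have d: "dual_sq P w = ennreal (N\<^sup>2)" using assms by (simp add: N_def)
  show thesis
  proof (rule that)
    show "0 \<le> N" "sqrt (enn2real (dual_sq P w)) = N" by (simp_all add: N_def)
    show "dual_sq P w = ennreal (N\<^sup>2)" by (rule d)
    fix p assume "p \<in> P"
    have "ennreal ((p \<bullet> w)\<^sup>2) \<le> ennreal (N\<^sup>2)" unfolding d[symmetric] by (rule dual_sq_upper[OF \<open>p \<in> P\<close>])
    then have "(p \<bullet> w)\<^sup>2 \<le> N\<^sup>2" by simp
    then have "\<bar>p \<bullet> w\<bar> \<le> \<bar>N\<bar>" by (simp only: abs_le_square_iff)
    then show "\<bar>p \<bullet> w\<bar> \<le> N" by (simp add: N_def)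
  qed
qed

definition nd :: "real^2 \<Rightarrow> real^2" where
  "nd x = vector [E\<^sup>2 * of_int (round (x$1 / E\<^sup>2)), E\<^sup>2 * of_int (round (x$2 / E\<^sup>2))]"

lemma nd_nodes: "nd x \<in> nodes" using E1 by (simp add: nodes_def nd_def)

lemma round_multiple: "\<bar>E\<^sup>2 * of_int (round (a / E\<^sup>2)) - a\<bar> \<le> E\<^sup>2 / 2"
proof -
  have "E\<^sup>2 * \<bar>of_int (round (a / E\<^sup>2)) - a / E\<^sup>2\<bar> \<le> E\<^sup>2 * (1/2)"
    by (intro mult_left_mono of_int_round_abs_le) simp
  moreover have "E\<^sup>2 * \<bar>of_int (round (a / E\<^sup>2)) - a / E\<^sup>2\<bar> = \<bar>E\<^sup>2 * (of_int (round (a / E\<^sup>2)) - a / E\<^sup>2)\<bar>" by (simp add: abs_mult)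
  moreover have "E\<^sup>2 * (of_int (round (a / E\<^sup>2)) - a / E\<^sup>2) = E\<^sup>2 * of_int (round (a / E\<^sup>2)) - a"
    using E1 by (simp add: right_diff_distrib)
  ultimately show ?thesis by simp
qed

lemma nd_near: "norm (nd x - x) \<le> E\<^sup>2"
proof -
  have "norm (nd x - x) \<le> (\<Sum>i\<in>UNIV. \<bar>(nd x - x) $ i\<bar>)" by (rule norm_le_l1_cart)
  also have "\<dots> \<le> E\<^sup>2 / 2 + E\<^sup>2 / 2"
    unfolding sum_2 by (intro add_mono) (use round_multiple in \<open>simp_all add: nd_def\<close>)
  finally show ?thesis by simp
qed

text \<open>Round the coefficients of a cheapest combination to multiples of \<open>E\<^sup>2\<close>, follow the corresponding curves one
  direction after the other, and correct the bounded remainder along the coordinate directions.\<close>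

lemma optimal_path:
  assumes fin_d: "dual_sq P (y - x) < \<infinity>"
  shows "\<exists>l. level_path \<phi> (nd x) (nd y) l \<and>
    l \<le> sqrt (enn2real (dual_sq P (y - x))) + (1 + E\<^sup>2 * sum L V + 2 * (sum L V * (2 * E\<^sup>2 + E\<^sup>2 * sum L V)))"
proof -
  define Ls where "Ls = sum L V"
  define w where "w = y - x"
  have E2: "0 < E\<^sup>2" using E1 by simp
  have Lle: "L m \<le> Ls" if "m \<in> V" for m unfolding Ls_def by (rule member_le_sum[OF that _ fin]) (use L1 in force)
  have Ls0: "0 \<le> Ls" using Lle[OF e1] L1[OF e1] by simp
  obtain N where N: "0 \<le> N" "sqrt (enn2real (dual_sq P w)) = N" "\<And>p. p \<in> P \<Longrightarrow> \<bar>p \<bullet> w\<bar> \<le> N"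
    by (rule dual_sq_P_real[OF fin_d[folded w_def]]) blast
  have N': "\<bar>p \<bullet> w\<bar> \<le> N + 1" if "p \<in> P" for p using N(3)[OF that] by simp
  have "0 < N + 1" using N(1) by simp
  from cheap_combination[OF this N'] obtain a where a: "w = (\<Sum>m\<in>V. a m *\<^sub>R m)" "(\<Sum>m\<in>V. L m * \<bar>a m\<bar>) \<le> N + 1" by blast
  define j where "j m = real_of_int (round (a m / E\<^sup>2))" for m
  have j: "\<bar>E\<^sup>2 * j m - a m\<bar> \<le> E\<^sup>2" for m unfolding j_def using round_multiple[of "a m"] E2 by linarith
  define z where "z = nd x + (\<Sum>m\<in>V. (E\<^sup>2 * j m) *\<^sub>R m)"
  define l1 where "l1 = (\<Sum>m\<in>V. L m * (E\<^sup>2 * \<bar>j m\<bar>))"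
  have jZ: "j m \<in> \<int>" for m by (simp add: j_def)
  have z: "z \<in> nodes" "level_path \<phi> (nd x) z l1"
    using steps_path[OF fin subset_refl nd_nodes[of x], of j, OF jZ] unfolding z_def l1_def by blast+
  have l1: "l1 \<le> N + 1 + E\<^sup>2 * Ls"
  proof -
    have "l1 \<le> (\<Sum>m\<in>V. L m * \<bar>a m\<bar> + E\<^sup>2 * L m)"
      unfolding l1_def
    proof (rule sum_mono)
      fix m assume m: "m \<in> V"
      have "E\<^sup>2 * \<bar>j m\<bar> = \<bar>E\<^sup>2 * j m\<bar>" by (simp add: abs_mult)
      then have "E\<^sup>2 * \<bar>j m\<bar> \<le> \<bar>a m\<bar> + E\<^sup>2" using j[of m] by linarith
      then have "L m * (E\<^sup>2 * \<bar>j m\<bar>) \<le> L m * (\<bar>a m\<bar> + E\<^sup>2)" using L1[OF m] by (intro mult_left_mono) auto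
      then show "L m * (E\<^sup>2 * \<bar>j m\<bar>) \<le> L m * \<bar>a m\<bar> + E\<^sup>2 * L m" by (simp add: algebra_simps)
    qed
    then show ?thesis using a(2) by (simp add: sum.distrib sum_distrib_left[symmetric] Ls_def)
  qed
  define u where "u = nd y - z"
  have u: "norm u \<le> 2 * E\<^sup>2 + E\<^sup>2 * Ls"
  proof -
    have "norm (\<Sum>m\<in>V. (E\<^sup>2 * j m - a m) *\<^sub>R m) \<le> (\<Sum>m\<in>V. E\<^sup>2 * L m)"
    proof (rule sum_norm_le)
      fix m assume m: "m \<in> V"
      show "norm ((E\<^sup>2 * j m - a m) *\<^sub>R m) \<le> E\<^sup>2 * L m"
        unfolding norm_scaleR using j[of m] len[OF m] by (intro mult_mono) auto
    qed
    then have s: "norm (\<Sum>m\<in>V. (E\<^sup>2 * j m - a m) *\<^sub>R m) \<le> E\<^sup>2 * Ls" by (simp add: sum_distrib_left[symmetric] Ls_def)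
    have "u = (nd y - y) - (nd x - x) - (\<Sum>m\<in>V. (E\<^sup>2 * j m - a m) *\<^sub>R m)"
      unfolding u_def z_def scaleR_diff_left sum_subtractf a(1)[symmetric] w_def by simp
    then have "norm u = norm ((nd y - y) - (nd x - x) - (\<Sum>m\<in>V. (E\<^sup>2 * j m - a m) *\<^sub>R m))" by (rule arg_cong)
    then have "norm u \<le> norm (nd y - y) + norm (nd x - x) + norm (\<Sum>m\<in>V. (E\<^sup>2 * j m - a m) *\<^sub>R m)"
      using norm_triangle_ineq4[of "(nd y - y) - (nd x - x)" "\<Sum>m\<in>V. (E\<^sup>2 * j m - a m) *\<^sub>R m"]
        norm_triangle_ineq4[of "nd y - y" "nd x - x"] by linarith
    then show ?thesis using nd_near[of x] nd_near[of y] s by linarith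
  qed
  have u12: "\<bar>u$1\<bar> \<le> 2 * E\<^sup>2 + E\<^sup>2 * Ls" "\<bar>u$2\<bar> \<le> 2 * E\<^sup>2 + E\<^sup>2 * Ls"
    using order_trans[OF component_le_norm_cart u] by blast+
  have uZ: "u$1 / E\<^sup>2 \<in> \<int>" "u$2 / E\<^sup>2 \<in> \<int>"
    using nd_nodes[of y] z(1) by (auto simp: u_def nodes_def diff_divide_distrib)
  define z' where "z' = z + (E\<^sup>2 * (u$1 / E\<^sup>2)) *\<^sub>R vector [1,0]"
  have z': "z' \<in> nodes" unfolding z'_def by (rule node_add[OF z(1) uZ(1)]) auto
  have p1: "level_path \<phi> z z' (L (vector [1,0]) * (E\<^sup>2 * \<bar>u$1 / E\<^sup>2\<bar>))"
    unfolding z'_def by (rule step_path[OF e1 z(1) uZ(1)])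
  have p2: "level_path \<phi> z' (z' + (E\<^sup>2 * (u$2 / E\<^sup>2)) *\<^sub>R vector [0,1]) (L (vector [0,1]) * (E\<^sup>2 * \<bar>u$2 / E\<^sup>2\<bar>))"
    by (rule step_path[OF e2 z' uZ(2)])
  have fin_eq: "z' + (E\<^sup>2 * (u$2 / E\<^sup>2)) *\<^sub>R vector [0,1] = nd y"
    using E2 by (simp add: z'_def u_def vec2_eq_iff)
  have b: "L m * (E\<^sup>2 * \<bar>t / E\<^sup>2\<bar>) \<le> Ls * (2 * E\<^sup>2 + E\<^sup>2 * Ls)" if "m \<in> V" "\<bar>t\<bar> \<le> 2 * E\<^sup>2 + E\<^sup>2 * Ls" for m t
  proof -
    have "E\<^sup>2 * \<bar>t / E\<^sup>2\<bar> = \<bar>t\<bar>" using E2 by (simp add: abs_divide)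
    then show ?thesis using that Lle[OF that(1)] L1[OF that(1)] Ls0 by (simp only:) (intro mult_mono; simp)
  qed
  have "level_path \<phi> (nd x) (nd y) ((l1 + L (vector [1,0]) * (E\<^sup>2 * \<bar>u$1 / E\<^sup>2\<bar>)) + L (vector [0,1]) * (E\<^sup>2 * \<bar>u$2 / E\<^sup>2\<bar>))"
    using level_path_trans[OF level_path_trans[OF z(2) p1] p2] unfolding fin_eq .
  moreover have "(l1 + L (vector [1,0]) * (E\<^sup>2 * \<bar>u$1 / E\<^sup>2\<bar>)) + L (vector [0,1]) * (E\<^sup>2 * \<bar>u$2 / E\<^sup>2\<bar>)
      \<le> N + (1 + E\<^sup>2 * Ls + 2 * (Ls * (2 * E\<^sup>2 + E\<^sup>2 * Ls)))"
    using l1 b[OF e1 u12(1)] b[OF e2 u12(2)] by linarith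
  ultimately show ?thesis using N(2) unfolding Ls_def w_def by blast
qed

theorem Gamma_convergence:
  assumes ratio: "filterlim (\<lambda>\<epsilon>. \<delta> \<epsilon> / \<epsilon>) at_top (at_right 0)"
  shows "Gamma_converges L2 L2_tendsto (F_eps \<delta> \<phi>) (F_lim (dual_sq P))"
proof (rule Gamma_convergence_of_network[OF _ _ _ _ _ optimal_path ratio])
  show "1-lipschitz_on UNIV \<phi>"
    by (rule lipschitz_onI) (use \<phi>_lip in \<open>auto simp: dist_real_def dist_norm\<close>)
  have "0 \<le> L m" if "m \<in> V" for m using L1[OF that] by linarith
  then have "0 \<in> P" by (simp add: P_def)
  then show "P \<noteq> {}" by blast
  show "has_correctors \<phi> p" if "p \<in> P" for p by (rule correctors) (use that in \<open>auto simp: P_def\<close>)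
  show "ennreal ((norm w)\<^sup>2) \<le> dual_sq P w" for w
  proof (cases "w = 0")
    case False
    define p where "p = w /\<^sub>R norm w"
    have np: "norm p = 1" using False by (simp add: p_def)
    have "\<bar>p \<bullet> m\<bar> \<le> L m" if "m \<in> V" for m
      using Cauchy_Schwarz_ineq2[of p m] np len[OF that] by simp
    then have "p \<in> P" by (simp add: P_def)
    moreover have "p \<bullet> w = norm w"
      using False by (simp add: p_def power2_norm_eq_inner[symmetric] power2_eq_square)
    ultimately show ?thesis using dual_sq_upper[of p P w] by simp
  qed simp
  have "L (vector [1, 0]) \<le> sum L V" by (rule member_le_sum[OF e1 _ fin]) (use L1 in force)
  then have Ls: "1 \<le> sum L V" using L1[OF e1] by linarith
  have "E\<^sup>2 * 1 \<le> E\<^sup>2 * sum L V" by (rule mult_left_mono[OF Ls]) simp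
  moreover have "0 \<le> sum L V * (2 * E\<^sup>2 + E\<^sup>2 * sum L V)" using Ls by simp
  ultimately show "norm (nd x - x) \<le> 1 + E\<^sup>2 * sum L V + 2 * (sum L V * (2 * E\<^sup>2 + E\<^sup>2 * sum L V))" for x
    using nd_near[of x] by linarith
qed

end

section \<open>Approximation of norms\<close>

lemma profile_mono: assumes "profile \<zeta> dz \<sigma> \<mu> A M" "M \<le> M'" shows "profile \<zeta> dz \<sigma> \<mu> A M'"
proof -
  interpret profile \<zeta> dz \<sigma> \<mu> A M by fact
  have "M * \<bar>s - s'\<bar> \<le> M' * \<bar>s - s'\<bar>" for s s' using assms(2) by (intro mult_right_mono) auto
  then have "\<bar>dz s - dz s'\<bar> \<le> M' * \<bar>s - s'\<bar>" for s s' by (rule order_trans[OF dz_lip])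
  moreover have "\<bar>dz s\<bar> \<le> M'" for s by (rule order_trans[OF dz_bound assms(2)])
  ultimately show ?thesis using dz periodic small \<sigma> \<sigma>0 \<sigma>1 A0 order_trans[OF M0 assms(2)]
    by (intro profile.intro)
qed

lemma common_multiple:
  fixes W :: "real set"
  assumes "finite W" "\<And>d. d \<in> W \<Longrightarrow> d \<in> \<int> \<and> d \<noteq> 0"
  shows "\<exists>E. E \<in> \<int> \<and> 1 \<le> E \<and> (\<forall>d\<in>W. E / d \<in> \<int>)"
proof -
  define X where "X = (\<Prod>d\<in>W. d)"
  have "\<bar>X\<bar> \<in> \<int>" "X \<noteq> 0" unfolding X_def using assms by (auto intro!: Ints_prod Ints_abs)
  moreover have "1 \<le> \<bar>X\<bar>" using calculation Ints_nonzero_abs_ge1[of "\<bar>X\<bar>"] by simp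
  moreover have "\<bar>X\<bar> / d \<in> \<int>" if d: "d \<in> W" for d
  proof -
    have "X / d = (\<Prod>d\<in>W - {d}. d)" unfolding X_def using prod.remove[OF assms(1) d, of "\<lambda>d. d"] assms(2)[OF d] by simp
    also have "\<dots> \<in> \<int>" using assms(2) by (auto intro!: Ints_prod)
    finally have "X / d \<in> \<int>" .
    then show ?thesis by (cases "0 \<le> X") auto
  qed
  ultimately show ?thesis by blast
qed

text \<open>The amplitude \<open>A\<close> and the spacing \<open>E\<close> only depend on the directions, so they can be fixed before the lengths of
  the curves are adjusted.\<close>

lemma network_exists:
  assumes fin: "finite V" and V_int: "\<And>m. m \<in> V \<Longrightarrow> m$1 \<in> \<int> \<and> m$2 \<in> \<int>" and V0: "\<And>m. m \<in> V \<Longrightarrow> m \<noteq> 0"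
    and e: "vector [1, 0] \<in> V" "vector [0, 1] \<in> V"
    and det: "\<And>m m'. m \<in> V \<Longrightarrow> m' \<in> V \<Longrightarrow> m \<noteq> m' \<Longrightarrow> perp m' \<bullet> m \<noteq> 0"
    and len: "\<And>m. norm m \<le> L m"
  shows "\<exists>\<zeta> dz \<sigma> A M E mx. network V L \<zeta> dz \<sigma> A M E mx"
proof -
  define mx where "mx = sum norm V"
  have mx: "norm m \<le> mx" if "m \<in> V" for m unfolding mx_def by (rule member_le_sum[OF that _ fin]) simp
  have "0 < norm (vector [1, 0] :: real^2)" using V0[OF e(1)] by simp
  then have mx0: "0 < mx" using mx[OF e(1)] by linarith
  define A where "A = 1 / (4 * mx ^ 3)"
  have A: "0 < A" "4 * mx ^ 3 * A \<le> 1" using mx0 by (simp_all add: A_def)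
  have \<mu>: "1 \<le> L m / norm m" if "m \<in> V" for m using len[of m] V0[OF that] by simp
  have "\<forall>m. \<exists>a. m \<in> V \<longrightarrow> (\<exists>b c d. profile a b c (L m / norm m) A d)" using exists_profile[OF A(1) \<mu>] by blast
  from choice[OF this] obtain \<zeta> where \<zeta>: "\<forall>m. m \<in> V \<longrightarrow> (\<exists>b c d. profile (\<zeta> m) b c (L m / norm m) A d)" by blast
  then have "\<forall>m. \<exists>b. m \<in> V \<longrightarrow> (\<exists>c d. profile (\<zeta> m) b c (L m / norm m) A d)" by blast
  from choice[OF this] obtain dz where dz: "\<forall>m. m \<in> V \<longrightarrow> (\<exists>c d. profile (\<zeta> m) (dz m) c (L m / norm m) A d)" by blast
  then have "\<forall>m. \<exists>c. m \<in> V \<longrightarrow> (\<exists>d. profile (\<zeta> m) (dz m) c (L m / norm m) A d)" by blast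
  from choice[OF this] obtain \<sigma> where \<sigma>: "\<forall>m. m \<in> V \<longrightarrow> (\<exists>d. profile (\<zeta> m) (dz m) (\<sigma> m) (L m / norm m) A d)" by blast
  then have "\<forall>m. \<exists>d. m \<in> V \<longrightarrow> profile (\<zeta> m) (dz m) (\<sigma> m) (L m / norm m) A d" by blast
  from choice[OF this] obtain M where M: "\<forall>m. m \<in> V \<longrightarrow> profile (\<zeta> m) (dz m) (\<sigma> m) (L m / norm m) A (M m)" by blast
  have "M m \<le> sum M V" if "m \<in> V" for m
    by (rule member_le_sum[OF that _ fin]) (use M profile.M0 in blast)
  then have prof: "profile (\<zeta> m) (dz m) (\<sigma> m) (L m / norm m) A (sum M V)" if "m \<in> V" for m
    using M that profile_mono by blast
  define W where "W = (\<lambda>m. (norm m)\<^sup>2) ` V \<union> (\<lambda>(m, m'). perp m' \<bullet> m) ` (V \<times> V - Id)"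
  have "\<exists>E. E \<in> \<int> \<and> 1 \<le> E \<and> (\<forall>d\<in>W. E / d \<in> \<int>)"
  proof (rule common_multiple)
    show "finite W" unfolding W_def using fin by auto
    fix d assume "d \<in> W"
    then consider m where "m \<in> V" "d = (norm m)\<^sup>2" | m m' where "m \<in> V" "m' \<in> V" "m \<noteq> m'" "d = perp m' \<bullet> m"
      by (auto simp: W_def)
    then show "d \<in> \<int> \<and> d \<noteq> 0"
    proof cases
      case 1
      then show ?thesis using V_int[OF 1(1)] V0[OF 1(1)] by (simp add: norm2_sq[symmetric]) (simp add: norm2_sq)
    next
      case 2
      then show ?thesis using V_int[OF 2(1)] V_int[OF 2(2)] det[OF 2(1-3)] by (simp add: inner2)
    qed
  qed
  then obtain E where E: "E \<in> \<int>" "1 \<le> E" "\<forall>d\<in>W. E / d \<in> \<int>" by blast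
  have "network V L \<zeta> dz \<sigma> A (sum M V) E mx"
  proof (rule network.intro)
    show "E / (norm m)\<^sup>2 \<in> \<int>" if "m \<in> V" for m using E(3) that by (auto simp: W_def)
    show "perp m' \<bullet> m \<noteq> 0 \<and> E / (perp m' \<bullet> m) \<in> \<int>" if m: "m \<in> V" "m' \<in> V" "m \<noteq> m'" for m m'
    proof -
      have "perp m' \<bullet> m \<in> W" unfolding W_def using m by (intro UnI2 image_eqI[of _ _ "(m, m')"]) auto
      then show ?thesis using det[OF m] E(3) by blast
    qed
  qed (use fin V_int V0 e prof len mx A E in auto)
  then show ?thesis by blast
qed

text \<open>A maximal subset of pairwise independent vectors represents all directions of a finite set.\<close>

lemma direction_representatives:
  fixes T V\<^sub>0 :: "(real^2) set"
  assumes "finite T" "finite V\<^sub>0" and V\<^sub>0: "\<And>m m'. m \<in> V\<^sub>0 \<Longrightarrow> m' \<in> V\<^sub>0 \<Longrightarrow> m \<noteq> m' \<Longrightarrow> perp m' \<bullet> m \<noteq> 0"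
  shows "\<exists>V. finite V \<and> V\<^sub>0 \<subseteq> V \<and> V \<subseteq> V\<^sub>0 \<union> T \<and> (\<forall>m\<in>V. \<forall>m'\<in>V. m \<noteq> m' \<longrightarrow> perp m' \<bullet> m \<noteq> 0) \<and>
    (\<forall>v\<in>T. \<exists>m\<in>V. perp m \<bullet> v = 0)"
  using assms(1)
proof (induction T rule: finite_induct)
  case empty
  show ?case using assms(2) V\<^sub>0 by (intro exI[of _ V\<^sub>0]) auto
next
  case (insert v T)
  then obtain V where V: "finite V" "V\<^sub>0 \<subseteq> V" "V \<subseteq> V\<^sub>0 \<union> T" "\<forall>m\<in>V. \<forall>m'\<in>V. m \<noteq> m' \<longrightarrow> perp m' \<bullet> m \<noteq> 0"
    "\<forall>v\<in>T. \<exists>m\<in>V. perp m \<bullet> v = 0" by blast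
  show ?case
  proof (cases "\<exists>m\<in>V. perp m \<bullet> v = 0")
    case True
    then show ?thesis using V by (intro exI[of _ V]) auto
  next
    case False
    have sym: "perp v \<bullet> m = - (perp m \<bullet> v)" for m by (simp add: inner2)
    have "perp v \<bullet> v = 0" by (simp add: inner2)
    have "perp m' \<bullet> m \<noteq> 0" if "m \<in> insert v V" "m' \<in> insert v V" "m \<noteq> m'" for m m'
    proof (cases "m' = v")
      case True
      then have "m \<in> V" using that by blast
      then have "perp m \<bullet> v \<noteq> 0" using False by blast
      then show ?thesis unfolding True sym by simp
    next
      case m': False
      then have "m' \<in> V" using that by blast
      then show ?thesis using that V(4) False by (cases "m = v") blast+
    qed
    moreover have "\<forall>x\<in>insert v T. \<exists>m\<in>insert v V. perp m \<bullet> x = 0" using V(5) \<open>perp v \<bullet> v = 0\<close> by blast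
    ultimately show ?thesis using V(1-3) by (intro exI[of _ "insert v V"] conjI) blast+
  qed
qed

lemma finite_lattice_box: "finite {v :: real^2. v$1 \<in> \<int> \<and> v$2 \<in> \<int> \<and> \<bar>v$1\<bar> \<le> R \<and> \<bar>v$2\<bar> \<le> R}"
proof (rule finite_subset)
  define I where "I = real_of_int ` {-\<lfloor>R\<rfloor>..\<lfloor>R\<rfloor>}"
  show "finite ((\<lambda>(a, b). vector [a, b] :: real^2) ` (I \<times> I))" by (simp add: I_def)
  show "{v :: real^2. v$1 \<in> \<int> \<and> v$2 \<in> \<int> \<and> \<bar>v$1\<bar> \<le> R \<and> \<bar>v$2\<bar> \<le> R} \<subseteq> (\<lambda>(a, b). vector [a, b]) ` (I \<times> I)"
  proof
    fix v :: "real^2" assume v: "v \<in> {v. v$1 \<in> \<int> \<and> v$2 \<in> \<int> \<and> \<bar>v$1\<bar> \<le> R \<and> \<bar>v$2\<bar> \<le> R}"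
    have I: "a \<in> I" if aZ: "a \<in> \<int>" and aR: "\<bar>a\<bar> \<le> R" for a
    proof -
      obtain i where i: "a = of_int i" using aZ by (auto elim: Ints_cases)
      have "real_of_int i \<le> R" "real_of_int (- i) \<le> R" using aR unfolding i of_int_minus by linarith+
      then have "i \<le> \<lfloor>R\<rfloor>" "- i \<le> \<lfloor>R\<rfloor>" by (simp_all only: le_floor_iff)
      then have "i \<in> {-\<lfloor>R\<rfloor>..\<lfloor>R\<rfloor>}" by simp
      then show ?thesis unfolding I_def i by (rule imageI)
    qed
    have "v = vector [v$1, v$2]" by (simp add: vec2_eq_iff)
    moreover have "(v$1, v$2) \<in> I \<times> I" using v I[of "v$1"] I[of "v$2"] by simp
    ultimately show "v \<in> (\<lambda>(a, b). vector [a, b]) ` (I \<times> I)" by (intro image_eqI[of _ _ "(v$1, v$2)"]) simp_all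
  qed
qed

text \<open>A vector of length \<open>R\<close> is within distance 1 of a lattice vector \<open>v\<close> in the box of size \<open>R\<close>, and the network norm is at most
  \<open>n v\<close> there. By homogeneity the relative error is of order \<open>1 / R\<close>. Conversely the network norm is at least
  \<open>n\<close> because \<open>n\<close> is subadditive along cheapest combinations.\<close>

theorem norm_network:
  fixes n :: "real^2 \<Rightarrow> real"
  assumes n_scale: "\<And>r w. n (r *\<^sub>R w) = \<bar>r\<bar> * n w" and n_add: "\<And>v w. n (v + w) \<le> n v + n w"
    and n_norm: "\<And>w. norm w \<le> n w" and \<eta>: "0 < \<eta>"
    and ratio: "filterlim (\<lambda>\<epsilon>. \<delta> \<epsilon> / \<epsilon>) at_top (at_right 0)"
  shows "\<exists>\<phi> P. periodic \<phi> \<and> (\<exists>L. L-lipschitz_on UNIV \<phi>) \<and>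
    Gamma_converges L2 L2_tendsto (F_eps \<delta> \<phi>) (F_lim (dual_sq P)) \<and>
    (\<forall>w. \<exists>b. dual_sq P w = ennreal b \<and> (n w)\<^sup>2 \<le> b \<and> b \<le> (n w)\<^sup>2 + \<eta> * (norm w)\<^sup>2)"
proof -
  define C where "C = n (vector [1,0]) + n (vector [0,1])"
  have n0: "0 \<le> n w" for w using order_trans[OF norm_ge_zero n_norm] .
  have n_C: "n w \<le> C * norm w" for w
  proof -
    have "w = w$1 *\<^sub>R vector [1,0] + w$2 *\<^sub>R vector [0,1]" by (simp add: vec2_eq_iff)
    then have "n w = n (w$1 *\<^sub>R vector [1,0] + w$2 *\<^sub>R vector [0,1])" by (rule arg_cong)
    also have "\<dots> \<le> \<bar>w$1\<bar> * n (vector [1,0]) + \<bar>w$2\<bar> * n (vector [0,1])"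
      using n_add[of "w$1 *\<^sub>R vector [1,0]" "w$2 *\<^sub>R vector [0,1]"] by (simp only: n_scale)
    also have "\<dots> \<le> norm w * n (vector [1,0]) + norm w * n (vector [0,1])"
      by (intro add_mono mult_right_mono component_le_norm_cart n0)
    finally show ?thesis by (simp add: C_def algebra_simps)
  qed
  have C0: "0 \<le> C" unfolding C_def by (intro add_nonneg_nonneg n0)
  define \<tau> where "\<tau> = min 1 (\<eta> / (2 * C + 1))"
  have \<tau>: "0 < \<tau>" "\<tau> \<le> 1" using \<eta> C0 by (auto simp: \<tau>_def)
  have \<tau>\<eta>: "\<tau> * (2 * C + 1) \<le> \<eta>"
  proof -
    have "\<tau> * (2 * C + 1) \<le> \<eta> / (2 * C + 1) * (2 * C + 1)" using C0 by (intro mult_right_mono) (auto simp: \<tau>_def)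
    then show ?thesis using C0 by simp
  qed
  obtain R :: nat where R: "1 \<le> real R" "2 * C / \<tau> \<le> real R"
  proof -
    obtain k :: nat where "max 1 (2 * C / \<tau>) \<le> real k" using real_arch_simple by blast
    then show ?thesis using that[of k] by simp
  qed
  define V\<^sub>0 :: "(real^2) set" where "V\<^sub>0 = {vector [1,0], vector [0,1]}"
  define T where "T = {v :: real^2. v$1 \<in> \<int> \<and> v$2 \<in> \<int> \<and> \<bar>v$1\<bar> \<le> real R \<and> \<bar>v$2\<bar> \<le> real R}"
  have "\<exists>V. finite V \<and> V\<^sub>0 \<subseteq> V \<and> V \<subseteq> V\<^sub>0 \<union> (T - {0}) \<and> (\<forall>m\<in>V. \<forall>m'\<in>V. m \<noteq> m' \<longrightarrow> perp m' \<bullet> m \<noteq> 0) \<and>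
    (\<forall>v\<in>T - {0}. \<exists>m\<in>V. perp m \<bullet> v = 0)"
  proof (rule direction_representatives)
    show "finite (T - {0})" unfolding T_def using finite_lattice_box[of "real R"] by simp
    show "finite V\<^sub>0" by (simp add: V\<^sub>0_def)
    show "perp m' \<bullet> m \<noteq> 0" if "m \<in> V\<^sub>0" "m' \<in> V\<^sub>0" "m \<noteq> m'" for m m'
      using that by (auto simp: V\<^sub>0_def inner2)
  qed
  then obtain V where V: "finite V" "V\<^sub>0 \<subseteq> V" "V \<subseteq> V\<^sub>0 \<union> (T - {0})"
    and det: "\<forall>m\<in>V. \<forall>m'\<in>V. m \<noteq> m' \<longrightarrow> perp m' \<bullet> m \<noteq> 0" and rep: "\<forall>v\<in>T - {0}. \<exists>m\<in>V. perp m \<bullet> v = 0" by blast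
  have V_int: "m$1 \<in> \<int> \<and> m$2 \<in> \<int> \<and> m \<noteq> 0" if "m \<in> V" for m
    using V(3) that by (auto simp: V\<^sub>0_def T_def vec2_eq_iff)
  have e: "vector [1,0] \<in> V" "vector [0,1] \<in> V" using V(2) by (auto simp: V\<^sub>0_def)
  have "\<exists>\<zeta> dz \<sigma> A M E mx. network V n \<zeta> dz \<sigma> A M E mx"
    by (rule network_exists) (use V(1) V_int e det n_norm in auto)
  then obtain \<zeta> dz \<sigma> A M E mx where net: "network V n \<zeta> dz \<sigma> A M E mx" by blast
  then interpret network V n \<zeta> dz \<sigma> A M E mx .
  have inT: "\<bar>p \<bullet> v\<bar> \<le> n v" if p: "p \<in> P" and v: "v \<in> T" for p v
  proof (cases "v = 0")
    case False
    then obtain m where m: "m \<in> V" "perp m \<bullet> v = 0" using rep v by blast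
    have "v = along m v *\<^sub>R m"
      using along_across_decomp[OF V0[OF m(1)], of v] m(2) by (simp add: across_def)
    then obtain t where t: "v = t *\<^sub>R m" by blast
    have "\<bar>t\<bar> * \<bar>p \<bullet> m\<bar> \<le> \<bar>t\<bar> * n m" using p m(1) by (intro mult_left_mono) (auto simp: P_def)
    then show ?thesis unfolding t n_scale by (simp add: abs_mult)
  qed (use n0 in simp)
  have up: "\<bar>p \<bullet> w\<bar> \<le> n w + \<tau> * norm w" if p: "p \<in> P" for p w
  proof (cases "w = 0")
    case False
    define \<rho> where "\<rho> = real R / norm w"
    have \<rho>: "0 < \<rho>" using False R(1) by (simp add: \<rho>_def)
    define x where "x = \<rho> *\<^sub>R w"
    have nx: "norm x = real R" using False R(1) by (simp add: x_def \<rho>_def)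
    define v :: "real^2" where "v = vector [of_int (round (x$1)), of_int (round (x$2))]"
    have box: "\<bar>real_of_int (round a)\<bar> \<le> real R" if "\<bar>a\<bar> \<le> real R" for a
    proof -
      have "round a \<le> round (real R)" "round (- real R) \<le> round a" using that by (intro round_mono; simp)+
      moreover have "round (real R) = int R" "round (- real R) = - int R"
        using round_of_int[of "int R"] round_of_int[of "- int R"] by simp_all
      ultimately show ?thesis by linarith
    qed
    have "v \<in> T" unfolding T_def v_def using component_le_norm_cart[of x] nx box by simp
    have xv: "norm (x - v) \<le> 1"
    proof -
      have "norm (x - v) \<le> (\<Sum>i\<in>UNIV. \<bar>(x - v) $ i\<bar>)" by (rule norm_le_l1_cart)
      also have "\<dots> \<le> 1/2 + 1/2"
        unfolding sum_2 by (intro add_mono) (use of_int_round_abs_le[of "x$1"] of_int_round_abs_le[of "x$2"] in \<open>simp_all add: v_def abs_minus_commute\<close>)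
      finally show ?thesis by simp
    qed
    have nC: "n (v - x) \<le> C"
      using n_C[of "v - x"] mult_left_mono[OF xv C0] by (simp add: norm_minus_commute)
    have "norm p \<le> C"
    proof -
      have "norm p \<le> (\<Sum>i\<in>UNIV. \<bar>p $ i\<bar>)" by (rule norm_le_l1_cart)
      also have "\<dots> = \<bar>p \<bullet> vector [1,0]\<bar> + \<bar>p \<bullet> vector [0,1]\<bar>" unfolding sum_2 inner2 by simp
      also have "\<dots> \<le> C" using p e by (auto simp: P_def C_def intro: add_mono)
      finally show ?thesis .
    qed
    then have px: "\<bar>p \<bullet> (x - v)\<bar> \<le> C * 1"
      using order_trans[OF Cauchy_Schwarz_ineq2 mult_mono[OF _ xv C0 norm_ge_zero]] by blast
    have "n v \<le> n x + C" using n_add[of x "v - x"] nC by simp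
    then have "\<bar>p \<bullet> x\<bar> \<le> n x + 2 * C"
      using inT[OF p \<open>v \<in> T\<close>] px by (simp add: inner_diff_right)
    then have "\<rho> * \<bar>p \<bullet> w\<bar> \<le> \<rho> * n w + 2 * C"
      using \<rho> by (simp add: x_def n_scale abs_mult)
    moreover have "2 * C \<le> \<rho> * (\<tau> * norm w)"
    proof -
      have "2 * C \<le> real R * \<tau>" using R(2) \<tau>(1) by (simp add: pos_divide_le_eq)
      then show ?thesis using False by (simp add: \<rho>_def)
    qed
    ultimately have "\<rho> * \<bar>p \<bullet> w\<bar> \<le> \<rho> * (n w + \<tau> * norm w)" unfolding distrib_left by linarith
    then show ?thesis using \<rho> by simp
  qed (use n0 in simp)
  have bounds: "\<exists>b. dual_sq P w = ennreal b \<and> (n w)\<^sup>2 \<le> b \<and> b \<le> (n w)\<^sup>2 + \<eta> * (norm w)\<^sup>2" for w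
  proof -
    have le: "dual_sq P w \<le> ennreal ((n w + \<tau> * norm w)\<^sup>2)"
      unfolding dual_sq_def
    proof (rule SUP_least)
      fix p assume p: "p \<in> P"
      have "(p \<bullet> w)\<^sup>2 \<le> (n w + \<tau> * norm w)\<^sup>2"
        by (subst power2_abs[symmetric]) (intro power_mono up[OF p] abs_ge_zero)
      then show "ennreal ((p \<bullet> w)\<^sup>2) \<le> ennreal ((n w + \<tau> * norm w)\<^sup>2)" by (rule ennreal_leI)
    qed
    then have "dual_sq P w < \<infinity>" using le_less_trans[OF le] by simp
    then obtain N where N: "0 \<le> N" "dual_sq P w = ennreal (N\<^sup>2)" "\<And>p. p \<in> P \<Longrightarrow> \<bar>p \<bullet> w\<bar> \<le> N"
      by (rule dual_sq_P_real) blast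
    have "n w \<le> N"
    proof (rule field_le_epsilon)
      fix s :: real assume "0 < s"
      then have s: "0 < N + s" using N(1) by simp
      have "\<bar>p \<bullet> w\<bar> \<le> N + s" if "p \<in> P" for p using N(3)[OF that] \<open>0 < s\<close> by simp
      from cheap_combination[OF s this] obtain a where a: "w = (\<Sum>m\<in>V. a m *\<^sub>R m)" "(\<Sum>m\<in>V. n m * \<bar>a m\<bar>) \<le> N + s" by blast
      have "n (\<Sum>m\<in>W. a m *\<^sub>R m) \<le> (\<Sum>m\<in>W. n m * \<bar>a m\<bar>)" if "finite W" for W
        using that
      proof (induction W rule: finite_induct)
        case empty
        show ?case using n_scale[of 0 0] by simp
      next
        case (insert m W)
        have "n (a m *\<^sub>R m + (\<Sum>m\<in>W. a m *\<^sub>R m)) \<le> n m * \<bar>a m\<bar> + (\<Sum>m\<in>W. n m * \<bar>a m\<bar>)"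
          using n_add[of "a m *\<^sub>R m" "\<Sum>m\<in>W. a m *\<^sub>R m"] insert.IH by (simp add: n_scale mult.commute)
        then show ?case using insert(1,2) by simp
      qed
      from this[OF V(1)] show "n w \<le> N + s" using a by simp
    qed
    then have "(n w)\<^sup>2 \<le> N\<^sup>2" by (rule power_mono[OF _ n0])
    moreover have "N\<^sup>2 \<le> (n w)\<^sup>2 + \<eta> * (norm w)\<^sup>2"
    proof -
      have "N\<^sup>2 \<le> (n w + \<tau> * norm w)\<^sup>2" using le unfolding N(2) by simp
      also have "\<dots> = (n w)\<^sup>2 + 2 * \<tau> * n w * norm w + \<tau> * \<tau> * (norm w)\<^sup>2" by (simp add: power2_eq_square algebra_simps)
      also have "\<dots> \<le> (n w)\<^sup>2 + 2 * \<tau> * (C * norm w) * norm w + \<tau> * 1 * (norm w)\<^sup>2"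
        using \<tau> n_C[of w] by (intro add_mono mult_right_mono mult_left_mono order_refl) auto
      also have "\<dots> = (n w)\<^sup>2 + \<tau> * (2 * C + 1) * (norm w)\<^sup>2" by (simp add: power2_eq_square algebra_simps)
      also have "\<dots> \<le> (n w)\<^sup>2 + \<eta> * (norm w)\<^sup>2" using \<tau>\<eta> by (intro add_left_mono mult_right_mono) auto
      finally show ?thesis .
    qed
    ultimately show ?thesis using N(2) by blast
  qed
  have "1-lipschitz_on UNIV \<phi>"
    by (rule lipschitz_onI) (use \<phi>_lip in \<open>auto simp: dist_real_def dist_norm\<close>)
  then have "\<exists>L. L-lipschitz_on UNIV \<phi>" by blast
  then show ?thesis using \<phi>_periodic Gamma_convergence[OF ratio] bounds
    by (intro exI[of _ \<phi>] exI[of _ P] conjI allI) assumption+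
qed

section \<open>Density of network energies\<close>

text \<open>The square root of a finite convex 2-homogeneous function is subadditive: its unit ball is convex.\<close>

lemma sqrt_subadditive:
  fixes F :: "'a::real_vector \<Rightarrow> real"
  assumes hom: "\<And>r w. F (r *\<^sub>R w) = r\<^sup>2 * F w" and pos: "\<And>w. w \<noteq> 0 \<Longrightarrow> 0 < F w"
    and conv: "\<And>s v w. 0 \<le> s \<Longrightarrow> s \<le> 1 \<Longrightarrow> F ((1 - s) *\<^sub>R v + s *\<^sub>R w) \<le> (1 - s) * F v + s * F w"
  shows "sqrt (F (v + w)) \<le> sqrt (F v) + sqrt (F w)"
proof -
  have F0: "F 0 = 0" using hom[of 0 0] by simp
  show ?thesis
  proof (cases "v = 0 \<or> w = 0")
    case True
    then show ?thesis using F0 by auto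
  next
    case False
    define a where "a = sqrt (F v)"
    define b where "b = sqrt (F w)"
    have ab: "0 < a" "0 < b" "F v = a\<^sup>2" "F w = b\<^sup>2" using pos[of v] pos[of w] False by (auto simp: a_def b_def)
    define s where "s = b / (a + b)"
    have s: "0 \<le> s" "s \<le> 1" "1 - s = a / (a + b)" using ab by (auto simp: s_def field_simps)
    have "(1 - s) * inverse a = inverse (a + b)" "s * inverse b = inverse (a + b)"
      unfolding s(3) using ab by (simp_all add: s_def divide_inverse mult_ac)
    then have "(1 - s) *\<^sub>R (inverse a *\<^sub>R v) + s *\<^sub>R (inverse b *\<^sub>R w) = inverse (a + b) *\<^sub>R (v + w)"
      by (simp only: scaleR_scaleR scaleR_add_right)
    then have "(inverse (a + b))\<^sup>2 * F (v + w) \<le> (1 - s) * ((inverse a)\<^sup>2 * a\<^sup>2) + s * ((inverse b)\<^sup>2 * b\<^sup>2)"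
      using conv[OF s(1,2), of "inverse a *\<^sub>R v" "inverse b *\<^sub>R w"] by (simp only: hom ab(3,4))
    also have "\<dots> = 1" using ab by (simp add: power_mult_distrib[symmetric])
    finally have "F (v + w) / (a + b)\<^sup>2 \<le> 1" by (simp add: power_inverse divide_inverse mult.commute)
    then have "F (v + w) \<le> (a + b)\<^sup>2" using ab by (simp add: pos_divide_le_eq)
    then show ?thesis unfolding a_def[symmetric] b_def[symmetric] using ab by (intro real_le_lsqrt) auto
  qed
qed

theorem mainTheorem2:
  fixes \<delta> :: "real \<Rightarrow> real"
    and \<psi> :: "real^2 \<Rightarrow> ennreal"
    and \<eta> :: real
  assumes delta_pos: "\<And>\<epsilon>. 0 < \<epsilon> \<Longrightarrow> 0 < \<delta> \<epsilon>"
    and delta_lim: "(\<delta> \<longlongrightarrow> 0) (at_right 0)"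
    and delta_ratio: "filterlim (\<lambda>\<epsilon>. \<delta> \<epsilon> / \<epsilon>) at_top (at_right 0)"
    and hom: "\<And>(r::real) w. \<psi> (r *\<^sub>R w) = ennreal (r\<^sup>2) * \<psi> w"
    and conv: "\<And>s v w. 0 \<le> s \<Longrightarrow> s \<le> 1 \<Longrightarrow>
        \<psi> ((1 - s) *\<^sub>R v + s *\<^sub>R w) \<le> ennreal (1 - s) * \<psi> v + ennreal s * \<psi> w"
    and lower: "\<And>w. ennreal ((norm w)\<^sup>2) \<le> \<psi> w"
    and dom: "{w. \<psi> w < \<infinity>} \<noteq> {0}"
    and eta_pos: "0 < \<eta>"
  shows "\<exists>\<phi>. periodic \<phi> \<and> (\<exists>L. L-lipschitz_on UNIV \<phi>) \<and>
    (\<exists>\<psi>\<^sub>\<eta> :: real^2 \<Rightarrow> ennreal.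
       \<psi>\<^sub>\<eta> \<in> borel_measurable borel \<and>
       Gamma_converges L2 L2_tendsto (F_eps \<delta> \<phi>) (F_lim \<psi>\<^sub>\<eta>) \<and>
       (\<forall>w. \<psi> w < \<infinity> \<longrightarrow>
          \<bar>enn2ereal (\<psi>\<^sub>\<eta> w) - enn2ereal (\<psi> w)\<bar> \<le> ereal (\<eta> * (norm w)\<^sup>2)) \<and>
       (\<forall>w. \<psi> w = \<infinity> \<longrightarrow> \<psi>\<^sub>\<eta> w = \<infinity>))"
proof -
  have psi0: "\<psi> 0 = 0" using hom[of 0 0] by simp
  obtain w0 where w0: "\<psi> w0 < \<infinity>" "w0 \<noteq> 0"
  proof -
    have "0 \<in> {w. \<psi> w < \<infinity>}" by (simp add: psi0)
    then have "\<exists>w0\<in>{w. \<psi> w < \<infinity>}. w0 \<noteq> 0" using dom by blast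
    then show ?thesis using that by blast
  qed
  have scale_fin: "\<psi> (r *\<^sub>R w) < \<infinity>" if "\<psi> w < \<infinity>" for r w
    unfolding hom using that by (simp add: ennreal_mult_less_top)
  define m where "m = w0 /\<^sub>R norm w0"
  have m: "norm m = 1" "\<psi> m < \<infinity>" using w0(2) scale_fin[OF w0(1)] by (simp_all add: m_def)
  have m0: "m \<noteq> 0" using m(1) by auto
  show ?thesis
  proof (cases "\<forall>w. \<psi> w < \<infinity> \<longrightarrow> across m w = 0")
    case True
    define c where "c = sqrt (enn2real (\<psi> m))"
    have psim: "\<psi> m = ennreal (c\<^sup>2)" using m(2) by (simp add: c_def)
    have c0: "0 \<le> c" by (simp add: c_def)
    have c: "1 \<le> c"
    proof -
      have "ennreal (1\<^sup>2) \<le> ennreal (c\<^sup>2)" using lower[of m] m(1) unfolding psim by simp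
      then have "1\<^sup>2 \<le> c\<^sup>2" by (subst (asm) ennreal_le_iff) simp_all
      then show ?thesis using c0 by (rule power2_le_imp_le)
    qed
    define P where "P = {p. \<bar>p \<bullet> m\<bar> \<le> c}"
    have eq: "dual_sq P w = \<psi> w" for w
    proof (cases "across m w = 0")
      case t: True
      then have "w = along m w *\<^sub>R m" using along_across_decomp[OF m0, of w] by simp
      then have "\<psi> w = \<psi> (along m w *\<^sub>R m)" by (rule arg_cong)
      also have "\<dots> = ennreal ((c * along m w)\<^sup>2)"
        unfolding hom psim by (simp add: ennreal_mult[symmetric] power_mult_distrib mult.commute)
      finally show ?thesis unfolding P_def dual_sq_strip[OF m(1) c0] using t by simp
    next
      case False
      then have "\<psi> w = \<infinity>" using True by (auto simp: less_top[symmetric])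
      then show ?thesis unfolding P_def dual_sq_strip[OF m(1) c0] using False by simp
    qed
    obtain \<phi> where \<phi>: "periodic \<phi>" "\<exists>L. L-lipschitz_on UNIV \<phi>"
      "Gamma_converges L2 L2_tendsto (F_eps \<delta> \<phi>) (F_lim (dual_sq P))"
      using line_network[OF m(1) c delta_ratio] unfolding P_def by blast
    have "\<bar>enn2ereal (dual_sq P w) - enn2ereal (\<psi> w)\<bar> \<le> ereal (\<eta> * (norm w)\<^sup>2)" if w: "\<psi> w < \<infinity>" for w
    proof -
      have "0 \<le> enn2real (\<psi> w)" "\<psi> w = ennreal (enn2real (\<psi> w))" using w by simp_all
      then obtain x where "0 \<le> x" "\<psi> w = ennreal x" by blast
      then show ?thesis unfolding eq using eta_pos by (simp add: enn2ereal_ennreal)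
    qed
    then have "\<forall>w. \<psi> w < \<infinity> \<longrightarrow> \<bar>enn2ereal (dual_sq P w) - enn2ereal (\<psi> w)\<bar> \<le> ereal (\<eta> * (norm w)\<^sup>2)" by blast
    moreover have "\<forall>w. \<psi> w = \<infinity> \<longrightarrow> dual_sq P w = \<infinity>" unfolding eq by blast
    ultimately show ?thesis
      by (intro exI[of _ \<phi>] exI[of _ "dual_sq P"] conjI \<phi> dual_sq_measurable)
  next
    case False
    then have "\<exists>w1. \<psi> w1 < \<infinity> \<and> across m w1 \<noteq> 0" by simp
    then obtain w1 where w1: "\<psi> w1 < \<infinity>" "across m w1 \<noteq> 0" by blast
    have fin: "\<psi> w < \<infinity>" for w
    proof -
      define t where "t = across m w / across m w1"
      define s where "s = along m w - t * along m w1"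
      have "w = along m w *\<^sub>R m + across m w *\<^sub>R perp m" by (rule along_across_decomp[OF m0])
      also have "\<dots> = s *\<^sub>R m + t *\<^sub>R (along m w1 *\<^sub>R m + across m w1 *\<^sub>R perp m)"
        using w1(2) by (simp add: s_def t_def algebra_simps)
      also have "along m w1 *\<^sub>R m + across m w1 *\<^sub>R perp m = w1" by (rule along_across_decomp[OF m0, symmetric])
      finally have w: "w = (1 - 1/2) *\<^sub>R ((2 * s) *\<^sub>R m) + (1/2) *\<^sub>R ((2 * t) *\<^sub>R w1)" by simp
      have "\<psi> w \<le> ennreal (1 - 1/2) * \<psi> ((2 * s) *\<^sub>R m) + ennreal (1/2) * \<psi> ((2 * t) *\<^sub>R w1)"
        by (subst w) (rule conv, simp_all)
      also have "\<dots> < \<infinity>"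
      proof -
        have "ennreal a * x < \<infinity>" if "x < \<infinity>" for a x using that by (simp add: ennreal_mult_less_top)
        from this[OF scale_fin[OF m(2)], of "1 - 1/2" "2 * s"] this[OF scale_fin[OF w1(1)], of "1/2" "2 * t"]
        show ?thesis unfolding infinity_ennreal_def ennreal_add_less_top by (rule conjI)
      qed
      finally show ?thesis .
    qed
    define F where "F w = enn2real (\<psi> w)" for w
    have F: "\<psi> w = ennreal (F w)" "0 \<le> F w" for w using fin[of w] by (simp_all add: F_def)
    have F_low: "(norm w)\<^sup>2 \<le> F w" for w
      using lower[of w] unfolding F(1) by (simp add: ennreal_le_iff F(2))
    have F_hom: "F (r *\<^sub>R w) = r\<^sup>2 * F w" for r w
      unfolding F_def hom by (simp add: enn2real_mult)
    have F_conv: "F ((1 - s) *\<^sub>R v + s *\<^sub>R w) \<le> (1 - s) * F v + s * F w" if s: "0 \<le> s" "s \<le> 1" for s v w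
    proof -
      have "ennreal (F ((1 - s) *\<^sub>R v + s *\<^sub>R w)) \<le> ennreal ((1 - s) * F v + s * F w)"
        using conv[OF s, of v w] s F(2) unfolding F(1) by (simp add: ennreal_mult[symmetric] ennreal_plus[symmetric] del: ennreal_plus)
      then show ?thesis using s F(2) by (subst (asm) ennreal_le_iff) auto
    qed
    define n where "n w = sqrt (F w)" for w
    have n2: "(n w)\<^sup>2 = F w" for w using F(2) by (simp add: n_def)
    have F_pos: "0 < F w" if "w \<noteq> 0" for w
      by (rule less_le_trans[OF _ F_low]) (use that in simp)
    have n_add: "n (v + w) \<le> n v + n w" for v w
      unfolding n_def by (rule sqrt_subadditive[OF F_hom F_pos F_conv])
    have n_scale: "n (r *\<^sub>R w) = \<bar>r\<bar> * n w" for r w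
      by (simp add: n_def F_hom real_sqrt_mult)
    have n_norm: "norm w \<le> n w" for w
      unfolding n_def by (rule real_le_rsqrt[OF F_low])
    obtain \<phi> P where \<phi>: "periodic \<phi>" "\<exists>L. L-lipschitz_on UNIV \<phi>"
      "Gamma_converges L2 L2_tendsto (F_eps \<delta> \<phi>) (F_lim (dual_sq P))"
      and bd: "\<forall>w. \<exists>b. dual_sq P w = ennreal b \<and> (n w)\<^sup>2 \<le> b \<and> b \<le> (n w)\<^sup>2 + \<eta> * (norm w)\<^sup>2"
      using norm_network[OF n_scale n_add n_norm eta_pos delta_ratio] by blast
    have "\<bar>enn2ereal (dual_sq P w) - enn2ereal (\<psi> w)\<bar> \<le> ereal (\<eta> * (norm w)\<^sup>2)" for w
    proof -
      obtain b where b: "dual_sq P w = ennreal b" "F w \<le> b" "b \<le> F w + \<eta> * (norm w)\<^sup>2"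
        using bd unfolding n2 by blast
      then have "\<bar>b - F w\<bar> \<le> \<eta> * (norm w)\<^sup>2" by linarith
      moreover have "0 \<le> b" using b(2) F(2)[of w] by linarith
      ultimately show ?thesis unfolding b(1) F(1) using F(2)[of w] by (simp add: enn2ereal_ennreal)
    qed
    then have "\<forall>w. \<psi> w < \<infinity> \<longrightarrow> \<bar>enn2ereal (dual_sq P w) - enn2ereal (\<psi> w)\<bar> \<le> ereal (\<eta> * (norm w)\<^sup>2)" by blast
    moreover have "\<forall>w. \<psi> w = \<infinity> \<longrightarrow> dual_sq P w = \<infinity>" using fin by (metis less_irrefl)
    ultimately show ?thesis
      by (intro exI[of _ \<phi>] exI[of _ "dual_sq P"] conjI \<phi> dual_sq_measurable)
  qed
qed

end
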